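(* Let $\phi_t$ be a $C^2$ flow on a $C^2$ complete Riemann manifold $M$ and let $\Lambda$ be a basic set for $\phi_t$ satisfying conditions (LUPC) and (I) stated in the context. With the notation of the context, choosing $\epsilon_2 \in (0,\epsilon_1/2]$ sufficiently small, for any $x_0 \in \Lambda$ and any $x\in W^{u,1}_{\epsilon_2}(x_0)$ we have the following: (a) For every $u\in E^u_1(x; \epsilon_2)$ there exists $$F_x(u) = \lim_{p\to\infty} d\hat f^p_{f^{-p}(x)}(0)\cdot \hat f_x^{-p}(u) \in E^u_1(x; 2\epsilon_2).$$ Moreover, there exists a constant $C_1 > 0$ such that $\|F_x(u) - d\hat f^p_{f^{-p}(x)}(0)\cdot \hat f_x^{-p}(u)\| \leq C_1 \gamma^p \|u\|^2$ for any $u\in E^u_1(x;\epsilon_2)$ and any integer $p \geq 0$. (b) The maps $F_x : E^u_1( x;\epsilon_2) \to F_x (E^u_1( x;\epsilon_2)) \subset E^u_1(x;2\epsilon_2)$ are $C^1$ diffeomorphisms with uniformly bounded derivatives. (c) For any integer $q\geq 1$ we have $d\hat f_{x}^{-q}(0) \circ F_{x} (v) = F_{ f^{-q}(x)} \circ \hat f_{x}^{-q} (v)$ for any $v \in E^u_1 (x;\epsilon_2)$. (d) For any $\xi, u \in E^u_1(x;\epsilon_2/2)$ there exist the limits $L_{x,\xi} = \lim_{p\to\infty} d\hat f^p_{f^{-p}(x)}(\hat f_x^{-p}(\xi))\circ d\hat f_x^{-p}(0)$ and $F_{x,\xi}(u) = \lim_{p\to\infty} d\hat f^p_{f^{-p}(x)}(\hat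 f_x^{-p}(\xi))\circ \hat f_x^{-p}(u)$. Moreover, for the linear map $L_{x,\xi} : E^u_1(x) \to E^u_1(x)$ we have $\|L_{x,\xi}\| \leq 2$, and $F_{x,\xi}(u) = L_{x,\xi} \circ F_x (u)$. (e) For any $u\in E^u_1(x;\epsilon_2)$ we have $F_x(u) = \lim_{t\to \infty} d\phi_t(\phi_{-t}(x))\cdot \hat\phi_{x,-t}(u)$, and for any $t\ge 0$, $d\phi_{-t}(x) \cdot F_x (u) = F_{\phi_{-t}(x)} ( \hat\phi_{x,-t} (u))$.
   Context: A basic set $\Lambda$ is a non-empty compact $\phi_t$-invariant set, not a single closed orbit and without fixed points, on which $\phi_t$ is transitive, which is locally maximal and hyperbolic, with splitting $T_xM=E^0(x)\oplus E^u(x)\oplus E^s(x)$. $W^u_\epsilon(x)=\{y\in M: d(\phi_t(x),\phi_t(y))\le\epsilon\ \forall t\le0,\ d(\phi_t(x),\phi_t(y))\to0\text{ as }t\to-\infty\}$, the strong local unstable manifold of $x\in\Lambda$, is tangent to $E^u(x)$ at $x$. (LUPC): there exist constants $C>0$, $0<\alpha\le\beta<\alpha_2\le\beta_2$, for every $x\in\Lambda$ constants $\alpha\le\alpha_1(x)\le\beta_1(x)\le\beta$ with $2\alpha_1(x)-\beta_1(x)\ge\alpha$, and a $d\phi_t$-invariant splitting $E^u(x)=E^u_1(x)\oplus E^u_2(x)$, continuous in $x\in\Lambda$, such that $\frac1Ce^{\alpha_1(x)t}\|u\|\le\|d\phi_t(x)\cdot u\|\le Ce^{\beta_1(x)t}\|u\|$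 for $u\in E^u_1(x)$, $t>0$, and $\frac1Ce^{\alpha_2t}\|u\|\le\|d\phi_t(x)\cdot u\|\le Ce^{\beta_2t}\|u\|$ for $u\in E^u_2(x)$, $t>0$. Under (LUPC), $E^u_2$ is integrable; $W^{u,2}_\epsilon(x)$ ($x\in\Lambda$, $\epsilon$ small) is the $\phi_t$-invariant family of $C^2$ submanifolds of $W^u_\epsilon(x)$ tangent to $E^u_2(x)$ at $x$. (I): there exist $\epsilon_0>0$ and a continuous $\phi_t$-invariant family $W^{u,1}_{\epsilon_0}(x)$ ($x\in\Lambda$) of $C^2$ submanifolds of $W^u_{\epsilon_0}(x)$ with $T_x(W^{u,1}_{\epsilon_0}(x))=E^u_1(x)$ for all $x\in\Lambda$, and for any $\epsilon>0$ and $x\in\Lambda$, $\Lambda\cap W^u_\epsilon(x)\not\subset W^{u,2}_\epsilon(x)$. For $x_0\in\Lambda$ and $x\in W^{u,1}_\epsilon(x_0)$ set $E^u_1(x)=T_x(W^{u,1}_\epsilon(x_0))$, $E^u_1(x;\delta)=\{u\in E^u_1(x):\|u\|\le\delta\}$, and let $\exp^{u,1}_x$ be the exponential map at $x$ of the leaf $W^{u,1}$ through $x$ (a diffeomorphism from $E^u_1(x;\epsilon_0)$ onto its image, $\epsilon_0$ being small). The constant $C\ge1$ is taken sufficiently large (in particular bounding the derivatives of these exponential maps and their inverses), $t_0>0$ is sufficiently large, in particular $\gamma=8C^3e^{-\alpha t_0/2}<1$, and $f=\phi_{t_0}$. $\epsilon_1\in(0,\epsilon_0]$ is sufficiently small so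 that $\hat f_x=(\exp^{u,1}_{f(x)})^{-1}\circ f\circ\exp^{u,1}_x:E^u_1(x;\epsilon_1)\to E^u_1(f(x);\epsilon_0)$ is well-defined. For integers $k\ge1$, $\hat f^k_y=\hat f_{f^{k-1}(y)}\circ\cdots\circ\hat f_{f(y)}\circ\hat f_y$ and $\hat f^{-k}_y=(\hat f_{f^{-k}(y)})^{-1}\circ\cdots\circ(\hat f_{f^{-1}(y)})^{-1}$, where well-defined. Finally $\hat\phi_{x,t}=(\exp^{u,1}_{\phi_t(x)})^{-1}\circ\phi_t\circ\exp^{u,1}_x$. *)

theory Defs
  imports "HOL-Analysis.Analysis"
begin

section \<open>Maps of class C1 and C2 between normed spaces\<close>

text \<open>
  Derivatives are taken within the set, so that the notions also make sense on balls of linear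
  subspaces. There only the values of the derivatives on the subspace are determined.
\<close>

definition C1_on :: "('a::real_normed_vector \<Rightarrow> 'b::real_normed_vector) \<Rightarrow> 'a set \<Rightarrow> bool" where
  "C1_on f S \<longleftrightarrow> (\<exists>f' :: 'a \<Rightarrow> 'a \<Rightarrow>\<^sub>L 'b.
     (\<forall>x\<in>S. (f has_derivative blinfun_apply (f' x)) (at x within S)) \<and> continuous_on S f')"

definition derivs2_on ::
  "('a::real_normed_vector \<Rightarrow> 'b::real_normed_vector) \<Rightarrow> 'a set \<Rightarrow>
   ('a \<Rightarrow> 'a \<Rightarrow>\<^sub>L 'b) \<Rightarrow> ('a \<Rightarrow> 'a \<Rightarrow>\<^sub>L ('a \<Rightarrow>\<^sub>L 'b)) \<Rightarrow> bool" where
  "derivs2_on f S f' f'' \<longleftrightarrow>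
     (\<forall>x\<in>S. (f has_derivative blinfun_apply (f' x)) (at x within S)) \<and>
     (\<forall>x\<in>S. (f' has_derivative blinfun_apply (f'' x)) (at x within S)) \<and>
     continuous_on S f''"

definition C2_on :: "('a::real_normed_vector \<Rightarrow> 'b::real_normed_vector) \<Rightarrow> 'a set \<Rightarrow> bool" where
  "C2_on f S \<longleftrightarrow> (\<exists>f' f''. derivs2_on f S f' f'')"

definition C1_diffeo_on :: "('a::real_normed_vector \<Rightarrow> 'b::real_normed_vector) \<Rightarrow> 'a set \<Rightarrow> bool" where
  "C1_diffeo_on f S \<longleftrightarrow> inj_on f S \<and> C1_on f S \<and> C1_on (inv_into S f) (f ` S)"


section \<open>Riemannian manifolds of class C2\<close>

text \<open>
  The manifold is the whole type \<open>'m\<close>, modelled on \<open>'e\<close>. A chart \<open>chart M x\<close> with domain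
  \<open>cdom M x\<close> is chosen around each point \<open>x\<close> (the charts at all points form the atlas), and the
  tangent space at \<open>x\<close> is identified with \<open>'e\<close> through the chart chosen at \<open>x\<close>.
  \<open>metric M x\<close> is the Riemannian metric on the tangent space at \<open>x\<close> under this identification.
\<close>

record ('m, 'e) riem =
  chart :: "'m \<Rightarrow> 'm \<Rightarrow> 'e"
  cdom :: "'m \<Rightarrow> 'm set"
  metric :: "'m \<Rightarrow> 'e \<Rightarrow> 'e \<Rightarrow> real"

definition ichart :: "('m, 'e, 'z) riem_scheme \<Rightarrow> 'm \<Rightarrow> 'e \<Rightarrow> 'm" where
  "ichart M x = inv_into (cdom M x) (chart M x)"

text \<open>The vectors at \<open>x\<close>, given in the chart at \<open>x\<close>, expressed in the chart around \<open>z\<close>.\<close>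

definition coord_change ::
  "('m, 'e::euclidean_space, 'z) riem_scheme \<Rightarrow> 'm \<Rightarrow> 'm \<Rightarrow> 'e \<Rightarrow> 'e" where
  "coord_change M x z = frechet_derivative (chart M z \<circ> ichart M x) (at (chart M x x))"

definition mdiff ::
  "('m, 'e::euclidean_space, 'z) riem_scheme \<Rightarrow> ('m \<Rightarrow> 'm) \<Rightarrow> 'm \<Rightarrow> 'e \<Rightarrow> 'e" where
  "mdiff M f x = frechet_derivative (chart M (f x) \<circ> f \<circ> ichart M x) (at (chart M x x))"

text \<open>The differential at \<open>v \<in> S\<close> of a map \<open>\<theta>\<close> from a subset \<open>S\<close> of a normed space into \<open>M\<close>.\<close>

definition diff_into ::
  "('m, 'e::euclidean_space, 'z) riem_scheme \<Rightarrow> 'a::real_normed_vector set \<Rightarrow> ('a \<Rightarrow> 'm) \<Rightarrow> 'a \<Rightarrow> 'a \<Rightarrow> 'e"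
  where
  "diff_into M S \<theta> v = frechet_derivative (chart M (\<theta> v) \<circ> \<theta>) (at v within S)"

definition C2_into ::
  "('m::topological_space, 'e::euclidean_space, 'z) riem_scheme \<Rightarrow> 'a::real_normed_vector set \<Rightarrow> ('a \<Rightarrow> 'm) \<Rightarrow> bool"
  where
  "C2_into M S \<theta> \<longleftrightarrow> continuous_on S \<theta> \<and> (\<forall>z. C2_on (chart M z \<circ> \<theta>) {v\<in>S. \<theta> v \<in> cdom M z})"

definition gnorm :: "('m, 'e, 'z) riem_scheme \<Rightarrow> 'm \<Rightarrow> 'e \<Rightarrow> real" where
  "gnorm M x v = sqrt (metric M x v v)"

text \<open>The metric in the coordinates of the chart around \<open>z\<close>, at the coordinate point \<open>p\<close>.\<close>

definition local_metric ::
  "('m, 'e::euclidean_space, 'z) riem_scheme \<Rightarrow> 'm \<Rightarrow> 'e \<Rightarrow> 'e \<Rightarrow> 'e \<Rightarrow> real" where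
  "local_metric M z p a b =
     (let y = ichart M z p; T = frechet_derivative (chart M y \<circ> ichart M z) (at p)
      in metric M y (T a) (T b))"

definition C1_path :: "('m::topological_space, 'e::euclidean_space, 'z) riem_scheme \<Rightarrow> (real \<Rightarrow> 'm) \<Rightarrow> bool"
  where
  "C1_path M c \<longleftrightarrow> continuous_on {0..1} c \<and>
     (\<forall>z. C1_on (chart M z \<circ> c) {t\<in>{0..1}. c t \<in> cdom M z})"

definition path_len :: "('m, 'e::euclidean_space, 'z) riem_scheme \<Rightarrow> (real \<Rightarrow> 'm) \<Rightarrow> real" where
  "path_len M c = integral {0..1}
     (\<lambda>t. gnorm M (c t) (vector_derivative (chart M (c t) \<circ> c) (at t within {0..1})))"

text \<open>
  A C2 manifold with a Riemannian metric of class C1 (the highest regularity that makes sense on a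
  C2 manifold), such that the distance of the type \<open>'m\<close> is the Riemannian distance.
\<close>

definition riemannian_manifold ::
  "('m::metric_space, 'e::euclidean_space, 'z) riem_scheme \<Rightarrow> bool" where
  "riemannian_manifold M \<longleftrightarrow>
     (\<forall>x. x \<in> cdom M x \<and> open (cdom M x) \<and> open (chart M x ` cdom M x) \<and>
          homeomorphism (cdom M x) (chart M x ` cdom M x) (chart M x) (ichart M x)) \<and>
     (\<forall>x y. C2_on (chart M y \<circ> ichart M x) (chart M x ` (cdom M x \<inter> cdom M y))) \<and>
     (\<forall>x. bilinear (metric M x) \<and> (\<forall>u v. metric M x u v = metric M x v u) \<and>
          (\<forall>u. u \<noteq> 0 \<longrightarrow> metric M x u u > 0)) \<and>
     (\<forall>z a b. C1_on (\<lambda>p. local_metric M z p a b) (chart M z ` cdom M z)) \<and>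
     (\<forall>x y. \<exists>c. C1_path M c \<and> c 0 = x \<and> c 1 = y) \<and>
     (\<forall>x y. dist x y = Inf {path_len M c | c. C1_path M c \<and> c 0 = x \<and> c 1 = y})"


section \<open>Embedded discs, their tangent spaces and their geodesics\<close>

definition disc :: "'e::real_normed_vector set \<Rightarrow> 'e set" where
  "disc V = {v\<in>V. norm v \<le> 1}"

definition disc_param ::
  "('m::topological_space, 'e::euclidean_space, 'z) riem_scheme \<Rightarrow> 'e set \<Rightarrow> ('e \<Rightarrow> 'm) \<Rightarrow> 'm set \<Rightarrow> bool"
  where
  "disc_param M V \<theta> W \<longleftrightarrow> subspace V \<and> C2_into M (disc V) \<theta> \<and> inj_on \<theta> (disc V) \<and>
     (\<forall>v\<in>disc V. inj_on (diff_into M (disc V) \<theta> v) V) \<and> \<theta> ` disc V = W"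

definition tangent_at ::
  "('m::topological_space, 'e::euclidean_space, 'z) riem_scheme \<Rightarrow> 'm set \<Rightarrow> 'm \<Rightarrow> 'e set" where
  "tangent_at M W x = {diff_into M (disc V) \<theta> v w | V \<theta> v w.
     disc_param M V \<theta> W \<and> v \<in> disc V \<and> \<theta> v = x \<and> w \<in> V}"

definition pullback_metric ::
  "('m::topological_space, 'e::euclidean_space, 'z) riem_scheme \<Rightarrow> 'e set \<Rightarrow> ('e \<Rightarrow> 'm) \<Rightarrow> 'e \<Rightarrow> 'e \<Rightarrow> 'e \<Rightarrow> real"
  where
  "pullback_metric M V \<theta> v a b =
     metric M (\<theta> v) (diff_into M (disc V) \<theta> v a) (diff_into M (disc V) \<theta> v b)"

text \<open>
  Geodesics \<open>\<gamma> : [0,1] \<rightarrow> W\<close> of the induced metric. In the coordinates \<open>c\<close> of a parametrization, with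
  \<open>h\<close> the pulled back metric, the geodesic equation with Christoffel symbols of the first kind reads
  \<open>h (c'', w) + (D h [c']) (c', w) - 1/2 (D h [w]) (c', c') = 0\<close> for all \<open>w \<in> V\<close>.
\<close>

definition geodesic_in ::
  "('m::topological_space, 'e::euclidean_space, 'z) riem_scheme \<Rightarrow> 'm set \<Rightarrow> (real \<Rightarrow> 'm) \<Rightarrow> bool" where
  "geodesic_in M W \<gamma> \<longleftrightarrow> (\<exists>V \<theta> c c' c''. disc_param M V \<theta> W \<and>
     (let h = pullback_metric M V \<theta>;
          Dh = (\<lambda>v a p q. frechet_derivative (\<lambda>v. h v p q) (at v within disc V) a)
      in \<forall>t\<in>{0..1}. c t \<in> disc V \<and> \<gamma> t = \<theta> (c t) \<and>
           (c has_vector_derivative c' t) (at t within {0..1}) \<and>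
           (c' has_vector_derivative c'' t) (at t within {0..1}) \<and>
           (\<forall>w\<in>V. h (c t) (c'' t) w + Dh (c t) (c' t) (c' t) w
                    - Dh (c t) w (c' t) (c' t) / 2 = 0)))"

text \<open>
  A continuous family of embedded C2 discs with centres \<open>x \<in> \<Lambda>\<close>: the parametrizations can locally be
  chosen to depend continuously, in the C2 topology, on \<open>x\<close>.
\<close>

definition continuous_disc_family ::
  "('m::metric_space, 'e::euclidean_space, 'z) riem_scheme \<Rightarrow> 'm set \<Rightarrow> ('m \<Rightarrow> 'm set) \<Rightarrow> bool" where
  "continuous_disc_family M \<Lambda> W \<longleftrightarrow> (\<forall>z\<in>\<Lambda>. \<exists>N V \<Theta>. open N \<and> z \<in> N \<and> subspace V \<and>
     (\<forall>x\<in>N \<inter> \<Lambda>. disc_param M V (\<Theta> x) (W x) \<and> \<Theta> x 0 = x) \<and>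
     continuous_on ((N \<inter> \<Lambda>) \<times> disc V) (\<lambda>(x, v). \<Theta> x v) \<and>
     (\<forall>y. \<exists>f' f''.
        (\<forall>x\<in>N \<inter> \<Lambda>. derivs2_on (chart M y \<circ> \<Theta> x) {v\<in>disc V. \<Theta> x v \<in> cdom M y} (f' x) (f'' x)) \<and>
        continuous_on {(x, v). x \<in> N \<inter> \<Lambda> \<and> v \<in> disc V \<and> \<Theta> x v \<in> cdom M y} (\<lambda>(x, v). f' x v) \<and>
        continuous_on {(x, v). x \<in> N \<inter> \<Lambda> \<and> v \<in> disc V \<and> \<Theta> x v \<in> cdom M y} (\<lambda>(x, v). f'' x v)))"


section \<open>Flows and basic sets\<close>

definition C2_flow ::
  "('m::metric_space, 'e::euclidean_space, 'z) riem_scheme \<Rightarrow> (real \<Rightarrow> 'm \<Rightarrow> 'm) \<Rightarrow> bool" where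
  "C2_flow M \<phi> \<longleftrightarrow> (\<forall>x. \<phi> 0 x = x) \<and> (\<forall>s t x. \<phi> (s + t) x = \<phi> s (\<phi> t x)) \<and>
     continuous_on UNIV (\<lambda>(t, x). \<phi> t x) \<and>
     (\<forall>x y. C2_on (\<lambda>(t, p). chart M y (\<phi> t (ichart M x p)))
               {(t, p). p \<in> chart M x ` cdom M x \<and> \<phi> t (ichart M x p) \<in> cdom M y})"

definition flow_field ::
  "('m, 'e::euclidean_space, 'z) riem_scheme \<Rightarrow> (real \<Rightarrow> 'm \<Rightarrow> 'm) \<Rightarrow> 'm \<Rightarrow> 'e" where
  "flow_field M \<phi> x = vector_derivative (\<lambda>t. chart M x (\<phi> t x)) (at 0)"

definition direct_sum :: "'e::real_vector set \<Rightarrow> 'e set \<Rightarrow> 'e set \<Rightarrow> bool" where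
  "direct_sum A B S \<longleftrightarrow> subspace A \<and> subspace B \<and> A \<inter> B = {0} \<and> S = {a + b | a b. a \<in> A \<and> b \<in> B}"

definition invariant_bundle ::
  "('m, 'e::euclidean_space, 'z) riem_scheme \<Rightarrow> (real \<Rightarrow> 'm \<Rightarrow> 'm) \<Rightarrow> 'm set \<Rightarrow> ('m \<Rightarrow> 'e set) \<Rightarrow> bool" where
  "invariant_bundle M \<phi> \<Lambda> E \<longleftrightarrow> (\<forall>x\<in>\<Lambda>. \<forall>t. mdiff M (\<phi> t) x ` E x = E (\<phi> t x))"

text \<open>Continuity of a field of subspaces: local continuous frames exist.\<close>

definition continuous_bundle ::
  "('m::topological_space, 'e::euclidean_space, 'z) riem_scheme \<Rightarrow> 'm set \<Rightarrow> ('m \<Rightarrow> 'e set) \<Rightarrow> bool" where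
  "continuous_bundle M \<Lambda> E \<longleftrightarrow> (\<forall>z\<in>\<Lambda>. \<exists>N (k::nat) b. open N \<and> z \<in> N \<and> N \<subseteq> cdom M z \<and>
     (\<forall>i<k. continuous_on (N \<inter> \<Lambda>) (b i)) \<and>
     (\<forall>x\<in>N \<inter> \<Lambda>. inj_on (\<lambda>i. b i x) {..<k} \<and> independent ((\<lambda>i. b i x) ` {..<k}) \<and>
        span ((\<lambda>i. b i x) ` {..<k}) = coord_change M x z ` E x))"

definition hyperbolic_splitting ::
  "('m, 'e::euclidean_space, 'z) riem_scheme \<Rightarrow> (real \<Rightarrow> 'm \<Rightarrow> 'm) \<Rightarrow> 'm set \<Rightarrow>
   ('m \<Rightarrow> 'e set) \<Rightarrow> ('m \<Rightarrow> 'e set) \<Rightarrow> ('m \<Rightarrow> 'e set) \<Rightarrow> bool" where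
  "hyperbolic_splitting M \<phi> \<Lambda> E0 Eu Es \<longleftrightarrow>
     (\<forall>x\<in>\<Lambda>. E0 x = span {flow_field M \<phi> x} \<and> flow_field M \<phi> x \<noteq> 0 \<and>
        (\<exists>S. direct_sum (Eu x) (Es x) S \<and> direct_sum (E0 x) S UNIV)) \<and>
     invariant_bundle M \<phi> \<Lambda> E0 \<and> invariant_bundle M \<phi> \<Lambda> Eu \<and> invariant_bundle M \<phi> \<Lambda> Es \<and>
     (\<exists>c \<rho>. 0 < c \<and> 0 < \<rho> \<and> \<rho> < 1 \<and> (\<forall>x\<in>\<Lambda>. \<forall>t\<ge>0.
        (\<forall>v\<in>Es x. gnorm M (\<phi> t x) (mdiff M (\<phi> t) x v) \<le> c * \<rho> powr t * gnorm M x v) \<and>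
        (\<forall>v\<in>Eu x. gnorm M (\<phi> (- t) x) (mdiff M (\<phi> (- t)) x v) \<le> c * \<rho> powr t * gnorm M x v)))"

definition basic_set ::
  "('m::metric_space, 'e::euclidean_space, 'z) riem_scheme \<Rightarrow> (real \<Rightarrow> 'm \<Rightarrow> 'm) \<Rightarrow> 'm set \<Rightarrow>
   ('m \<Rightarrow> 'e set) \<Rightarrow> ('m \<Rightarrow> 'e set) \<Rightarrow> ('m \<Rightarrow> 'e set) \<Rightarrow> bool" where
  "basic_set M \<phi> \<Lambda> E0 Eu Es \<longleftrightarrow>
     \<Lambda> \<noteq> {} \<and> compact \<Lambda> \<and> (\<forall>t. \<phi> t ` \<Lambda> = \<Lambda>) \<and>
     \<not> (\<exists>x\<in>\<Lambda>. \<exists>T>0. \<phi> T x = x \<and> \<Lambda> = range (\<lambda>t. \<phi> t x)) \<and>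
     (\<forall>x\<in>\<Lambda>. \<exists>t. \<phi> t x \<noteq> x) \<and>
     (\<exists>x\<in>\<Lambda>. \<Lambda> \<subseteq> closure (range (\<lambda>t. \<phi> t x))) \<and>
     (\<exists>N. open N \<and> \<Lambda> \<subseteq> N \<and> \<Lambda> = (\<Inter>t. \<phi> t ` N)) \<and>
     hyperbolic_splitting M \<phi> \<Lambda> E0 Eu Es"

definition local_unstable :: "(real \<Rightarrow> 'm \<Rightarrow> 'm) \<Rightarrow> real \<Rightarrow> 'm::metric_space \<Rightarrow> 'm set" where
  "local_unstable \<phi> \<epsilon> x = {y. (\<forall>t\<le>0. dist (\<phi> t x) (\<phi> t y) \<le> \<epsilon>) \<and>
     ((\<lambda>t. dist (\<phi> t x) (\<phi> t y)) \<longlongrightarrow> 0) at_bot}"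

definition LUPC ::
  "('m::topological_space, 'e::euclidean_space, 'z) riem_scheme \<Rightarrow> (real \<Rightarrow> 'm \<Rightarrow> 'm) \<Rightarrow> 'm set \<Rightarrow>
   ('m \<Rightarrow> 'e set) \<Rightarrow> ('m \<Rightarrow> 'e set) \<Rightarrow> ('m \<Rightarrow> 'e set) \<Rightarrow>
   real \<Rightarrow> real \<Rightarrow> real \<Rightarrow> real \<Rightarrow> real \<Rightarrow> bool" where
  "LUPC M \<phi> \<Lambda> Eu E1 E2 C \<alpha> \<beta> \<alpha>2 \<beta>2 \<longleftrightarrow>
     0 < C \<and> 0 < \<alpha> \<and> \<alpha> \<le> \<beta> \<and> \<beta> < \<alpha>2 \<and> \<alpha>2 \<le> \<beta>2 \<and>
     (\<forall>x\<in>\<Lambda>. direct_sum (E1 x) (E2 x) (Eu x)) \<and>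
     invariant_bundle M \<phi> \<Lambda> E1 \<and> invariant_bundle M \<phi> \<Lambda> E2 \<and>
     continuous_bundle M \<Lambda> E1 \<and> continuous_bundle M \<Lambda> E2 \<and>
     (\<forall>x\<in>\<Lambda>. \<exists>\<alpha>1 \<beta>1. \<alpha> \<le> \<alpha>1 \<and> \<alpha>1 \<le> \<beta>1 \<and> \<beta>1 \<le> \<beta> \<and> 2 * \<alpha>1 - \<beta>1 \<ge> \<alpha> \<and>
        (\<forall>u\<in>E1 x. \<forall>t>0.
           1 / C * exp (\<alpha>1 * t) * gnorm M x u \<le> gnorm M (\<phi> t x) (mdiff M (\<phi> t) x u) \<and>
           gnorm M (\<phi> t x) (mdiff M (\<phi> t) x u) \<le> C * exp (\<beta>1 * t) * gnorm M x u) \<and>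
        (\<forall>u\<in>E2 x. \<forall>t>0.
           1 / C * exp (\<alpha>2 * t) * gnorm M x u \<le> gnorm M (\<phi> t x) (mdiff M (\<phi> t) x u) \<and>
           gnorm M (\<phi> t x) (mdiff M (\<phi> t) x u) \<le> C * exp (\<beta>2 * t) * gnorm M x u))"

text \<open>
  The local leaves \<open>W x\<close> of size \<open>\<epsilon>\<close> of an invariant family tangent to \<open>E\<close>. As for the local unstable
  manifolds, invariance of local leaves means that the flow maps leaves into leaves backwards in time.
\<close>

definition unstable_subfamily ::
  "('m::metric_space, 'e::euclidean_space, 'z) riem_scheme \<Rightarrow> (real \<Rightarrow> 'm \<Rightarrow> 'm) \<Rightarrow> 'm set \<Rightarrow>
   ('m \<Rightarrow> 'e set) \<Rightarrow> real \<Rightarrow> ('m \<Rightarrow> 'm set) \<Rightarrow> bool" where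
  "unstable_subfamily M \<phi> \<Lambda> E \<epsilon> W \<longleftrightarrow> 0 < \<epsilon> \<and> continuous_disc_family M \<Lambda> W \<and>
     (\<forall>x\<in>\<Lambda>. W x \<subseteq> local_unstable \<phi> \<epsilon> x \<and> tangent_at M (W x) x = E x \<and>
        (\<forall>t\<ge>0. \<phi> (- t) ` W x \<subseteq> W (\<phi> (- t) x)))"

text \<open>The leaves of smaller size \<open>\<epsilon>\<close> of such a family.\<close>

definition small_leaf ::
  "(real \<Rightarrow> 'm \<Rightarrow> 'm) \<Rightarrow> ('m \<Rightarrow> 'm set) \<Rightarrow> real \<Rightarrow> 'm::metric_space \<Rightarrow> 'm set" where
  "small_leaf \<phi> W \<epsilon> x = W x \<inter> local_unstable \<phi> \<epsilon> x"

text \<open>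
  Condition (I). \<open>W1\<close> is the family of leaves of size \<open>\<delta>1\<close> whose existence is required, \<open>W2\<close> the family
  of leaves, of some small size \<open>\<delta>2\<close>, of the strong unstable subfoliation tangent to \<open>E2\<close>.
\<close>

definition condition_I ::
  "('m::metric_space, 'e::euclidean_space, 'z) riem_scheme \<Rightarrow> (real \<Rightarrow> 'm \<Rightarrow> 'm) \<Rightarrow> 'm set \<Rightarrow>
   ('m \<Rightarrow> 'e set) \<Rightarrow> ('m \<Rightarrow> 'e set) \<Rightarrow> real \<Rightarrow> ('m \<Rightarrow> 'm set) \<Rightarrow> real \<Rightarrow> ('m \<Rightarrow> 'm set) \<Rightarrow> bool" where
  "condition_I M \<phi> \<Lambda> E1 E2 \<delta>1 W1 \<delta>2 W2 \<longleftrightarrow>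
     unstable_subfamily M \<phi> \<Lambda> E1 \<delta>1 W1 \<and> unstable_subfamily M \<phi> \<Lambda> E2 \<delta>2 W2 \<and>
     (\<forall>\<epsilon> x. 0 < \<epsilon> \<and> \<epsilon> \<le> \<delta>2 \<and> x \<in> \<Lambda> \<longrightarrow> \<not> \<Lambda> \<inter> local_unstable \<phi> \<epsilon> x \<subseteq> small_leaf \<phi> W2 \<epsilon> x)"


section \<open>The maps induced on the tangent spaces of the leaves\<close>

text \<open>
  The data on which the induced maps depend. Points \<open>x\<close> of leaves are given together with the base
  point \<open>x0 \<in> \<Lambda>\<close> of the leaf: \<open>leaf K x0\<close> is the leaf of \<open>x0\<close> given by condition (I),
  \<open>lexp K x0 x\<close> the exponential map of that leaf at \<open>x\<close>; \<open>eps0 K\<close>, \<open>eps1 K\<close> and \<open>time K\<close> are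
  the constants \<open>\<epsilon>\<^sub>0\<close>, \<open>\<epsilon>\<^sub>1\<close> and \<open>t\<^sub>0\<close>.
\<close>

record ('m, 'e) leaf_data = "('m, 'e) riem" +
  flow :: "real \<Rightarrow> 'm \<Rightarrow> 'm"
  leaf :: "'m \<Rightarrow> 'm set"
  lexp :: "'m \<Rightarrow> 'm \<Rightarrow> 'e \<Rightarrow> 'm"
  eps0 :: real
  eps1 :: real
  time :: real

definition sleaf :: "('m::metric_space, 'e) leaf_data \<Rightarrow> real \<Rightarrow> 'm \<Rightarrow> 'm set" where
  "sleaf K = small_leaf (flow K) (leaf K)"

definition tleaf :: "('m::topological_space, 'e::euclidean_space) leaf_data \<Rightarrow> 'm \<Rightarrow> 'm \<Rightarrow> 'e set" where
  "tleaf K x0 x = tangent_at K (leaf K x0) x"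

definition tball :: "('m::topological_space, 'e::euclidean_space) leaf_data \<Rightarrow> 'm \<Rightarrow> 'm \<Rightarrow> real \<Rightarrow> 'e set"
  where
  "tball K x0 x r = {u\<in>tleaf K x0 x. gnorm K x u \<le> r}"

text \<open>
  The exponential maps of the leaves at \<open>x\<close> in the leaf of size \<open>\<epsilon>\<^sub>0\<close> of \<open>x0\<close>. They are C2 diffeomorphisms
  onto their images, their derivatives and the inverses of their derivatives are bounded by \<open>C\<close>, and
  their second derivatives are uniformly bounded. Second derivatives of maps into \<open>M\<close> only make sense
  in charts of \<open>M\<close>, so the bound \<open>B\<close> on them is allowed to depend on the chart.
\<close>

definition leaf_exponentials ::
  "('m::metric_space, 'e::euclidean_space) leaf_data \<Rightarrow> 'm set \<Rightarrow> real \<Rightarrow> bool" where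
  "leaf_exponentials K \<Lambda> C \<longleftrightarrow>
     (\<forall>x0\<in>\<Lambda>. \<forall>x\<in>sleaf K (eps0 K) x0.
        let S = tball K x0 x (eps0 K); e = lexp K x0 x in
        e 0 = x \<and>
        (\<forall>u\<in>S. geodesic_in K (leaf K x0) (\<lambda>t. e (t *\<^sub>R u)) \<and>
           ((\<lambda>t. chart K x (e (t *\<^sub>R u))) has_vector_derivative u) (at 0 within {0..1})) \<and>
        C2_into K S e \<and> inj_on e S \<and>
        (\<forall>u\<in>S. \<forall>v\<in>tleaf K x0 x.
           gnorm K (e u) (diff_into K S e u v) \<le> C * gnorm K x v \<and>
           gnorm K x v \<le> C * gnorm K (e u) (diff_into K S e u v))) \<and>
     (\<forall>z. \<exists>r>0. \<exists>B. ball z r \<subseteq> cdom K z \<and>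
        (\<forall>x0\<in>\<Lambda>. \<forall>x\<in>sleaf K (eps0 K) x0.
           let S = {u\<in>tball K x0 x (eps0 K). lexp K x0 x u \<in> ball z r} in
           \<exists>f' f''. derivs2_on (chart K z \<circ> lexp K x0 x) S f' f'' \<and>
             (\<forall>u\<in>S. \<forall>v\<in>tleaf K x0 x. \<forall>w\<in>tleaf K x0 x.
                norm (blinfun_apply (blinfun_apply (f'' u) v) w) \<le> B * gnorm K x v * gnorm K x w)))"

text \<open>The map \<open>\<phi>\<^sub>t\<close> in exponential coordinates; the case \<open>t = t\<^sub>0\<close> is the map induced by \<open>f\<close>.\<close>

definition phihat ::
  "('m::topological_space, 'e::euclidean_space) leaf_data \<Rightarrow> 'm \<Rightarrow> 'm \<Rightarrow> real \<Rightarrow> 'e \<Rightarrow> 'e" where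
  "phihat K x0 x t = inv_into (tball K (flow K t x0) (flow K t x) (eps0 K))
       (lexp K (flow K t x0) (flow K t x)) \<circ> flow K t \<circ> lexp K x0 x"

definition phihat_defined ::
  "('m::topological_space, 'e::euclidean_space) leaf_data \<Rightarrow> 'm \<Rightarrow> 'm \<Rightarrow> real \<Rightarrow> 'e \<Rightarrow> bool" where
  "phihat_defined K x0 x t u \<longleftrightarrow> flow K t (lexp K x0 x u)
     \<in> lexp K (flow K t x0) (flow K t x) ` tball K (flow K t x0) (flow K t x) (eps0 K)"

definition fhat ::
  "('m::topological_space, 'e::euclidean_space) leaf_data \<Rightarrow> 'm \<Rightarrow> 'm \<Rightarrow> 'e \<Rightarrow> 'e" where
  "fhat K x0 x = phihat K x0 x (time K)"

definition fiter :: "('m, 'e) leaf_data \<Rightarrow> int \<Rightarrow> 'm \<Rightarrow> 'm" where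
  "fiter K k = flow K (of_int k * time K)"

primrec fhat_pow ::
  "('m::topological_space, 'e::euclidean_space) leaf_data \<Rightarrow> nat \<Rightarrow> 'm \<Rightarrow> 'm \<Rightarrow> 'e \<Rightarrow> 'e" where
  "fhat_pow K 0 x0 x u = u"
| "fhat_pow K (Suc k) x0 x u = fhat K (fiter K (int k) x0) (fiter K (int k) x) (fhat_pow K k x0 x u)"

primrec fhat_inv ::
  "('m::topological_space, 'e::euclidean_space) leaf_data \<Rightarrow> nat \<Rightarrow> 'm \<Rightarrow> 'm \<Rightarrow> 'e \<Rightarrow> 'e" where
  "fhat_inv K 0 x0 x u = u"
| "fhat_inv K (Suc k) x0 x u =
     (let y0 = fiter K (- int (Suc k)) x0; y = fiter K (- int (Suc k)) x
      in inv_into (tball K y0 y (eps1 K)) (fhat K y0 y) (fhat_inv K k x0 x u))"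

definition fhat_inv_defined ::
  "('m::topological_space, 'e::euclidean_space) leaf_data \<Rightarrow> nat \<Rightarrow> 'm \<Rightarrow> 'm \<Rightarrow> 'e \<Rightarrow> bool" where
  "fhat_inv_defined K p x0 x u \<longleftrightarrow>
     (\<forall>k<p. let y0 = fiter K (- int (Suc k)) x0; y = fiter K (- int (Suc k)) x
            in fhat_inv K k x0 x u \<in> fhat K y0 y ` tball K y0 y (eps1 K))"

text \<open>
  The derivative at \<open>u\<close> of a map defined near \<open>u\<close> in the tangent space at \<open>x\<close> of the leaf of \<open>x0\<close>.
  It is only meaningful on vectors of that tangent space.
\<close>

definition tderiv ::
  "('m::topological_space, 'e::euclidean_space) leaf_data \<Rightarrow> 'm \<Rightarrow> 'm \<Rightarrow> ('e \<Rightarrow> 'e) \<Rightarrow> 'e \<Rightarrow> 'e \<Rightarrow> 'e" where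
  "tderiv K x0 x g u = frechet_derivative g (at u within tleaf K x0 x)"

text \<open>The derivative at \<open>w\<close> of the \<open>p\<close>-th iterate that starts at \<open>f\<^sup>-\<^sup>p(x)\<close> and ends at \<open>x\<close>.\<close>

definition dfhat_back ::
  "('m::topological_space, 'e::euclidean_space) leaf_data \<Rightarrow> nat \<Rightarrow> 'm \<Rightarrow> 'm \<Rightarrow> 'e \<Rightarrow> 'e \<Rightarrow> 'e" where
  "dfhat_back K p x0 x w =
     (let y0 = fiter K (- int p) x0; y = fiter K (- int p) x
      in tderiv K y0 y (fhat_pow K p y0 y) w)"

definition F_approx ::
  "('m::topological_space, 'e::euclidean_space) leaf_data \<Rightarrow> 'm \<Rightarrow> 'm \<Rightarrow> nat \<Rightarrow> 'e \<Rightarrow> 'e" where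
  "F_approx K x0 x p u = dfhat_back K p x0 x 0 (fhat_inv K p x0 x u)"

definition F_map ::
  "('m::topological_space, 'e::euclidean_space) leaf_data \<Rightarrow> 'm \<Rightarrow> 'm \<Rightarrow> 'e \<Rightarrow> 'e" where
  "F_map K x0 x u = lim (\<lambda>p. F_approx K x0 x p u)"

definition L_approx ::
  "('m::topological_space, 'e::euclidean_space) leaf_data \<Rightarrow> 'm \<Rightarrow> 'm \<Rightarrow> 'e \<Rightarrow> nat \<Rightarrow> 'e \<Rightarrow> 'e" where
  "L_approx K x0 x \<xi> p v =
     dfhat_back K p x0 x (fhat_inv K p x0 x \<xi>) (tderiv K x0 x (fhat_inv K p x0 x) 0 v)"

definition L_map ::
  "('m::topological_space, 'e::euclidean_space) leaf_data \<Rightarrow> 'm \<Rightarrow> 'm \<Rightarrow> 'e \<Rightarrow> 'e \<Rightarrow> 'e" where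
  "L_map K x0 x \<xi> v = lim (\<lambda>p. L_approx K x0 x \<xi> p v)"

definition F_approx_at ::
  "('m::topological_space, 'e::euclidean_space) leaf_data \<Rightarrow> 'm \<Rightarrow> 'm \<Rightarrow> 'e \<Rightarrow> nat \<Rightarrow> 'e \<Rightarrow> 'e" where
  "F_approx_at K x0 x \<xi> p u = dfhat_back K p x0 x (fhat_inv K p x0 x \<xi>) (fhat_inv K p x0 x u)"

definition F_map_at ::
  "('m::topological_space, 'e::euclidean_space) leaf_data \<Rightarrow> 'm \<Rightarrow> 'm \<Rightarrow> 'e \<Rightarrow> 'e \<Rightarrow> 'e" where
  "F_map_at K x0 x \<xi> u = lim (\<lambda>p. F_approx_at K x0 x \<xi> p u)"

end

theory Submission
  imports Defs
begin

text \<open>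
  The maps whose limits are taken are best read backwards in time, where the leaves contract. In
  exponential coordinates the flow over one period, backwards, is a map \<open>h k\<close> from a ball in the tangent
  space of the leaf at the \<open>k\<close>-th point of the backward orbit of \<open>x\<close> to the tangent space at the next one.
  The composition \<open>H p\<close> of the first \<open>p\<close> of these maps is \<open>fhat_inv K p x0 x\<close> (\<open>fhat_inv_H\<close>), and the
  derivative of the \<open>p\<close>-th forward iterate at a point \<open>H p \<xi>\<close> inverts that of \<open>H p\<close> at \<open>\<xi>\<close>
  (\<open>dfhat_back_inverse\<close>). So the approximations of \<open>F\<close> are the maps \<open>T p = (H p)'(0)\<^sup>-\<^sup>1 \<circ> H p\<close>
  (\<open>F_approx_T\<close>).
  
  Their derivatives change, from \<open>p\<close> to \<open>p + 1\<close> and on a vector \<open>v\<close>, by what the inverse of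
  \<open>(H (p + 1))'(0)\<close> makes of \<open>((h p)'(H p u) - (h p)'(0)) ((H p)'(u) v)\<close>. The last vector is small of
  second order in the contraction of \<open>H p\<close>: one factor comes from \<open>(H p)'(u) v\<close>, the other from the
  Lipschitz continuity of \<open>(h p)'\<close> and the size of \<open>H p u\<close>. The inverse expands it at most by the
  reciprocal of the contraction of the linear parts. If \<open>\<alpha>1\<close> and \<open>\<beta>1\<close> are the rates of the base point, a
  single step reduces norms to at most \<open>2 C exp (- \<alpha>1 t0)\<close> times their value, and its linear part to at
  least \<open>exp (- \<beta>1 t0) / (2 C)\<close> times their value; since \<open>2 \<alpha>1 - \<beta>1 \<ge> \<alpha>\<close>, the square of the first number is
  at most \<open>\<gamma>\<close> times the second. Hence the derivatives of \<open>T p\<close> converge at the rate \<open>\<gamma> ^ p\<close>, uniformly on the ball, to those of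
  \<open>F\<close>. The quadratic estimate follows by integration, and on a small ball the derivative of \<open>F\<close> is so
  close to the identity that \<open>F\<close> is a diffeomorphism. This argument is carried out for an abstract
  \<open>contraction_chain\<close> (\<open>T'_step\<close>, \<open>F_T_diff\<close>, \<open>F_C1_diffeo\<close>). There \<open>L\<^sub>\<xi>\<close> turns out to be the inverse of the
  derivative of \<open>F\<close> at \<open>\<xi>\<close>, because its approximations are the inverses of the derivatives of \<open>T p\<close>
  (\<open>inverse_derivatives_limit\<close>).
  
  What remains is to see that backward orbits of points of small leaves are such chains, with uniform
  constants. That the flow maps exponential balls of a uniform size into exponential balls at all is a
  connectedness argument based on invariance of domain (\<open>flow_exp_ball_local\<close>). Its uniform derivative and
  Lipschitz bounds hold near each point and each time, and extend to compact sets of times and base points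
  (\<open>backward_control_uniform\<close>). The rates are given only at the points of \<open>\<Lambda>\<close>; over one period they are
  valid up to a factor \<open>3/2\<close> at all points of sufficiently small leaves, because the leaves form a continuous
  family over a compact set (\<open>stretch_near_center\<close>, \<open>center_rates\<close>). Small leaves are mapped into small
  leaves backwards in time, so that this applies to all steps of a chain (\<open>chain_exists\<close>).
  
  Over a time that is not a multiple of the period, one more linearization over less than a period is
  needed. It is again quadratic, and is carried back like the other errors (\<open>continuous_time_approx\<close>), so
  that the limit over all real times is the same. Then both sides of the equivariance relation are limits
  along one curve (\<open>F_map_equivariant\<close>), and its case of a multiple of the period is the relation for
  \<open>fhat_inv\<close>.
\<close>

section \<open>Derivatives within convex subsets of linear subspaces\<close>

text \<open>
  Balls of tangent spaces of the leaves have empty interior in the ambient space, so that derivatives within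
  them are not unique there. For sets \<open>S\<close> of the present kind the derivative is unique on \<open>V\<close>.
\<close>

definition solid_in :: "'a::real_normed_vector set \<Rightarrow> 'a set \<Rightarrow> bool" where
  "solid_in V S \<longleftrightarrow> subspace V \<and> convex S \<and> S \<subseteq> V \<and> (\<forall>v\<in>V. \<exists>e>0. e *\<^sub>R v \<in> S)"

lemma solid_in_zero: "solid_in V S \<Longrightarrow> 0 \<in> S"
  unfolding solid_in_def using subspace_0 by fastforce

lemma solid_in_self: "subspace V \<Longrightarrow> solid_in V V"
  unfolding solid_in_def by (auto intro: subspace_imp_convex exI[of _ 1])

lemma derivative_along_segment:
  fixes f :: "'a::real_normed_vector \<Rightarrow> 'b::real_normed_vector"
  assumes f: "(f has_derivative f') (at (u + s *\<^sub>R d) within S)"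
    and seg: "\<And>t. t \<in> {0..1} \<Longrightarrow> u + t *\<^sub>R d \<in> S"
  shows "((\<lambda>t. f (u + t *\<^sub>R d)) has_vector_derivative f' d) (at s within {0..1})"
proof -
  have 1: "((\<lambda>t::real. u + t *\<^sub>R d) has_derivative (\<lambda>h. h *\<^sub>R d)) (at s within {0..1})"
    by (auto intro!: derivative_eq_intros)
  have 2: "(f has_derivative f') (at (u + s *\<^sub>R d) within (\<lambda>t. u + t *\<^sub>R d) ` {0..1})"
    by (rule has_derivative_subset[OF f]) (use seg in auto)
  have "((\<lambda>t. f (u + t *\<^sub>R d)) has_derivative (\<lambda>h. f' (h *\<^sub>R d))) (at s within {0..1})"
    by (rule has_derivative_in_compose[OF 1 2])
  moreover have "f' (h *\<^sub>R d) = h *\<^sub>R f' d" for h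
    using linear_cmul[OF has_derivative_linear[OF f]] .
  ultimately show ?thesis unfolding has_vector_derivative_def by simp
qed

text \<open>
  A derivative within such a set is determined on the whole subspace: segments determine it on the
  differences of points of the set, and these span the subspace.
\<close>

lemma derivative_unique_on_solid:
  assumes S: "solid_in V S" and u: "u \<in> S" and v: "v \<in> V"
    and f: "(f has_derivative f1) (at u within S)" "(f has_derivative f2) (at u within S)"
  shows "f1 v = f2 v"
proof -
  have diff: "f1 (w - u) = f2 (w - u)" if "w \<in> S" for w
  proof -
    have seg: "u + t *\<^sub>R (w - u) \<in> S" if "t \<in> {0..1}" for t
    proof -
      have "(1 - t) *\<^sub>R u + t *\<^sub>R w \<in> S"
        using S u \<open>w \<in> S\<close> that unfolding solid_in_def convex_def by auto
      then show ?thesis by (simp add: algebra_simps)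
    qed
    have "((\<lambda>t. f (u + t *\<^sub>R (w - u))) has_vector_derivative f1 (w - u)) (at 0 within {0..1})"
         "((\<lambda>t. f (u + t *\<^sub>R (w - u))) has_vector_derivative f2 (w - u)) (at 0 within {0..1})"
      by (rule derivative_along_segment[OF _ seg]; use f in simp)+
    then show ?thesis
      by (rule vector_derivative_unique_within[rotated]) (simp add: trivial_limit_within islimpt_Icc)
  qed
  obtain e where e: "e > 0" "e *\<^sub>R v \<in> S" using S v unfolding solid_in_def by auto
  have lin: "linear f1" "linear f2" using f by (auto dest: has_derivative_linear)
  have "f1 ((e *\<^sub>R v - u) - (0 - u)) = f2 ((e *\<^sub>R v - u) - (0 - u))"
    unfolding linear_diff[OF lin(1), of "e *\<^sub>R v - u"] linear_diff[OF lin(2), of "e *\<^sub>R v - u"]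
    using diff[OF e(2)] diff[OF solid_in_zero[OF S]] by simp
  then show ?thesis using e(1) by (simp add: linear_cmul[OF lin(1)] linear_cmul[OF lin(2)])
qed

text \<open>
  Composed with a projection to the subspace a derivative is controlled on all vectors by its values on
  the subspace, as is needed for the convergence of derivatives as linear maps.
\<close>

lemma has_derivative_change_off_subspace:
  assumes f: "(f has_derivative f') (at u within S)" and S: "subspace V" "S \<subseteq> V" "u \<in> V"
    and g: "bounded_linear f''" and eq: "\<And>v. v \<in> V \<Longrightarrow> f'' v = f' v"
  shows "(f has_derivative f'') (at u within S)"
proof -
  have "((\<lambda>y. (1 / norm (y - u)) *\<^sub>R (f y - (f u + f'' (y - u)))) \<longlongrightarrow> 0) (at u within S)"
    using f unfolding has_derivative_within
  proof (elim conjE Lim_transform_eventually)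
    show "\<forall>\<^sub>F y in at u within S. (1 / norm (y - u)) *\<^sub>R (f y - (f u + f' (y - u)))
      = (1 / norm (y - u)) *\<^sub>R (f y - (f u + f'' (y - u)))"
      unfolding eventually_at_filter
      by (rule always_eventually) (use eq S in \<open>auto simp: subspace_diff subsetD\<close>)
  qed
  then show ?thesis unfolding has_derivative_within using g by simp
qed

text \<open>
  If \<open>G \<circ> w\<close> is differentiable and the derivative of \<open>G\<close> is injective on the directions in which \<open>w\<close>
  moves, then the continuous map \<open>w\<close> is differentiable: the increments of \<open>w\<close> are recovered from
  those of \<open>G \<circ> w\<close> by a left inverse of the derivative, up to an error that is small relative to the
  increments of \<open>w\<close> and is therefore absorbed.
\<close>

lemma has_derivative_lift_left_inverse:
  fixes G :: "'a::euclidean_space \<Rightarrow> 'b::euclidean_space" and w :: "'c::real_normed_vector \<Rightarrow> 'a"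
  assumes G: "(G has_derivative G') (at (w s) within S)"
    and J: "linear J" "\<And>t. t \<in> T \<Longrightarrow> J (G' (w t - w s)) = w t - w s"
    and S: "\<And>t. t \<in> T \<Longrightarrow> w t \<in> S"
    and k: "((\<lambda>t. G (w t)) has_derivative k') (at s within T)"
    and cont: "continuous (at s within T) w"
  shows "(w has_derivative (\<lambda>h. J (k' h))) (at s within T)"
proof -
  have blJ: "bounded_linear J" using J(1) by (simp add: linear_conv_bounded_linear)
  obtain c where c: "c > 0" "\<And>v. norm (J v) \<le> norm v * c"
    using bounded_linear.pos_bounded[OF blJ] by blast
  have blk: "bounded_linear k'" using k by (rule has_derivative_bounded_linear)
  obtain M where M: "M > 0" "\<And>h. norm (k' h) \<le> norm h * M"
    using bounded_linear.pos_bounded[OF blk] by blast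
  have est: "\<exists>d>0. \<forall>t\<in>T. norm (t - s) < d \<longrightarrow>
      norm (w t - w s - J (k' (t - s))) \<le> e * norm (t - s)" if e: "e > 0" for e
  proof -
    \<comment> \<open>The increment of \<open>w\<close> is at most \<open>2 c (M + 1)\<close> times that of the parameter once the relative
        error \<open>e1\<close> of \<open>G\<close> is below \<open>1 / (2 c)\<close>; then both errors add up to at most \<open>e\<close>.\<close>
    define e1 where "e1 = min (1 / (2 * c)) (e / (4 * c * c * (M + 1)))"
    define e2 where "e2 = min 1 (e / (2 * c))"
    have pos: "e1 > 0" "e2 > 0" using c(1) M(1) e by (auto simp: e1_def e2_def)
    obtain d1 where d1: "d1 > 0" "\<And>y. y \<in> S \<Longrightarrow> norm (y - w s) < d1 \<Longrightarrow>
        norm (G y - G (w s) - G' (y - w s)) \<le> e1 * norm (y - w s)"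
      using G pos(1) unfolding has_derivative_within_alt by metis
    obtain d2 where d2: "d2 > 0" "\<And>t. t \<in> T \<Longrightarrow> norm (t - s) < d2 \<Longrightarrow>
        norm (G (w t) - G (w s) - k' (t - s)) \<le> e2 * norm (t - s)"
      using k pos(2) unfolding has_derivative_within_alt by metis
    obtain d3 where d3: "d3 > 0" "\<And>t. t \<in> T \<Longrightarrow> norm (t - s) < d3 \<Longrightarrow> norm (w t - w s) < d1"
      using cont d1(1) unfolding continuous_within_eps_delta dist_norm by metis
    show ?thesis
    proof (intro exI[of _ "min d2 d3"] conjI ballI impI)
      show "min d2 d3 > 0" using d2(1) d3(1) by simp
      fix t assume t: "t \<in> T" "norm (t - s) < min d2 d3"
      define x where "x = w t - w s"
      define a where "a = G (w t) - G (w s) - G' x"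
      define b where "b = G (w t) - G (w s) - k' (t - s)"
      have a: "norm a \<le> e1 * norm x" using d1(2)[OF S[OF t(1)]] d3(2)[OF t(1)] t(2)
        by (simp add: a_def x_def)
      have b: "norm b \<le> e2 * norm (t - s)" using d2(2)[OF t(1)] t(2) by (simp add: b_def)
      have "x = J (G' x)" using J(2)[OF t(1)] by (simp add: x_def)
      also have "G' x = k' (t - s) + b - a" by (simp add: a_def b_def)
      also have "J \<dots> = J (k' (t - s)) + J b - J a"
        by (simp add: linear_add[OF J(1)] linear_diff[OF J(1)])
      finally have x: "x = J (k' (t - s)) + J b - J a" .
      have Ja: "norm (J a) \<le> e1 * c * norm x"
        using order_trans[OF c(2)[of a] mult_right_mono[OF a less_imp_le[OF c(1)]]] by (simp add: ac_simps)
      have Jb: "norm (J b) \<le> e2 * c * norm (t - s)"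
        using order_trans[OF c(2)[of b] mult_right_mono[OF b less_imp_le[OF c(1)]]] by (simp add: ac_simps)
      have Jk: "norm (J (k' (t - s))) \<le> c * M * norm (t - s)"
        using order_trans[OF c(2)[of "k' (t - s)"] mult_right_mono[OF M(2)[of "t - s"] less_imp_le[OF c(1)]]]
        by (simp add: ac_simps)
      have "e1 * c \<le> 1 / (2 * c) * c" using c(1) by (intro mult_right_mono) (auto simp: e1_def)
      then have "e1 * c \<le> 1 / 2" using c(1) by simp
      then have Ja': "norm (J a) \<le> 1 / 2 * norm x"
        using Ja mult_right_mono[of "e1 * c" "1/2" "norm x"] by simp
      have e2c: "e2 * c \<le> c" using c(1) by (simp add: e2_def)
      have Jb': "norm (J b) \<le> c * norm (t - s)"
        using Jb mult_right_mono[OF e2c, of "norm (t - s)"] by simp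
      have "norm x \<le> norm (J (k' (t - s))) + norm (J b) + norm (J a)"
        using norm_triangle_ineq4[of "J (k' (t - s)) + J b" "J a"] norm_triangle_ineq[of "J (k' (t - s))" "J b"]
        unfolding x[symmetric] by linarith
      then have nx: "norm x \<le> 2 * c * (M + 1) * norm (t - s)"
        using Ja' Jb' Jk by (simp add: algebra_simps)
      have "e1 * c * (2 * c * (M + 1)) \<le> e / (4 * c * c * (M + 1)) * c * (2 * c * (M + 1))"
        using c(1) M(1) by (intro mult_right_mono) (auto simp: e1_def)
      also have "\<dots> = e / 2"
      proof -
        have "c \<noteq> 0" "M + 1 \<noteq> 0" using c(1) M(1) by auto
        then show ?thesis by (simp add: divide_simps)
      qed
      finally have e1e: "e1 * c * (2 * c * (M + 1)) \<le> e / 2" .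
      have "norm (J a) \<le> e1 * c * (2 * c * (M + 1) * norm (t - s))"
        using order_trans[OF Ja mult_left_mono[OF nx, of "e1 * c"]] pos(1) c(1) by simp
      also have "\<dots> \<le> e / 2 * norm (t - s)"
        using mult_right_mono[OF e1e, of "norm (t - s)"] by (simp add: ac_simps)
      finally have A: "norm (J a) \<le> e / 2 * norm (t - s)" .
      have "e2 * c \<le> e / (2 * c) * c" using c(1) by (intro mult_right_mono) (auto simp: e2_def)
      then have "e2 * c \<le> e / 2" using c(1) by simp
      then have B: "norm (J b) \<le> e / 2 * norm (t - s)"
        using Jb mult_right_mono[of "e2 * c" "e/2" "norm (t - s)"] by simp
      have "w t - w s - J (k' (t - s)) = J b - J a" using x by (simp add: x_def)
      then have "norm (w t - w s - J (k' (t - s))) \<le> norm (J b) + norm (J a)"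
        by (metis norm_triangle_ineq4)
      then show "norm (w t - w s - J (k' (t - s))) \<le> e * norm (t - s)" using A B by simp
    qed
  qed
  show ?thesis unfolding has_derivative_within_alt
    using bounded_linear_compose[OF blJ blk] est by blast
qed

corollary has_derivative_lift:
  fixes G :: "'a::euclidean_space \<Rightarrow> 'b::euclidean_space" and w :: "'c::real_normed_vector \<Rightarrow> 'a"
  assumes G: "(G has_derivative G') (at (w s) within S)"
    and V: "subspace V" "\<And>t. t \<in> T \<Longrightarrow> w t - w s \<in> V" and inj: "inj_on G' V"
    and S: "\<And>t. t \<in> T \<Longrightarrow> w t \<in> S"
    and k: "((\<lambda>t. G (w t)) has_derivative k') (at s within T)"
    and cont: "continuous (at s within T) w"
  shows "\<exists>w'. (w has_derivative w') (at s within T) \<and> (\<forall>h. w' h \<in> V)"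
proof -
  obtain J where J: "range J \<subseteq> V" "linear J" "\<And>v. v \<in> V \<Longrightarrow> J (G' v) = v"
    using linear_exists_left_inverse_on[OF has_derivative_linear[OF G] V(1) inj] by blast
  have "(w has_derivative (\<lambda>h. J (k' h))) (at s within T)"
    by (rule has_derivative_lift_left_inverse[where G = G and G' = G' and w = w, OF G J(2) _ S k cont])
      (simp_all add: J(3) V(2))
  then show ?thesis using J(1) by blast
qed

section \<open>Local bounds for maps of class C2\<close>

text \<open>The second derivative is bounded near \<open>x\<close> by continuity, which makes the first one Lipschitz.\<close>

lemma derivs2_on_local_bound:
  fixes f :: "'a::real_normed_vector \<Rightarrow> 'b::real_normed_vector"
  assumes f: "derivs2_on f S f' f''" and S: "open S" "x \<in> S"
  obtains r B where "r > 0" "B > 0" "ball x r \<subseteq> S"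
    "\<And>y. y \<in> ball x r \<Longrightarrow> norm (f' y) \<le> B"
    "\<And>y z. y \<in> ball x r \<Longrightarrow> z \<in> ball x r \<Longrightarrow> norm (f' y - f' z) \<le> B * norm (y - z)"
proof -
  have c2: "continuous (at x) f''"
    using f S unfolding derivs2_on_def by (simp add: continuous_on_eq_continuous_at)
  have "(f' has_derivative blinfun_apply (f'' x)) (at x)"
    using f S unfolding derivs2_on_def by (metis at_within_open)
  then have c1: "continuous (at x) f'" by (rule has_derivative_continuous)
  obtain r1 where r1: "r1 > 0" "ball x r1 \<subseteq> S" using S open_contains_ball by blast
  obtain r2 where r2: "r2 > 0" "\<And>y. dist y x < r2 \<Longrightarrow> dist (f'' y) (f'' x) < 1"
    using c2 unfolding continuous_at_eps_delta by (metis zero_less_one)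
  obtain r3 where r3: "r3 > 0" "\<And>y. dist y x < r3 \<Longrightarrow> dist (f' y) (f' x) < 1"
    using c1 unfolding continuous_at_eps_delta by (metis zero_less_one)
  define r where "r = min r1 (min r2 r3)"
  define B where "B = norm (f' x) + norm (f'' x) + 1"
  have sub: "ball x r \<subseteq> S" using r1 by (auto simp: r_def)
  have b2: "norm (f'' y) \<le> B" and b1: "norm (f' y) \<le> B" if "y \<in> ball x r" for y
  proof -
    have "norm (f'' y) \<le> norm (f'' x) + dist (f'' y) (f'' x)"
         "norm (f' y) \<le> norm (f' x) + dist (f' y) (f' x)"
      unfolding dist_norm by (metis add.commute diff_add_cancel norm_triangle_ineq)+
    moreover have "dist y x < r2" "dist y x < r3" using that by (auto simp: r_def dist_commute)
    moreover note r2(2)[of y] r3(2)[of y] norm_ge_zero[of "f' x"] norm_ge_zero[of "f'' x"]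
    ultimately show "norm (f'' y) \<le> B" "norm (f' y) \<le> B" unfolding B_def by linarith+
  qed
  have "norm (f' y - f' z) \<le> B * norm (y - z)" if "y \<in> ball x r" "z \<in> ball x r" for y z
  proof (rule differentiable_bound[OF convex_ball[of x r], where f' = "\<lambda>y. blinfun_apply (f'' y)"])
    fix a assume a: "a \<in> ball x r"
    then have "(f' has_derivative blinfun_apply (f'' a)) (at a within S)"
      using f sub unfolding derivs2_on_def by blast
    then show "(f' has_derivative blinfun_apply (f'' a)) (at a within ball x r)"
      by (rule has_derivative_subset[OF _ sub])
    show "onorm (blinfun_apply (f'' a)) \<le> B" using b2[OF a] by (simp add: norm_blinfun.rep_eq)
  qed (use that in auto)
  moreover have "r > 0" "B > 0" using r1 r2 r3 by (auto simp: r_def B_def add_nonneg_pos)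
  ultimately show ?thesis using that[of r B] sub b1 by blast
qed

section \<open>Norms of inner products\<close>

text \<open>The metric depends on the point of the manifold, so that no type class can provide its norms.\<close>

definition inner_form :: "('a::real_vector \<Rightarrow> 'a \<Rightarrow> real) \<Rightarrow> bool" where
  "inner_form m \<longleftrightarrow> bilinear m \<and> (\<forall>u v. m u v = m v u) \<and> (\<forall>u. u \<noteq> 0 \<longrightarrow> m u u > 0)"

definition form_norm :: "('a \<Rightarrow> 'a \<Rightarrow> real) \<Rightarrow> 'a \<Rightarrow> real" where
  "form_norm m v = sqrt (m v v)"

context
  fixes m :: "'a::real_vector \<Rightarrow> 'a \<Rightarrow> real"
  assumes m: "inner_form m"
begin

lemma inner_form_bilinear: "bilinear m" using m by (simp add: inner_form_def)

lemma inner_form_sym: "m u v = m v u" using m by (simp add: inner_form_def)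

lemma inner_form_ge0: "m u u \<ge> 0"
  using m bilinear_lzero[OF inner_form_bilinear, of u] unfolding inner_form_def by (cases "u = 0") (auto simp: less_imp_le)

lemma form_norm_ge0 [simp]: "form_norm m u \<ge> 0"
  by (simp add: form_norm_def inner_form_ge0)

lemma form_norm_0 [simp]: "form_norm m 0 = 0"
  by (simp add: form_norm_def bilinear_lzero[OF inner_form_bilinear])

lemma form_norm_eq_0: "form_norm m u = 0 \<longleftrightarrow> u = 0"
proof
  assume "form_norm m u = 0"
  then show "u = 0" using m by (cases "u = 0") (auto simp: form_norm_def inner_form_def)
qed simp

lemma form_norm_pos: "u \<noteq> 0 \<Longrightarrow> form_norm m u > 0"
  using form_norm_ge0[of u] form_norm_eq_0[of u] by linarith

lemma form_norm_sq: "(form_norm m u)\<^sup>2 = m u u"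
  by (simp add: form_norm_def inner_form_ge0)

lemma form_norm_scale: "form_norm m (a *\<^sub>R u) = \<bar>a\<bar> * form_norm m u"
proof -
  have "m (a *\<^sub>R u) (a *\<^sub>R u) = a\<^sup>2 * m u u"
    by (simp add: bilinear_lmul[OF inner_form_bilinear] bilinear_rmul[OF inner_form_bilinear] power2_eq_square)
  then show ?thesis by (simp add: form_norm_def real_sqrt_mult)
qed

lemma form_norm_minus: "form_norm m (- u) = form_norm m u"
  using form_norm_scale[of "-1" u] by simp

lemma form_norm_diff_commute: "form_norm m (u - v) = form_norm m (v - u)"
  using form_norm_minus[of "u - v"] by simp

lemma inner_form_Cauchy_Schwarz: "m u v \<le> form_norm m u * form_norm m v"
proof (cases "v = 0")
  case True
  then show ?thesis by (simp add: bilinear_rzero[OF inner_form_bilinear])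
next
  case False
  have pos: "m v v > 0" using m False by (simp add: inner_form_def)
  define a where "a = m u v / m v v"
  have "0 \<le> m (u - a *\<^sub>R v) (u - a *\<^sub>R v)" by (rule inner_form_ge0)
  also have "\<dots> = m u u - 2 * a * m u v + a\<^sup>2 * m v v"
    by (simp add: bilinear_lsub[OF inner_form_bilinear] bilinear_rsub[OF inner_form_bilinear] bilinear_lmul[OF inner_form_bilinear]
        bilinear_rmul[OF inner_form_bilinear] inner_form_sym[of v u] power2_eq_square algebra_simps)
  also have "\<dots> = m u u - (m u v)\<^sup>2 / m v v"
    using pos by (simp add: a_def power2_eq_square field_simps)
  finally have "(m u v)\<^sup>2 \<le> m u u * m v v" using pos by (simp add: field_simps)
  then have "\<bar>m u v\<bar> \<le> sqrt (m u u * m v v)" using real_le_rsqrt by simp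
  then show ?thesis by (simp add: form_norm_def real_sqrt_mult)
qed

lemma form_norm_triangle: "form_norm m (u + v) \<le> form_norm m u + form_norm m v"
proof -
  have "(form_norm m (u + v))\<^sup>2 = m u u + 2 * m u v + m v v"
    by (simp add: form_norm_sq bilinear_ladd[OF inner_form_bilinear] bilinear_radd[OF inner_form_bilinear]
        inner_form_sym[of v u])
  also have "\<dots> \<le> (form_norm m u + form_norm m v)\<^sup>2"
    using inner_form_Cauchy_Schwarz[of u v] by (simp add: power2_sum form_norm_sq)
  finally show ?thesis by (rule power2_le_imp_le) simp
qed

lemma form_norm_reverse_triangle: "form_norm m u - form_norm m v \<le> form_norm m (u - v)"
  using form_norm_triangle[of "u - v" v] by simp

lemma form_norm_diff_triangle: "form_norm m (u - w) \<le> form_norm m (u - v) + form_norm m (v - w)"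
  using form_norm_triangle[of "u - v" "v - w"] by simp

end

lemma form_norm_bounds:
  fixes m :: "'e::euclidean_space \<Rightarrow> 'e \<Rightarrow> real"
  assumes m: "inner_form m"
  obtains c where "c > 0" "\<And>v. norm v \<le> c * form_norm m v" "\<And>v. form_norm m v \<le> c * norm v"
proof -
  have bl: "bilinear m" by (rule inner_form_bilinear[OF m])
  have bb: "bounded_bilinear m" using bl by (simp add: bilinear_conv_bounded_bilinear)
  have cont: "continuous_on UNIV (form_norm m)"
    unfolding form_norm_def by (intro continuous_intros bounded_bilinear.continuous_on[OF bb])
  have "compact (sphere (0::'e) 1)" "sphere (0::'e) 1 \<noteq> {}" by simp_all
  from continuous_attains_inf[OF this continuous_on_subset[OF cont]]
    continuous_attains_sup[OF this continuous_on_subset[OF cont]]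
  obtain a b where a: "a \<in> sphere 0 1" "\<And>v. v \<in> sphere 0 1 \<Longrightarrow> form_norm m a \<le> form_norm m v"
    and b: "\<And>v. v \<in> sphere 0 1 \<Longrightarrow> form_norm m v \<le> form_norm m b" by (metis subset_UNIV)
  have ap: "form_norm m a > 0" using a(1) by (intro form_norm_pos[OF m]) auto
  define c where "c = max (form_norm m b) (1 / form_norm m a)"
  have c: "c > 0" using ap by (simp add: c_def less_max_iff_disj)
  have "norm v \<le> c * form_norm m v \<and> form_norm m v \<le> c * norm v" for v
  proof (cases "v = 0")
    case False
    define u where "u = (1 / norm v) *\<^sub>R v"
    have u: "u \<in> sphere 0 1" and v: "v = norm v *\<^sub>R u" using False by (auto simp: u_def)
    have n: "form_norm m v = norm v * form_norm m u"
      by (subst v) (simp add: form_norm_scale[OF m])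
    have "1 \<le> 1 / form_norm m a * form_norm m u" using a(2)[OF u] ap by (simp add: field_simps)
    also have "\<dots> \<le> c * form_norm m u"
      by (intro mult_right_mono) (auto simp: c_def form_norm_ge0[OF m])
    finally have "1 \<le> c * form_norm m u" .
    from mult_left_mono[OF this, of "norm v"] have 1: "norm v \<le> c * form_norm m v"
      unfolding n by (simp add: ac_simps)
    have "form_norm m u \<le> c" using b[OF u] by (simp add: c_def)
    from mult_left_mono[OF this, of "norm v"] show ?thesis using 1 by (simp add: n ac_simps)
  qed (simp add: form_norm_0[OF m])
  then show ?thesis using that c by blast
qed

lemma continuous_on_form_norm:
  fixes m :: "'e::euclidean_space \<Rightarrow> 'e \<Rightarrow> real"
  assumes "inner_form m" "continuous_on S f"
  shows "continuous_on S (\<lambda>x. form_norm m (f x))"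
proof -
  have bb: "bounded_bilinear m" using inner_form_bilinear[OF assms(1)]
    by (simp add: bilinear_conv_bounded_bilinear)
  show ?thesis unfolding form_norm_def
    by (intro continuous_intros bounded_bilinear.continuous_on[OF bb] assms(2))
qed

lemma solid_in_form_ball:
  fixes m :: "'e::euclidean_space \<Rightarrow> 'e \<Rightarrow> real"
  assumes m: "inner_form m" and V: "subspace V" and r: "r > 0"
  shows "solid_in V {u\<in>V. form_norm m u \<le> r}"
  unfolding solid_in_def
proof (intro conjI ballI)
  show "convex {u \<in> V. form_norm m u \<le> r}"
  proof (rule convexI)
    fix x y :: 'e and u v :: real
    assume x: "x \<in> {u \<in> V. form_norm m u \<le> r}" "y \<in> {u \<in> V. form_norm m u \<le> r}"
      and u: "0 \<le> u" "0 \<le> v" "u + v = 1"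
    have "form_norm m (u *\<^sub>R x + v *\<^sub>R y) \<le> u * form_norm m x + v * form_norm m y"
      using form_norm_triangle[OF m, of "u *\<^sub>R x" "v *\<^sub>R y"] u by (simp add: form_norm_scale[OF m])
    also have "\<dots> \<le> u * r + v * r" using x u by (intro add_mono mult_left_mono) auto
    also have "\<dots> = r" using u by (metis distrib_right mult_1)
    finally show "u *\<^sub>R x + v *\<^sub>R y \<in> {u \<in> V. form_norm m u \<le> r}"
      using x V by (simp add: subspace_add subspace_scale)
  qed
  fix v assume v: "v \<in> V"
  show "\<exists>e>0. e *\<^sub>R v \<in> {u \<in> V. form_norm m u \<le> r}"
  proof (intro exI conjI)
    have n: "form_norm m v + 1 > 0" using form_norm_ge0[OF m, of v] by linarith
    then show "r / (form_norm m v + 1) > 0" using r by simp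
    show "(r / (form_norm m v + 1)) *\<^sub>R v \<in> {u \<in> V. form_norm m u \<le> r}"
      using v V r n form_norm_ge0[OF m, of v]
      by (auto simp: form_norm_scale[OF m] subspace_scale field_simps)
  qed
qed (use V in auto)

lemma compact_form_ball:
  fixes V :: "'e::euclidean_space set"
  assumes m: "inner_form m" and V: "subspace V"
  shows "compact {u\<in>V. form_norm m u \<le> r}"
proof -
  obtain c where c: "c > 0" "\<And>v. norm v \<le> c * form_norm m v"
    using form_norm_bounds[OF m] by metis
  have "bounded {u\<in>V. form_norm m u \<le> r}"
  proof (rule boundedI)
    fix u assume "u \<in> {u\<in>V. form_norm m u \<le> r}"
    then have "c * form_norm m u \<le> c * r" using c(1) by (intro mult_left_mono) auto
    then show "norm u \<le> c * r" using c(2)[of u] by linarith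
  qed
  moreover have "closed {u\<in>V. form_norm m u \<le> r}"
  proof -
    have "closed {u. form_norm m u \<le> r}"
      by (intro closed_Collect_le continuous_on_form_norm m continuous_intros)
    then show ?thesis using closed_subspace[OF V] by (simp add: Collect_conj_eq closed_Int)
  qed
  ultimately show ?thesis by (simp add: compact_eq_bounded_closed)
qed

text \<open>The one-dimensional mean value theorem, applied to the inner product of \<open>f\<close> with its own increment.\<close>

lemma form_norm_mean_value:
  fixes m :: "'e::euclidean_space \<Rightarrow> 'e \<Rightarrow> real" and f :: "'a::real_normed_vector \<Rightarrow> 'e"
  assumes m: "inner_form m" and S: "convex S" "u \<in> S" "v \<in> S"
    and f: "\<And>x. x \<in> S \<Longrightarrow> (f has_derivative f' x) (at x within S)"
    and bd: "\<And>x. x \<in> S \<Longrightarrow> form_norm m (f' x (v - u)) \<le> B"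
  shows "form_norm m (f v - f u) \<le> B"
proof -
  define w where "w = f v - f u"
  have seg: "u + t *\<^sub>R (v - u) \<in> S" if "t \<in> {0..1}" for t
  proof -
    have "(1 - t) *\<^sub>R u + t *\<^sub>R v \<in> S" using S that unfolding convex_def by auto
    then show ?thesis by (simp add: algebra_simps)
  qed
  have bm: "bounded_linear (m w)"
    using inner_form_bilinear[OF m] unfolding bilinear_def by (simp add: linear_conv_bounded_linear)
  have "\<exists>x\<in>{0<..<1}. m w (f (u + 1 *\<^sub>R (v - u))) - m w (f (u + 0 *\<^sub>R (v - u))) =
      (\<lambda>h. h * m w (f' (u + x *\<^sub>R (v - u)) (v - u))) (1 - 0)"
  proof (rule mvt_simple)
    fix x :: real assume x: "0 \<le> x" "x \<le> 1"
    have "((\<lambda>t. f (u + t *\<^sub>R (v - u))) has_vector_derivative f' (u + x *\<^sub>R (v - u)) (v - u)) (at x within {0..1})"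
      by (rule derivative_along_segment[OF f seg]) (use seg x in auto)
    then have "((\<lambda>t. f (u + t *\<^sub>R (v - u))) has_derivative (\<lambda>h. h *\<^sub>R f' (u + x *\<^sub>R (v - u)) (v - u))) (at x within {0..1})"
      unfolding has_vector_derivative_def .
    from bounded_linear.has_derivative[OF bm this]
    show "((\<lambda>t. m w (f (u + t *\<^sub>R (v - u)))) has_derivative (\<lambda>h. h * m w (f' (u + x *\<^sub>R (v - u)) (v - u)))) (at x within {0..1})"
      by (simp add: linear_cmul[OF bounded_linear.linear[OF bm]])
  qed simp
  then obtain x where "x \<in> {0<..<1}" "m w (f (u + 1 *\<^sub>R (v - u))) - m w (f (u + 0 *\<^sub>R (v - u))) =
      (1 - 0) * m w (f' (u + x *\<^sub>R (v - u)) (v - u))" by blast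
  then have x: "x \<in> {0..1}" "m w (f v) - m w (f u) = m w (f' (u + x *\<^sub>R (v - u)) (v - u))"
    by auto
  have "form_norm m w * form_norm m w = m w w"
    using form_norm_sq[OF m, of w] by (simp add: power2_eq_square)
  also have "\<dots> = m w (f v) - m w (f u)"
    unfolding w_def by (rule bilinear_rsub[OF inner_form_bilinear[OF m]])
  also have "\<dots> \<le> form_norm m w * B"
    unfolding x(2) using inner_form_Cauchy_Schwarz[OF m] bd[OF seg[OF x(1)]] form_norm_ge0[OF m]
    by (meson mult_left_mono order_trans)
  finally have *: "form_norm m w * form_norm m w \<le> form_norm m w * B" .
  have "B \<ge> 0" using bd[OF S(2)] form_norm_ge0[OF m] order_trans by blast
  show ?thesis
  proof (cases "form_norm m w = 0")
    case False
    then show ?thesis using * form_norm_ge0[OF m, of w] unfolding w_def[symmetric] by simp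
  qed (use \<open>B \<ge> 0\<close> in \<open>simp add: w_def\<close>)
qed

section \<open>Uniform constants from compactness\<close>

text \<open>
  One constant \<open>D\<close> is enough even where several quantities have to be controlled, since \<open>1 / D\<close> can serve
  as a radius.
\<close>

lemma compact_uniform_constant:
  fixes P :: "real \<Rightarrow> 'a::topological_space \<Rightarrow> bool"
  assumes S: "compact S" and mono: "\<And>D D' x. P D x \<Longrightarrow> D \<le> D' \<Longrightarrow> P D' x"
    and loc: "\<And>x. x \<in> S \<Longrightarrow> \<exists>U D. open U \<and> x \<in> U \<and> (\<forall>y\<in>U \<inter> S. P D y)"
  obtains D where "D > 0" "\<And>x. x \<in> S \<Longrightarrow> P D x"
proof -
  obtain U D where UD: "\<And>x. x \<in> S \<Longrightarrow> open (U x) \<and> x \<in> U x \<and> (\<forall>y\<in>U x \<inter> S. P (D x) y)"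
    using loc by metis
  obtain F where F: "F \<subseteq> S" "finite F" "S \<subseteq> (\<Union>x\<in>F. U x)"
    using compactE_image[OF S, of S U] UD by blast
  define E where "E = Max (insert 1 (D ` F))"
  have E: "E \<ge> 1" "\<And>x. x \<in> F \<Longrightarrow> D x \<le> E" using F(2) by (auto simp: E_def)
  have "P E x" if x: "x \<in> S" for x
  proof -
    obtain y where "y \<in> F" "x \<in> U y" using F(3) x by blast
    then show ?thesis using UD[of y] F(1) E(2)[of y] mono x by blast
  qed
  then show ?thesis using that[of E] E(1) by simp
qed

section \<open>Linearization of a chain of contractions\<close>

text \<open>
  An abstract chain of contractions \<open>h k\<close> between balls of inner product spaces \<open>V k\<close>. The pinching
  condition, that the square of the contraction rate \<open>\<kappa> k\<close> of \<open>h k\<close> is at most \<open>\<gamma>\<close> times the lower bound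
  \<open>\<mu> k\<close> for its linear part, makes second order errors at the far end of the chain small when they are
  carried back by the linear parts. The assumption on \<open>\<rho>\<close> bounds the sum of all these errors, so that
  the derivative of the limit differs from the identity by at most \<open>1 / 2\<close>.
\<close>

locale contraction_chain =
  fixes V :: "nat \<Rightarrow> 'e::euclidean_space set" and m :: "nat \<Rightarrow> 'e \<Rightarrow> 'e \<Rightarrow> real"
    and h :: "nat \<Rightarrow> 'e \<Rightarrow> 'e" and h' :: "nat \<Rightarrow> 'e \<Rightarrow> 'e \<Rightarrow> 'e"
    and \<rho> D Q \<gamma> :: real and \<kappa> \<mu> :: "nat \<Rightarrow> real"
  assumes subspace_V: "subspace (V k)" and inner_m: "inner_form (m k)" and \<rho>: "\<rho> > 0"
    and h_derivative: "u \<in> V k \<Longrightarrow> form_norm (m k) u \<le> \<rho> \<Longrightarrow>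
          (h k has_derivative h' k u) (at u within {u\<in>V k. form_norm (m k) u \<le> \<rho>})"
    and h_0: "h k 0 = 0"
    and h_in: "u \<in> V k \<Longrightarrow> form_norm (m k) u \<le> \<rho> \<Longrightarrow> h k u \<in> V (Suc k)"
    and h'_in: "u \<in> V k \<Longrightarrow> form_norm (m k) u \<le> \<rho> \<Longrightarrow> v \<in> V k \<Longrightarrow> h' k u v \<in> V (Suc k)"
    and onto: "h' k 0 ` V k = V (Suc k)"
    and contracts: "u \<in> V k \<Longrightarrow> form_norm (m k) u \<le> \<rho> \<Longrightarrow> v \<in> V k \<Longrightarrow>
          form_norm (m (Suc k)) (h' k u v) \<le> \<kappa> k * form_norm (m k) v"
    and expands: "v \<in> V k \<Longrightarrow> \<mu> k * form_norm (m k) v \<le> form_norm (m (Suc k)) (h' k 0 v)"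
    and \<kappa>: "0 \<le> \<kappa> k" "\<kappa> k \<le> 1" and \<mu>: "0 < \<mu> k" "1 / \<mu> k \<le> Q"
    and pinching: "(\<kappa> k)\<^sup>2 / \<mu> k \<le> \<gamma>" and \<gamma>: "\<gamma> < 1"
    and lipschitz: "u \<in> V k \<Longrightarrow> form_norm (m k) u \<le> \<rho> \<Longrightarrow> u' \<in> V k \<Longrightarrow> form_norm (m k) u' \<le> \<rho> \<Longrightarrow> v \<in> V k \<Longrightarrow>
          form_norm (m (Suc k)) (h' k u v - h' k u' v) \<le> D * form_norm (m k) (u - u') * form_norm (m k) v"
    and D: "D \<ge> 0" and small: "Q * D / (1 - \<gamma>) * \<rho> \<le> 1 / 2"
begin

abbreviation N :: "nat \<Rightarrow> 'e \<Rightarrow> real" where "N k \<equiv> form_norm (m k)"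

definition B :: "nat \<Rightarrow> 'e set" where "B k = {u\<in>V k. N k u \<le> \<rho>}"

definition c :: real where "c = Q * D / (1 - \<gamma>)"

primrec H :: "nat \<Rightarrow> 'e \<Rightarrow> 'e" where
  "H 0 u = u" | "H (Suc p) u = h p (H p u)"

primrec H' :: "nat \<Rightarrow> 'e \<Rightarrow> 'e \<Rightarrow> 'e" where
  "H' 0 u v = v" | "H' (Suc p) u v = h' p (H p u) (H' p u v)"

lemma N_ge0 [simp]: "N k u \<ge> 0" by (rule form_norm_ge0[OF inner_m])

lemma N_0 [simp]: "N k 0 = 0" by (rule form_norm_0[OF inner_m])

lemma zero_in_V [simp]: "0 \<in> V k" using subspace_V by (rule subspace_0)

lemma zero_in_B [simp]: "0 \<in> B k" using \<rho> by (simp add: B_def)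

lemma solid_B: "solid_in (V k) (B k)" unfolding B_def by (rule solid_in_form_ball[OF inner_m subspace_V \<rho>])

lemma convex_B: "convex (B k)" using solid_B by (simp add: solid_in_def)

lemma B_V: "u \<in> B k \<Longrightarrow> u \<in> V k" by (simp add: B_def)

lemma \<gamma>_ge0: "\<gamma> \<ge> 0" using pinching[of 0] \<kappa>(1)[of 0] \<mu>(1)[of 0] by (meson divide_nonneg_pos order_trans zero_le_power2)

lemma Q_pos: "Q > 0" using \<mu>[of 0] by (meson less_le_trans zero_less_divide_1_iff)

lemma c_ge0: "c \<ge> 0" unfolding c_def using Q_pos D \<gamma> by simp

lemma c_small: "c * \<rho> \<le> 1 / 2" using small by (simp add: c_def)

lemma linear_h': "u \<in> B k \<Longrightarrow> linear (h' k u)"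
  using h_derivative[of u k] has_derivative_linear by (auto simp: B_def)

lemma h_contracts:
  assumes "u \<in> B k"
  shows "N (Suc k) (h k u) \<le> \<kappa> k * N k u"
proof -
  have "N (Suc k) (h k u - h k 0) \<le> \<kappa> k * N k u"
    by (rule form_norm_mean_value[OF inner_m convex_B[of k] zero_in_B assms])
      (use h_derivative contracts assms in \<open>auto simp: B_def\<close>)
  then show ?thesis by (simp add: h_0)
qed

lemma h_B: "u \<in> B k \<Longrightarrow> h k u \<in> B (Suc k)"
proof -
  assume u: "u \<in> B k"
  have "N (Suc k) (h k u) \<le> \<kappa> k * N k u" by (rule h_contracts[OF u])
  also have "\<dots> \<le> 1 * N k u" using \<kappa>(2) by (intro mult_right_mono) auto
  finally show ?thesis using u h_in[of u k] by (auto simp: B_def)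
qed

definition contraction :: "nat \<Rightarrow> real" where "contraction p = (\<Prod>k<p. \<kappa> k)"

definition expansion :: "nat \<Rightarrow> real" where "expansion p = (\<Prod>k<p. \<mu> k)"

lemma contraction_ge0: "contraction p \<ge> 0" unfolding contraction_def by (intro prod_nonneg) (simp add: \<kappa>)

lemma expansion_pos: "expansion p > 0" unfolding expansion_def by (intro prod_pos) (simp add: \<mu>)

lemma contraction_pinching: "(contraction p)\<^sup>2 / expansion p \<le> \<gamma> ^ p"
proof (induction p)
  case (Suc p)
  have "(contraction (Suc p))\<^sup>2 / expansion (Suc p) = ((contraction p)\<^sup>2 / expansion p) * ((\<kappa> p)\<^sup>2 / \<mu> p)"
    by (simp add: contraction_def expansion_def power_mult_distrib)
  also have "\<dots> \<le> \<gamma> ^ p * \<gamma>"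
    using Suc pinching[of p] \<gamma>_ge0 \<mu>(1)[of p] by (intro mult_mono) (auto intro: less_imp_le)
  finally show ?case by (simp add: mult.commute)
qed (simp add: contraction_def expansion_def)

lemma H_B: "u \<in> B 0 \<Longrightarrow> H p u \<in> B p"
  by (induction p) (auto intro: h_B)

lemma H_0 [simp]: "H p 0 = 0" by (induction p) (auto simp: h_0)

lemma H_contracts: "u \<in> B 0 \<Longrightarrow> N p (H p u) \<le> contraction p * N 0 u"
proof (induction p)
  case (Suc p)
  have "N (Suc p) (H (Suc p) u) \<le> \<kappa> p * N p (H p u)" using h_contracts[OF H_B[OF Suc(2)]] by simp
  also have "\<dots> \<le> \<kappa> p * (contraction p * N 0 u)" using Suc \<kappa>(1) by (intro mult_left_mono) auto
  finally show ?case by (simp add: contraction_def ac_simps)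
qed (simp add: contraction_def)

lemma H'_V: "u \<in> B 0 \<Longrightarrow> v \<in> V 0 \<Longrightarrow> H' p u v \<in> V p"
  by (induction p) (use H_B h'_in in \<open>auto simp: B_def\<close>)

lemma linear_H': "u \<in> B 0 \<Longrightarrow> linear (H' p u)"
proof (induction p)
  case 0
  have "H' 0 u = id" by auto
  then show ?case using linear_id by metis
next
  case (Suc p)
  have "H' (Suc p) u = h' p (H p u) \<circ> H' p u" by auto
  then show ?case using linear_compose[OF Suc(1)[OF Suc(2)] linear_h'[OF H_B[OF Suc(2)], of p]] by metis
qed

lemma H'_contracts: "u \<in> B 0 \<Longrightarrow> v \<in> V 0 \<Longrightarrow> N p (H' p u v) \<le> contraction p * N 0 v"
proof (induction p)
  case (Suc p)
  have "N (Suc p) (H' (Suc p) u v) \<le> \<kappa> p * N p (H' p u v)"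
    using contracts[of "H p u" p "H' p u v"] H_B[OF Suc(2), of p] H'_V[OF Suc(2,3), of p] by (simp add: B_def)
  also have "\<dots> \<le> \<kappa> p * (contraction p * N 0 v)" using Suc \<kappa>(1) by (intro mult_left_mono) auto
  finally show ?case by (simp add: contraction_def ac_simps)
qed (simp add: contraction_def)

lemma H_derivative: "u \<in> B 0 \<Longrightarrow> (H p has_derivative H' p u) (at u within B 0)"
proof (induction p)
  case 0
  have "H 0 = (\<lambda>u. u)" "H' 0 u = (\<lambda>v. v)" by auto
  then show ?case by simp
next
  case (Suc p)
  have sub: "H p ` B 0 \<subseteq> B p" using H_B by auto
  have "(h p has_derivative h' p (H p u)) (at (H p u) within B p)"
    using h_derivative[of "H p u" p] H_B[OF Suc(2), of p] unfolding B_def by simp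
  from has_derivative_in_compose[OF Suc(1)[OF Suc(2)] has_derivative_subset[OF this sub]]
  show ?case by (simp add: fun_eq_iff[symmetric])
qed

lemma H_lipschitz:
  assumes u: "u \<in> B 0" "u' \<in> B 0"
  shows "N p (H p u - H p u') \<le> contraction p * N 0 (u - u')"
  by (rule form_norm_mean_value[OF inner_m convex_B[of 0] u(2,1) H_derivative])
    (use u H'_contracts subspace_diff[OF subspace_V[of 0]] in \<open>auto simp: B_def\<close>)

text \<open>
  The constant may grow with \<open>p\<close>: the estimate only serves to make the derivatives of the approximations
  continuous.
\<close>

lemma H'_lipschitz:
  "\<exists>L. \<forall>u\<in>B 0. \<forall>u'\<in>B 0. \<forall>v\<in>V 0. N p (H' p u v - H' p u' v) \<le> L * N 0 (u - u') * N 0 v"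
proof (induction p)
  case 0
  show ?case by (intro exI[of _ 0]) simp
next
  case (Suc p)
  then obtain L where L: "\<And>u u' v. u \<in> B 0 \<Longrightarrow> u' \<in> B 0 \<Longrightarrow> v \<in> V 0 \<Longrightarrow> N p (H' p u v - H' p u' v) \<le> L * N 0 (u - u') * N 0 v"
    by blast
  define k where "k = contraction p"
  show ?case
  proof (intro exI[of _ "D * k * k + \<kappa> p * L"] ballI)
    fix u u' v assume u: "u \<in> B 0" "u' \<in> B 0" and v: "v \<in> V 0"
    note b = H_B[OF u(1), of p] H_B[OF u(2), of p] and w = H'_V[OF u(1) v, of p] H'_V[OF u(2) v, of p]
    have d: "H' p u v - H' p u' v \<in> V p" using w subspace_V by (intro subspace_diff)
    have lin: "linear (h' p (H p u'))" by (rule linear_h'[OF b(2)])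
    have k0: "k \<ge> 0" by (simp add: k_def contraction_ge0)
    have 1: "N (Suc p) (h' p (H p u) (H' p u v) - h' p (H p u') (H' p u v)) \<le> D * N p (H p u - H p u') * N p (H' p u v)"
      using b w by (intro lipschitz) (auto simp: B_def)
    also have "\<dots> \<le> D * (k * N 0 (u - u')) * (k * N 0 v)"
      using H_lipschitz[OF u, of p] H'_contracts[OF u(1) v, of p] D k0 unfolding k_def[symmetric]
      by (intro mult_mono mult_left_mono) auto
    finally have 1: "N (Suc p) (h' p (H p u) (H' p u v) - h' p (H p u') (H' p u v)) \<le> D * k * k * N 0 (u - u') * N 0 v"
      by (simp add: ac_simps)
    have "N (Suc p) (h' p (H p u') (H' p u v) - h' p (H p u') (H' p u' v)) \<le> \<kappa> p * N p (H' p u v - H' p u' v)"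
      using contracts[of "H p u'" p "H' p u v - H' p u' v"] b d by (simp add: B_def linear_diff[OF lin])
    also have "\<dots> \<le> \<kappa> p * (L * N 0 (u - u') * N 0 v)" using L[OF u v] \<kappa>(1) by (intro mult_left_mono)
    finally have "N (Suc p) (H' (Suc p) u v - H' (Suc p) u' v) \<le> D * k * k * N 0 (u - u') * N 0 v + \<kappa> p * (L * N 0 (u - u') * N 0 v)"
      using 1 form_norm_diff_triangle[OF inner_m, of "Suc p" "h' p (H p u) (H' p u v)" "h' p (H p u') (H' p u' v)" "h' p (H p u') (H' p u v)"]
      by simp
    then show "N (Suc p) (H' (Suc p) u v - H' (Suc p) u' v) \<le> (D * k * k + \<kappa> p * L) * N 0 (u - u') * N 0 v"
      by (simp add: algebra_simps)
  qed
qed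

subsection \<open>Carrying back by the linear parts\<close>

lemma H'_expands: "v \<in> V 0 \<Longrightarrow> expansion p * N 0 v \<le> N p (H' p 0 v)"
proof (induction p)
  case (Suc p)
  have "expansion (Suc p) * N 0 v = \<mu> p * (expansion p * N 0 v)" by (simp add: expansion_def)
  also have "\<dots> \<le> \<mu> p * N p (H' p 0 v)" using Suc \<mu>(1)[of p] by (intro mult_left_mono) auto
  also have "\<dots> \<le> N (Suc p) (H' (Suc p) 0 v)" using expands[OF H'_V[OF zero_in_B Suc(2), of p]] by simp
  finally show ?case .
qed (simp add: expansion_def)

lemma H'_onto: "H' p 0 ` V 0 = V p"
proof (induction p)
  case (Suc p)
  have "H' (Suc p) 0 ` V 0 = h' p 0 ` (H' p 0 ` V 0)" by (simp add: image_image)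
  then show ?case using Suc onto by simp
qed (auto simp: image_def)

lemma H'_inj: "inj_on (H' p 0) (V 0)"
  unfolding linear_injective_on_subspace_0[OF linear_H'[OF zero_in_B] subspace_V]
proof (intro ballI impI)
  fix v assume v: "v \<in> V 0" "H' p 0 v = 0"
  then have "expansion p * N 0 v \<le> 0" using H'_expands[OF v(1), of p] by simp
  then have "N 0 v \<le> 0" using expansion_pos[of p] by (simp add: mult_le_0_iff)
  then show "v = 0" using N_ge0[of 0 v] form_norm_eq_0[OF inner_m, of 0 v] by linarith
qed

text \<open>
  The inverse of the linear part of \<open>H p\<close>, extended linearly from \<open>V p\<close> to the whole space so that it can
  be composed with derivatives; in particular \<open>J 0\<close> is a projection onto \<open>V 0\<close>.
\<close>

definition J :: "nat \<Rightarrow> 'e \<Rightarrow> 'e" where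
  "J p = (SOME g. range g \<subseteq> V 0 \<and> linear g \<and> (\<forall>v\<in>V 0. g (H' p 0 v) = v))"

lemma J: "J p w \<in> V 0" "linear (J p)" "v \<in> V 0 \<Longrightarrow> J p (H' p 0 v) = v"
proof -
  have "range (J p) \<subseteq> V 0 \<and> linear (J p) \<and> (\<forall>v\<in>V 0. J p (H' p 0 v) = v)"
    unfolding J_def
    by (rule someI_ex[OF linear_exists_left_inverse_on[OF linear_H'[OF zero_in_B] subspace_V H'_inj]])
  then show "J p w \<in> V 0" "linear (J p)" "v \<in> V 0 \<Longrightarrow> J p (H' p 0 v) = v" by auto
qed

lemma J_right: "w \<in> V p \<Longrightarrow> H' p 0 (J p w) = w"
  using H'_onto[of p] J(3) by (metis imageE)

lemma J_bound:
  assumes w: "w \<in> V p"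
  shows "N 0 (J p w) \<le> N p w / expansion p"
  using H'_expands[OF J(1)[of p w], of p] expansion_pos[of p] unfolding J_right[OF w]
  by (simp add: pos_le_divide_eq mult.commute)

lemma J_step: "w \<in> V p \<Longrightarrow> J (Suc p) (h' p 0 w) = J p w"
  using J(3)[OF J(1)[of p w], of "Suc p"] by (simp add: J_right)

text \<open>
  The square of the contraction that the error gains at the far end outweighs what it loses when it is
  carried back.
\<close>

lemma J_quadratic:
  assumes u: "u \<in> B 0" and w: "w \<in> V p" "N p w \<le> E * (N p (H p u))\<^sup>2" and E: "E \<ge> 0"
  shows "N 0 (J p w) \<le> E * \<gamma> ^ p * (N 0 u)\<^sup>2"
proof -
  have "(N p (H p u))\<^sup>2 \<le> (contraction p * N 0 u)\<^sup>2" by (intro power_mono H_contracts[OF u]) auto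
  then have "E * (N p (H p u))\<^sup>2 \<le> E * (contraction p * N 0 u)\<^sup>2" using E by (rule mult_left_mono)
  then have "N p w / expansion p \<le> E * (contraction p * N 0 u)\<^sup>2 / expansion p"
    using w(2) expansion_pos[of p] by (intro divide_right_mono) auto
  also have "\<dots> = E * (N 0 u)\<^sup>2 * ((contraction p)\<^sup>2 / expansion p)" by (simp add: power_mult_distrib)
  also have "\<dots> \<le> E * (N 0 u)\<^sup>2 * \<gamma> ^ p" using E by (intro mult_left_mono contraction_pinching) auto
  finally show ?thesis using J_bound[OF w(1)] by (simp add: ac_simps)
qed

definition T :: "nat \<Rightarrow> 'e \<Rightarrow> 'e" where "T p u = J p (H p u)"

definition T' :: "nat \<Rightarrow> 'e \<Rightarrow> 'e \<Rightarrow> 'e" where "T' p u v = J p (H' p u v)"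

lemma T_V: "T p u \<in> V 0" and T'_V: "T' p u v \<in> V 0" by (simp_all add: T_def T'_def J)

lemma T_0 [simp]: "T p 0 = 0" by (simp add: T_def linear_0[OF J(2)])

lemma T'_zero: "v \<in> V 0 \<Longrightarrow> T' 0 u v = v"
  using J(3)[of _ 0] by (simp add: T'_def)

lemma linear_T': "u \<in> B 0 \<Longrightarrow> linear (T' p u)"
  using linear_compose[OF linear_H' J(2), of u p p] unfolding T'_def o_def .

lemma T_derivative: "u \<in> B 0 \<Longrightarrow> (T p has_derivative T' p u) (at u within B 0)"
  using has_derivative_compose[OF H_derivative linear_imp_has_derivative[OF J(2)], of u p p]
  unfolding T_def T'_def by (simp add: fun_eq_iff[symmetric])

text \<open>
  Since \<open>J (Suc p) \<circ> h' p 0\<close> is \<open>J p\<close> on \<open>V p\<close>, the difference is \<open>J (Suc p)\<close> applied to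
  \<open>(h' p (H p u) - h' p 0) (H' p u v)\<close>. Lipschitz continuity bounds this by the square of the contraction
  of \<open>H p\<close>; the factor \<open>Q\<close> accounts for the one step by which \<open>J (Suc p)\<close> reaches further than \<open>H p\<close>.
\<close>

lemma T'_step:
  assumes u: "u \<in> B 0" and v: "v \<in> V 0"
  shows "N 0 (T' (Suc p) u v - T' p u v) \<le> Q * D * \<gamma> ^ p * (N 0 u * N 0 v)"
proof -
  define w where "w = H' p u v"
  have w: "w \<in> V p" unfolding w_def by (rule H'_V[OF u v])
  have b: "H p u \<in> B p" by (rule H_B[OF u])
  define d where "d = h' p (H p u) w - h' p 0 w"
  have d: "d \<in> V (Suc p)" unfolding d_def
    using b w \<rho> by (intro subspace_diff subspace_V h'_in) (auto simp: B_def)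
  have "T' (Suc p) u v - T' p u v = J (Suc p) (h' p (H p u) w) - J (Suc p) (h' p 0 w)"
    unfolding J_step[OF w] by (simp add: T'_def w_def)
  also have "\<dots> = J (Suc p) d" by (simp add: d_def linear_diff[OF J(2)])
  finally have eq: "T' (Suc p) u v - T' p u v = J (Suc p) d" .
  have "N (Suc p) d \<le> D * N p (H p u - 0) * N p w"
    unfolding d_def using b w \<rho> by (intro lipschitz) (auto simp: B_def)
  also have "\<dots> \<le> D * (contraction p * N 0 u) * (contraction p * N 0 v)"
    using H_contracts[OF u, of p] H'_contracts[OF u v, of p] D contraction_ge0[of p] unfolding w_def[symmetric]
    by (intro mult_mono mult_left_mono) auto
  finally have dn: "N (Suc p) d \<le> D * (contraction p)\<^sup>2 * (N 0 u * N 0 v)" by (simp add: power2_eq_square ac_simps)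
  have "N 0 (T' (Suc p) u v - T' p u v) \<le> N (Suc p) d / expansion (Suc p)"
    unfolding eq by (rule J_bound[OF d])
  also have "\<dots> \<le> D * (contraction p)\<^sup>2 * (N 0 u * N 0 v) / expansion (Suc p)"
    using expansion_pos[of "Suc p"] dn by (intro divide_right_mono) auto
  also have "\<dots> = D * (N 0 u * N 0 v) * ((1 / \<mu> p) * ((contraction p)\<^sup>2 / expansion p))"
    by (simp add: expansion_def ac_simps)
  also have "\<dots> \<le> D * (N 0 u * N 0 v) * (Q * \<gamma> ^ p)"
    using D \<mu>[of p] contraction_pinching[of p] Q_pos expansion_pos[of p] \<gamma>_ge0
    by (intro mult_left_mono mult_mono) (auto intro!: divide_nonneg_pos)
  finally show ?thesis by (simp add: ac_simps)
qed

text \<open>The geometric sum of the steps; the factor \<open>1 - \<gamma> ^ n\<close> makes the induction close.\<close>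

lemma T'_diff_aux:
  assumes u: "u \<in> B 0" and v: "v \<in> V 0"
  shows "N 0 (T' (p + n) u v - T' p u v) \<le> c * \<gamma> ^ p * (1 - \<gamma> ^ n) * (N 0 u * N 0 v)"
proof (induction n)
  case (Suc n)
  have "N 0 (T' (p + Suc n) u v - T' p u v) \<le> N 0 (T' (Suc (p + n)) u v - T' (p + n) u v) + N 0 (T' (p + n) u v - T' p u v)"
    using form_norm_diff_triangle[OF inner_m] by simp
  also have "\<dots> \<le> Q * D * \<gamma> ^ (p + n) * (N 0 u * N 0 v) + c * \<gamma> ^ p * (1 - \<gamma> ^ n) * (N 0 u * N 0 v)"
    using Suc T'_step[OF u v, of "p + n"] by linarith
  also have "Q * D = c * (1 - \<gamma>)" using \<gamma> by (simp add: c_def)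
  also have "c * (1 - \<gamma>) * \<gamma> ^ (p + n) * (N 0 u * N 0 v) + c * \<gamma> ^ p * (1 - \<gamma> ^ n) * (N 0 u * N 0 v)
      = c * \<gamma> ^ p * (1 - \<gamma> ^ Suc n) * (N 0 u * N 0 v)"
    by (simp add: power_add algebra_simps)
  finally show ?case .
qed simp

lemma T'_diff:
  assumes u: "u \<in> B 0" and v: "v \<in> V 0" and n: "p \<le> n"
  shows "N 0 (T' n u v - T' p u v) \<le> c * \<gamma> ^ p * (N 0 u * N 0 v)"
proof -
  have "c * \<gamma> ^ p * (1 - \<gamma> ^ (n - p)) * (N 0 u * N 0 v) \<le> c * \<gamma> ^ p * 1 * (N 0 u * N 0 v)"
    using c_ge0 \<gamma>_ge0 by (intro mult_right_mono mult_left_mono) auto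
  then show ?thesis using T'_diff_aux[OF u v, of p "n - p"] n by simp
qed

text \<open>\<open>T 0\<close> is the identity, and the choice of the radius bounds the sum of all later changes.\<close>

lemma T'_near_id:
  assumes u: "u \<in> B 0" and v: "v \<in> V 0"
  shows "N 0 (T' p u v - v) \<le> 1 / 2 * N 0 v"
proof -
  have "N 0 (T' p u v - v) \<le> c * N 0 u * N 0 v" using T'_diff[OF u v, of 0 p] T'_zero[OF v] by (simp add: mult.assoc)
  also have "\<dots> \<le> 1 / 2 * N 0 v"
  proof -
    have "c * N 0 u \<le> c * \<rho>" using u c_ge0 by (intro mult_left_mono) (auto simp: B_def)
    then show ?thesis using c_small by (intro mult_right_mono) auto
  qed
  finally show ?thesis .
qed

subsection \<open>The linearizing map\<close>

lemma tendsto_N: "(f \<longlongrightarrow> a) G \<Longrightarrow> ((\<lambda>x. N k (f x)) \<longlongrightarrow> N k a) G"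
  unfolding form_norm_def using inner_form_bilinear[OF inner_m[of k]]
  by (intro tendsto_real_sqrt bounded_bilinear.tendsto[of "m k"]) (auto simp: bilinear_conv_bounded_bilinear)

lemma tendsto_by_N:
  assumes "((\<lambda>x. N k (f x - a)) \<longlongrightarrow> 0) G"
  shows "(f \<longlongrightarrow> a) G"
proof -
  obtain b where b: "\<And>v. norm v \<le> b * N k v" using form_norm_bounds[OF inner_m[of k]] by metis
  have "((\<lambda>x. b * N k (f x - a)) \<longlongrightarrow> b * 0) G" by (intro tendsto_intros assms)
  then have "((\<lambda>x. f x - a) \<longlongrightarrow> 0) G"
    by (intro Lim_null_comparison[of "\<lambda>x. f x - a" "\<lambda>x. b * N k (f x - a)"]) (auto simp: b)
  then show ?thesis by (simp add: LIM_zero_iff)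
qed

text \<open>The projection \<open>J 0\<close> makes the derivatives converge on all vectors and not only on those of \<open>V 0\<close>.\<close>

definition F' :: "'e \<Rightarrow> 'e \<Rightarrow> 'e" where "F' u v = lim (\<lambda>p. T' p u (J 0 v))"

definition F :: "'e \<Rightarrow> 'e" where "F u = lim (\<lambda>p. T p u)"

lemma J0 [simp]: "v \<in> V 0 \<Longrightarrow> J 0 v = v" using J(3)[of v 0] by simp

lemma T'_limit:
  assumes u: "u \<in> B 0"
  shows "(\<lambda>p. T' p u (J 0 v)) \<longlonglongrightarrow> F' u v"
proof -
  define w where "w = J 0 v"
  have w: "w \<in> V 0" by (simp add: w_def J)
  obtain b where b: "b > 0" "\<And>v. norm v \<le> b * N 0 v" using form_norm_bounds[OF inner_m[of 0]] by metis
  have "Cauchy (\<lambda>p. T' p u w)"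
  proof (rule CauchyI)
    fix e :: real assume e: "e > 0"
    have "(\<lambda>p. b * (c * \<gamma> ^ p * (N 0 u * N 0 w)) * 2) \<longlonglongrightarrow> b * (c * 0 * (N 0 u * N 0 w)) * 2"
      using \<gamma>_ge0 \<gamma> by (intro tendsto_intros LIMSEQ_power_zero) simp
    then have "(\<lambda>p. b * (c * \<gamma> ^ p * (N 0 u * N 0 w)) * 2) \<longlonglongrightarrow> 0" by simp
    from order_tendstoD(2)[OF this e] obtain M where M: "\<And>p. p \<ge> M \<Longrightarrow> b * (c * \<gamma> ^ p * (N 0 u * N 0 w)) * 2 < e"
      unfolding eventually_sequentially by auto
    have est: "norm (T' n u w - T' M u w) \<le> b * (c * \<gamma> ^ M * (N 0 u * N 0 w))" if "n \<ge> M" for n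
    proof -
      have "b * N 0 (T' n u w - T' M u w) \<le> b * (c * \<gamma> ^ M * (N 0 u * N 0 w))"
        using T'_diff[OF u w that] b(1) by (intro mult_left_mono) auto
      then show ?thesis using b(2)[of "T' n u w - T' M u w"] by linarith
    qed
    show "\<exists>M. \<forall>n\<ge>M. \<forall>n'\<ge>M. norm (T' n u w - T' n' u w) < e"
    proof (intro exI[of _ M] allI impI)
      fix n n' assume n: "n \<ge> M" "n' \<ge> M"
      have "norm (T' n u w - T' n' u w) \<le> norm (T' n u w - T' M u w) + norm (T' n' u w - T' M u w)"
        using norm_triangle_ineq4[of "T' n u w - T' M u w" "T' n' u w - T' M u w"] by simp
      then show "norm (T' n u w - T' n' u w) < e" using est[OF n(1)] est[OF n(2)] M[of M] by simp
    qed
  qed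
  then show ?thesis unfolding F'_def w_def[symmetric] by (simp add: Cauchy_convergent_iff convergent_LIMSEQ_iff)
qed

lemma F'_limit: "u \<in> B 0 \<Longrightarrow> v \<in> V 0 \<Longrightarrow> (\<lambda>p. T' p u v) \<longlonglongrightarrow> F' u v"
  using T'_limit[of u v] by simp

lemma F'_V: "u \<in> B 0 \<Longrightarrow> F' u v \<in> V 0"
  using closed_sequentially[OF closed_subspace[OF subspace_V[of 0]] _ T'_limit] T'_V by blast

lemma linear_F': 
  assumes u: "u \<in> B 0"
  shows "linear (F' u)"
proof (rule linearI)
  note l = linear_T'[OF u] and j = J(2)[of 0]
  fix a b and r :: real
  have "(\<lambda>p. T' p u (J 0 (a + b))) \<longlonglongrightarrow> F' u a + F' u b"
    unfolding linear_add[OF j] linear_add[OF l] by (intro tendsto_add T'_limit u)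
  then show "F' u (a + b) = F' u a + F' u b" by (rule LIMSEQ_unique[OF T'_limit[OF u]])
  have "(\<lambda>p. T' p u (J 0 (r *\<^sub>R a))) \<longlonglongrightarrow> r *\<^sub>R F' u a"
    unfolding linear_cmul[OF j] linear_cmul[OF l] by (intro tendsto_scaleR tendsto_const T'_limit u)
  then show "F' u (r *\<^sub>R a) = r *\<^sub>R F' u a" by (rule LIMSEQ_unique[OF T'_limit[OF u]])
qed

lemma F'_T'_diff:
  assumes u: "u \<in> B 0" and v: "v \<in> V 0"
  shows "N 0 (F' u v - T' p u v) \<le> c * \<gamma> ^ p * (N 0 u * N 0 v)"
proof (rule tendsto_upperbound)
  show "(\<lambda>n. N 0 (T' n u v - T' p u v)) \<longlonglongrightarrow> N 0 (F' u v - T' p u v)"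
    by (intro tendsto_N tendsto_diff F'_limit u v tendsto_const)
  show "\<forall>\<^sub>F n in sequentially. N 0 (T' n u v - T' p u v) \<le> c * \<gamma> ^ p * (N 0 u * N 0 v)"
    using eventually_ge_at_top[of p] by eventually_elim (rule T'_diff[OF u v])
qed simp

lemma F'_near_id:
  assumes u: "u \<in> B 0" and v: "v \<in> V 0"
  shows "N 0 (F' u v - v) \<le> 1 / 2 * N 0 v"
proof (rule tendsto_upperbound)
  show "(\<lambda>n. N 0 (T' n u v - v)) \<longlonglongrightarrow> N 0 (F' u v - v)"
    by (intro tendsto_N tendsto_diff F'_limit u v tendsto_const)
  show "\<forall>\<^sub>F n in sequentially. N 0 (T' n u v - v) \<le> 1 / 2 * N 0 v"
    by (rule always_eventually) (intro allI T'_near_id[OF u v])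
qed simp

lemma near_id_bounds:
  assumes "N 0 (a - v) \<le> 1 / 2 * N 0 v"
  shows "N 0 v \<le> 2 * N 0 a" "N 0 a \<le> 3 / 2 * N 0 v"
  using form_norm_reverse_triangle[OF inner_m, of 0 v a] form_norm_triangle[OF inner_m, of 0 "a - v" v] assms
    form_norm_diff_commute[OF inner_m, of 0 v a] by simp_all

text \<open>The derivatives converge uniformly on the convex ball, and the maps themselves converge at \<open>0\<close>.\<close>

lemma F_limit_derivative:
  "u \<in> B 0 \<Longrightarrow> (\<lambda>p. T p u) \<longlonglongrightarrow> F u" and F_derivative: "u \<in> B 0 \<Longrightarrow> (F has_derivative F' u) (at u within B 0)"
proof -
  obtain b where b: "b > 0" "\<And>v. norm v \<le> b * N 0 v" "\<And>v. N 0 v \<le> b * norm v"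
    using form_norm_bounds[OF inner_m[of 0]] by metis
  have blJ: "bounded_linear (J 0)" using J(2)[of 0] by (simp add: linear_conv_bounded_linear)
  obtain j where j: "j > 0" "\<And>v. norm (J 0 v) \<le> norm v * j" using bounded_linear.pos_bounded[OF blJ] by blast
  have "\<exists>g. \<forall>u\<in>B 0. (\<lambda>p. T p u) \<longlonglongrightarrow> g u \<and> (g has_derivative F' u) (at u within B 0)"
  proof (rule has_derivative_sequence[OF convex_B[of 0], where f' = "\<lambda>p u v. T' p u (J 0 v)"])
    show "(T p has_derivative (\<lambda>v. T' p u (J 0 v))) (at u within B 0)" if u: "u \<in> B 0" for p u
    proof (rule has_derivative_change_off_subspace[OF T_derivative[OF u] subspace_V[of 0]])
      show "bounded_linear (\<lambda>v. T' p u (J 0 v))"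
        using bounded_linear_compose[OF _ blJ, of "T' p u"] linear_T'[OF u, of p] by (simp add: linear_conv_bounded_linear)
    qed (use u in \<open>auto simp: B_def\<close>)
    show "\<forall>\<^sub>F p in sequentially. \<forall>u\<in>B 0. \<forall>v. norm (T' p u (J 0 v) - F' u v) \<le> e * norm v" if e: "e > 0" for e :: real
    proof -
      have "(\<lambda>p. b * (c * \<gamma> ^ p * (\<rho> * (b * j)))) \<longlonglongrightarrow> b * (c * 0 * (\<rho> * (b * j)))"
        using \<gamma>_ge0 \<gamma> by (intro tendsto_intros LIMSEQ_power_zero) simp
      then have "(\<lambda>p. b * (c * \<gamma> ^ p * (\<rho> * (b * j)))) \<longlonglongrightarrow> 0" by simp
      from order_tendstoD(2)[OF this e] show ?thesis
      proof eventually_elim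
        case (elim p)
        show ?case
        proof (intro ballI allI)
          fix u v assume u: "u \<in> B 0"
          define w where "w = J 0 v"
          have w: "w \<in> V 0" by (simp add: w_def J)
          have "N 0 w \<le> b * norm w" by (rule b(3))
          also have "\<dots> \<le> b * (norm v * j)" using b(1) j(2)[of v] unfolding w_def by (intro mult_left_mono) auto
          finally have "N 0 w \<le> b * (norm v * j)" .
          then have "N 0 u * N 0 w \<le> \<rho> * (b * (norm v * j))"
            using u \<rho> by (intro mult_mono) (auto simp: B_def)
          then have "c * \<gamma> ^ p * (N 0 u * N 0 w) \<le> c * \<gamma> ^ p * (\<rho> * (b * (norm v * j)))"
            using c_ge0 \<gamma>_ge0 by (intro mult_left_mono) auto
          moreover have "N 0 (F' u w - T' p u w) \<le> c * \<gamma> ^ p * (N 0 u * N 0 w)" by (rule F'_T'_diff[OF u w])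
          ultimately have "b * N 0 (F' u w - T' p u w) \<le> b * (c * \<gamma> ^ p * (\<rho> * (b * (norm v * j))))"
            using b(1) by (intro mult_left_mono) auto
          then have "norm (F' u w - T' p u w) \<le> b * (c * \<gamma> ^ p * (\<rho> * (b * j))) * norm v"
            using b(2)[of "F' u w - T' p u w"] by (simp add: ac_simps)
          also have "\<dots> \<le> e * norm v" using elim by (intro mult_right_mono) auto
          finally have "norm (F' u w - T' p u w) \<le> e * norm v" .
          moreover have "F' u w = F' u v" unfolding F'_def w_def using J(1)[of 0 v] by simp
          ultimately show "norm (T' p u (J 0 v) - F' u v) \<le> e * norm v" by (simp add: w_def norm_minus_commute)
        qed
      qed
    qed
    show "0 \<in> B 0" by simp
    show "(\<lambda>p. T p 0) \<longlonglongrightarrow> 0" by simp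
  qed
  then obtain g where g: "\<And>u. u \<in> B 0 \<Longrightarrow> (\<lambda>p. T p u) \<longlonglongrightarrow> g u"
    "\<And>u. u \<in> B 0 \<Longrightarrow> (g has_derivative F' u) (at u within B 0)" by blast
  have gF: "F u = g u" if "u \<in> B 0" for u unfolding F_def using g(1)[OF that] by (rule limI)
  show "(\<lambda>p. T p u) \<longlonglongrightarrow> F u" if "u \<in> B 0" using g(1)[OF that] gF[OF that] by simp
  show "(F has_derivative F' u) (at u within B 0)" if u: "u \<in> B 0"
    by (rule has_derivative_transform[OF u _ g(2)[OF u]]) (rule gF)
qed

lemmas F_limit = F_limit_derivative

lemma F_0 [simp]: "F 0 = 0" by (simp add: F_def)

lemma F_V: "u \<in> B 0 \<Longrightarrow> F u \<in> V 0"
  using closed_sequentially[OF closed_subspace[OF subspace_V[of 0]] _ F_limit] T_V by blast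

text \<open>
  The mean value inequality is applied on the ball of radius \<open>N 0 u\<close>, where the derivatives differ by at
  most \<open>c \<gamma>\<^sup>p N 0 u\<close>; on the whole ball the estimate would only be linear in \<open>u\<close>.
\<close>

lemma F_T_diff:
  assumes u: "u \<in> B 0"
  shows "N 0 (F u - T p u) \<le> c * \<gamma> ^ p * (N 0 u)\<^sup>2"
proof (cases "u = 0")
  case False
  define S where "S = {x\<in>V 0. N 0 x \<le> N 0 u}"
  have Npos: "N 0 u > 0" using form_norm_pos[OF inner_m False] .
  have S: "convex S" "0 \<in> S" "u \<in> S" "S \<subseteq> B 0"
    using solid_in_form_ball[OF inner_m subspace_V Npos, of 0 0] u by (auto simp: S_def B_def solid_in_def)
  have "N 0 ((F u - T p u) - (F 0 - T p 0)) \<le> c * \<gamma> ^ p * (N 0 u)\<^sup>2"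
  proof (rule form_norm_mean_value[OF inner_m S(1,2,3), where f' = "\<lambda>x v. F' x v - T' p x v"])
    fix x assume x: "x \<in> S"
    then have xB: "x \<in> B 0" using S(4) by blast
    show "((\<lambda>u. F u - T p u) has_derivative (\<lambda>v. F' x v - T' p x v)) (at x within S)"
      by (rule has_derivative_subset[OF has_derivative_diff[OF F_derivative[OF xB] T_derivative[OF xB]] S(4)])
    have "N 0 (F' x u - T' p x u) \<le> c * \<gamma> ^ p * (N 0 x * N 0 u)" by (rule F'_T'_diff[OF xB B_V[OF u]])
    also have "\<dots> \<le> c * \<gamma> ^ p * (N 0 u * N 0 u)"
      using x c_ge0 \<gamma>_ge0 by (intro mult_left_mono mult_right_mono) (auto simp: S_def)
    finally show "N 0 (F' x (u - 0) - T' p x (u - 0)) \<le> c * \<gamma> ^ p * (N 0 u)\<^sup>2" by (simp add: power2_eq_square)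
  qed
  then show ?thesis by simp
qed simp

lemma F_close:
  assumes u: "u \<in> B 0" "u' \<in> B 0"
  shows "N 0 ((F u - F u') - (u - u')) \<le> 1 / 2 * N 0 (u - u')"
proof -
  have d: "u - u' \<in> V 0" using u by (intro subspace_diff subspace_V B_V)
  have "N 0 ((F u - u) - (F u' - u')) \<le> 1 / 2 * N 0 (u - u')"
    by (rule form_norm_mean_value[OF inner_m convex_B[of 0] u(2,1), where f' = "\<lambda>x v. F' x v - v"])
      (rule has_derivative_diff[OF F_derivative has_derivative_ident], assumption, rule F'_near_id[OF _ d])
  moreover have "(F u - u) - (F u' - u') = (F u - F u') - (u - u')" by simp
  ultimately show ?thesis by simp
qed

lemma F_lower: "u \<in> B 0 \<Longrightarrow> u' \<in> B 0 \<Longrightarrow> N 0 (u - u') \<le> 2 * N 0 (F u - F u')"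
  using near_id_bounds(1)[OF F_close] .

lemma F_bound: "u \<in> B 0 \<Longrightarrow> N 0 (F u) \<le> 2 * N 0 u"
proof -
  assume "u \<in> B 0"
  then have "N 0 (F u) \<le> 3 / 2 * N 0 u" using near_id_bounds(2)[OF F_close, of u 0] by simp
  then show ?thesis using N_ge0[of 0 u] by linarith
qed

lemma F'_bound: "u \<in> B 0 \<Longrightarrow> v \<in> V 0 \<Longrightarrow> N 0 (F' u v) \<le> 2 * N 0 v"
  using near_id_bounds(2)[OF F'_near_id, of u v] N_ge0[of 0 v] by linarith

lemma F'_lower: "u \<in> B 0 \<Longrightarrow> v \<in> V 0 \<Longrightarrow> N 0 v \<le> 2 * N 0 (F' u v)"
  using near_id_bounds(1)[OF F'_near_id] .

text \<open>
  A uniform limit of continuous maps; at each single \<open>p\<close> continuity follows from Lipschitz continuity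
  with a constant that depends on \<open>p\<close>.
\<close>

lemma F'_continuous:
  shows "continuous_on (B 0) (\<lambda>u. F' u v)"
proof -
  define w where "w = J 0 v"
  have w: "w \<in> V 0" by (simp add: w_def J)
  obtain b where b: "b > 0" "\<And>v. norm v \<le> b * N 0 v" "\<And>v. N 0 v \<le> b * norm v"
    using form_norm_bounds[OF inner_m[of 0]] by metis
  have cont: "continuous_on (B 0) (\<lambda>u. H' p u w)" for p
  proof -
    obtain L where L: "\<And>u u'. u \<in> B 0 \<Longrightarrow> u' \<in> B 0 \<Longrightarrow> N p (H' p u w - H' p u' w) \<le> L * N 0 (u - u') * N 0 w"
      using H'_lipschitz[of p] w by blast
    have "((\<lambda>u. H' p u w) \<longlongrightarrow> H' p u0 w) (at u0 within B 0)" if u0: "u0 \<in> B 0" for u0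
    proof (rule tendsto_by_N[of p], rule tendsto_sandwich[OF _ _ tendsto_const])
      show "\<forall>\<^sub>F u in at u0 within B 0. N p (H' p u w - H' p u0 w) \<le> L * N 0 (u - u0) * N 0 w"
        unfolding eventually_at_filter by (rule always_eventually) (use L u0 in auto)
      have "((\<lambda>u. u - u0) \<longlongrightarrow> u0 - u0) (at u0 within B 0)" by (intro tendsto_intros)
      from tendsto_N[OF this, of 0]
      have "((\<lambda>u. L * N 0 (u - u0) * N 0 w) \<longlongrightarrow> L * 0 * N 0 w) (at u0 within B 0)"
        by (intro tendsto_intros) simp
      then show "((\<lambda>u. L * N 0 (u - u0) * N 0 w) \<longlongrightarrow> 0) (at u0 within B 0)" by simp
    qed simp
    then show ?thesis by (simp add: continuous_on_def)
  qed
  have cT: "continuous_on (B 0) (\<lambda>u. T' p u w)" for p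
    unfolding T'_def using J(2)[of p] by (intro bounded_linear.continuous_on[OF _ cont]) (simp add: linear_conv_bounded_linear)
  have "uniform_limit (B 0) (\<lambda>p u. T' p u w) (\<lambda>u. F' u v) sequentially"
  proof (rule uniform_limitI)
    fix e :: real assume e: "e > 0"
    have "(\<lambda>p. b * (c * \<gamma> ^ p * (\<rho> * N 0 w))) \<longlonglongrightarrow> b * (c * 0 * (\<rho> * N 0 w))"
      using \<gamma>_ge0 \<gamma> by (intro tendsto_intros LIMSEQ_power_zero) simp
    then have "(\<lambda>p. b * (c * \<gamma> ^ p * (\<rho> * N 0 w))) \<longlonglongrightarrow> 0" by simp
    from order_tendstoD(2)[OF this e]
    show "\<forall>\<^sub>F p in sequentially. \<forall>u\<in>B 0. dist (T' p u w) (F' u v) < e"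
    proof eventually_elim
      case (elim p)
      show ?case
      proof
        fix u assume u: "u \<in> B 0"
        have "N 0 (F' u w - T' p u w) \<le> c * \<gamma> ^ p * (N 0 u * N 0 w)" by (rule F'_T'_diff[OF u w])
        also have "\<dots> \<le> c * \<gamma> ^ p * (\<rho> * N 0 w)"
          using u c_ge0 \<gamma>_ge0 by (intro mult_left_mono mult_right_mono) (auto simp: B_def)
        finally have "b * N 0 (F' u w - T' p u w) \<le> b * (c * \<gamma> ^ p * (\<rho> * N 0 w))"
          using b(1) by (intro mult_left_mono) auto
        then have "b * N 0 (F' u w - T' p u w) < e" using elim by linarith
        moreover have "F' u w = F' u v" unfolding F'_def w_def using J(1)[of 0 v] by simp
        ultimately show "dist (T' p u w) (F' u v) < e"
          using b(2)[of "F' u w - T' p u w"] by (simp add: dist_norm norm_minus_commute)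
      qed
    qed
  qed
  from uniform_limit_theorem[OF _ this] cT show ?thesis by simp
qed

subsection \<open>Inverse derivatives\<close>

definition L :: "'e \<Rightarrow> 'e \<Rightarrow> 'e" where "L u = inv_into (V 0) (F' u)"

lemma F'_inj: "u \<in> B 0 \<Longrightarrow> inj_on (F' u) (V 0)"
  unfolding linear_injective_on_subspace_0[OF linear_F' subspace_V]
proof (intro ballI impI)
  fix v assume "u \<in> B 0" "v \<in> V 0" "F' u v = 0"
  then have "N 0 v \<le> 0" using F'_lower[of u v] by simp
  then show "v = 0" using N_ge0[of 0 v] form_norm_eq_0[OF inner_m, of 0 v] by linarith
qed

lemma F'_onto: 
  assumes u: "u \<in> B 0"
  shows "F' u ` V 0 = V 0"
proof (rule subspace_dim_equal)
  have "span (V 0) = V 0" using subspace_V[of 0] by (simp only: span_eq_iff)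
  with F'_inj[OF u] have "inj_on (F' u) (span (V 0))" by metis
  then have "dim (F' u ` V 0) = dim (V 0)" by (rule dim_image_eq[OF linear_F'[OF u]])
  then show "dim (V 0) \<le> dim (F' u ` V 0)" by simp
qed (use subspace_V F'_V[OF u] in \<open>auto intro: linear_subspace_image linear_F'[OF u]\<close>)

lemma L_V: "u \<in> B 0 \<Longrightarrow> v \<in> V 0 \<Longrightarrow> L u v \<in> V 0"
  and F'_L: "u \<in> B 0 \<Longrightarrow> v \<in> V 0 \<Longrightarrow> F' u (L u v) = v"
  unfolding L_def using F'_onto by (metis inv_into_into, metis f_inv_into_f)

lemma L_F': "u \<in> B 0 \<Longrightarrow> v \<in> V 0 \<Longrightarrow> L u (F' u v) = v"
  unfolding L_def by (rule inv_into_f_f[OF F'_inj])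

lemma L_bound: "u \<in> B 0 \<Longrightarrow> v \<in> V 0 \<Longrightarrow> N 0 (L u v) \<le> 2 * N 0 v"
  using F'_lower[OF _ L_V, of u u v] by (simp add: F'_L)

lemma L_linear:
  assumes u: "u \<in> B 0" and v: "v \<in> V 0" "w \<in> V 0"
  shows "L u (a *\<^sub>R v + b *\<^sub>R w) = a *\<^sub>R L u v + b *\<^sub>R L u w"
proof -
  have in_V: "a *\<^sub>R L u v + b *\<^sub>R L u w \<in> V 0"
    by (intro subspace_add subspace_scale subspace_V L_V u v)
  have "F' u (a *\<^sub>R L u v + b *\<^sub>R L u w) = a *\<^sub>R v + b *\<^sub>R w"
    by (simp add: linear_add[OF linear_F'[OF u]] linear_cmul[OF linear_F'[OF u]] F'_L u v)
  then show ?thesis using L_F'[OF u in_V] by simp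
qed

lemma T'_lower: "u \<in> B 0 \<Longrightarrow> v \<in> V 0 \<Longrightarrow> N 0 v \<le> 2 * N 0 (T' p u v)"
  using near_id_bounds(1)[OF T'_near_id] .

lemma T'_inj: "u \<in> B 0 \<Longrightarrow> inj_on (T' p u) (V 0)"
  unfolding linear_injective_on_subspace_0[OF linear_T' subspace_V]
proof (intro ballI impI)
  fix v assume "u \<in> B 0" "v \<in> V 0" "T' p u v = 0"
  then have "N 0 v \<le> 0" using T'_lower[of u v p] by simp
  then show "v = 0" using N_ge0[of 0 v] form_norm_eq_0[OF inner_m, of 0 v] by linarith
qed

lemma H'_inj_at: "u \<in> B 0 \<Longrightarrow> inj_on (H' p u) (V 0)"
  using T'_inj[of u p] unfolding T'_def inj_on_def by metis

text \<open>The inverses of the derivatives along the chain converge to the inverse of the derivative of the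
  limit, since \<open>G p\<close> on \<open>V p\<close> is \<open>T' p \<xi>\<close> inverted after carrying back to \<open>V 0\<close>.\<close>

lemma inverse_derivatives_limit:
  assumes \<xi>: "\<xi> \<in> B 0" and G: "\<And>p w. w \<in> V 0 \<Longrightarrow> G p (H' p \<xi> w) = w"
    and a: "\<And>p. a p \<in> V 0" "a \<longlonglongrightarrow> l" "l \<in> V 0"
  shows "(\<lambda>p. G p (H' p 0 (a p))) \<longlonglongrightarrow> L \<xi> l"
proof (rule tendsto_by_N[of 0], rule tendsto_sandwich[OF _ _ tendsto_const])
  define w where "w = L \<xi> l"
  have w: "w \<in> V 0" "F' \<xi> w = l" unfolding w_def by (intro L_V F'_L \<xi> a)+
  have "N 0 (G p (H' p 0 (a p)) - w) \<le> 2 * N 0 ((a p - l) + (F' \<xi> w - T' p \<xi> w))" for p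
  proof -
    have inj: "inj_on (T' p \<xi>) (V 0)" by (rule T'_inj[OF \<xi>])
    have "span (V 0) = V 0" using subspace_V[of 0] by (simp only: span_eq_iff)
    with inj have "inj_on (T' p \<xi>) (span (V 0))" by metis
    then have "dim (T' p \<xi> ` V 0) = dim (V 0)" by (rule dim_image_eq[OF linear_T'[OF \<xi>]])
    then have "T' p \<xi> ` V 0 = V 0"
      by (intro subspace_dim_equal) (use subspace_V T'_V in \<open>auto intro: linear_subspace_image linear_T'[OF \<xi>]\<close>)
    then obtain x where x: "x \<in> V 0" "T' p \<xi> x = a p" using a(1)[of p] by (metis imageE)
    have "H' p \<xi> x = H' p 0 (a p)"
      using J_right[OF H'_V[OF \<xi> x(1)], of p] x(2) by (simp add: T'_def)
    then have "G p (H' p 0 (a p)) = x" using G[OF x(1), of p] by simp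
    moreover have "T' p \<xi> (x - w) = (a p - l) + (F' \<xi> w - T' p \<xi> w)"
      by (simp add: linear_diff[OF linear_T'[OF \<xi>]] x w)
    ultimately show ?thesis using T'_lower[OF \<xi>, of "x - w" p] x(1) w(1) subspace_diff[OF subspace_V] by metis
  qed
  then show "\<forall>\<^sub>F p in sequentially. N 0 (G p (H' p 0 (a p)) - L \<xi> l) \<le> 2 * N 0 ((a p - l) + (F' \<xi> w - T' p \<xi> w))"
    by (simp add: w_def)
  have "(\<lambda>p. 2 * N 0 ((a p - l) + (F' \<xi> w - T' p \<xi> w))) \<longlonglongrightarrow> 2 * N 0 ((l - l) + (F' \<xi> w - F' \<xi> w))"
    by (intro tendsto_intros tendsto_N a F'_limit \<xi> w)
  then show "(\<lambda>p. 2 * N 0 ((a p - l) + (F' \<xi> w - T' p \<xi> w))) \<longlonglongrightarrow> 0" by simp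
qed simp

text \<open>
  The inverse is continuous because the ball is compact, and differentiable because a continuous inverse
  of a map with left invertible derivative is. Its derivative \<open>L u\<close> depends continuously on \<open>u\<close>
  since the derivatives of \<open>F\<close> are uniformly bounded below.
\<close>

lemma F_C1_diffeo: "C1_diffeo_on F (B 0)"
  unfolding C1_diffeo_on_def
proof (intro conjI)
  have blF: "bounded_linear (F' u)" if "u \<in> B 0" for u using linear_F'[OF that] by (simp add: linear_conv_bounded_linear)
  show inj: "inj_on F (B 0)"
  proof (rule inj_onI)
    fix u u' assume "u \<in> B 0" "u' \<in> B 0" "F u = F u'"
    then have "N 0 (u - u') \<le> 0" using F_lower[of u u'] by simp
    then have "u - u' = 0" using N_ge0[of 0 "u - u'"] form_norm_eq_0[OF inner_m, of 0 "u - u'"] by linarith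
    then show "u = u'" by simp
  qed
  have cF: "continuous_on (B 0) F"
    by (auto simp: continuous_on_eq_continuous_within intro: has_derivative_continuous F_derivative)
  have app: "blinfun_apply (Blinfun (F' u)) = F' u" if "u \<in> B 0" for u
    using blF[OF that] by (rule bounded_linear_Blinfun_apply)
  show "C1_on F (B 0)" unfolding C1_on_def
  proof (intro exI[of _ "\<lambda>u. Blinfun (F' u)"] conjI ballI)
    show "(F has_derivative blinfun_apply (Blinfun (F' u))) (at u within B 0)" if "u \<in> B 0" for u
      using F_derivative[OF that] by (simp add: app[OF that])
    show "continuous_on (B 0) (\<lambda>u. Blinfun (F' u))"
    proof (rule continuous_on_blinfun_componentwise)
      fix i :: 'e
      show "continuous_on (B 0) (\<lambda>u. blinfun_apply (Blinfun (F' u)) i)"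
        by (rule continuous_on_eq[OF F'_continuous[of i]]) (simp add: app)
    qed
  qed
  define g where "g = inv_into (B 0) F"
  have gB: "g y \<in> B 0" "F (g y) = y" if "y \<in> F ` B 0" for y
    using that unfolding g_def by (auto intro: inv_into_into f_inv_into_f)
  have compact: "compact (B 0)" unfolding B_def by (rule compact_form_ball[OF inner_m subspace_V])
  have cg: "continuous_on (F ` B 0) g"
    unfolding g_def using inj by (intro continuous_on_inv[OF cF compact]) simp
  define R where "R = (\<lambda>u v. L u (J 0 v))"
  have linR: "linear (R u)" if u: "u \<in> B 0" for u
  proof (rule linearI)
    fix a b and r :: real
    show "R u (a + b) = R u a + R u b"
      using L_linear[OF u J(1) J(1), of 1 0 a 1 0 b] by (simp add: R_def linear_add[OF J(2)])
    show "R u (r *\<^sub>R a) = r *\<^sub>R R u a"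
      using L_linear[OF u J(1) zero_in_V, of r 0 a 0] by (simp add: R_def linear_cmul[OF J(2)])
  qed
  have R_cont: "continuous_on (B 0) (\<lambda>u. R u v)" for v
  proof -
    define b where "b = J 0 v"
    have b: "b \<in> V 0" by (simp add: b_def J)
    have "((\<lambda>u. L u b) \<longlongrightarrow> L u0 b) (at u0 within B 0)" if u0: "u0 \<in> B 0" for u0
    proof (rule tendsto_by_N[of 0], rule tendsto_sandwich[OF _ _ tendsto_const])
      define w where "w = L u0 b"
      have w: "w \<in> V 0" "F' u0 w = b" unfolding w_def by (intro L_V F'_L u0 b)+
      have "N 0 (L u b - w) \<le> 2 * N 0 (F' u0 w - F' u w)" if u: "u \<in> B 0" for u
      proof -
        have "N 0 (L u b - w) \<le> 2 * N 0 (F' u (L u b - w))"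
          by (intro F'_lower u subspace_diff subspace_V L_V b w)
        then show ?thesis by (simp add: linear_diff[OF linear_F'[OF u]] F'_L[OF u b] w)
      qed
      then show "\<forall>\<^sub>F u in at u0 within B 0. N 0 (L u b - L u0 b) \<le> 2 * N 0 (F' u0 w - F' u w)"
        unfolding eventually_at_filter w_def by (intro always_eventually) auto
      have "((\<lambda>u. F' u w) \<longlongrightarrow> F' u0 w) (at u0 within B 0)"
        using F'_continuous[of w] u0 by (simp add: continuous_on_def)
      then have "((\<lambda>u. 2 * N 0 (F' u0 w - F' u w)) \<longlongrightarrow> 2 * N 0 (F' u0 w - F' u0 w)) (at u0 within B 0)"
        by (intro tendsto_intros tendsto_N)
      then show "((\<lambda>u. 2 * N 0 (F' u0 w - F' u w)) \<longlongrightarrow> 0) (at u0 within B 0)" by simp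
    qed simp
    then show ?thesis by (simp add: continuous_on_def R_def b_def)
  qed
  have appR: "blinfun_apply (Blinfun (R u)) = R u" if "u \<in> B 0" for u
    using linR[OF that] by (simp add: linear_conv_bounded_linear bounded_linear_Blinfun_apply)
  show "C1_on (inv_into (B 0) F) (F ` B 0)" unfolding C1_on_def g_def[symmetric]
  proof (intro exI[of _ "\<lambda>y. Blinfun (R (g y))"] conjI ballI)
    fix y assume y: "y \<in> F ` B 0"
    have "(g has_derivative (\<lambda>v. R (g y) v)) (at y within F ` B 0)"
    proof (rule has_derivative_lift_left_inverse[where G = F and S = "B 0" and w = g and k' = "\<lambda>v. v"])
      show "(F has_derivative F' (g y)) (at (g y) within B 0)" by (rule F_derivative[OF gB(1)[OF y]])
      show "linear (R (g y))" by (rule linR[OF gB(1)[OF y]])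
      show "R (g y) (F' (g y) (g t - g y)) = g t - g y" if "t \<in> F ` B 0" for t
        using gB(1)[OF that] gB(1)[OF y] subspace_diff[OF subspace_V B_V B_V, of "g t" 0 "g y"]
        by (simp add: R_def F'_V L_F')
      show "((\<lambda>t. F (g t)) has_derivative (\<lambda>v. v)) (at y within F ` B 0)"
        by (rule has_derivative_transform[OF y _ has_derivative_ident]) (simp add: gB)
      show "continuous (at y within F ` B 0) g" using cg y unfolding continuous_on_eq_continuous_within by blast
    qed (rule gB(1))
    then show "(g has_derivative blinfun_apply (Blinfun (R (g y)))) (at y within F ` B 0)"
      by (simp add: appR[OF gB(1)[OF y]])
  next
    show "continuous_on (F ` B 0) (\<lambda>y. Blinfun (R (g y)))"
    proof (rule continuous_on_blinfun_componentwise)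
      fix i :: 'e
      have "continuous_on (F ` B 0) (\<lambda>y. R (g y) i)"
        by (rule continuous_on_compose2[OF R_cont cg]) (use gB in auto)
      then show "continuous_on (F ` B 0) (\<lambda>y. blinfun_apply (Blinfun (R (g y))) i)"
        by (rule continuous_on_eq) (simp add: appR gB)
    qed
  qed
qed

end

section \<open>Flows in charts\<close>

lemma gnorm_form_norm: "gnorm M x = form_norm (metric M x)"
  by (simp add: fun_eq_iff gnorm_def form_norm_def)

locale riemannian_flow =
  fixes M :: "('m::metric_space, 'e::euclidean_space, 'z) riem_scheme"
    and \<phi> :: "real \<Rightarrow> 'm \<Rightarrow> 'm"
  assumes manifold: "riemannian_manifold M" and C2_flow: "C2_flow M \<phi>"
begin

lemma cdom_self [simp]: "x \<in> cdom M x" and open_cdom: "open (cdom M x)"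
  and open_chart_image: "open (chart M x ` cdom M x)"
  and chart_homeomorphism: "homeomorphism (cdom M x) (chart M x ` cdom M x) (chart M x) (ichart M x)"
  using manifold unfolding riemannian_manifold_def by blast+

lemma ichart_chart [simp]: "y \<in> cdom M z \<Longrightarrow> ichart M z (chart M z y) = y"
  using chart_homeomorphism[of z] unfolding homeomorphism_def by auto

lemma chart_ichart: "p \<in> chart M z ` cdom M z \<Longrightarrow> chart M z (ichart M z p) = p"
  using chart_homeomorphism[of z] unfolding homeomorphism_def by auto

lemma continuous_on_chart: "continuous_on (cdom M z) (chart M z)"
  using chart_homeomorphism[of z] unfolding homeomorphism_def by auto

lemma continuous_on_ichart: "continuous_on (chart M z ` cdom M z) (ichart M z)"
  using chart_homeomorphism[of z] unfolding homeomorphism_def by auto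

lemma isCont_chart: "y \<in> cdom M z \<Longrightarrow> isCont (chart M z) y"
  using continuous_on_chart[of z] open_cdom[of z] by (simp add: continuous_on_eq_continuous_at)

lemma inner_form_metric: "inner_form (metric M x)"
  using manifold unfolding riemannian_manifold_def inner_form_def by blast

lemma flow_0 [simp]: "\<phi> 0 x = x" and flow_add: "\<phi> (s + t) x = \<phi> s (\<phi> t x)"
  and continuous_on_flow: "continuous_on UNIV (\<lambda>(t, x). \<phi> t x)"
  using C2_flow unfolding C2_flow_def by blast+

lemma flow_minus [simp]: "\<phi> (- t) (\<phi> t x) = x" "\<phi> t (\<phi> (- t) x) = x"
  using flow_add[of "- t" t x] flow_add[of t "- t" x] by simp_all

lemma inj_flow: "inj (\<phi> t)"
  by (rule inj_on_inverseI[of _ "\<phi> (- t)"]) simp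

lemma isCont_flow: "isCont (\<lambda>(t, x). \<phi> t x) (t, x)"
  using continuous_on_flow by (simp add: continuous_on_eq_continuous_at)

lemma continuous_on_flow_at: "continuous_on A f \<Longrightarrow> continuous_on A (\<lambda>x. \<phi> t (f x))"
proof -
  assume "continuous_on A f"
  then have "continuous_on A (\<lambda>x. (t, f x))" by (intro continuous_intros)
  from continuous_on_compose2[OF continuous_on_flow this] show ?thesis by simp
qed

definition coord_flow_dom :: "'m \<Rightarrow> 'm \<Rightarrow> (real \<times> 'e) set" where
  "coord_flow_dom x z = {(t, p). p \<in> chart M x ` cdom M x \<and> \<phi> t (ichart M x p) \<in> cdom M z}"

lemma open_coord_flow_dom: "open (coord_flow_dom x z)"
proof -
  have "continuous_on (UNIV \<times> chart M x ` cdom M x) (\<lambda>q. (\<lambda>(t, x). \<phi> t x) (fst q, ichart M x (snd q)))"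
    by (intro continuous_on_compose2[OF continuous_on_flow] continuous_intros
        continuous_on_compose2[OF continuous_on_ichart]) auto
  moreover have "open (UNIV \<times> chart M x ` cdom M x)"
    by (intro open_Times open_UNIV open_chart_image)
  ultimately have "open ((UNIV \<times> chart M x ` cdom M x) \<inter>
      (\<lambda>q. (\<lambda>(t, x). \<phi> t x) (fst q, ichart M x (snd q))) -` cdom M z)"
    by (rule continuous_open_preimage) (rule open_cdom)
  moreover have "(UNIV \<times> chart M x ` cdom M x) \<inter>
      (\<lambda>q. (\<lambda>(t, x). \<phi> t x) (fst q, ichart M x (snd q))) -` cdom M z = coord_flow_dom x z"
    unfolding coord_flow_dom_def by auto
  ultimately show ?thesis by simp
qed

lemma coord_flow_domI: "y \<in> cdom M x \<Longrightarrow> \<phi> t y \<in> cdom M z \<Longrightarrow> (t, chart M x y) \<in> coord_flow_dom x z"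
  unfolding coord_flow_dom_def by auto

text \<open>The spatial derivative of the flow at time \<open>t\<close> and the point \<open>y\<close>, from the chart \<open>x\<close> to the chart
  \<open>z\<close>. With \<open>t = 0\<close> these are the changes of coordinates, so that the same chain rule serves both.\<close>

definition coord_deriv :: "'m \<Rightarrow> 'm \<Rightarrow> real \<Rightarrow> 'm \<Rightarrow> 'e \<Rightarrow> 'e" where
  "coord_deriv x z t y = frechet_derivative (chart M z \<circ> \<phi> t \<circ> ichart M x) (at (chart M x y))"

lemma coord_flow_derivs:
  obtains f' f'' where "derivs2_on (\<lambda>(t, p). chart M z (\<phi> t (ichart M x p))) (coord_flow_dom x z) f' f''"
    "\<forall>t y. y \<in> cdom M x \<longrightarrow> \<phi> t y \<in> cdom M z \<longrightarrow>
       ((chart M z \<circ> \<phi> t \<circ> ichart M x) has_derivative (\<lambda>a. f' (t, chart M x y) (0, a))) (at (chart M x y))"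
proof -
  obtain f' f'' where d: "derivs2_on (\<lambda>(t, p). chart M z (\<phi> t (ichart M x p))) (coord_flow_dom x z) f' f''"
    using C2_flow unfolding C2_flow_def C2_on_def coord_flow_dom_def by blast
  have "((chart M z \<circ> \<phi> t \<circ> ichart M x) has_derivative (\<lambda>a. f' (t, chart M x y) (0, a))) (at (chart M x y))"
    if y: "y \<in> cdom M x" "\<phi> t y \<in> cdom M z" for t y
  proof -
    have "((\<lambda>(t, p). chart M z (\<phi> t (ichart M x p))) has_derivative f' (t, chart M x y)) (at (t, chart M x y))"
      using d coord_flow_domI[OF y] open_coord_flow_dom[of x z] unfolding derivs2_on_def
      by (metis at_within_open)
    moreover have "((\<lambda>p. (t, p)) has_derivative (\<lambda>a. (0, a))) (at (chart M x y))"
      by (intro has_derivative_Pair has_derivative_const has_derivative_ident)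
    ultimately have "((\<lambda>p. (\<lambda>(t, p). chart M z (\<phi> t (ichart M x p))) (t, p)) has_derivative
        (\<lambda>a. f' (t, chart M x y) (0, a))) (at (chart M x y))"
      by (rule has_derivative_compose[rotated])
    then show ?thesis by (simp add: o_def)
  qed
  then show ?thesis using that d by blast
qed

lemma coord_deriv:
  assumes "y \<in> cdom M x" "\<phi> t y \<in> cdom M z"
  shows "((chart M z \<circ> \<phi> t \<circ> ichart M x) has_derivative coord_deriv x z t y) (at (chart M x y))"
proof -
  obtain f' f'' where "derivs2_on (\<lambda>(t, p). chart M z (\<phi> t (ichart M x p))) (coord_flow_dom x z) f' f''"
    and d: "\<And>t y. y \<in> cdom M x \<Longrightarrow> \<phi> t y \<in> cdom M z \<Longrightarrow>
       ((chart M z \<circ> \<phi> t \<circ> ichart M x) has_derivative (\<lambda>a. f' (t, chart M x y) (0, a))) (at (chart M x y))"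
    using coord_flow_derivs[of z x] by blast
  from d[OF assms] show ?thesis unfolding coord_deriv_def
    by (metis differentiableI frechet_derivative_works)
qed

lemma linear_coord_deriv: "y \<in> cdom M x \<Longrightarrow> \<phi> t y \<in> cdom M z \<Longrightarrow> linear (coord_deriv x z t y)"
  using coord_deriv has_derivative_linear by blast

lemma coord_deriv_chain:
  assumes y: "y \<in> cdom M x1" "\<phi> t y \<in> cdom M x2" "\<phi> s (\<phi> t y) \<in> cdom M x3"
  shows "coord_deriv x2 x3 s (\<phi> t y) (coord_deriv x1 x2 t y a) = coord_deriv x1 x3 (s + t) y a"
proof -
  define F where "F = (\<lambda>p. (chart M x3 \<circ> \<phi> s \<circ> ichart M x2) ((chart M x2 \<circ> \<phi> t \<circ> ichart M x1) p))"
  have "((chart M x3 \<circ> \<phi> s \<circ> ichart M x2) has_derivative coord_deriv x2 x3 s (\<phi> t y))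
      (at ((chart M x2 \<circ> \<phi> t \<circ> ichart M x1) (chart M x1 y)))"
    using coord_deriv[OF y(2,3)] y(1) by simp
  from has_derivative_compose[OF coord_deriv[OF y(1,2)] this]
  have F: "(F has_derivative (\<lambda>a. coord_deriv x2 x3 s (\<phi> t y) (coord_deriv x1 x2 t y a))) (at (chart M x1 y))"
    unfolding F_def .
  define U where "U = (\<lambda>p. (t, p)) -` coord_flow_dom x1 x2"
  have U: "open U" unfolding U_def by (intro open_vimage open_coord_flow_dom continuous_intros)
  have yU: "chart M x1 y \<in> U" using coord_flow_domI[OF y(1,2)] by (simp add: U_def)
  have eq: "F p = (chart M x3 \<circ> \<phi> (s + t) \<circ> ichart M x1) p" if "p \<in> U" for p
    using that by (auto simp: U_def F_def coord_flow_dom_def flow_add)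
  have "((chart M x3 \<circ> \<phi> (s + t) \<circ> ichart M x1) has_derivative
      (\<lambda>a. coord_deriv x2 x3 s (\<phi> t y) (coord_deriv x1 x2 t y a))) (at (chart M x1 y))"
    using has_derivative_transform_within_open[OF F U yU eq] .
  from has_derivative_unique[OF this coord_deriv[OF y(1)]] y(3)
  show ?thesis by (simp add: flow_add fun_eq_iff)
qed

lemma coord_deriv_id: "y \<in> cdom M x \<Longrightarrow> coord_deriv x x 0 y a = a"
proof -
  assume y: "y \<in> cdom M x"
  have "((\<lambda>p. p) has_derivative (\<lambda>a. a)) (at (chart M x y))" by simp
  then have "((chart M x \<circ> \<phi> 0 \<circ> ichart M x) has_derivative (\<lambda>a. a)) (at (chart M x y))"
    by (rule has_derivative_transform_within_open[OF _ open_chart_image[of x]])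
      (use y in \<open>auto simp: chart_ichart\<close>)
  from has_derivative_unique[OF this coord_deriv[OF y]] y show ?thesis by (simp add: fun_eq_iff)
qed

lemma coord_change_coord_deriv: "coord_change M y z = coord_deriv y z 0 y"
proof -
  have "\<phi> 0 = id" by auto
  then show ?thesis unfolding coord_change_def coord_deriv_def by simp
qed

lemma mdiff_coord_deriv: "mdiff M (\<phi> t) y = coord_deriv y (\<phi> t y) t y"
  unfolding mdiff_def coord_deriv_def ..

lemma linear_coord_change: "y \<in> cdom M z \<Longrightarrow> linear (coord_change M y z)"
  unfolding coord_change_coord_deriv by (rule linear_coord_deriv) auto

lemma coord_change_inverse:
  assumes "y \<in> cdom M z"
  shows "coord_deriv z y 0 y (coord_change M y z v) = v" "coord_change M y z (coord_deriv z y 0 y v) = v"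
  using coord_deriv_chain[of y y 0 z 0 y v] coord_deriv_chain[of y z 0 y 0 z v] assms
  by (simp_all add: coord_change_coord_deriv coord_deriv_id)

lemma inj_coord_change: "y \<in> cdom M z \<Longrightarrow> inj (coord_change M y z)"
  by (rule inj_on_inverseI[of _ "coord_deriv z y 0 y"]) (rule coord_change_inverse)

lemma coord_deriv_mdiff:
  assumes "y \<in> cdom M x" "\<phi> t y \<in> cdom M z"
  shows "coord_deriv x z t y (coord_change M y x v) = coord_change M (\<phi> t y) z (mdiff M (\<phi> t) y v)"
  using coord_deriv_chain[of y y 0 x t z v] coord_deriv_chain[of y y t "\<phi> t y" 0 z v] assms
  by (simp add: coord_change_coord_deriv mdiff_coord_deriv)

lemma linear_mdiff: "linear (mdiff M (\<phi> t) y)"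
  unfolding mdiff_coord_deriv by (rule linear_coord_deriv) auto

lemma mdiff_add: "mdiff M (\<phi> (s + t)) y v = mdiff M (\<phi> s) (\<phi> t y) (mdiff M (\<phi> t) y v)"
  unfolding mdiff_coord_deriv using coord_deriv_chain[of y y t "\<phi> t y" s "\<phi> (s + t) y" v]
  by (simp add: flow_add)

lemma mdiff_zero [simp]: "mdiff M (\<phi> 0) y v = v"
  by (simp add: mdiff_coord_deriv coord_deriv_id)

lemma mdiff_minus [simp]:
  "mdiff M (\<phi> (- t)) (\<phi> t y) (mdiff M (\<phi> t) y v) = v"
  "mdiff M (\<phi> t) (\<phi> (- t) y) (mdiff M (\<phi> (- t)) y v) = v"
  using mdiff_add[of "- t" t y v] mdiff_add[of t "- t" y v] by simp_all

lemma inj_mdiff: "inj (mdiff M (\<phi> t) y)"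
  by (rule inj_on_inverseI[of _ "mdiff M (\<phi> (- t)) (\<phi> t y)"]) simp

section \<open>The metric in charts\<close>

definition coord_norm :: "'m \<Rightarrow> 'm \<Rightarrow> 'e \<Rightarrow> real" where
  "coord_norm z y a = gnorm M y (coord_deriv z y 0 y a)"

lemma coord_norm_change: "y \<in> cdom M z \<Longrightarrow> coord_norm z y (coord_change M y z v) = gnorm M y v"
  by (simp add: coord_norm_def coord_change_inverse)

lemma coord_norm_local_metric:
  assumes y: "y \<in> cdom M z"
  shows "coord_norm z y a = sqrt (local_metric M z (chart M z y) a a)"
proof -
  have "\<phi> 0 = id" by auto
  then show ?thesis using y by (simp add: coord_norm_def gnorm_def local_metric_def Let_def coord_deriv_def)
qed

lemma coord_norm_scale: "y \<in> cdom M z \<Longrightarrow> coord_norm z y (c *\<^sub>R a) = \<bar>c\<bar> * coord_norm z y a"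
  unfolding coord_norm_def gnorm_form_norm
  by (simp add: linear_cmul[OF linear_coord_deriv] form_norm_scale[OF inner_form_metric])

lemma coord_norm_pos: 
  assumes "y \<in> cdom M z" "a \<noteq> 0"
  shows "coord_norm z y a > 0"
proof -
  have "coord_deriv z y 0 y a \<noteq> 0"
    using coord_change_inverse(2)[OF assms(1), of a] assms linear_0[OF linear_coord_change[OF assms(1)]] by auto
  then show ?thesis unfolding coord_norm_def gnorm_form_norm by (rule form_norm_pos[OF inner_form_metric])
qed

lemma coord_norm_0: "y \<in> cdom M z \<Longrightarrow> coord_norm z y 0 = 0"
  unfolding coord_norm_def gnorm_form_norm
  by (simp add: linear_0[OF linear_coord_deriv] form_norm_0[OF inner_form_metric])

text \<open>
  The regularity of the metric in a chart is given for fixed pairs of vectors; an expansion in the basis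
  yields joint continuity.
\<close>

lemma continuous_on_coord_norm: "continuous_on (cdom M z \<times> UNIV) (\<lambda>(y, a). coord_norm z y a)"
proof -
  have lm: "local_metric M z (chart M z y) a b = 
      (\<Sum>i\<in>Basis. \<Sum>j\<in>Basis. (a \<bullet> i) * (b \<bullet> j) * local_metric M z (chart M z y) i j)"
    if y: "y \<in> cdom M z" for y a b
  proof -
    have "\<phi> 0 = id" by auto
    then have lm: "local_metric M z (chart M z y) = (\<lambda>a b. metric M y (coord_deriv z y 0 y a) (coord_deriv z y 0 y b))"
      using y by (intro ext) (simp add: local_metric_def Let_def coord_deriv_def)
    have l: "linear (coord_deriv z y 0 y)" using y by (intro linear_coord_deriv) auto
    have b: "bilinear (metric M y)" by (rule inner_form_bilinear[OF inner_form_metric])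
    have "coord_deriv z y 0 y v = (\<Sum>i\<in>Basis. (v \<bullet> i) *\<^sub>R coord_deriv z y 0 y i)" for v
      by (subst euclidean_representation[of v, symmetric]) (simp only: linear_sum[OF l] linear_cmul[OF l])
    then have "metric M y (coord_deriv z y 0 y a) (coord_deriv z y 0 y b) =
       metric M y (\<Sum>i\<in>Basis. (a \<bullet> i) *\<^sub>R coord_deriv z y 0 y i) (\<Sum>j\<in>Basis. (b \<bullet> j) *\<^sub>R coord_deriv z y 0 y j)"
      by metis
    also have "\<dots> = (\<Sum>(i,j)\<in>Basis \<times> Basis. metric M y ((a \<bullet> i) *\<^sub>R coord_deriv z y 0 y i) ((b \<bullet> j) *\<^sub>R coord_deriv z y 0 y j))"
      by (rule bilinear_sum[OF b])
    also have "\<dots> = (\<Sum>i\<in>Basis. \<Sum>j\<in>Basis. (a \<bullet> i) * (b \<bullet> j) * metric M y (coord_deriv z y 0 y i) (coord_deriv z y 0 y j))"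
      by (simp add: sum.cartesian_product[symmetric] bilinear_lmul[OF b] bilinear_rmul[OF b] ac_simps)
    finally show ?thesis by (simp add: lm)
  qed
  have c: "continuous_on (chart M z ` cdom M z) (\<lambda>p. local_metric M z p i j)" for i j
  proof -
    obtain f' where "\<forall>p\<in>chart M z ` cdom M z. ((\<lambda>p. local_metric M z p i j) has_derivative 
       blinfun_apply (f' p)) (at p within chart M z ` cdom M z)"
      using manifold unfolding riemannian_manifold_def C1_on_def by blast
    then show ?thesis by (auto simp: continuous_on_eq_continuous_within intro: has_derivative_continuous)
  qed
  have c2: "continuous_on (cdom M z \<times> UNIV) (\<lambda>q::'m \<times> 'e. local_metric M z (chart M z (fst q)) i j)" for i j
    by (rule continuous_on_compose2[OF c])
      (auto intro!: continuous_intros continuous_on_compose2[OF continuous_on_chart])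
  have "continuous_on (cdom M z \<times> UNIV) (\<lambda>q. sqrt (\<Sum>i\<in>Basis. \<Sum>j\<in>Basis. (snd q \<bullet> i) * (snd q \<bullet> j) *
     local_metric M z (chart M z (fst q)) i j))"
    by (intro continuous_intros c2)
  then show ?thesis
    by (rule continuous_on_eq) (auto simp: coord_norm_local_metric lm[symmetric])
qed

text \<open>Joint continuity and compactness of the unit sphere.\<close>

lemma coord_norm_equivalent:
  obtains r B where "r > 0" "B > 0" "ball z r \<subseteq> cdom M z"
    "\<And>y a. y \<in> ball z r \<Longrightarrow> norm a \<le> B * coord_norm z y a"
    "\<And>y a. y \<in> ball z r \<Longrightarrow> coord_norm z y a \<le> B * norm a"
proof -
  obtain r0 where r0: "r0 > 0" "ball z r0 \<subseteq> cdom M z"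
    using open_cdom[of z] cdom_self open_contains_ball by blast
  define P where "P = (\<lambda>D a. D > 0 \<and> (\<forall>y\<in>ball z (1 / D) \<inter> ball z r0. 1 \<le> D * coord_norm z y a \<and> coord_norm z y a \<le> D))"
  obtain D where D: "D > 0" "\<And>a. a \<in> sphere 0 1 \<Longrightarrow> P D a"
  proof (rule compact_uniform_constant[of "sphere (0::'e) 1" P])
    show "P D' a" if "P D a" "D \<le> D'" for D D' a
      unfolding P_def
    proof (intro conjI ballI)
      show D': "D' > 0" using that by (simp add: P_def)
      fix y assume y: "y \<in> ball z (1 / D') \<inter> ball z r0"
      have "1 / D' \<le> 1 / D" using that D' by (intro divide_left_mono) (auto simp: P_def)
      then have y': "y \<in> ball z (1 / D) \<inter> ball z r0" using y by auto
      have n: "coord_norm z y a \<ge> 0" unfolding coord_norm_def gnorm_form_norm by (simp add: form_norm_ge0[OF inner_form_metric])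
      have "1 \<le> D * coord_norm z y a" "coord_norm z y a \<le> D" using that(1) y' by (auto simp: P_def)
      then show "coord_norm z y a \<le> D'" "1 \<le> D' * coord_norm z y a"
        using mult_right_mono[OF that(2) n] that(2) by linarith+
    qed
    fix a :: 'e assume a: "a \<in> sphere 0 1"
    define n where "n = coord_norm z z a"
    have n: "n > 0" unfolding n_def using a by (intro coord_norm_pos) auto
    have "open (cdom M z \<times> (UNIV::'e set))" using open_cdom by (intro open_Times) auto
    then have "isCont (\<lambda>(y, a). coord_norm z y a) (z, a)"
      using continuous_on_coord_norm[of z] by (simp add: continuous_on_eq_continuous_at)
    then obtain d where d: "d > 0" "\<And>q. dist q (z, a) < d \<Longrightarrow> dist ((\<lambda>(y, a). coord_norm z y a) q) n < n / 2"
      unfolding continuous_at_eps_delta n_def using n unfolding n_def by (metis (no_types, lifting) half_gt_zero case_prod_conv)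
    define E where "E = max (2 / d) (max (2 / n) (2 * n))"
    have E: "E > 0" "2 / d \<le> E" "2 / n \<le> E" "2 * n \<le> E" using d(1) n by (auto simp: E_def less_max_iff_disj)
    have "P E b" if b: "b \<in> ball a (d / 2)" for b unfolding P_def
    proof (intro conjI ballI E(1))
      fix y assume y: "y \<in> ball z (1 / E) \<inter> ball z r0"
      have "1 / E \<le> d / 2" using E(1,2) d(1) by (simp add: field_simps)
      then have "dist y z < d / 2" using y by (auto simp: dist_commute)
      then have "dist (y, b) (z, a) < d"
        using b sqrt_sum_squares_le_sum[of "dist y z" "dist b a"] unfolding dist_Pair_Pair
        by (simp add: dist_commute)
      from d(2)[OF this] have "\<bar>coord_norm z y b - n\<bar> < n / 2" by (simp add: dist_real_def)
      then have 1: "coord_norm z y b \<ge> n / 2" "coord_norm z y b \<le> 2 * n" using n by linarith+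
      then show "coord_norm z y b \<le> E" using E(4) by linarith
      have "1 = (2 / n) * (n / 2)" using n by simp
      also have "\<dots> \<le> E * coord_norm z y b" using E 1(1) n by (intro mult_mono) auto
      finally show "1 \<le> E * coord_norm z y b" .
    qed
    then show "\<exists>U D. open U \<and> a \<in> U \<and> (\<forall>y\<in>U \<inter> sphere 0 1. P D y)"
      using d(1) by (intro exI[of _ "ball a (d / 2)"] exI[of _ E]) auto
  qed (use that in auto)
  show ?thesis
  proof (rule that[of "min r0 (1 / D)" D])
    show "ball z (min r0 (1 / D)) \<subseteq> cdom M z" using r0(2) by auto
    fix y a assume y: "y \<in> ball z (min r0 (1 / D))"
    have yc: "y \<in> cdom M z" using y r0(2) by auto
    have "norm a \<le> D * coord_norm z y a \<and> coord_norm z y a \<le> D * norm a"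
    proof (cases "a = 0")
      case False
      define u where "u = (1 / norm a) *\<^sub>R a"
      have "u \<in> sphere 0 1" and a: "a = norm a *\<^sub>R u" using False by (auto simp: u_def)
      from D(2)[OF this(1)] have u: "1 \<le> D * coord_norm z y u" "coord_norm z y u \<le> D"
        using y by (auto simp: P_def)
      have "coord_norm z y a = norm a * coord_norm z y u"
        by (subst a) (simp add: coord_norm_scale[OF yc])
      then show ?thesis
        using mult_left_mono[OF u(1), of "norm a"] mult_left_mono[OF u(2), of "norm a"] by (simp add: ac_simps)
    qed (simp add: coord_norm_0[OF yc])
    then show "norm a \<le> D * coord_norm z y a" "coord_norm z y a \<le> D * norm a" by auto
  qed (use r0 D in auto)
qed

text \<open>
  The flow is of class C2 in time and space together, so that one neighbourhood and one constant serve
  for all times near \<open>s\<close>.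
\<close>

lemma coord_deriv_local_bound:
  assumes w: "\<phi> s x \<in> cdom M z" and V: "open V" "\<phi> s x \<in> V"
  obtains r B where "r > 0" "B > 0"
    "\<And>t y. \<bar>t - s\<bar> < r \<Longrightarrow> y \<in> ball x r \<Longrightarrow> y \<in> cdom M x \<and> \<phi> t y \<in> cdom M z \<and> \<phi> t y \<in> V"
    "\<And>t y a. \<bar>t - s\<bar> < r \<Longrightarrow> y \<in> ball x r \<Longrightarrow> norm (coord_deriv x z t y a) \<le> B * norm a"
    "\<And>t y y' a. \<bar>t - s\<bar> < r \<Longrightarrow> y \<in> ball x r \<Longrightarrow> y' \<in> ball x r \<Longrightarrow>
       norm (coord_deriv x z t y a - coord_deriv x z t y' a) \<le> B * norm (chart M x y - chart M x y') * norm a"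
proof -
  obtain f' f'' where d: "derivs2_on (\<lambda>(t, p). chart M z (\<phi> t (ichart M x p))) (coord_flow_dom x z) f' f''"
    and f': "\<And>t y. y \<in> cdom M x \<Longrightarrow> \<phi> t y \<in> cdom M z \<Longrightarrow>
       ((chart M z \<circ> \<phi> t \<circ> ichart M x) has_derivative (\<lambda>a. f' (t, chart M x y) (0, a))) (at (chart M x y))"
    using coord_flow_derivs[of z x] by blast
  obtain r1 B where B: "r1 > 0" "B > 0" "ball (s, chart M x x) r1 \<subseteq> coord_flow_dom x z"
    "\<And>y. y \<in> ball (s, chart M x x) r1 \<Longrightarrow> norm (f' y) \<le> B"
    "\<And>y z. y \<in> ball (s, chart M x x) r1 \<Longrightarrow> z \<in> ball (s, chart M x x) r1 \<Longrightarrow> norm (f' y - f' z) \<le> B * norm (y - z)"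
    using derivs2_on_local_bound[OF d open_coord_flow_dom coord_flow_domI[OF cdom_self w]] by metis
  obtain r2 where r2: "r2 > 0" "\<And>y. dist y x < r2 \<Longrightarrow> dist (chart M x y) (chart M x x) < r1 / 2"
    using isCont_chart[of x x] B(1) unfolding continuous_at_eps_delta by (metis cdom_self half_gt_zero)
  obtain r3 where r3: "r3 > 0" "ball x r3 \<subseteq> cdom M x"
    using open_cdom[of x] cdom_self open_contains_ball by blast
  have "open (cdom M z \<inter> V)" using V open_cdom by blast
  then have "open ((\<lambda>(t, x). \<phi> t x) -` (cdom M z \<inter> V))" by (rule open_vimage) (rule continuous_on_flow)
  moreover have "(s, x) \<in> (\<lambda>(t, x). \<phi> t x) -` (cdom M z \<inter> V)" using w V by simp
  ultimately obtain r4 where r4: "r4 > 0" "ball (s, x) r4 \<subseteq> (\<lambda>(t, x). \<phi> t x) -` (cdom M z \<inter> V)"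
    using open_contains_ball by blast
  define r where "r = min (r1 / 2) (min r2 (min r3 (r4 / 2)))"
  have r: "r > 0" "r \<le> r1 / 2" "r \<le> r2" "r \<le> r3" "r \<le> r4 / 2" using B(1) r2(1) r3(1) r4(1) by (auto simp: r_def)
  have dom: "y \<in> cdom M x \<and> \<phi> t y \<in> cdom M z \<and> \<phi> t y \<in> V" if "\<bar>t - s\<bar> < r" "y \<in> ball x r" for t y
  proof -
    have "dist (t, y) (s, x) \<le> \<bar>t - s\<bar> + dist x y"
      unfolding dist_Pair_Pair using sqrt_sum_squares_le_sum[of "dist t s" "dist y x"] by (simp add: dist_real_def dist_commute)
    then have "dist (t, y) (s, x) < r4" using that r(5) by auto
    then have "(t, y) \<in> ball (s, x) r4" by (simp add: dist_commute)
    then have "\<phi> t y \<in> cdom M z \<inter> V" using r4(2) by auto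
    then show ?thesis using that r(4) r3(2) by auto
  qed
  have inb: "(t, chart M x y) \<in> ball (s, chart M x x) r1" if "\<bar>t - s\<bar> < r" "y \<in> ball x r" for t y
  proof -
    have "dist (s, chart M x x) (t, chart M x y) \<le> \<bar>t - s\<bar> + dist (chart M x y) (chart M x x)"
      unfolding dist_Pair_Pair using sqrt_sum_squares_le_sum[of "dist s t" "dist (chart M x x) (chart M x y)"]
      by (simp add: dist_real_def dist_commute)
    moreover have "dist (chart M x y) (chart M x x) < r1 / 2" using that r(3) by (intro r2(2)) (auto simp: dist_commute)
    ultimately show ?thesis using that r(2) by auto
  qed
  have cd: "coord_deriv x z t y a = f' (t, chart M x y) (0, a)" if "\<bar>t - s\<bar> < r" "y \<in> ball x r" for t y a
  proof -
    have d: "y \<in> cdom M x" "\<phi> t y \<in> cdom M z" using dom[OF that] by auto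
    from has_derivative_unique[OF coord_deriv[OF d] f'[OF d]] show ?thesis by (simp add: fun_eq_iff)
  qed
  have n0: "norm ((0::real), a) = norm a" for a :: 'e by (simp add: norm_Pair)
  show ?thesis
  proof (rule that[OF r(1) B(2) dom])
    fix t y a assume t: "\<bar>t - s\<bar> < r" "y \<in> ball x r"
    show "norm (coord_deriv x z t y a) \<le> B * norm a"
      unfolding cd[OF t] using norm_blinfun[of "f' (t, chart M x y)" "(0, a)"] B(4)[OF inb[OF t]]
        mult_right_mono[OF B(4)[OF inb[OF t]], of "norm a"] by (simp add: n0)
  next
    fix t y y' a assume t: "\<bar>t - s\<bar> < r" "y \<in> ball x r" "y' \<in> ball x r"
    have "norm (coord_deriv x z t y a - coord_deriv x z t y' a) =
        norm ((f' (t, chart M x y) - f' (t, chart M x y')) (0, a))"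
      unfolding cd[OF t(1,2)] cd[OF t(1,3)] by (simp add: blinfun.diff_left)
    also have "\<dots> \<le> norm (f' (t, chart M x y) - f' (t, chart M x y')) * norm a"
      using norm_blinfun[of "f' (t, chart M x y) - f' (t, chart M x y')" "(0, a)"] by (simp add: n0)
    also have "\<dots> \<le> (B * norm ((t, chart M x y) - (t, chart M x y'))) * norm a"
      by (intro mult_right_mono B(5) inb t) auto
    also have "norm ((t, chart M x y) - (t, chart M x y')) = norm (chart M x y - chart M x y')"
      by (simp add: n0)
    finally show "norm (coord_deriv x z t y a - coord_deriv x z t y' a) \<le> B * norm (chart M x y - chart M x y') * norm a" .
  qed
qed

text \<open>In charts around a point and its image the differential is bounded and the norms are equivalent to
  the Euclidean one; compactness makes the constants uniform.\<close>

lemma mdiff_uniform_bound: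
  assumes L: "compact \<Lambda>"
  obtains D where "D > 0"
    "\<And>t x0 y v. \<bar>t\<bar> \<le> T \<Longrightarrow> x0 \<in> \<Lambda> \<Longrightarrow> dist x0 y < 1 / D \<Longrightarrow>
      gnorm M (\<phi> t y) (mdiff M (\<phi> t) y v) \<le> D * gnorm M y v"
proof -
  define P where "P = (\<lambda>D (t, x0). D > 0 \<and> (\<forall>y v. dist x0 y < 1 / D \<longrightarrow>
      gnorm M (\<phi> t y) (mdiff M (\<phi> t) y v) \<le> D * gnorm M y v))"
  have g0: "gnorm M y v \<ge> 0" for y v unfolding gnorm_form_norm by (rule form_norm_ge0[OF inner_form_metric])
  obtain D where "D > 0" and D: "\<And>q. q \<in> {-T..T} \<times> \<Lambda> \<Longrightarrow> P D q"
  proof (rule compact_uniform_constant[of "{-T..T} \<times> \<Lambda>" P])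
    show "compact ({-T..T} \<times> \<Lambda>)" using L by (intro compact_Times) auto
    show "P D' q" if "P D q" "D \<le> D'" for D D' q
    proof (cases q)
      case (Pair t x0)
      have D': "D > 0" "D' > 0" using that unfolding P_def Pair by auto
      have "1 / D' \<le> 1 / D" using that D' by (intro divide_left_mono) auto
      moreover have "D * gnorm M y v \<le> D' * gnorm M y v" for y v using that(2) g0 by (rule mult_right_mono)
      ultimately show ?thesis using that(1) D' unfolding P_def Pair split_conv
        by (meson less_le_trans order_trans)
    qed
    fix q assume "q \<in> {-T..T} \<times> \<Lambda>"
    obtain s x where q: "q = (s, x)" by (cases q)
    define z where "z = \<phi> s x"
    obtain r1 B1 where 1: "r1 > 0" "B1 > 0" "ball x r1 \<subseteq> cdom M x"
      "\<And>y a. y \<in> ball x r1 \<Longrightarrow> norm a \<le> B1 * coord_norm x y a" using coord_norm_equivalent[of x] by metis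
    obtain r2 B2 where 2: "r2 > 0" "B2 > 0" "ball z r2 \<subseteq> cdom M z"
      "\<And>y a. y \<in> ball z r2 \<Longrightarrow> coord_norm z y a \<le> B2 * norm a" using coord_norm_equivalent[of z] by metis
    obtain r3 B3 where 3: "r3 > 0" "B3 > 0"
      "\<And>t y. \<bar>t - s\<bar> < r3 \<Longrightarrow> y \<in> ball x r3 \<Longrightarrow> y \<in> cdom M x \<and> \<phi> t y \<in> cdom M z \<and> \<phi> t y \<in> ball z r2"
      "\<And>t y a. \<bar>t - s\<bar> < r3 \<Longrightarrow> y \<in> ball x r3 \<Longrightarrow> norm (coord_deriv x z t y a) \<le> B3 * norm a"
      using coord_deriv_local_bound[of s x z "ball z r2"] 2(1) unfolding z_def
      by (metis cdom_self open_ball centre_in_ball)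
    define r where "r = min r1 r3"
    define E where "E = max (2 / r) (B1 * B3 * B2)"
    have r: "r > 0" "r \<le> r1" "r \<le> r3" using 1(1) 3(1) by (auto simp: r_def)
    have E: "E > 0" "2 / r \<le> E" "B1 * B3 * B2 \<le> E" using r(1) by (auto simp: E_def less_max_iff_disj)
    have Er: "1 / E \<le> r / 2" using E r by (simp add: field_simps)
    have "P E (t, x0)" if t: "\<bar>t - s\<bar> < r" "dist x x0 < r / 2" for t x0
      unfolding P_def split_conv
    proof (intro conjI allI impI E(1))
      fix y v assume "dist x0 y < 1 / E"
      then have "dist x y < r" using t(2) Er dist_triangle[of x y x0] by linarith
      then have y: "y \<in> ball x r1" "y \<in> ball x r3" using r by auto
      have t3: "\<bar>t - s\<bar> < r3" using t r by simp
      have yc: "y \<in> cdom M x" "\<phi> t y \<in> cdom M z" "\<phi> t y \<in> ball z r2" using 3(3)[OF t3 y(2)] by auto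
      have "gnorm M (\<phi> t y) (mdiff M (\<phi> t) y v) = coord_norm z (\<phi> t y) (coord_deriv x z t y (coord_change M y x v))"
        unfolding coord_deriv_mdiff[OF yc(1,2)] coord_norm_change[OF yc(2)] ..
      also have "\<dots> \<le> B2 * norm (coord_deriv x z t y (coord_change M y x v))" by (rule 2(4)[OF yc(3)])
      also have "\<dots> \<le> B2 * (B3 * norm (coord_change M y x v))"
        using 2(2) by (intro mult_left_mono 3(4)[OF t3 y(2)]) auto
      also have "\<dots> \<le> B2 * (B3 * (B1 * coord_norm x y (coord_change M y x v)))"
        using 2(2) 3(2) by (intro mult_left_mono 1(4)[OF y(1)]) auto
      also have "\<dots> = B1 * B3 * B2 * gnorm M y v" by (simp add: coord_norm_change[OF yc(1)] ac_simps)
      also have "\<dots> \<le> E * gnorm M y v" using E(3) g0 by (rule mult_right_mono)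
      finally show "gnorm M (\<phi> t y) (mdiff M (\<phi> t) y v) \<le> E * gnorm M y v" .
    qed
    then have "\<forall>p\<in>(ball s r \<times> ball x (r / 2)) \<inter> ({-T..T} \<times> \<Lambda>). P E p" by (auto simp: dist_real_def)
    moreover have "open (ball s r \<times> ball x (r / 2))" by (intro open_Times) auto
    moreover have "q \<in> ball s r \<times> ball x (r / 2)" using r(1) q by auto
    ultimately show "\<exists>U D. open U \<and> q \<in> U \<and> (\<forall>y\<in>U \<inter> ({-T..T} \<times> \<Lambda>). P D y)" by blast
  qed (use that in auto)
  show ?thesis
  proof (rule that[OF \<open>D > 0\<close>])
    fix t x0 y v assume "\<bar>t\<bar> \<le> T" "x0 \<in> \<Lambda>" and y: "dist x0 y < 1 / D"
    then have "P D (t, x0)" by (intro D) auto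
    then show "gnorm M (\<phi> t y) (mdiff M (\<phi> t) y v) \<le> D * gnorm M y v" using y by (simp add: P_def)
  qed
qed

end

section \<open>Embedded pieces of submanifolds\<close>

context riemannian_flow
begin

text \<open>
  Covers the parametrizations of the leaves as well as their exponential maps, whose parameters range
  over balls of different subspaces.
\<close>

definition embedded_piece :: "'a::euclidean_space set \<Rightarrow> 'a set \<Rightarrow> ('a \<Rightarrow> 'm) \<Rightarrow> bool" where
  "embedded_piece V A \<theta> \<longleftrightarrow> solid_in V A \<and> compact A \<and> C2_into M A \<theta> \<and> inj_on \<theta> A \<and>
     (\<forall>v\<in>A. inj_on (diff_into M A \<theta> v) V)"

lemma C2_into_continuous_on: "C2_into M A \<theta> \<Longrightarrow> continuous_on A \<theta>"
  unfolding C2_into_def by blast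

lemma chart_dom_eventually:
  assumes c: "continuous_on A \<theta>" and v: "v \<in> A" "\<theta> v \<in> cdom M z"
  shows "\<forall>\<^sub>F w in at v within A. \<theta> w \<in> cdom M z"
proof -
  have "(\<theta> \<longlongrightarrow> \<theta> v) (at v within A)" using c v(1) by (simp add: continuous_on_def)
  then show ?thesis using topological_tendstoD open_cdom v(2) by blast
qed

lemma C2_into_derivs2:
  assumes \<theta>: "C2_into M A \<theta>"
  obtains f' f'' where "derivs2_on (chart M z \<circ> \<theta>) {v\<in>A. \<theta> v \<in> cdom M z} f' f''"
    "\<forall>v\<in>A. \<theta> v \<in> cdom M z \<longrightarrow> ((chart M z \<circ> \<theta>) has_derivative blinfun_apply (f' v)) (at v within A)"
proof -
  obtain f' f'' where d: "derivs2_on (chart M z \<circ> \<theta>) {v\<in>A. \<theta> v \<in> cdom M z} f' f''"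
    using \<theta> unfolding C2_into_def C2_on_def by blast
  have "((chart M z \<circ> \<theta>) has_derivative blinfun_apply (f' v)) (at v within A)" if v: "v \<in> A" "\<theta> v \<in> cdom M z" for v
  proof -
    obtain U where U: "open U" "v \<in> U" "\<And>w. w \<in> U \<Longrightarrow> w \<noteq> v \<Longrightarrow> w \<in> A \<Longrightarrow> \<theta> w \<in> cdom M z"
      using chart_dom_eventually[OF C2_into_continuous_on[OF \<theta>] v] unfolding eventually_at_topological by auto
    have "at v within {v\<in>A. \<theta> v \<in> cdom M z} = at v within A"
      by (rule at_within_nhd[OF U(2,1)]) (use U(3) in auto)
    moreover have "((chart M z \<circ> \<theta>) has_derivative blinfun_apply (f' v)) (at v within {v\<in>A. \<theta> v \<in> cdom M z})"
      using d v unfolding derivs2_on_def by blast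
    ultimately show ?thesis by simp
  qed
  then show ?thesis using that d by blast
qed

lemma diff_into_derivative:
  assumes \<theta>: "C2_into M A \<theta>" and v: "v \<in> A"
  shows "((chart M (\<theta> v) \<circ> \<theta>) has_derivative diff_into M A \<theta> v) (at v within A)"
proof -
  obtain f' f'' where "\<forall>w\<in>A. \<theta> w \<in> cdom M (\<theta> v) \<longrightarrow>
      ((chart M (\<theta> v) \<circ> \<theta>) has_derivative blinfun_apply (f' w)) (at w within A)"
    using C2_into_derivs2[OF \<theta>, of "\<theta> v"] by blast
  then have "((chart M (\<theta> v) \<circ> \<theta>) has_derivative blinfun_apply (f' v)) (at v within A)"
    using v cdom_self by blast
  then show ?thesis unfolding diff_into_def by (metis differentiableI frechet_derivative_works)
qed

lemma linear_diff_into: "C2_into M A \<theta> \<Longrightarrow> v \<in> A \<Longrightarrow> linear (diff_into M A \<theta> v)"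
  using diff_into_derivative has_derivative_linear by blast

text \<open>The derivative in arbitrary charts of a piece transported by the flow; the case of time \<open>0\<close> is
  the derivative of the piece itself.\<close>

lemma flow_piece_derivative:
  assumes \<theta>: "C2_into M A \<theta>" and v: "v \<in> A" and z: "\<phi> t (\<theta> v) \<in> cdom M z"
  shows "((\<lambda>w. chart M z (\<phi> t (\<theta> w))) has_derivative
     (\<lambda>a. coord_change M (\<phi> t (\<theta> v)) z (mdiff M (\<phi> t) (\<theta> v) (diff_into M A \<theta> v a)))) (at v within A)"
proof -
  have "((\<lambda>w. (chart M z \<circ> \<phi> t \<circ> ichart M (\<theta> v)) ((chart M (\<theta> v) \<circ> \<theta>) w)) has_derivative
     (\<lambda>a. coord_deriv (\<theta> v) z t (\<theta> v) (diff_into M A \<theta> v a))) (at v within A)"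
    by (rule has_derivative_compose[OF diff_into_derivative[OF \<theta> v]]) (use coord_deriv[OF cdom_self z] in \<open>simp add: o_def\<close>)
  moreover have "\<forall>\<^sub>F w in at v within A. (chart M z \<circ> \<phi> t \<circ> ichart M (\<theta> v)) ((chart M (\<theta> v) \<circ> \<theta>) w) = chart M z (\<phi> t (\<theta> w))"
    by (rule eventually_mono[OF chart_dom_eventually[OF C2_into_continuous_on[OF \<theta>] v cdom_self]]) simp
  moreover have "coord_deriv (\<theta> v) z t (\<theta> v) a = coord_change M (\<phi> t (\<theta> v)) z (mdiff M (\<phi> t) (\<theta> v) a)" for a
    using coord_deriv_mdiff[of "\<theta> v" "\<theta> v" t z a] z
    by (simp add: coord_change_coord_deriv coord_deriv_id)
  ultimately show ?thesis
    by (simp add: has_derivative_transform_eventually[OF _ _ _ v])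
qed

lemma piece_derivative:
  assumes "C2_into M A \<theta>" "v \<in> A" "\<theta> v \<in> cdom M z"
  shows "((\<lambda>w. chart M z (\<theta> w)) has_derivative (\<lambda>a. coord_change M (\<theta> v) z (diff_into M A \<theta> v a))) (at v within A)"
  using flow_piece_derivative[OF assms(1,2), of 0 z] assms(3) by simp

lemma embedded_piece_homeomorphism:
  assumes "embedded_piece V A \<theta>"
  shows "homeomorphism A (\<theta> ` A) \<theta> (inv_into A \<theta>)"
proof -
  have "inj_on \<theta> A" "continuous_on A \<theta>" "compact A"
    using assms unfolding embedded_piece_def by (auto intro: C2_into_continuous_on)
  then show ?thesis by (auto simp: homeomorphism_def intro: continuous_on_inv inv_into_into f_inv_into_f)
qed

lemma continuous_on_lift:
  assumes \<theta>: "embedded_piece V A \<theta>" and g: "continuous_on T g" "g ` T \<subseteq> \<theta> ` A"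
  shows "continuous_on T (\<lambda>s. inv_into A \<theta> (g s))"
proof -
  have "continuous_on (\<theta> ` A) (inv_into A \<theta>)"
    using embedded_piece_homeomorphism[OF \<theta>] unfolding homeomorphism_def by blast
  from continuous_on_compose2[OF this g] show ?thesis .
qed

text \<open>A map into an embedded piece is differentiable in the coordinates of the piece if it is
  differentiable in a chart of the manifold, since the derivative of the piece is injective.\<close>

lemma lift_derivative:
  assumes \<theta>: "embedded_piece V A \<theta>" and T: "solid_in U T" "s \<in> T"
    and g: "continuous_on T g" "g ` T \<subseteq> \<theta> ` A"
    and k: "((\<lambda>t. chart M z (g t)) has_derivative k') (at s within T)" and z: "g s \<in> cdom M z"
  obtains w' where "((\<lambda>t. inv_into A \<theta> (g t)) has_derivative w') (at s within T)"
    "\<And>h. w' h \<in> V"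
    "\<And>h. h \<in> U \<Longrightarrow> coord_change M (g s) z (diff_into M A \<theta> (inv_into A \<theta> (g s)) (w' h)) = k' h"
proof -
  define w where "w = (\<lambda>t. inv_into A \<theta> (g t))"
  have w: "w t \<in> A" "\<theta> (w t) = g t" if "t \<in> T" for t
    using g(2) that unfolding w_def by (meson f_inv_into_f image_subset_iff inv_into_into)+
  have V: "solid_in V A" "C2_into M A \<theta>" "inj_on (diff_into M A \<theta> (w s)) V"
    using \<theta> w(1)[OF T(2)] unfolding embedded_piece_def by auto
  have sub: "subspace V" "A \<subseteq> V" using V(1) by (auto simp: solid_in_def)
  define G' where "G' = (\<lambda>a. coord_change M (g s) z (diff_into M A \<theta> (w s) a))"
  have G: "((\<lambda>v. chart M z (\<theta> v)) has_derivative G') (at (w s) within A)"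
    using piece_derivative[OF V(2) w(1)[OF T(2)], of z] z w(2)[OF T(2)] by (simp add: G'_def)
  have inj: "inj_on G' V" unfolding G'_def
    using V(3) inj_coord_change[OF z] by (auto simp: inj_on_def)
  have d: "w t - w s \<in> V" if "t \<in> T" for t
    using w(1)[OF that] w(1)[OF T(2)] sub by (auto intro: subspace_diff)
  have "((\<lambda>t. chart M z (\<theta> (w t))) has_derivative k') (at s within T)"
    by (rule has_derivative_transform[OF T(2) _ k]) (simp add: w(2))
  moreover have "continuous (at s within T) w"
    using continuous_on_lift[OF \<theta> g] T(2) unfolding w_def by (simp add: continuous_on_eq_continuous_within)
  ultimately obtain w' where w': "(w has_derivative w') (at s within T)" "\<And>h. w' h \<in> V"
    using has_derivative_lift[where w = w and V = V and S = A and G' = G', OF G sub(1) d inj w(1)] by blast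
  have "w ` T \<subseteq> A" using w(1) by auto
  from has_derivative_in_compose[OF w'(1) has_derivative_subset[OF G this]]
  have c: "((\<lambda>t. chart M z (\<theta> (w t))) has_derivative (\<lambda>h. G' (w' h))) (at s within T)" .
  have "G' (w' h) = k' h" if "h \<in> U" for h
    by (rule derivative_unique_on_solid[OF T that c])
      (rule has_derivative_transform[OF T(2) _ k], simp add: w(2))
  then show ?thesis using that[of w'] w' unfolding w_def G'_def by simp
qed

text \<open>
  The change of parameters is an injective continuous map between spaces of the same dimension, so that
  invariance of domain applies.
\<close>

lemma embedded_piece_open_map:
  assumes \<theta>: "embedded_piece V A \<theta>" and \<theta>': "embedded_piece V' A' \<theta>'"
    and sub: "\<theta>' ` A' \<subseteq> \<theta> ` A" and dim: "dim V = dim V'"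
    and N: "openin (top_of_set V') N" "N \<subseteq> A'"
  shows "openin (top_of_set (\<theta> ` A)) (\<theta>' ` N)"
proof -
  define g where "g = (\<lambda>v. inv_into A \<theta> (\<theta>' v))"
  have sub: "\<theta>' ` N \<subseteq> \<theta> ` A" using sub N(2) by blast
  have gA: "g ` N \<subseteq> A" unfolding g_def using sub by (meson image_subset_iff inv_into_into)
  have \<theta>g: "\<theta> (g v) = \<theta>' v" if "v \<in> N" for v
    unfolding g_def using sub that by (meson f_inv_into_f image_subset_iff)
  have V: "subspace V" "subspace V'" "A \<subseteq> V" "inj_on \<theta>' N" "continuous_on N \<theta>'"
    using \<theta> \<theta>' N(2) unfolding embedded_piece_def solid_in_def
    by (auto intro: inj_on_subset continuous_on_subset C2_into_continuous_on)
  have "inj_on g N" using V(4) \<theta>g by (metis inj_on_def)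
  then have "openin (top_of_set V) (g ` N)"
    using gA V dim continuous_on_lift[OF \<theta> V(5) sub] unfolding g_def[symmetric]
    by (intro invariance_of_domain_subspaces[OF N(1)]) auto
  then have "openin (top_of_set A) (g ` N)" using gA V(3) by (rule openin_subset_trans)
  then have "openin (top_of_set (\<theta> ` A)) (\<theta> ` (g ` N))"
    using homeomorphism_imp_open_map[OF embedded_piece_homeomorphism[OF \<theta>]] by blast
  moreover have "\<theta> ` (g ` N) = \<theta>' ` N" using \<theta>g by force
  ultimately show ?thesis by simp
qed

section \<open>Tangent spaces of discs\<close>

lemma solid_in_disc: "subspace V \<Longrightarrow> solid_in V (disc V)"
proof -
  assume V: "subspace V"
  have eq: "disc V = V \<inter> cball 0 1" by (auto simp: disc_def)
  have "\<exists>e>0. e *\<^sub>R v \<in> disc V" if "v \<in> V" for v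
  proof (intro exI conjI)
    show "1 / (norm v + 1) > 0" using norm_ge_zero[of v] by (simp add: add_nonneg_pos)
    show "(1 / (norm v + 1)) *\<^sub>R v \<in> disc V"
    proof -
      have n: "norm v + 1 > 0" using norm_ge_zero[of v] by linarith
      then show ?thesis using that V by (simp add: disc_def subspace_scale)
    qed
  qed
  then show ?thesis unfolding solid_in_def eq
    using V by (auto intro: convex_Int subspace_imp_convex)
qed

lemma disc_param_piece:
  fixes V :: "'e set"
  assumes "disc_param M V \<theta> W"
  shows "embedded_piece V (disc V) \<theta>" "W = \<theta> ` disc V" "subspace V"
proof -
  have "disc V = cball 0 1 \<inter> V" by (auto simp: disc_def)
  moreover have V: "subspace V" using assms unfolding disc_param_def by blast
  ultimately have "compact (disc V)" by (simp add: compact_Int_closed closed_subspace)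
  then show "embedded_piece V (disc V) \<theta>" "W = \<theta> ` disc V" "subspace V"
    using assms solid_in_disc[OF V] unfolding disc_param_def embedded_piece_def by auto
qed

text \<open>Everything that moves differentiably inside a disc moves tangentially to it.\<close>

lemma tangent_at_lift:
  fixes \<theta> :: "'e \<Rightarrow> 'm"
  assumes W: "disc_param M V \<theta> W" and T: "solid_in U T" "s \<in> T"
    and g: "continuous_on T g" "g ` T \<subseteq> W"
    and k: "((\<lambda>t. chart M (g s) (g t)) has_derivative k') (at s within T)" and h: "h \<in> U"
  shows "k' h \<in> diff_into M (disc V) \<theta> (inv_into (disc V) \<theta> (g s)) ` V"
proof -
  note p = disc_param_piece[OF W]
  obtain w' where "\<And>h. w' h \<in> V"
    "\<And>h. h \<in> U \<Longrightarrow> coord_change M (g s) (g s) (diff_into M (disc V) \<theta> (inv_into (disc V) \<theta> (g s)) (w' h)) = k' h"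
    using lift_derivative[OF p(1) T g(1) g(2)[unfolded p(2)] k cdom_self] by metis
  then show ?thesis using h coord_deriv_id[OF cdom_self, of "g s"]
    unfolding coord_change_coord_deriv by (metis imageI)
qed

text \<open>Another parametrization of the disc moves inside the disc, hence tangentially to the given one.\<close>

lemma tangent_at_param:
  fixes \<theta> :: "'e \<Rightarrow> 'm"
  assumes W: "disc_param M V \<theta> W" and v: "v \<in> disc V"
  shows "tangent_at M W (\<theta> v) = diff_into M (disc V) \<theta> v ` V"
proof
  show "diff_into M (disc V) \<theta> v ` V \<subseteq> tangent_at M W (\<theta> v)"
    unfolding tangent_at_def using W v by blast
  show "tangent_at M W (\<theta> v) \<subseteq> diff_into M (disc V) \<theta> v ` V"
  proof
    fix a assume "a \<in> tangent_at M W (\<theta> v)"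
    then obtain V' \<theta>' v' h where *: "a = diff_into M (disc V') \<theta>' v' h" "disc_param M V' \<theta>' W" "v' \<in> disc V'"
      "\<theta>' v' = \<theta> v" "h \<in> V'" unfolding tangent_at_def by blast
    have p: "embedded_piece V' (disc V') \<theta>'" "W = \<theta>' ` disc V'" by (rule disc_param_piece[OF *(2)])+
    have c: "C2_into M (disc V') \<theta>'" "solid_in V' (disc V')" using p(1) unfolding embedded_piece_def by auto
    have i: "inv_into (disc V) \<theta> (\<theta> v) = v" using W v unfolding disc_param_def by (simp add: inv_into_f_f)
    have "diff_into M (disc V') \<theta>' v' h \<in> diff_into M (disc V) \<theta> (inv_into (disc V) \<theta> (\<theta>' v')) ` V"
      by (rule tangent_at_lift[OF W c(2) *(3) C2_into_continuous_on[OF c(1)] _ _ *(5)])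
        (use p(2) diff_into_derivative[OF c(1) *(3)] in \<open>auto simp: o_def\<close>)
    then show "a \<in> diff_into M (disc V) \<theta> v ` V" by (simp add: * i)
  qed
qed

lemma tangent_at_subspace:
  fixes \<theta> :: "'e \<Rightarrow> 'm"
  assumes W: "disc_param M V \<theta> W" and x: "x \<in> W"
  shows "subspace (tangent_at M W x)" "dim (tangent_at M W x) = dim V"
proof -
  note p = disc_param_piece[OF W]
  obtain v where v: "v \<in> disc V" "x = \<theta> v" using x p(2) by auto
  have c: "C2_into M (disc V) \<theta>" "inj_on (diff_into M (disc V) \<theta> v) V"
    using p(1) v unfolding embedded_piece_def by auto
  have l: "linear (diff_into M (disc V) \<theta> v)" by (rule linear_diff_into[OF c(1) v(1)])
  have t: "tangent_at M W x = diff_into M (disc V) \<theta> v ` V" unfolding v(2) by (rule tangent_at_param[OF W v(1)])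
  show "subspace (tangent_at M W x)" unfolding t by (rule linear_subspace_image[OF l p(3)])
  have "span V = V" using p(3) by (simp only: span_eq_iff)
  with c(2) have "inj_on (diff_into M (disc V) \<theta> v) (span V)" by metis
  then show "dim (tangent_at M W x) = dim V" unfolding t by (rule dim_image_eq[OF l])
qed

lemma tangent_at_memI:
  fixes g :: "'a::euclidean_space \<Rightarrow> 'm"
  assumes W: "disc_param M (V::'e set) \<theta> W" and T: "solid_in U T" "s \<in> T"
    and g: "continuous_on T g" "g ` T \<subseteq> W"
    and k: "((\<lambda>t. chart M (g s) (g t)) has_derivative k') (at s within T)" and h: "h \<in> U"
  shows "k' h \<in> tangent_at M W (g s)"
proof -
  have "g s \<in> \<theta> ` disc V" using g(2) T(2) disc_param_piece(2)[OF W] by auto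
  then have i: "inv_into (disc V) \<theta> (g s) \<in> disc V" "\<theta> (inv_into (disc V) \<theta> (g s)) = g s"
    by (auto intro: inv_into_into f_inv_into_f)
  show ?thesis using tangent_at_lift[OF assms] tangent_at_param[OF W i(1)] i(2) by simp
qed

end

section \<open>Leaves and their tangent spaces\<close>

locale leaf_system =
  fixes K :: "('m::metric_space, 'e::euclidean_space) leaf_data"
    and \<Lambda> :: "'m set"
    and E0 Eu Es E1 E2 :: "'m \<Rightarrow> 'e set"
    and W2 :: "'m \<Rightarrow> 'm set"
    and C \<alpha> \<beta> \<alpha>2 \<beta>2 \<delta>1 \<delta>2 \<gamma> :: real
  assumes manifold: "riemannian_manifold K" "complete (UNIV :: 'm set)"
    and flow: "C2_flow K (flow K)"
    and basic: "basic_set K (flow K) \<Lambda> E0 Eu Es"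
    and lupc: "LUPC K (flow K) \<Lambda> Eu E1 E2 C \<alpha> \<beta> \<alpha>2 \<beta>2"
    and cond_I: "condition_I K (flow K) \<Lambda> E1 E2 \<delta>1 (leaf K) \<delta>2 W2"
    and eps0: "0 < eps0 K" "eps0 K \<le> \<delta>1"
    and exponentials: "leaf_exponentials K \<Lambda> C"
    and C: "C \<ge> 1"
    and t0: "time K > 0" "\<gamma> = 8 * C ^ 3 * exp (- \<alpha> * time K / 2)" "\<gamma> < 1"
    and eps1: "0 < eps1 K" "eps1 K \<le> eps0 K"
    and fhat_defined: "\<And>x0 x. x0 \<in> \<Lambda> \<Longrightarrow> x \<in> sleaf K (eps1 K) x0 \<Longrightarrow>
          flow K (time K) x \<in> sleaf K (eps0 K) (flow K (time K) x0) \<and>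
          (\<forall>u\<in>tball K x0 x (eps1 K). phihat_defined K x0 x (time K) u)"
begin

sublocale riemannian_flow K "flow K"
  by unfold_locales (fact manifold(1) flow)+

lemma compact_Lambda: "compact \<Lambda>"
  using basic by (simp add: basic_set_def)

lemma flow_Lambda: "x0 \<in> \<Lambda> \<Longrightarrow> flow K t x0 \<in> \<Lambda>"
proof -
  have "\<forall>t. flow K t ` \<Lambda> = \<Lambda>" using basic by (simp add: basic_set_def)
  then show "x0 \<in> \<Lambda> \<Longrightarrow> flow K t x0 \<in> \<Lambda>" by blast
qed

lemma unstable_leaves: "unstable_subfamily K (flow K) \<Lambda> E1 \<delta>1 (leaf K)"
  using cond_I by (simp add: condition_I_def)

lemma leaf_param:
  assumes "x0 \<in> \<Lambda>"
  obtains V \<theta> where "disc_param K (V::'e set) \<theta> (leaf K x0)" "\<theta> 0 = x0"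
  using unstable_leaves assms unfolding unstable_subfamily_def continuous_disc_family_def
  by (metis IntI)

lemma leaf_center: "x0 \<in> \<Lambda> \<Longrightarrow> x0 \<in> leaf K x0"
proof -
  assume "x0 \<in> \<Lambda>"
  then obtain V \<theta> where W: "disc_param K (V::'e set) \<theta> (leaf K x0)" "\<theta> 0 = x0" by (rule leaf_param)
  then have "0 \<in> disc V" by (simp add: disc_def disc_param_def subspace_0)
  then show ?thesis using disc_param_piece(2)[OF W(1)] W(2) by blast
qed

lemma leaf_backward:
  "x0 \<in> \<Lambda> \<Longrightarrow> t \<ge> 0 \<Longrightarrow> y \<in> leaf K x0 \<Longrightarrow> flow K (- t) y \<in> leaf K (flow K (- t) x0)"
  using unstable_leaves unfolding unstable_subfamily_def by blast

lemma sleaf_leaf: "x \<in> sleaf K r x0 \<Longrightarrow> x \<in> leaf K x0"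
  by (simp add: sleaf_def small_leaf_def)

lemma sleaf_dist: "x \<in> sleaf K r x0 \<Longrightarrow> dist x0 x \<le> r"
  unfolding sleaf_def small_leaf_def local_unstable_def by (auto dest: spec[of _ 0])

lemma sleaf_mono: "x \<in> sleaf K r x0 \<Longrightarrow> r \<le> r' \<Longrightarrow> x \<in> sleaf K r' x0"
  unfolding sleaf_def small_leaf_def local_unstable_def by (auto intro: order_trans)

lemma sleaf_backward:
  assumes "x0 \<in> \<Lambda>" "t \<ge> 0" "x \<in> sleaf K r x0"
  shows "flow K (- t) x \<in> sleaf K r (flow K (- t) x0)"
proof -
  have d: "\<And>s. s \<le> 0 \<Longrightarrow> dist (flow K s x0) (flow K s x) \<le> r"
    and l: "((\<lambda>s. dist (flow K s x0) (flow K s x)) \<longlongrightarrow> 0) at_bot"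
    using assms(3) unfolding sleaf_def small_leaf_def local_unstable_def by auto
  have "filterlim (\<lambda>s. s + (- t)) at_bot (at_bot :: real filter)"
    unfolding filterlim_at_bot eventually_at_bot_linorder
  proof
    fix Z show "\<exists>N. \<forall>s\<le>N. s + - t \<le> Z" using assms(2) by (intro exI[of _ Z]) auto
  qed
  from filterlim_compose[OF l this]
  have "((\<lambda>s. dist (flow K s (flow K (- t) x0)) (flow K s (flow K (- t) x))) \<longlongrightarrow> 0) at_bot"
    by (simp add: flow_add[symmetric])
  moreover have "dist (flow K s (flow K (- t) x0)) (flow K s (flow K (- t) x)) \<le> r" if "s \<le> 0" for s
    using d[of "s + (- t)"] that assms(2) by (simp add: flow_add[symmetric])
  ultimately show ?thesis
    using leaf_backward[OF assms(1,2) sleaf_leaf[OF assms(3)]]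
    by (simp add: sleaf_def small_leaf_def local_unstable_def)
qed

lemma subspace_tleaf: "x0 \<in> \<Lambda> \<Longrightarrow> x \<in> leaf K x0 \<Longrightarrow> subspace (tleaf K x0 x)"
  unfolding tleaf_def using leaf_param tangent_at_subspace(1) by metis

text \<open>The dimension is constant along the leaf, and at its centre the tangent space is the invariant bundle.\<close>

lemma dim_tleaf: "x0 \<in> \<Lambda> \<Longrightarrow> x \<in> leaf K x0 \<Longrightarrow> dim (tleaf K x0 x) = dim (E1 x0)"
proof -
  assume x: "x0 \<in> \<Lambda>" "x \<in> leaf K x0"
  obtain V \<theta> where W: "disc_param K (V::'e set) \<theta> (leaf K x0)" using leaf_param[OF x(1)] by blast
  have "E1 x0 = tangent_at K (leaf K x0) x0"
    using unstable_leaves x(1) unfolding unstable_subfamily_def by blast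
  then show ?thesis unfolding tleaf_def
    using tangent_at_subspace(2)[OF W x(2)] tangent_at_subspace(2)[OF W leaf_center[OF x(1)]] by simp
qed

lemma tleaf_center: "x0 \<in> \<Lambda> \<Longrightarrow> tleaf K x0 x0 = E1 x0"
  using unstable_leaves unfolding unstable_subfamily_def tleaf_def by blast

lemma dim_E1_flow: 
  assumes "x0 \<in> \<Lambda>"
  shows "dim (E1 (flow K t x0)) = dim (E1 x0)"
proof -
  have "mdiff K (flow K t) x0 ` E1 x0 = E1 (flow K t x0)"
  proof -
    have "invariant_bundle K (flow K) \<Lambda> E1" using lupc by (simp add: LUPC_def)
    then show ?thesis using assms unfolding invariant_bundle_def by blast
  qed
  then show ?thesis
    using dim_image_eq[OF linear_mdiff[of t x0], of "E1 x0"] inj_mdiff[of t x0] by (metis inj_on_subset subset_UNIV)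
qed

lemma dim_tleaf_backward:
  assumes "x0 \<in> \<Lambda>" "t \<ge> 0" "x \<in> leaf K x0"
  shows "dim (tleaf K (flow K (- t) x0) (flow K (- t) x)) = dim (tleaf K x0 x)"
  using dim_tleaf[OF flow_Lambda[OF assms(1)] leaf_backward[OF assms]] dim_tleaf[OF assms(1,3)]
    dim_E1_flow[OF assms(1)] by simp

text \<open>The inclusion holds because the flow maps leaves into leaves backwards in time, and equality
  because all tangent spaces of leaves along an orbit have the dimension of the invariant bundle.\<close>

lemma mdiff_tleaf:
  assumes x: "x0 \<in> \<Lambda>" "t \<ge> 0" "x \<in> leaf K x0"
  shows "mdiff K (flow K (- t)) x ` tleaf K x0 x = tleaf K (flow K (- t) x0) (flow K (- t) x)"
proof -
  obtain V \<theta> where W: "disc_param K (V::'e set) \<theta> (leaf K x0)" using leaf_param[OF x(1)] by blast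
  obtain V' \<theta>' where W': "disc_param K (V'::'e set) \<theta>' (leaf K (flow K (- t) x0))"
    using leaf_param[OF flow_Lambda[OF x(1)]] by blast
  note p = disc_param_piece[OF W]
  have c: "C2_into K (disc V) \<theta>" "solid_in V (disc V)" using p(1) by (auto simp: embedded_piece_def)
  obtain v where v: "v \<in> disc V" "x = \<theta> v" using x(3) p(2) by auto
  define D where "D = mdiff K (flow K (- t)) x"
  have sub: "D ` tleaf K x0 x \<subseteq> tleaf K (flow K (- t) x0) (flow K (- t) x)"
  proof
    fix b assume "b \<in> D ` tleaf K x0 x"
    then obtain h where h: "h \<in> V" "b = D (diff_into K (disc V) \<theta> v h)"
      unfolding tleaf_def v(2) tangent_at_param[OF W v(1)] by blast
    have "coord_change K (flow K (- t) (\<theta> v)) (flow K (- t) (\<theta> v)) (mdiff K (flow K (- t)) (\<theta> v) (diff_into K (disc V) \<theta> v h))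
        \<in> tangent_at K (leaf K (flow K (- t) x0)) (flow K (- t) (\<theta> v))"
      by (rule tangent_at_memI[OF W' c(2) v(1) _ _ flow_piece_derivative[OF c(1) v(1) cdom_self] h(1)])
        (use leaf_backward[OF x(1,2)] p(2) in \<open>auto intro: continuous_on_flow_at C2_into_continuous_on[OF c(1)]\<close>)
    then show "b \<in> tleaf K (flow K (- t) x0) (flow K (- t) x)"
      by (simp add: h(2) D_def v(2) tleaf_def coord_change_coord_deriv coord_deriv_id)
  qed
  have s: "subspace (tleaf K x0 x)" by (rule subspace_tleaf[OF x(1,3)])
  have "dim (D ` tleaf K x0 x) = dim (tleaf K x0 x)"
    unfolding D_def by (intro dim_image_eq linear_mdiff inj_on_subset[OF inj_mdiff]) simp
  then have "D ` tleaf K x0 x = tleaf K (flow K (- t) x0) (flow K (- t) x)"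
    using sub s dim_tleaf_backward[OF x] subspace_tleaf[OF flow_Lambda[OF x(1)] leaf_backward[OF x]]
    by (intro subspace_dim_equal) (auto simp: D_def intro: linear_subspace_image linear_mdiff)
  then show ?thesis by (simp add: D_def)
qed

section \<open>Exponential maps of the leaves\<close>

lemma tball_eq: "tball K x0 x r = {u\<in>tleaf K x0 x. form_norm (metric K x) u \<le> r}"
  by (simp add: tball_def gnorm_form_norm)

lemma tball_mono: "u \<in> tball K x0 x r \<Longrightarrow> r \<le> s \<Longrightarrow> u \<in> tball K x0 x s"
  by (simp add: tball_def)

lemma tball_tleaf: "u \<in> tball K x0 x r \<Longrightarrow> u \<in> tleaf K x0 x"
  by (simp add: tball_def)

lemma gnorm_ge0 [simp]: "gnorm K x v \<ge> 0"
  unfolding gnorm_form_norm by (rule form_norm_ge0[OF inner_form_metric])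

lemma gnorm_0 [simp]: "gnorm K x 0 = 0"
  unfolding gnorm_form_norm by (rule form_norm_0[OF inner_form_metric])

lemma gnorm_scale: "gnorm K x (a *\<^sub>R v) = \<bar>a\<bar> * gnorm K x v"
  unfolding gnorm_form_norm by (rule form_norm_scale[OF inner_form_metric])

lemma gnorm_eq_0: "gnorm K x v = 0 \<longleftrightarrow> v = 0"
  unfolding gnorm_form_norm by (rule form_norm_eq_0[OF inner_form_metric])

lemma solid_in_tball:
  "x0 \<in> \<Lambda> \<Longrightarrow> x \<in> leaf K x0 \<Longrightarrow> r > 0 \<Longrightarrow> solid_in (tleaf K x0 x) (tball K x0 x r)"
  unfolding tball_eq by (intro solid_in_form_ball inner_form_metric subspace_tleaf)

lemma compact_tball: "x0 \<in> \<Lambda> \<Longrightarrow> x \<in> leaf K x0 \<Longrightarrow> compact (tball K x0 x r)"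
  unfolding tball_eq by (intro compact_form_ball inner_form_metric subspace_tleaf)

lemma zero_in_tball: "x0 \<in> \<Lambda> \<Longrightarrow> x \<in> leaf K x0 \<Longrightarrow> r \<ge> 0 \<Longrightarrow> 0 \<in> tball K x0 x r"
  by (simp add: tball_def subspace_0 subspace_tleaf)

lemma scale_in_tball:
  "x0 \<in> \<Lambda> \<Longrightarrow> x \<in> leaf K x0 \<Longrightarrow> u \<in> tball K x0 x r \<Longrightarrow> 0 \<le> s \<Longrightarrow> s \<le> 1 \<Longrightarrow> s *\<^sub>R u \<in> tball K x0 x r"
  using mult_left_le_one_le[of "gnorm K x u" s]
  by (auto simp: tball_def subspace_scale subspace_tleaf gnorm_scale)

lemma openin_gnorm_ball:
  fixes V :: "'e set"
  shows "openin (top_of_set V) {u\<in>V. gnorm K x u < r}"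
proof -
  have "open {u. form_norm (metric K x) u < r}"
    by (intro open_Collect_less continuous_on_form_norm inner_form_metric continuous_intros)
  moreover have "{u\<in>V. gnorm K x u < r} = V \<inter> {u. form_norm (metric K x) u < r}"
    by (auto simp: gnorm_form_norm)
  ultimately show ?thesis by (simp add: openin_open_Int)
qed

context
  fixes x0 x assumes x0: "x0 \<in> \<Lambda>" and x: "x \<in> sleaf K (eps0 K) x0"
begin

lemma exp_center: "lexp K x0 x 0 = x"
  and exp_C2: "C2_into K (tball K x0 x (eps0 K)) (lexp K x0 x)"
  and exp_inj: "inj_on (lexp K x0 x) (tball K x0 x (eps0 K))"
  and exp_geodesic: "u \<in> tball K x0 x (eps0 K) \<Longrightarrow> geodesic_in K (leaf K x0) (\<lambda>t. lexp K x0 x (t *\<^sub>R u))"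
  and exp_velocity: "u \<in> tball K x0 x (eps0 K) \<Longrightarrow>
     ((\<lambda>t. chart K x (lexp K x0 x (t *\<^sub>R u))) has_vector_derivative u) (at 0 within {0..1})"
  and exp_upper: "u \<in> tball K x0 x (eps0 K) \<Longrightarrow> v \<in> tleaf K x0 x \<Longrightarrow>
     gnorm K (lexp K x0 x u) (diff_into K (tball K x0 x (eps0 K)) (lexp K x0 x) u v) \<le> C * gnorm K x v"
  and exp_lower: "u \<in> tball K x0 x (eps0 K) \<Longrightarrow> v \<in> tleaf K x0 x \<Longrightarrow>
     gnorm K x v \<le> C * gnorm K (lexp K x0 x u) (diff_into K (tball K x0 x (eps0 K)) (lexp K x0 x) u v)"
  using exponentials x0 x unfolding leaf_exponentials_def Let_def by blast+

lemma x_leaf: "x \<in> leaf K x0" using x by (rule sleaf_leaf)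

lemma exp_solid: "solid_in (tleaf K x0 x) (tball K x0 x (eps0 K))"
  by (rule solid_in_tball[OF x0 x_leaf eps0(1)])

text \<open>Geodesics of a leaf stay in the leaf by definition.\<close>

lemma exp_in_leaf: 
  assumes "u \<in> tball K x0 x (eps0 K)"
  shows "lexp K x0 x u \<in> leaf K x0"
proof -
  obtain V \<theta> c where *: "disc_param K V \<theta> (leaf K x0)" "\<forall>t\<in>{0..1::real}. c t \<in> disc V \<and> lexp K x0 x (t *\<^sub>R u) = \<theta> (c t)"
    using exp_geodesic[OF assms] unfolding geodesic_in_def Let_def by metis
  then have "c 1 \<in> disc V" "lexp K x0 x u = \<theta> (c 1)" by (auto dest: bspec[of _ _ "1::real"])
  then show ?thesis using disc_param_piece(2)[OF *(1)] by blast
qed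

lemma exp_piece: "embedded_piece (tleaf K x0 x) (tball K x0 x (eps0 K)) (lexp K x0 x)"
  unfolding embedded_piece_def
proof (intro conjI ballI exp_solid exp_C2 exp_inj compact_tball[OF x0 x_leaf])
  fix u assume u: "u \<in> tball K x0 x (eps0 K)"
  show "inj_on (diff_into K (tball K x0 x (eps0 K)) (lexp K x0 x) u) (tleaf K x0 x)"
    unfolding linear_injective_on_subspace_0[OF linear_diff_into[OF exp_C2 u] subspace_tleaf[OF x0 x_leaf]]
  proof (intro ballI impI)
    fix v assume "v \<in> tleaf K x0 x" "diff_into K (tball K x0 x (eps0 K)) (lexp K x0 x) u v = 0"
    then have "gnorm K x v \<le> 0" using exp_lower[OF u, of v] by simp
    then show "v = 0" using gnorm_ge0[of x v] gnorm_eq_0[of x v] by linarith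
  qed
qed

text \<open>The initial velocities of the geodesics give this on the ball, and linearity everywhere.\<close>

lemma exp_diff_zero:
  assumes v: "v \<in> tleaf K x0 x"
  shows "diff_into K (tball K x0 x (eps0 K)) (lexp K x0 x) 0 v = v"
proof -
  define D where "D = diff_into K (tball K x0 x (eps0 K)) (lexp K x0 x) 0"
  have z: "0 \<in> tball K x0 x (eps0 K)" by (rule solid_in_zero[OF exp_solid])
  have D: "((chart K x \<circ> lexp K x0 x) has_derivative D) (at 0 within tball K x0 x (eps0 K))"
    using diff_into_derivative[OF exp_C2 z] by (simp add: exp_center D_def)
  have ball: "D u = u" if u: "u \<in> tball K x0 x (eps0 K)" for u
  proof -
    have "((\<lambda>t. (chart K x \<circ> lexp K x0 x) (0 + t *\<^sub>R u)) has_vector_derivative D u) (at 0 within {0..1})"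
      by (rule derivative_along_segment[where S = "tball K x0 x (eps0 K)"]) (use D scale_in_tball[OF x0 x_leaf u] in \<open>auto simp: o_def\<close>)
    moreover have "((\<lambda>t. (chart K x \<circ> lexp K x0 x) (0 + t *\<^sub>R u)) has_vector_derivative u) (at 0 within {0..1})"
      using exp_velocity[OF u] by (simp add: o_def)
    ultimately show ?thesis
      by (rule vector_derivative_unique_within[rotated]) (simp add: trivial_limit_within islimpt_Icc)
  qed
  obtain e where e: "e > 0" "e *\<^sub>R v \<in> tball K x0 x (eps0 K)"
    using exp_solid v unfolding solid_in_def by blast
  have "e *\<^sub>R D v = e *\<^sub>R v"
    using ball[OF e(2)] linear_cmul[OF has_derivative_linear[OF D], of e v] by simp
  then show ?thesis using e(1) by (simp add: D_def)
qed

lemma exp_open: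
  assumes "r \<le> eps0 K"
  shows "openin (top_of_set (leaf K x0)) (lexp K x0 x ` {u\<in>tleaf K x0 x. gnorm K x u < r})"
proof -
  obtain V \<theta> where W: "disc_param K (V::'e set) \<theta> (leaf K x0)" using leaf_param[OF x0] by blast
  note p = disc_param_piece[OF W]
  have sub: "lexp K x0 x ` tball K x0 x (eps0 K) \<subseteq> \<theta> ` disc V" using exp_in_leaf p(2) by auto
  have dim: "dim V = dim (tleaf K x0 x)" unfolding tleaf_def using tangent_at_subspace(2)[OF W x_leaf] by simp
  have "openin (top_of_set (\<theta> ` disc V)) (lexp K x0 x ` {u\<in>tleaf K x0 x. gnorm K x u < r})"
    by (rule embedded_piece_open_map[OF p(1) exp_piece sub dim openin_gnorm_ball])
      (use assms in \<open>auto simp: tball_def\<close>)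
  then show ?thesis using p(2) by simp
qed

text \<open>The image of the segment from \<open>0\<close> to \<open>u\<close> is a path of length at most \<open>C\<close> times the norm of \<open>u\<close>.\<close>

lemma exp_dist:
  assumes u: "u \<in> tball K x0 x (eps0 K)"
  shows "dist x (lexp K x0 x u) \<le> C * gnorm K x u"
proof -
  define S where "S = tball K x0 x (eps0 K)"
  define e where "e = lexp K x0 x"
  define c where "c = (\<lambda>t::real. e (t *\<^sub>R u))"
  have C2: "C2_into K S e" unfolding S_def e_def by (rule exp_C2)
  have cont: "continuous_on S e" by (rule C2_into_continuous_on[OF C2])
  have inS: "t *\<^sub>R u \<in> S" if "t \<in> {0..1}" for t
    unfolding S_def using scale_in_tball[OF x0 x_leaf u] that by simp
  have u': "u \<in> tleaf K x0 x" using u by (rule tball_tleaf)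
  have path: "C1_path K c" unfolding C1_path_def
  proof (intro conjI allI)
    show "continuous_on {0..1} c" unfolding c_def
      by (intro continuous_on_compose2[OF cont] continuous_intros) (use inS in auto)
    fix z
    define T where "T = {t\<in>{0..1}. c t \<in> cdom K z}"
    define A where "A = {v\<in>S. e v \<in> cdom K z}"
    obtain f' f'' where d: "derivs2_on (chart K z \<circ> e) A f' f''"
      using C2 unfolding C2_into_def C2_on_def A_def by blast
    have TA: "(\<lambda>t. t *\<^sub>R u) ` T \<subseteq> A" using inS by (auto simp: T_def A_def c_def)
    have "((chart K z \<circ> c) has_derivative blinfun_apply (blinfun_scaleR_left (f' (t *\<^sub>R u) u))) (at t within T)"
      if t: "t \<in> T" for t
    proof -
      have 1: "((\<lambda>t. t *\<^sub>R u) has_derivative (\<lambda>h. h *\<^sub>R u)) (at t within T)"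
        by (auto intro!: derivative_eq_intros)
      have "((chart K z \<circ> e) has_derivative blinfun_apply (f' (t *\<^sub>R u))) (at (t *\<^sub>R u) within A)"
        using d TA t unfolding derivs2_on_def by blast
      from has_derivative_in_compose[OF 1 has_derivative_subset[OF this TA]]
      show ?thesis by (simp add: c_def o_def blinfun.scaleR_right)
    qed
    moreover have "continuous_on T (\<lambda>t. blinfun_scaleR_left (f' (t *\<^sub>R u) u))"
    proof -
      have "continuous_on A f'" using d unfolding derivs2_on_def
        by (auto simp: continuous_on_eq_continuous_within intro: has_derivative_continuous)
      from continuous_on_compose2[OF this _ TA] have "continuous_on T (\<lambda>t. f' (t *\<^sub>R u))"
        by (simp add: continuous_intros)
      then show ?thesis
        by (intro bounded_linear.continuous_on[OF bounded_linear_blinfun_scaleR_left]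
            bounded_linear.continuous_on[OF blinfun.bounded_linear_left])
    qed
    ultimately show "C1_on (chart K z \<circ> c) {t \<in> {0..1}. c t \<in> cdom K z}"
      unfolding C1_on_def T_def[symmetric]
      by (intro exI[of _ "\<lambda>t. blinfun_scaleR_left (f' (t *\<^sub>R u) u)"]) simp
  qed
  define w where "w = (\<lambda>t. gnorm K (c t) (vector_derivative (chart K (c t) \<circ> c) (at t within {0..1})))"
  have w: "w t \<le> C * gnorm K x u" if t: "t \<in> {0..1}" for t
  proof -
    have "((\<lambda>s. (chart K (c t) \<circ> e) (0 + s *\<^sub>R u)) has_vector_derivative diff_into K S e (t *\<^sub>R u) u) (at t within {0..1})"
      by (rule derivative_along_segment[where S = S and f' = "diff_into K S e (t *\<^sub>R u)"])
        (use diff_into_derivative[OF C2 inS[OF t]] inS in \<open>auto simp: c_def o_def\<close>)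
    then have "((chart K (c t) \<circ> c) has_vector_derivative diff_into K S e (t *\<^sub>R u) u) (at t within {0..1})"
      by (simp add: c_def o_def)
    then have "vector_derivative (chart K (c t) \<circ> c) (at t within {0..1}) = diff_into K S e (t *\<^sub>R u) u"
      using t by (intro vector_derivative_within_closed_interval) auto
    then show ?thesis using exp_upper[OF inS[OF t, unfolded S_def] u'] by (simp add: w_def c_def S_def e_def)
  qed
  have len: "path_len K c \<le> C * gnorm K x u"
  proof (cases "w integrable_on {0..1}")
    case True
    have "integral {0..1} w \<le> integral {0..1::real} (\<lambda>_. C * gnorm K x u)"
      by (rule integral_le[OF True]) (use w in auto)
    then show ?thesis by (simp add: path_len_def w_def)
  next
    case False
    then show ?thesis using C by (simp add: path_len_def w_def[symmetric] not_integrable_integral)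
  qed
  have nonneg: "path_len K c' \<ge> 0" for c'
  proof (cases "(\<lambda>t. gnorm K (c' t) (vector_derivative (chart K (c' t) \<circ> c') (at t within {0..1}))) integrable_on {0..1}")
    case True
    then show ?thesis unfolding path_len_def by (rule integral_nonneg) simp
  qed (simp add: path_len_def not_integrable_integral)
  have "dist x (e u) = Inf {path_len K c | c. C1_path K c \<and> c 0 = x \<and> c 1 = e u}"
    using manifold(1) unfolding riemannian_manifold_def by blast
  also have "\<dots> \<le> path_len K c"
    by (rule cInf_lower) (use path nonneg exp_center in \<open>auto simp: c_def e_def intro!: bdd_belowI[of _ 0]\<close>)
  finally show ?thesis using len by (simp add: e_def)
qed

end

definition exp_deriv :: "'m \<Rightarrow> 'm \<Rightarrow> 'm \<Rightarrow> 'e \<Rightarrow> 'e \<Rightarrow> 'e" where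
  "exp_deriv z x0 x u v = coord_change K (lexp K x0 x u) z (diff_into K (tball K x0 x (eps0 K)) (lexp K x0 x) u v)"

lemma inner_form_inner: "inner_form (\<lambda>x y. x \<bullet> (y::'a::euclidean_space))"
  unfolding inner_form_def using bounded_bilinear_inner
  by (auto simp: inner_commute bilinear_conv_bounded_bilinear)

text \<open>
  Quantifying over convex sets \<open>A\<close> is necessary: the part of the domain that is mapped into the ball need
  not be convex, and the Lipschitz estimate comes from integrating along segments.
\<close>

definition exp_chart_control :: "'m \<Rightarrow> real \<Rightarrow> real \<Rightarrow> bool" where
  "exp_chart_control z r B \<longleftrightarrow> ball z r \<subseteq> cdom K z \<and> (\<forall>x0\<in>\<Lambda>. \<forall>x\<in>sleaf K (eps0 K) x0.
     (\<forall>u\<in>tball K x0 x (eps0 K). \<forall>v\<in>tleaf K x0 x. lexp K x0 x u \<in> ball z r \<longrightarrow>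
        norm (exp_deriv z x0 x u v) \<le> B * gnorm K x v \<and> gnorm K x v \<le> B * norm (exp_deriv z x0 x u v)) \<and>
     (\<forall>A. convex A \<longrightarrow> A \<subseteq> tball K x0 x (eps0 K) \<longrightarrow> lexp K x0 x ` A \<subseteq> ball z r \<longrightarrow>
        (\<forall>u\<in>A. \<forall>u'\<in>A. \<forall>v\<in>tleaf K x0 x.
           norm (exp_deriv z x0 x u v - exp_deriv z x0 x u' v) \<le> B * gnorm K x (u - u') * gnorm K x v)))"

lemma exp_chart_controlD:
  assumes "exp_chart_control z r B" and x: "x0 \<in> \<Lambda>" "x \<in> sleaf K (eps0 K) x0" and v: "v \<in> tleaf K x0 x"
  shows "u \<in> tball K x0 x (eps0 K) \<Longrightarrow> lexp K x0 x u \<in> ball z r \<Longrightarrow>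
       norm (exp_deriv z x0 x u v) \<le> B * gnorm K x v \<and> gnorm K x v \<le> B * norm (exp_deriv z x0 x u v)"
    and "convex A \<Longrightarrow> A \<subseteq> tball K x0 x (eps0 K) \<Longrightarrow> lexp K x0 x ` A \<subseteq> ball z r \<Longrightarrow> u \<in> A \<Longrightarrow> u' \<in> A \<Longrightarrow>
       norm (exp_deriv z x0 x u v - exp_deriv z x0 x u' v) \<le> B * gnorm K x (u - u') * gnorm K x v"
  using assms unfolding exp_chart_control_def by blast+

text \<open>
  The bounds on the derivatives are those in the Riemannian norms, which in one chart are equivalent to
  the Euclidean norm; the Lipschitz estimate integrates the bound on the second derivatives.
\<close>

lemma exp_chart_control_exists:
  obtains r B where "r > 0" "B > 0" "exp_chart_control z r B"
proof -
  obtain r1 B1 where 1: "r1 > 0" "B1 > 0" "ball z r1 \<subseteq> cdom K z"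
    "\<And>y a. y \<in> ball z r1 \<Longrightarrow> norm a \<le> B1 * coord_norm z y a"
    "\<And>y a. y \<in> ball z r1 \<Longrightarrow> coord_norm z y a \<le> B1 * norm a"
    using coord_norm_equivalent[of z] by metis
  obtain r2 B2 where 2: "r2 > 0" "ball z r2 \<subseteq> cdom K z"
    and d2: "\<forall>x0\<in>\<Lambda>. \<forall>x\<in>sleaf K (eps0 K) x0.
           \<exists>f' f''. derivs2_on (chart K z \<circ> lexp K x0 x) {u\<in>tball K x0 x (eps0 K). lexp K x0 x u \<in> ball z r2} f' f'' \<and>
             (\<forall>u\<in>{u\<in>tball K x0 x (eps0 K). lexp K x0 x u \<in> ball z r2}. \<forall>v\<in>tleaf K x0 x. \<forall>w\<in>tleaf K x0 x.
                norm (blinfun_apply (blinfun_apply (f'' u) v) w) \<le> B2 * gnorm K x v * gnorm K x w)"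
    using exponentials unfolding leaf_exponentials_def Let_def by meson
  define r where "r = min r1 r2"
  define B where "B = max (max B1 (B1 * C)) B2"
  have r: "r > 0" "r \<le> r1" "r \<le> r2" using 1(1) 2(1) by (auto simp: r_def)
  have B: "B > 0" "B1 \<le> B" "B1 * C \<le> B" "B2 \<le> B" using 1(2) by (auto simp: B_def less_max_iff_disj)
  have "exp_chart_control z r B" unfolding exp_chart_control_def
  proof (intro conjI ballI allI impI)
    show "ball z r \<subseteq> cdom K z" using r(2) 1(3) by auto
  next
    fix x0 x u v assume x: "x0 \<in> \<Lambda>" "x \<in> sleaf K (eps0 K) x0" and u: "u \<in> tball K x0 x (eps0 K)"
      "lexp K x0 x u \<in> ball z r" "v \<in> tleaf K x0 x"
    define y where "y = lexp K x0 x u"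
    have y: "y \<in> ball z r1" "y \<in> cdom K z" using u(2) r 1(3) by (auto simp: y_def)
    define a where "a = diff_into K (tball K x0 x (eps0 K)) (lexp K x0 x) u v"
    have E: "exp_deriv z x0 x u v = coord_change K y z a" by (simp add: exp_deriv_def a_def y_def)
    have a: "gnorm K y a \<le> C * gnorm K x v" "gnorm K x v \<le> C * gnorm K y a"
      using exp_upper[OF x u(1,3)] exp_lower[OF x u(1,3)] by (auto simp: y_def a_def)
    have "norm (exp_deriv z x0 x u v) \<le> B1 * gnorm K y a"
      unfolding E using 1(4)[OF y(1), of "coord_change K y z a"] by (simp add: coord_norm_change[OF y(2)])
    also have "\<dots> \<le> B1 * (C * gnorm K x v)" using 1(2) a(1) by (intro mult_left_mono) auto
    also have "\<dots> = (B1 * C) * gnorm K x v" by simp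
    also have "\<dots> \<le> B * gnorm K x v" by (rule mult_right_mono[OF B(3)]) simp
    finally have i: "norm (exp_deriv z x0 x u v) \<le> B * gnorm K x v" .
    have "gnorm K y a \<le> B1 * norm (exp_deriv z x0 x u v)"
      unfolding E using 1(5)[OF y(1), of "coord_change K y z a"] by (simp add: coord_norm_change[OF y(2)])
    then have "C * gnorm K y a \<le> C * (B1 * norm (exp_deriv z x0 x u v))" using C by (intro mult_left_mono) auto
    also have "\<dots> = (B1 * C) * norm (exp_deriv z x0 x u v)" by simp
    also have "\<dots> \<le> B * norm (exp_deriv z x0 x u v)" by (rule mult_right_mono[OF B(3)]) simp
    finally have "gnorm K x v \<le> B * norm (exp_deriv z x0 x u v)" using a(2) by linarith
    note ii = i this
    show "norm (exp_deriv z x0 x u v) \<le> B * gnorm K x v" by (rule ii)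
    show "gnorm K x v \<le> B * norm (exp_deriv z x0 x u v)" by (rule ii)
  next
    fix x0 x A u u' v assume x: "x0 \<in> \<Lambda>" "x \<in> sleaf K (eps0 K) x0" and A: "convex A" "A \<subseteq> tball K x0 x (eps0 K)"
      "lexp K x0 x ` A \<subseteq> ball z r" and u: "u \<in> A" "u' \<in> A" "v \<in> tleaf K x0 x"
    define S where "S = tball K x0 x (eps0 K)"
    define N where "N = {u\<in>S. lexp K x0 x u \<in> ball z r2}"
    obtain f' f'' where d: "derivs2_on (chart K z \<circ> lexp K x0 x) N f' f''"
      and bd: "\<forall>u\<in>N. \<forall>v\<in>tleaf K x0 x. \<forall>w\<in>tleaf K x0 x.
                norm (blinfun_apply (blinfun_apply (f'' u) v) w) \<le> B2 * gnorm K x v * gnorm K x w"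
      using d2 x unfolding N_def S_def by blast
    have AN: "A \<subseteq> N" using A r(3) by (force simp: N_def S_def)
    have C2: "C2_into K S (lexp K x0 x)" unfolding S_def by (rule exp_C2[OF x])
    have solid: "solid_in (tleaf K x0 x) S" unfolding S_def by (rule exp_solid[OF x])
    have sub: "subspace (tleaf K x0 x)" by (rule subspace_tleaf[OF x(1) sleaf_leaf[OF x(2)]])
    have AV: "A \<subseteq> tleaf K x0 x" using A(2) by (auto simp: tball_def)
    have agree: "exp_deriv z x0 x a v = f' a v" if a: "a \<in> N" for a
    proof -
      have aS: "a \<in> S" "lexp K x0 x a \<in> cdom K z" using a 2(2) by (auto simp: N_def)
      have "continuous_on S (lexp K x0 x)" by (rule C2_into_continuous_on[OF C2])
      then have "(lexp K x0 x \<longlongrightarrow> lexp K x0 x a) (at a within S)" using aS(1) by (simp add: continuous_on_def)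
      then have "\<forall>\<^sub>F w in at a within S. lexp K x0 x w \<in> ball z r2"
        by (rule topological_tendstoD) (use a in \<open>auto simp: N_def\<close>)
      then obtain U where U: "open U" "a \<in> U" "\<And>w. w \<in> U \<Longrightarrow> w \<noteq> a \<Longrightarrow> w \<in> S \<Longrightarrow> lexp K x0 x w \<in> ball z r2"
        unfolding eventually_at_topological by auto
      have "at a within N = at a within S"
        by (rule at_within_nhd[OF U(2,1)]) (use U(3) in \<open>auto simp: N_def\<close>)
      then have "((chart K z \<circ> lexp K x0 x) has_derivative f' a) (at a within S)"
        using d a unfolding derivs2_on_def by metis
      moreover have "((chart K z \<circ> lexp K x0 x) has_derivative exp_deriv z x0 x a) (at a within S)"
        using piece_derivative[OF C2 aS] unfolding exp_deriv_def S_def o_def .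
      ultimately show ?thesis using derivative_unique_on_solid[OF solid aS(1) u(3)] by metis
    qed
    have "form_norm (\<lambda>x y. x \<bullet> y) (f' u v - f' u' v) \<le> B * gnorm K x (u - u') * gnorm K x v"
    proof (rule form_norm_mean_value[OF inner_form_inner A(1) u(2,1), where f' = "\<lambda>a h. f'' a h v"])
      fix a assume a: "a \<in> A"
      have "(f' has_derivative f'' a) (at a within N)" using d a AN unfolding derivs2_on_def by blast
      then have "(f' has_derivative f'' a) (at a within A)" using AN by (rule has_derivative_subset)
      from bounded_linear.has_derivative[OF blinfun.bounded_linear_left this]
      show "((\<lambda>a. f' a v) has_derivative (\<lambda>h. f'' a h v)) (at a within A)" .
      have uu: "u - u' \<in> tleaf K x0 x" using u AV sub by (auto intro: subspace_diff)
      have "norm (f'' a (u - u') v) \<le> B2 * gnorm K x (u - u') * gnorm K x v" using bd a AN uu u(3) by blast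
      also have "\<dots> \<le> B * gnorm K x (u - u') * gnorm K x v" using B(4) by (intro mult_right_mono) auto
      finally show "form_norm (\<lambda>x y. x \<bullet> y) (f'' a (u - u') v) \<le> B * gnorm K x (u - u') * gnorm K x v"
        by (simp add: form_norm_def norm_eq_sqrt_inner)
    qed
    then show "norm (exp_deriv z x0 x u v - exp_deriv z x0 x u' v) \<le> B * gnorm K x (u - u') * gnorm K x v"
      using agree u AN by (simp add: form_norm_def norm_eq_sqrt_inner subset_iff)
  qed
  then show ?thesis by (rule that[OF r(1) B(1)])
qed

end

section \<open>The flow in exponential coordinates, backwards in time\<close>

context leaf_system
begin

lemma linear_exp_deriv:
  assumes x: "x0 \<in> \<Lambda>" "x \<in> sleaf K (eps0 K) x0" and u: "u \<in> tball K x0 x (eps0 K)" "lexp K x0 x u \<in> cdom K z"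
  shows "linear (exp_deriv z x0 x u)"
  using linear_compose[OF linear_diff_into[OF exp_C2[OF x] u(1)] linear_coord_change[OF u(2)]]
  unfolding exp_deriv_def o_def .

lemma exp_deriv_has_derivative:
  assumes x: "x0 \<in> \<Lambda>" "x \<in> sleaf K (eps0 K) x0" and u: "u \<in> tball K x0 x (eps0 K)" "lexp K x0 x u \<in> cdom K z"
  shows "((\<lambda>u. chart K z (lexp K x0 x u)) has_derivative exp_deriv z x0 x u) (at u within tball K x0 x (eps0 K))"
  using piece_derivative[OF exp_C2[OF x] u] unfolding exp_deriv_def .

lemma exp_deriv_zero:
  assumes x: "x0 \<in> \<Lambda>" "x \<in> sleaf K (eps0 K) x0" and v: "v \<in> tleaf K x0 x"
  shows "exp_deriv z x0 x 0 v = coord_change K x z v"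
  by (simp add: exp_deriv_def exp_center[OF x] exp_diff_zero[OF x v])

lemma exp_ball_dist:
  assumes x: "x0 \<in> \<Lambda>" "x \<in> sleaf K (eps0 K) x0" and u: "u \<in> tball K x0 x \<rho>" "\<rho> \<le> eps0 K"
  shows "dist x (lexp K x0 x u) \<le> C * \<rho>"
proof -
  have "C * gnorm K x u \<le> C * \<rho>" using u(1) C by (intro mult_left_mono) (auto simp: tball_def)
  then show ?thesis using exp_dist[OF x tball_mono[OF u]] by linarith
qed

text \<open>The exponential map moves points of norm \<open>\<eta>\<close> a definite amount in a chart: its derivative at
  \<open>0\<close> is bounded below, and it differs from that derivative only by a quadratic term.\<close>

lemma exp_chart_separation:
  assumes "\<eta>0 > 0"
  obtains \<eta> \<kappa> r where "0 < \<eta>" "\<eta> \<le> \<eta>0" "0 < \<kappa>" "0 < r" "ball z r \<subseteq> cdom K z"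
    "\<And>x0 x w. x0 \<in> \<Lambda> \<Longrightarrow> x \<in> sleaf K (eps0 K) x0 \<Longrightarrow> x \<in> ball z r \<Longrightarrow> w \<in> tleaf K x0 x \<Longrightarrow> gnorm K x w = \<eta> \<Longrightarrow>
       \<kappa> \<le> norm (chart K z (lexp K x0 x w) - chart K z x)"
proof -
  obtain r B where rB: "r > 0" "B > 0" and ctl: "exp_chart_control z r B"
    using exp_chart_control_exists[of z] by blast
  have 1: "r > 0" "B > 0" "ball z r \<subseteq> cdom K z" using rB ctl by (auto simp: exp_chart_control_def)
  define \<eta> where "\<eta> = min (min \<eta>0 (eps0 K)) (min (r / (4 * C)) (1 / (2 * B * B)))"
  have \<eta>: "\<eta> > 0" "\<eta> \<le> \<eta>0" "\<eta> \<le> eps0 K" "\<eta> \<le> r / (4 * C)" "\<eta> \<le> 1 / (2 * B * B)"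
    using assms eps0 1 C by (auto simp: \<eta>_def)
  have \<eta>C: "C * \<eta> \<le> r / 4" using \<eta>(4) C by (simp add: field_simps)
  show ?thesis
  proof (rule that[of \<eta> "\<eta> / (2 * B)" "r / 2"])
    show "ball z (r / 2) \<subseteq> cdom K z" using 1(1,3) subset_ball[of "r / 2" r z] by auto
    fix x0 x w assume x: "x0 \<in> \<Lambda>" "x \<in> sleaf K (eps0 K) x0" and xz: "x \<in> ball z (r / 2)"
      and w: "w \<in> tleaf K x0 x" "gnorm K x w = \<eta>"
    define A where "A = tball K x0 x \<eta>"
    have A: "convex A" "A \<subseteq> tball K x0 x (eps0 K)" "w \<in> A" "0 \<in> A"
      using solid_in_tball[OF x(1) sleaf_leaf[OF x(2)] \<eta>(1)] \<eta> w zero_in_tball[OF x(1) sleaf_leaf[OF x(2)], of \<eta>]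
      by (auto simp: A_def tball_def solid_in_def)
    have Ar: "lexp K x0 x a \<in> ball z r" if "a \<in> A" for a
    proof -
      have "dist x (lexp K x0 x a) \<le> C * \<eta>"
        using that unfolding A_def by (rule exp_ball_dist[OF x _ \<eta>(3)])
      then have "dist z (lexp K x0 x a) < r"
        using dist_triangle[of z "lexp K x0 x a" x] xz \<eta>C 1(1) by simp
      then show ?thesis by simp
    qed
    define f where "f = (\<lambda>a. chart K z (lexp K x0 x a) - exp_deriv z x0 x 0 a)"
    have lin: "linear (exp_deriv z x0 x 0)" using A(2,4) Ar[OF A(4)] 1(3) by (intro linear_exp_deriv[OF x]) auto
    have "form_norm (\<lambda>x y. x \<bullet> y) (f w - f 0) \<le> B * \<eta> * \<eta>"
    proof (rule form_norm_mean_value[OF inner_form_inner A(1,4,3), where f' = "\<lambda>a h. exp_deriv z x0 x a h - exp_deriv z x0 x 0 h"])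
      fix a assume a: "a \<in> A"
      have "((\<lambda>u. chart K z (lexp K x0 x u)) has_derivative exp_deriv z x0 x a) (at a within A)"
        by (rule has_derivative_subset[OF exp_deriv_has_derivative[OF x] A(2)]) (use a A(2) Ar[OF a] 1(3) in auto)
      moreover have "(exp_deriv z x0 x 0 has_derivative exp_deriv z x0 x 0) (at a within A)"
        using lin by (simp add: linear_imp_has_derivative)
      ultimately show "(f has_derivative (\<lambda>h. exp_deriv z x0 x a h - exp_deriv z x0 x 0 h)) (at a within A)"
        unfolding f_def by (rule has_derivative_diff)
      have "norm (exp_deriv z x0 x a w - exp_deriv z x0 x 0 w) \<le> B * gnorm K x (a - 0) * gnorm K x w"
        using Ar by (intro exp_chart_controlD(2)[OF ctl x w(1) A(1,2) _ a A(4)]) auto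
      also have "\<dots> \<le> B * \<eta> * \<eta>" using a 1(2) \<eta>(1) w(2)
        by (auto simp: A_def tball_def)
      finally show "form_norm (\<lambda>x y. x \<bullet> y) (exp_deriv z x0 x a (w - 0) - exp_deriv z x0 x 0 (w - 0)) \<le> B * \<eta> * \<eta>"
        by (simp add: form_norm_def norm_eq_sqrt_inner)
    qed
    then have 2: "norm (f w - f 0) \<le> B * \<eta> * \<eta>" by (simp add: form_norm_def norm_eq_sqrt_inner)
    have fw: "f w - f 0 = (chart K z (lexp K x0 x w) - chart K z x) - exp_deriv z x0 x 0 w"
      using linear_0[OF lin] by (simp add: f_def exp_center[OF x])
    have "\<eta> \<le> B * norm (exp_deriv z x0 x 0 w)" using exp_chart_controlD(1)[OF ctl x w(1) _ Ar[OF A(4)]] A(2,4) w(2) by auto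
    then have 3: "\<eta> / B \<le> norm (exp_deriv z x0 x 0 w)" using 1(2) by (simp add: field_simps)
    have "\<eta> * (B * \<eta>) \<le> \<eta> * (1 / (2 * B))"
      using \<eta>(5) 1(2) \<eta>(1) by (intro mult_left_mono) (auto simp: field_simps)
    then have 4: "B * \<eta> * \<eta> \<le> \<eta> / B - \<eta> / (2 * B)" using 1(2) by (simp add: field_simps)
    show "\<eta> / (2 * B) \<le> norm (chart K z (lexp K x0 x w) - chart K z x)"
      using 2 3 4 norm_triangle_ineq4[of "chart K z (lexp K x0 x w) - chart K z x" "f w - f 0"] unfolding fw by simp
  qed (use \<eta> 1 in auto)
qed

text \<open>
  Backwards the flow maps small exponential balls into exponential balls of any prescribed size \<open>\<eta>0\<close>.
  Along a radius, the points sent into the open ball of a suitable radius \<open>\<eta>\<close> form an open set by invariance of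
  domain, and a closed one because the images stay too close to the new centre to meet its boundary.
\<close>

lemma flow_exp_ball_local:
  assumes \<eta>0: "\<eta>0 > 0"
  obtains \<delta> where "\<delta> > 0" "\<And>t x0 x u. \<bar>t - s\<bar> < \<delta> \<Longrightarrow> t \<ge> 0 \<Longrightarrow> x0 \<in> \<Lambda> \<Longrightarrow> dist xc x0 < \<delta> \<Longrightarrow> x \<in> sleaf K \<delta> x0 \<Longrightarrow>
     u \<in> tball K x0 x \<delta> \<Longrightarrow> flow K (- t) (lexp K x0 x u) \<in>
     lexp K (flow K (- t) x0) (flow K (- t) x) ` tball K (flow K (- t) x0) (flow K (- t) x) \<eta>0"
proof -
  define z where "z = flow K (- s) xc"
  obtain \<eta> \<kappa> r where \<eta>: "0 < \<eta>" "\<eta> \<le> min \<eta>0 (eps0 K)" "0 < \<kappa>" "0 < r" "ball z r \<subseteq> cdom K z"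
    and sep: "\<And>x0 x w. x0 \<in> \<Lambda> \<Longrightarrow> x \<in> sleaf K (eps0 K) x0 \<Longrightarrow> x \<in> ball z r \<Longrightarrow> w \<in> tleaf K x0 x \<Longrightarrow> gnorm K x w = \<eta> \<Longrightarrow>
       \<kappa> \<le> norm (chart K z (lexp K x0 x w) - chart K z x)"
    using exp_chart_separation[of "min \<eta>0 (eps0 K)" z] \<eta>0 eps0(1) by (metis min_less_iff_conj)
  obtain d2 where d2: "d2 > 0" "\<And>q. dist q z < d2 \<Longrightarrow> dist (chart K z q) (chart K z z) < \<kappa> / 2"
    using isCont_chart[of z z] \<eta>(3) unfolding continuous_at_eps_delta by (metis cdom_self half_gt_zero)
  define d where "d = min d2 r"
  have d: "d > 0" using d2 \<eta> by (simp add: d_def)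
  have "continuous_on UNIV (\<lambda>q. (\<lambda>(t, x). flow K t x) (- fst q, snd q))"
    by (intro continuous_on_compose2[OF continuous_on_flow] continuous_intros) auto
  then have "isCont (\<lambda>q. flow K (- fst q) (snd q)) (s, xc)"
    by (simp add: continuous_on_eq_continuous_at)
  then obtain d3 where d3: "d3 > 0" "\<And>q. dist q (s, xc) < d3 \<Longrightarrow> dist (flow K (- fst q) (snd q)) z < d"
    using d unfolding continuous_at_eps_delta z_def by (metis fst_conv snd_conv)
  define \<delta> where "\<delta> = min (eps0 K) (d3 / (4 + C))"
  have \<delta>: "\<delta> > 0" "\<delta> \<le> eps0 K" "\<delta> * (3 + C) < d3"
  proof -
    have c: "4 + C > 0" using C by simp
    show pos: "\<delta> > 0" "\<delta> \<le> eps0 K" using eps0(1) d3(1) c by (auto simp: \<delta>_def)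
    have "\<delta> \<le> d3 / (4 + C)" by (simp add: \<delta>_def)
    then have "\<delta> * (4 + C) \<le> d3" using c by (simp add: pos_le_divide_eq)
    then show "\<delta> * (3 + C) < d3" using pos(1) by (simp add: algebra_simps)
  qed
  show ?thesis
  proof (rule that[OF \<delta>(1)])
    fix t x0 x u
    assume t: "\<bar>t - s\<bar> < \<delta>" "t \<ge> 0" and x0: "x0 \<in> \<Lambda>" "dist xc x0 < \<delta>" and x: "x \<in> sleaf K \<delta> x0"
      and u: "u \<in> tball K x0 x \<delta>"
    define y0 y where "y0 = flow K (- t) x0" and "y = flow K (- t) x"
    have xs: "x \<in> sleaf K (eps0 K) x0" using x \<delta>(2) by (rule sleaf_mono)
    have xl: "x \<in> leaf K x0" using x by (rule sleaf_leaf)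
    have y0: "y0 \<in> \<Lambda>" unfolding y0_def by (rule flow_Lambda[OF x0(1)])
    have y: "y \<in> sleaf K (eps0 K) y0" unfolding y_def y0_def by (rule sleaf_backward[OF x0(1) t(2) xs])
    have near: "dist (flow K (- t) q) z < d" if "dist x q \<le> C * \<delta>" for q
    proof -
      have "dist xc q \<le> dist xc x0 + dist x0 x + dist x q"
        using dist_triangle[of xc q x0] dist_triangle[of x0 q x] by linarith
      also have "\<dots> < \<delta> + \<delta> + C * \<delta>" using x0(2) sleaf_dist[OF x] that by linarith
      finally have "dist (t, q) (s, xc) < \<bar>t - s\<bar> + (\<delta> + \<delta> + C * \<delta>)"
        using sqrt_sum_squares_le_sum[of "dist t s" "dist q xc"] unfolding dist_Pair_Pair
        by (simp add: dist_real_def dist_commute)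
      also have "\<dots> < d3" using t(1) \<delta>(3) by (simp add: algebra_simps)
      finally show ?thesis using d3(2)[of "(t, q)"] by simp
    qed
    have near_y: "dist y z < d" unfolding y_def using C \<delta>(1) by (intro near) simp
    define c where "c = (\<lambda>a::real. flow K (- t) (lexp K x0 x (a *\<^sub>R u)))"
    have inb: "a *\<^sub>R u \<in> tball K x0 x \<delta>" if "a \<in> {0..1}" for a
      using scale_in_tball[OF x0(1) xl u] that by simp
    have inb0: "a *\<^sub>R u \<in> tball K x0 x (eps0 K)" if "a \<in> {0..1}" for a
      using tball_mono[OF inb[OF that] \<delta>(2)] .
    have near_c: "dist (c a) z < d" if "a \<in> {0..1}" for a
      unfolding c_def by (intro near exp_ball_dist[OF x0(1) xs inb[OF that] \<delta>(2)])
    have c_leaf: "c a \<in> leaf K y0" if "a \<in> {0..1}" for a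
      unfolding c_def y0_def by (intro leaf_backward x0(1) t(2) exp_in_leaf[OF x0(1) xs inb0[OF that]])
    have c_cont: "continuous_on {0..1} c"
      unfolding c_def
      by (intro continuous_on_flow_at continuous_on_compose2[OF C2_into_continuous_on[OF exp_C2[OF x0(1) xs]]] continuous_intros)
        (use inb0 in auto)
    define e where "e = lexp K y0 y"
    define N where "N = e ` {w\<in>tleaf K y0 y. gnorm K y w < \<eta>}"
    have N_open: "openin (top_of_set (leaf K y0)) N" unfolding N_def e_def using \<eta>(2) by (intro exp_open[OF y0 y]) simp
    have N_closed: "{0..1} \<inter> c -` N = {0..1} \<inter> c -` (e ` tball K y0 y \<eta>)"
    proof -
      have "gnorm K y w < \<eta>" if a: "a \<in> {0..1}" "c a = e w" "w \<in> tball K y0 y \<eta>" for a w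
      proof (rule ccontr)
        assume "\<not> gnorm K y w < \<eta>"
        then have w: "gnorm K y w = \<eta>" "w \<in> tleaf K y0 y" using a(3) by (auto simp: tball_def)
        have "\<kappa> \<le> norm (chart K z (e w) - chart K z y)"
          unfolding e_def using near_y by (intro sep[OF y0 y _ w(2,1)]) (simp add: d_def dist_commute)
        moreover have "dist (chart K z (e w)) (chart K z z) < \<kappa> / 2"
          using near_c[OF a(1)] a(2) by (intro d2(2)) (simp add: d_def)
        moreover have "dist (chart K z y) (chart K z z) < \<kappa> / 2"
          using near_y by (intro d2(2)) (simp add: d_def)
        ultimately show False using dist_triangle2[of "chart K z (e w)" "chart K z y" "chart K z z"]
          by (simp add: dist_norm)
      qed
      then show ?thesis unfolding N_def by (auto simp: tball_def)
    qed
    have op: "openin (top_of_set {0..1}) ({0..1} \<inter> c -` N)"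
      using continuous_on_open_gen[of c "{0..1}" "leaf K y0"] c_cont c_leaf N_open by (auto simp: Pi_iff)
    have comp: "compact (e ` tball K y0 y \<eta>)"
    proof (rule compact_continuous_image)
      show "compact (tball K y0 y \<eta>)" by (rule compact_tball[OF y0 sleaf_leaf[OF y]])
      show "continuous_on (tball K y0 y \<eta>) e" unfolding e_def
        by (rule continuous_on_subset[OF C2_into_continuous_on[OF exp_C2[OF y0 y]]]) (use \<eta>(2) in \<open>auto simp: tball_def\<close>)
    qed
    have "closedin (top_of_set {0..1}) ({0..1} \<inter> c -` (e ` tball K y0 y \<eta>))"
      by (rule continuous_closedin_preimage[OF c_cont compact_imp_closed[OF comp]])
    then have cl: "closedin (top_of_set {0..1}) ({0..1} \<inter> c -` N)" unfolding N_closed .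
    have "c 0 = e 0" by (simp add: c_def e_def y_def exp_center[OF x0(1) xs] exp_center[OF y0 y[unfolded y_def]])
    then have "0 \<in> {0..1} \<inter> c -` N" using \<eta>(1) subspace_0[OF subspace_tleaf[OF y0 sleaf_leaf[OF y]]]
      unfolding N_def by auto
    then have "{0..1} \<inter> c -` N = {0..1::real}"
      using op cl connected_clopen[of "{0..1::real}"] by (metis connected_Icc empty_iff)
    moreover have "1 \<in> {0..1::real}" by simp
    ultimately have "c 1 \<in> N" by (metis IntD2 vimage_eq)
    then have "c 1 \<in> e ` tball K y0 y \<eta>0" using \<eta>(2) by (auto simp: N_def tball_def)
    then show "flow K (- t) (lexp K x0 x u) \<in>
     lexp K (flow K (- t) x0) (flow K (- t) x) ` tball K (flow K (- t) x0) (flow K (- t) x) \<eta>0"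
      by (simp add: c_def e_def y_def y0_def)
  qed
qed

lemma phihat_0:
  assumes x: "x0 \<in> \<Lambda>" "x \<in> sleaf K (eps0 K) x0" and t: "t \<ge> 0"
  shows "phihat K x0 x (- t) 0 = 0"
proof -
  note y = flow_Lambda[OF x(1), of "- t"] sleaf_backward[OF x(1) t x(2)]
  show ?thesis unfolding phihat_def o_def exp_center[OF x]
    using inv_into_f_f[OF exp_inj[OF y] zero_in_tball[OF y(1) sleaf_leaf[OF y(2)]]] eps0(1)
    by (simp add: exp_center[OF y])
qed

lemma phihat_inverse:
  assumes "phihat_defined K x0 x t u"
  shows "lexp K (flow K t x0) (flow K t x) (phihat K x0 x t u) = flow K t (lexp K x0 x u)"
    "phihat K x0 x t u \<in> tball K (flow K t x0) (flow K t x) (eps0 K)"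
  using assms unfolding phihat_defined_def phihat_def o_def
  by (auto simp: f_inv_into_f intro: inv_into_into)

text \<open>The bounds concern vectors of the tangent space of the leaf, on which alone the derivative is
  determined.\<close>

definition controlled_derivative :: "real \<Rightarrow> real \<Rightarrow> real \<Rightarrow> 'm \<Rightarrow> 'm \<Rightarrow> ('e \<Rightarrow> 'e \<Rightarrow> 'e) \<Rightarrow> bool" where
  "controlled_derivative D \<rho> t x0 x g' \<longleftrightarrow> (\<forall>u\<in>tball K x0 x \<rho>.
     phihat_defined K x0 x (- t) u \<and>
     (phihat K x0 x (- t) has_derivative g' u) (at u within tball K x0 x \<rho>) \<and>
     (\<forall>v. g' u v \<in> tleaf K (flow K (- t) x0) (flow K (- t) x)) \<and>
     (\<forall>v\<in>tleaf K x0 x. g' 0 v = mdiff K (flow K (- t)) x v \<and>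
        gnorm K (flow K (- t) x) (g' u v) \<le> D * gnorm K x v \<and>
        (\<forall>u'\<in>tball K x0 x \<rho>.
           gnorm K (flow K (- t) x) (g' u v - g' u' v) \<le> D * gnorm K x (u - u') * gnorm K x v)))"

lemma controlled_derivativeD:
  assumes "controlled_derivative D \<rho> t x0 x g'" and u: "u \<in> tball K x0 x \<rho>"
  shows "phihat_defined K x0 x (- t) u"
    and "(phihat K x0 x (- t) has_derivative g' u) (at u within tball K x0 x \<rho>)"
    and "g' u w \<in> tleaf K (flow K (- t) x0) (flow K (- t) x)"
    and "v \<in> tleaf K x0 x \<Longrightarrow> g' 0 v = mdiff K (flow K (- t)) x v"
    and "v \<in> tleaf K x0 x \<Longrightarrow> gnorm K (flow K (- t) x) (g' u v) \<le> D * gnorm K x v"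
    and "v \<in> tleaf K x0 x \<Longrightarrow> u' \<in> tball K x0 x \<rho> \<Longrightarrow>
       gnorm K (flow K (- t) x) (g' u v - g' u' v) \<le> D * gnorm K x (u - u') * gnorm K x v"
  using assms unfolding controlled_derivative_def by blast+

lemma controlled_derivative_mono:
  assumes c: "controlled_derivative D \<rho> t x0 x g'" and le: "D \<le> D'" "\<rho>' \<le> \<rho>"
  shows "controlled_derivative D' \<rho>' t x0 x g'"
  unfolding controlled_derivative_def
proof (intro ballI conjI allI)
  have sub: "tball K x0 x \<rho>' \<subseteq> tball K x0 x \<rho>" using le(2) by (auto intro: tball_mono)
  have m: "a \<le> D * b \<Longrightarrow> b \<ge> 0 \<Longrightarrow> a \<le> D' * b" for a b using mult_right_mono[OF le(1)] order_trans by blast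
  fix u assume "u \<in> tball K x0 x \<rho>'"
  then have u: "u \<in> tball K x0 x \<rho>" using sub by blast
  note d = controlled_derivativeD[OF c u]
  show "phihat_defined K x0 x (- t) u" by (rule d(1))
  show "(phihat K x0 x (- t) has_derivative g' u) (at u within tball K x0 x \<rho>')"
    by (rule has_derivative_subset[OF d(2) sub])
  show "g' u w \<in> tleaf K (flow K (- t) x0) (flow K (- t) x)" for w by (rule d(3))
  fix v assume v: "v \<in> tleaf K x0 x"
  show "g' 0 v = mdiff K (flow K (- t)) x v" by (rule d(4)[OF v])
  show "gnorm K (flow K (- t) x) (g' u v) \<le> D' * gnorm K x v" by (rule m[OF d(5)[OF v] gnorm_ge0])
  fix u' assume "u' \<in> tball K x0 x \<rho>'"
  then have u': "u' \<in> tball K x0 x \<rho>" using sub by blast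
  show "gnorm K (flow K (- t) x) (g' u v - g' u' v) \<le> D' * gnorm K x (u - u') * gnorm K x v"
    using m[of _ "gnorm K x (u - u') * gnorm K x v"] d(6)[OF v u'] by (simp add: mult.assoc)
qed

text \<open>\<open>D\<close> bounds the derivatives, and \<open>1 / D\<close> is the size of the balls and of the leaves, so that
  compactness has to provide only one constant.\<close>

definition backward_control :: "real \<Rightarrow> real \<times> 'm \<Rightarrow> bool" where
  "backward_control D q \<longleftrightarrow> D > 0 \<and> 1 / D \<le> eps0 K \<and> (\<forall>t x0 x. q = (t, x0) \<longrightarrow> t \<ge> 0 \<longrightarrow> x0 \<in> \<Lambda> \<longrightarrow> x \<in> sleaf K (1 / D) x0 \<longrightarrow>
     (\<exists>g'. controlled_derivative D (1 / D) t x0 x g'))"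

lemma backward_control_mono:
  assumes D: "backward_control D q" "D \<le> D'"
  shows "backward_control D' q"
proof -
  have D0: "D > 0" "1 / D \<le> eps0 K" "D' > 0" using D unfolding backward_control_def by auto
  have inv: "1 / D' \<le> 1 / D" using D0 D(2) by (intro divide_left_mono) auto
  show ?thesis unfolding backward_control_def
  proof (intro conjI allI impI)
    show "D' > 0" "1 / D' \<le> eps0 K" using D0 inv by linarith+
    fix t x0 x assume q: "q = (t, x0)" "t \<ge> 0" "x0 \<in> \<Lambda>" and x: "x \<in> sleaf K (1 / D') x0"
    obtain g' where "controlled_derivative D (1 / D) t x0 x g'"
      using D(1) q sleaf_mono[OF x inv] unfolding backward_control_def by blast
    from controlled_derivative_mono[OF this D(2) inv]
    show "\<exists>g'. controlled_derivative D' (1 / D') t x0 x g'" by blast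
  qed
qed

text \<open>The bound on the derivative and its Lipschitz continuity, integrated from \<open>0\<close> to \<open>u\<close>.\<close>

lemma backward_control_bounds:
  assumes c: "backward_control D (t, x0)" and t: "t \<ge> 0" and x0: "x0 \<in> \<Lambda>" and x: "x \<in> sleaf K (1 / D) x0"
    and u: "u \<in> tball K x0 x (1 / D)"
  shows "phihat_defined K x0 x (- t) u"
    "gnorm K (flow K (- t) x) (phihat K x0 x (- t) u) \<le> D * gnorm K x u"
    "gnorm K (flow K (- t) x) (phihat K x0 x (- t) u - mdiff K (flow K (- t)) x u) \<le> D * (gnorm K x u)\<^sup>2"
proof -
  define y where "y = flow K (- t) x"
  define g where "g = phihat K x0 x (- t)"
  obtain g' where g': "controlled_derivative D (1 / D) t x0 x g'"
    using c t x0 x unfolding backward_control_def by blast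
  have D: "D > 0" "1 / D \<le> eps0 K" using c by (auto simp: backward_control_def)
  note d = controlled_derivativeD[OF g', folded y_def g_def]
  have xl: "x \<in> leaf K x0" using x by (rule sleaf_leaf)
  show "phihat_defined K x0 x (- t) u" by (rule d(1)[OF u])
  have z: "0 \<in> tball K x0 x (1 / D)" using zero_in_tball[OF x0 xl, of "1 / D"] D(1) by simp
  have ut: "u \<in> tleaf K x0 x" using u by (rule tball_tleaf)
  have g0: "g 0 = 0" unfolding g_def by (rule phihat_0[OF x0 sleaf_mono[OF x D(2)] t])
  define A where "A = closed_segment 0 u"
  have A: "convex A" "0 \<in> A" "u \<in> A" "A \<subseteq> tball K x0 x (1 / D)" unfolding A_def
    using solid_in_tball[OF x0 xl, of "1 / D"] D(1) u z by (auto simp: closed_segment_subset solid_in_def)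
  have An: "gnorm K x a \<le> gnorm K x u" if a: "a \<in> A" for a
  proof -
    obtain r where "0 \<le> r" "r \<le> 1" "a = r *\<^sub>R u" using a by (auto simp: A_def in_segment)
    then show ?thesis using mult_left_le_one_le[of "gnorm K x u" r] by (simp add: gnorm_scale)
  qed
  have dA: "(g has_derivative g' a) (at a within A)" if "a \<in> A" for a
    using has_derivative_subset[OF d(2) A(4)] A(4) that by blast
  have "gnorm K y (g u - g 0) \<le> D * gnorm K x u"
    unfolding gnorm_form_norm[of K y]
    by (rule form_norm_mean_value[OF inner_form_metric A(1,2,3) dA]) (use d(5)[OF _ ut] A(4) in \<open>auto simp: gnorm_form_norm\<close>)
  then show "gnorm K (flow K (- t) x) (phihat K x0 x (- t) u) \<le> D * gnorm K x u"
    using g0 by (simp add: g_def y_def)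
  have lin: "linear (g' 0)" by (rule has_derivative_linear[OF d(2)[OF z]])
  have "gnorm K y ((g u - g' 0 u) - (g 0 - g' 0 0)) \<le> D * (gnorm K x u)\<^sup>2"
    unfolding gnorm_form_norm[of K y]
  proof (rule form_norm_mean_value[OF inner_form_metric A(1,2,3), where f' = "\<lambda>a v. g' a v - g' 0 v"])
    fix a assume a: "a \<in> A"
    show "((\<lambda>w. g w - g' 0 w) has_derivative (\<lambda>v. g' a v - g' 0 v)) (at a within A)"
      by (intro has_derivative_diff dA[OF a] linear_imp_has_derivative lin)
    have "gnorm K y (g' a u - g' 0 u) \<le> D * gnorm K x a * gnorm K x u"
      using d(6)[OF _ ut z, of a] a A(4) by auto
    also have "\<dots> \<le> D * gnorm K x u * gnorm K x u" using An[OF a] D(1) by (intro mult_right_mono mult_left_mono) auto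
    finally show "form_norm (metric K y) (g' a (u - 0) - g' 0 (u - 0)) \<le> D * (gnorm K x u)\<^sup>2"
      by (simp add: gnorm_form_norm power2_eq_square)
  qed
  then show "gnorm K (flow K (- t) x) (phihat K x0 x (- t) u - mdiff K (flow K (- t)) x u) \<le> D * (gnorm K x u)\<^sup>2"
    using g0 d(4)[OF u ut] linear_0[OF lin] by (simp add: g_def y_def)
qed

lemma exp_chart_lipschitz:
  assumes x: "x0 \<in> \<Lambda>" "x \<in> sleaf K (eps0 K) x0" and A: "convex A" "A \<subseteq> tball K x0 x (eps0 K)"
    "lexp K x0 x ` A \<subseteq> cdom K z" and u: "u \<in> A" "u' \<in> A"
    and B: "\<And>a v. a \<in> A \<Longrightarrow> v \<in> tleaf K x0 x \<Longrightarrow> norm (exp_deriv z x0 x a v) \<le> B * gnorm K x v"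
  shows "norm (chart K z (lexp K x0 x u) - chart K z (lexp K x0 x u')) \<le> B * gnorm K x (u - u')"
proof -
  have uu: "u - u' \<in> tleaf K x0 x"
    using u A(2) subspace_diff[OF subspace_tleaf[OF x(1) sleaf_leaf[OF x(2)]]] by (auto simp: tball_def)
  have "form_norm (\<lambda>x y. x \<bullet> y) (chart K z (lexp K x0 x u) - chart K z (lexp K x0 x u')) \<le> B * gnorm K x (u - u')"
  proof (rule form_norm_mean_value[OF inner_form_inner A(1) u(2,1), where f' = "exp_deriv z x0 x"])
    fix a assume a: "a \<in> A"
    show "((\<lambda>u. chart K z (lexp K x0 x u)) has_derivative exp_deriv z x0 x a) (at a within A)"
      by (rule has_derivative_subset[OF exp_deriv_has_derivative[OF x] A(2)]) (use a A in auto)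
    show "form_norm (\<lambda>x y. x \<bullet> y) (exp_deriv z x0 x a (u - u')) \<le> B * gnorm K x (u - u')"
      using B[OF a uu] by (simp add: form_norm_def norm_eq_sqrt_inner)
  qed
  then show ?thesis by (simp add: form_norm_def norm_eq_sqrt_inner)
qed

text \<open>
  With \<open>e\<close>, \<open>e'\<close> the exponential maps at \<open>x\<close> and at its image \<open>y\<close>, the map \<open>g\<close> induced by the flow
  satisfies \<open>e' \<circ> g = flow (- t) \<circ> e\<close>. In fixed charts around \<open>xc\<close> and \<open>z\<close> the derivatives \<open>E\<close>, \<open>E'\<close> of the
  exponential maps and \<open>P\<close> of the flow therefore satisfy \<open>E' (g u) (g' u v) = P u (E u v)\<close>. As \<open>E'\<close> is bounded
  below, \<open>g'\<close> inherits the bounds and the Lipschitz continuity of \<open>E\<close>, \<open>E'\<close> and \<open>P\<close>.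
\<close>

lemma backward_control_local:
  assumes xc: "xc \<in> \<Lambda>"
  shows "\<exists>U D. open U \<and> (s, xc) \<in> U \<and> (\<forall>q\<in>U. backward_control D q)"
proof -
  define z where "z = flow K (- s) xc"
  obtain r1 B1 where 1: "r1 > 0" "B1 > 0" and c1: "exp_chart_control xc r1 B1"
    using exp_chart_control_exists[of xc] by blast
  obtain r2 B2 where rB2: "r2 > 0" "B2 > 0" and c2: "exp_chart_control z r2 B2"
    using exp_chart_control_exists[of z] by blast
  have 2: "r2 > 0" "B2 > 0" "ball z r2 \<subseteq> cdom K z" using rB2 c2 by (auto simp: exp_chart_control_def)
  note bd1 = exp_chart_controlD(1)[OF c1] and lip1 = exp_chart_controlD(2)[OF c1]
    and bd2 = exp_chart_controlD(1)[OF c2] and lip2 = exp_chart_controlD(2)[OF c2]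
  have c: "flow K (- s) xc \<in> cdom K z" "flow K (- s) xc \<in> ball z (r2 / 2)"
    using 2(1) by (auto simp: z_def)
  obtain r3 B3 where b3: "r3 > 0" "B3 > 0"
    and dom3: "\<And>t y. \<bar>t - (- s)\<bar> < r3 \<Longrightarrow> y \<in> ball xc r3 \<Longrightarrow> y \<in> cdom K xc \<and> flow K t y \<in> cdom K z \<and> flow K t y \<in> ball z (r2 / 2)"
    and bd3: "\<And>t y a. \<bar>t - (- s)\<bar> < r3 \<Longrightarrow> y \<in> ball xc r3 \<Longrightarrow> norm (coord_deriv xc z t y a) \<le> B3 * norm a"
    and lip3: "\<And>t y y' a. \<bar>t - (- s)\<bar> < r3 \<Longrightarrow> y \<in> ball xc r3 \<Longrightarrow> y' \<in> ball xc r3 \<Longrightarrow>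
       norm (coord_deriv xc z t y a - coord_deriv xc z t y' a) \<le> B3 * norm (chart K xc y - chart K xc y') * norm a"
    using coord_deriv_local_bound[OF c(1) open_ball c(2)] by metis
  define \<eta> where "\<eta> = min (eps0 K) (r2 / (4 * C))"
  have \<eta>: "\<eta> > 0" "\<eta> \<le> eps0 K" "C * \<eta> < r2 / 2"
  proof -
    show "\<eta> > 0" "\<eta> \<le> eps0 K" using eps0(1) 2(1) C by (auto simp: \<eta>_def)
    have "\<eta> \<le> r2 / (4 * C)" by (simp add: \<eta>_def)
    then have "C * \<eta> \<le> r2 / 4" using C by (simp add: field_simps)
    then show "C * \<eta> < r2 / 2" using 2(1) by linarith
  qed
  obtain \<delta> where \<delta>: "\<delta> > 0" and maps: "\<And>t x0 x u. \<bar>t - s\<bar> < \<delta> \<Longrightarrow> t \<ge> 0 \<Longrightarrow> x0 \<in> \<Lambda> \<Longrightarrow> dist xc x0 < \<delta> \<Longrightarrow> x \<in> sleaf K \<delta> x0 \<Longrightarrow>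
     u \<in> tball K x0 x \<delta> \<Longrightarrow> flow K (- t) (lexp K x0 x u) \<in>
     lexp K (flow K (- t) x0) (flow K (- t) x) ` tball K (flow K (- t) x0) (flow K (- t) x) \<eta>"
    using flow_exp_ball_local[OF \<eta>(1), of s xc] by metis
  define r where "r = min r1 r3"
  define \<rho>0 where "\<rho>0 = min (min \<delta> (eps0 K)) (r / (3 + C))"
  define L where "L = B2 * B3 * B1"
  define T where "T = B2 * (B3 * B1 + B3 * B1 * B1 + B2 * L * L)"
  define D where "D = max (1 / \<rho>0) (max L T)"
  define \<rho> where "\<rho> = 1 / D"
  have c3: "3 + C > 0" using C by simp
  have r: "r > 0" "r \<le> r1" "r \<le> r3" using 1(1) b3(1) by (auto simp: r_def)
  have \<rho>0: "\<rho>0 > 0" using \<delta> eps0(1) r(1) c3 by (simp add: \<rho>0_def)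
  have LT: "L > 0" "T > 0" using 1(2) 2(2) b3(2) by (auto simp: L_def T_def intro!: mult_pos_pos add_pos_pos)
  have D: "D > 0" "L \<le> D" "T \<le> D" "1 / \<rho>0 \<le> D" using \<rho>0 by (auto simp: D_def less_max_iff_disj)
  have \<rho>: "\<rho> > 0" "\<rho> \<le> \<rho>0" using D \<rho>0 by (auto simp: \<rho>_def field_simps)
  have \<rho>1: "\<rho> \<le> \<delta>" "\<rho> \<le> eps0 K" "\<rho> \<le> r / (3 + C)" using \<rho>(2) by (auto simp: \<rho>0_def)
  have \<rho>r: "\<rho> * (2 + C) < r"
  proof -
    have "\<rho> * (3 + C) \<le> r" using \<rho>1(3) c3 by (simp add: pos_le_divide_eq)
    then show ?thesis using \<rho>(1) by (simp add: algebra_simps)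
  qed
  define \<tau> where "\<tau> = min \<rho> r3"
  have \<tau>: "\<tau> > 0" "\<tau> \<le> \<rho>" "\<tau> \<le> r3" using \<rho>(1) b3(1) by (auto simp: \<tau>_def)
  have main: "backward_control D (t, x0)" if tx: "\<bar>t - s\<bar> < \<tau>" "dist xc x0 < \<tau>" for t x0
    unfolding backward_control_def \<rho>_def[symmetric] prod.inject
  proof (intro conjI allI impI, goal_cases)
    case 1 show ?case by (rule D(1))
    case 2 show ?case by (rule \<rho>1(2))
  next
    case (3 t' x0' x)
    then have t: "t \<ge> 0" and x0: "x0 \<in> \<Lambda>" and x: "x \<in> sleaf K \<rho> x0" and tt: "t' = t" "x0' = x0" by auto
    have defined: "phihat_defined K x0 x (- t) u" if u: "u \<in> tball K x0 x \<rho>" for u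
    proof -
      have "tball K (flow K (- t) x0) (flow K (- t) x) \<eta> \<subseteq> tball K (flow K (- t) x0) (flow K (- t) x) (eps0 K)"
        using \<eta>(2) by (auto intro: tball_mono)
      moreover have "flow K (- t) (lexp K x0 x u) \<in>
        lexp K (flow K (- t) x0) (flow K (- t) x) ` tball K (flow K (- t) x0) (flow K (- t) x) \<eta>"
        using tx \<tau> \<rho>1 by (intro maps t x0 sleaf_mono[OF x] tball_mono[OF u]) auto
      ultimately show ?thesis unfolding phihat_defined_def by blast
    qed
    define y0 y where "y0 = flow K (- t) x0" and "y = flow K (- t) x"
    have xs: "x \<in> sleaf K (eps0 K) x0" using x \<rho>1(2) by (rule sleaf_mono)
    have xl: "x \<in> leaf K x0" using x by (rule sleaf_leaf)
    have y0: "y0 \<in> \<Lambda>" unfolding y0_def by (rule flow_Lambda[OF x0])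
    have y: "y \<in> sleaf K (eps0 K) y0" unfolding y_def y0_def by (rule sleaf_backward[OF x0 t xs])
    have yl: "y \<in> leaf K y0" using y by (rule sleaf_leaf)
    have t3: "\<bar>- t - (- s)\<bar> < r3" using tx(1) \<tau> by simp
    define S where "S = tball K x0 x \<rho>"
    define A where "A = tball K y0 y \<eta>"
    define e e' g where "e = lexp K x0 x" and "e' = lexp K y0 y" and "g = phihat K x0 x (- t)"
    have S: "solid_in (tleaf K x0 x) S" "S \<subseteq> tball K x0 x (eps0 K)" "0 \<in> S"
      unfolding S_def using solid_in_tball[OF x0 xl \<rho>(1)] \<rho>1(2) zero_in_tball[OF x0 xl, of \<rho>] \<rho>(1)
      by (auto intro: tball_mono)
    have convS: "convex S" using S(1) by (simp add: solid_in_def)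
    have A: "convex A" "A \<subseteq> tball K y0 y (eps0 K)"
      unfolding A_def using solid_in_tball[OF y0 yl \<eta>(1)] \<eta>(2) by (auto intro: tball_mono simp: solid_in_def)
    have subx: "subspace (tleaf K x0 x)" by (rule subspace_tleaf[OF x0 xl])
    have suby: "subspace (tleaf K y0 y)" by (rule subspace_tleaf[OF y0 yl])
    have eS: "e u \<in> ball xc r" if "u \<in> S" for u
    proof -
      have "dist x (e u) \<le> C * \<rho>" using that unfolding S_def e_def by (rule exp_ball_dist[OF x0 xs _ \<rho>1(2)])
      moreover have "dist xc (e u) \<le> dist xc x0 + dist x0 x + dist x (e u)"
        using dist_triangle[of xc "e u" x0] dist_triangle[of x0 "e u" x] by linarith
      ultimately have "dist xc (e u) \<le> \<rho> * (2 + C)"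
        using tx(2) \<tau>(2) sleaf_dist[OF x] by (simp add: algebra_simps)
      then show ?thesis using \<rho>r by simp
    qed
    have eS1: "e u \<in> ball xc r1" "e u \<in> ball xc r3" "e u \<in> cdom K xc" if "u \<in> S" for u
      using eS[OF that] r c1 by (auto simp: exp_chart_control_def)
    have gA: "g u \<in> A" "e' (g u) = flow K (- t) (e u)" if u: "u \<in> S" for u
    proof -
      have "flow K (- t) (e u) \<in> e' ` A"
        unfolding e_def e'_def A_def y0_def y_def using tx \<tau> \<rho>1 u unfolding S_def
        by (intro maps t x0 sleaf_mono[OF x]) (auto intro: tball_mono)
      then obtain w where w: "w \<in> A" "flow K (- t) (e u) = e' w" by blast
      then have "g u = w" unfolding g_def phihat_def o_def e_def[symmetric] y0_def[symmetric] y_def[symmetric]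
        using inv_into_f_f[OF exp_inj[OF y0 y], of w] A(2) by (auto simp: e'_def)
      then show "g u \<in> A" "e' (g u) = flow K (- t) (e u)" using w by auto
    qed
    have eA: "e' w \<in> ball z r2" if w: "w \<in> A" for w
    proof -
      have "dist y (e' w) \<le> C * \<eta>" using w unfolding A_def e'_def by (rule exp_ball_dist[OF y0 y _ \<eta>(2)])
      moreover have "x \<in> ball xc r3" using eS1(2)[OF S(3)] by (simp add: e_def exp_center[OF x0 xs])
      then have "y \<in> ball z (r2 / 2)" unfolding y_def using dom3[OF t3] by blast
      ultimately show ?thesis using \<eta>(3) dist_triangle[of z "e' w" y] by simp
    qed
    have eAc: "e' w \<in> cdom K z" if "w \<in> A" for w using eA[OF that] 2(3) by blast
    define E E' P where "E = exp_deriv xc x0 x" and "E' = exp_deriv z y0 y"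
      and "P = (\<lambda>u. coord_deriv xc z (- t) (e u))"
    have linE': "linear (E' w)" if "w \<in> A" for w
      unfolding E'_def using that A(2) eAc[OF that] by (intro linear_exp_deriv[OF y0 y]) (auto simp: e'_def)
    have linP: "linear (P u)" if "u \<in> S" for u
      unfolding P_def using dom3[OF t3 eS1(2)[OF that]] eS1(3)[OF that] by (intro linear_coord_deriv) auto
    have ex: "\<exists>w'. (g has_derivative w') (at u within S) \<and> (\<forall>h. w' h \<in> tleaf K y0 y) \<and>
        (\<forall>h\<in>tleaf K x0 x. E' (g u) (w' h) = P u (E u h))" if u: "u \<in> S" for u
    proof -
      define G where "G = (\<lambda>u. flow K (- t) (e u))"
      have Gz: "G u \<in> cdom K z" using dom3[OF t3 eS1(2)[OF u]] by (simp add: G_def)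
      have Gc: "continuous_on S G" unfolding G_def e_def
        by (intro continuous_on_flow_at continuous_on_subset[OF C2_into_continuous_on[OF exp_C2[OF x0 xs]] S(2)])
      have Gi: "G ` S \<subseteq> lexp K y0 y ` tball K y0 y (eps0 K)"
        using gA A(2) unfolding G_def e'_def by (force simp: image_subset_iff)
      have u0: "u \<in> tball K x0 x (eps0 K)" using u S(2) by blast
      have "((\<lambda>w. chart K z (G w)) has_derivative (\<lambda>a. coord_change K (G u) z (mdiff K (flow K (- t)) (e u)
          (diff_into K (tball K x0 x (eps0 K)) e u a)))) (at u within S)"
        unfolding G_def e_def
        by (rule has_derivative_subset[OF flow_piece_derivative[OF exp_C2[OF x0 xs] u0] S(2)])
          (use Gz in \<open>simp add: G_def e_def\<close>)
      then obtain w' where w': "((\<lambda>t. inv_into (tball K y0 y (eps0 K)) (lexp K y0 y) (G t)) has_derivative w') (at u within S)"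
        "\<And>h. w' h \<in> tleaf K y0 y"
        "\<And>h. h \<in> tleaf K x0 x \<Longrightarrow> coord_change K (G u) z (diff_into K (tball K y0 y (eps0 K)) (lexp K y0 y)
            (inv_into (tball K y0 y (eps0 K)) (lexp K y0 y) (G u)) (w' h)) =
            coord_change K (G u) z (mdiff K (flow K (- t)) (e u) (diff_into K (tball K x0 x (eps0 K)) e u h))"
        using lift_derivative[OF exp_piece[OF y0 y] S(1) u Gc Gi _ Gz] by metis
      have gG: "g = (\<lambda>t. inv_into (tball K y0 y (eps0 K)) (lexp K y0 y) (G t))"
        by (simp add: g_def phihat_def fun_eq_iff G_def e_def y0_def y_def)
      have "E' (g u) (w' h) = P u (E u h)" if h: "h \<in> tleaf K x0 x" for h
      proof -
        have "E' (g u) (w' h) = coord_change K (G u) z (diff_into K (tball K y0 y (eps0 K)) (lexp K y0 y)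
            (inv_into (tball K y0 y (eps0 K)) (lexp K y0 y) (G u)) (w' h))"
          using gA(2)[OF u] by (simp add: E'_def exp_deriv_def gG[symmetric] e'_def G_def) (simp add: gG G_def)
        also have "\<dots> = P u (E u h)"
          unfolding w'(3)[OF h] P_def E_def exp_deriv_def e_def[symmetric]
          using coord_deriv_mdiff[OF eS1(3)[OF u], of "- t" z] Gz by (simp add: G_def)
        finally show ?thesis .
      qed
      then show ?thesis using w'(1,2) unfolding gG by blast
    qed
    then obtain g' where g': "\<And>u. u \<in> S \<Longrightarrow> (g has_derivative g' u) (at u within S)"
      "\<And>u h. u \<in> S \<Longrightarrow> g' u h \<in> tleaf K y0 y"
      "\<And>u h. u \<in> S \<Longrightarrow> h \<in> tleaf K x0 x \<Longrightarrow> E' (g u) (g' u h) = P u (E u h)"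
      by metis
    have E1: "norm (E u v) \<le> B1 * gnorm K x v" if "u \<in> S" "v \<in> tleaf K x0 x" for u v
      unfolding E_def using bd1[OF x0 xs that(2), of u] eS1(1)[OF that(1)] S(2) that(1) by (auto simp: e_def)
    have E2: "norm (E' w v) \<le> B2 * gnorm K y v" "gnorm K y v \<le> B2 * norm (E' w v)" if "w \<in> A" "v \<in> tleaf K y0 y" for w v
      unfolding E'_def using bd2[OF y0 y that(2), of w] eA[OF that(1)] A(2) that(1) by (auto simp: e'_def)
    have P1: "norm (P u a) \<le> B3 * norm a" if "u \<in> S" for u a
      unfolding P_def by (rule bd3[OF t3 eS1(2)[OF that]])
    have bound: "gnorm K y (g' u v) \<le> L * gnorm K x v" if u: "u \<in> S" and v: "v \<in> tleaf K x0 x" for u v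
    proof -
      have "gnorm K y (g' u v) \<le> B2 * norm (P u (E u v))"
        using E2(2)[OF gA(1)[OF u] g'(2)[OF u, of v]] by (simp add: g'(3)[OF u v])
      also have "\<dots> \<le> B2 * (B3 * (B1 * gnorm K x v))"
      proof -
        have "B3 * norm (E u v) \<le> B3 * (B1 * gnorm K x v)" using E1[OF u v] b3(2) by (intro mult_left_mono) auto
        then have "norm (P u (E u v)) \<le> B3 * (B1 * gnorm K x v)" using P1[OF u, of "E u v"] by linarith
        then show ?thesis using 2(2) by (intro mult_left_mono) auto
      qed
      finally show ?thesis by (simp add: L_def ac_simps)
    qed
    have g_lip: "gnorm K y (g u - g u') \<le> L * gnorm K x (u - u')" if u: "u \<in> S" "u' \<in> S" for u u'
    proof -
      have uu: "u - u' \<in> tleaf K x0 x" using u subx S(1) by (auto simp: solid_in_def intro: subspace_diff)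
      show ?thesis unfolding gnorm_form_norm[of K y]
        by (rule form_norm_mean_value[OF inner_form_metric convS u(2,1) g'(1)])
          (use bound[OF _ uu] in \<open>auto simp: gnorm_form_norm\<close>)
    qed
    have lip: "gnorm K y (g' u v - g' u' v) \<le> T * gnorm K x (u - u') * gnorm K x v"
      if u: "u \<in> S" "u' \<in> S" and v: "v \<in> tleaf K x0 x" for u u' v
    proof -
      define n where "n = gnorm K x (u - u')"
      define m where "m = gnorm K x v"
      have nm: "n \<ge> 0" "m \<ge> 0" by (auto simp: n_def m_def)
      have "norm (E u v - E u' v) \<le> B1 * n * m" unfolding E_def n_def m_def
        using eS1(1) by (intro lip1[OF x0 xs v convS S(2) _ u]) (auto simp: e_def)
      then have a1: "norm (P u (E u v - E u' v)) \<le> B3 * (B1 * n * m)"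
        using P1[OF u(1), of "E u v - E u' v"] b3(2) mult_left_mono[of "norm (E u v - E u' v)" "B1 * n * m" B3] by linarith
      have "norm (chart K xc (e u) - chart K xc (e u')) \<le> B1 * n" unfolding e_def n_def
        by (rule exp_chart_lipschitz[OF x0 xs convS S(2) _ u]) (use eS1 E1 in \<open>auto simp: e_def E_def\<close>)
      then have "B3 * norm (chart K xc (e u) - chart K xc (e u')) * norm (E u' v) \<le> B3 * (B1 * n) * (B1 * m)"
        using E1[OF u(2) v] 1(2) b3(2) nm by (intro mult_mono) (auto simp: m_def)
      then have a2: "norm (P u (E u' v) - P u' (E u' v)) \<le> B3 * (B1 * n) * (B1 * m)"
        using lip3[OF t3 eS1(2)[OF u(1)] eS1(2)[OF u(2)], of "E u' v"] unfolding P_def by linarith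
      have "norm (E' (g u) (g' u' v) - E' (g u') (g' u' v)) \<le> B2 * gnorm K y (g u - g u') * gnorm K y (g' u' v)"
        unfolding E'_def using eA
        by (intro lip2[OF y0 y g'(2)[OF u(2)] A _ gA(1)[OF u(1)] gA(1)[OF u(2)]]) (auto simp: e'_def)
      also have "\<dots> \<le> B2 * (L * n) * (L * m)"
        using g_lip[OF u] bound[OF u(2) v] 2(2) LT nm by (intro mult_mono mult_left_mono) (auto simp: n_def m_def)
      finally have a3: "norm (E' (g u) (g' u' v) - E' (g u') (g' u' v)) \<le> B2 * (L * n) * (L * m)" .
      have "E' (g u) (g' u v - g' u' v) = P u (E u v - E u' v) + (P u (E u' v) - P u' (E u' v))
          - (E' (g u) (g' u' v) - E' (g u') (g' u' v))"
        using g'(3)[OF u(1) v] g'(3)[OF u(2) v]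
        by (simp add: linear_diff[OF linE'[OF gA(1)[OF u(1)]]] linear_diff[OF linP[OF u(1)]])
      then have "norm (E' (g u) (g' u v - g' u' v)) \<le> B3 * (B1 * n * m) + B3 * (B1 * n) * (B1 * m) + B2 * (L * n) * (L * m)"
        using a1 a2 a3 norm_triangle_ineq4[of "P u (E u v - E u' v) + (P u (E u' v) - P u' (E u' v))" "E' (g u) (g' u' v) - E' (g u') (g' u' v)"]
          norm_triangle_ineq[of "P u (E u v - E u' v)" "P u (E u' v) - P u' (E u' v)"] by simp
      also have "\<dots> = (B3 * B1 + B3 * B1 * B1 + B2 * L * L) * (n * m)" by (simp add: algebra_simps)
      finally have "B2 * norm (E' (g u) (g' u v - g' u' v)) \<le> B2 * ((B3 * B1 + B3 * B1 * B1 + B2 * L * L) * (n * m))"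
        using 2(2) by (intro mult_left_mono) auto
      moreover have "gnorm K y (g' u v - g' u' v) \<le> B2 * norm (E' (g u) (g' u v - g' u' v))"
        by (intro E2(2) gA u subspace_diff suby g'(2))
      ultimately show ?thesis by (simp add: T_def n_def m_def mult.assoc)
    qed
    have g0: "g 0 = 0" unfolding g_def by (rule phihat_0[OF x0 xs t])
    have zero: "g' 0 v = mdiff K (flow K (- t)) x v" if v: "v \<in> tleaf K x0 x" for v
    proof -
      have yz: "x \<in> cdom K xc" "y \<in> cdom K z" using eS1(3)[OF S(3)] dom3[OF t3 eS1(2)[OF S(3)]]
        by (auto simp: e_def exp_center[OF x0 xs] y_def)
      have "coord_change K y z (g' 0 v) = P 0 (E 0 v)"
        using g'(3)[OF S(3) v] exp_deriv_zero[OF y0 y g'(2)[OF S(3)], of z v] by (simp add: g0 E'_def)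
      also have "\<dots> = coord_change K y z (mdiff K (flow K (- t)) x v)"
        unfolding P_def E_def exp_deriv_zero[OF x0 xs v] e_def exp_center[OF x0 xs]
        using coord_deriv_mdiff[OF yz(1), of "- t" z v] yz(2) by (simp add: y_def)
      finally show ?thesis using inj_coord_change[OF yz(2)] by (simp add: inj_eq)
    qed
    have "controlled_derivative D \<rho> t x0 x g'"
      unfolding controlled_derivative_def S_def[symmetric] g_def[symmetric] y0_def[symmetric] y_def[symmetric]
    proof (intro ballI conjI allI g' zero)
      show "phihat_defined K x0 x (- t) u" if "u \<in> S" for u using defined that by (simp add: S_def)
      fix u v u' assume u: "u \<in> S" and v: "v \<in> tleaf K x0 x"
      show "gnorm K y (g' u v) \<le> D * gnorm K x v"
        using bound[OF u v] mult_right_mono[OF D(2), of "gnorm K x v"] by simp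
      assume u': "u' \<in> S"
      have "T * (gnorm K x (u - u') * gnorm K x v) \<le> D * (gnorm K x (u - u') * gnorm K x v)"
        using D(3) by (intro mult_right_mono) auto
      then show "gnorm K y (g' u v - g' u' v) \<le> D * gnorm K x (u - u') * gnorm K x v"
        using lip[OF u u' v] by (simp add: mult.assoc)
    qed
    then show ?case unfolding tt by blast
  qed
  show ?thesis
  proof (intro exI conjI ballI)
    show "open (ball s \<tau> \<times> ball xc \<tau>)" by (intro open_Times) auto
    show "(s, xc) \<in> ball s \<tau> \<times> ball xc \<tau>" using \<tau>(1) by auto
    fix q assume "q \<in> ball s \<tau> \<times> ball xc \<tau>"
    then show "backward_control D q" using main by (cases q) (auto simp: dist_real_def abs_minus_commute)
  qed
qed

lemma backward_control_uniform:
  obtains D where "\<And>t x0. 0 \<le> t \<Longrightarrow> t \<le> T \<Longrightarrow> x0 \<in> \<Lambda> \<Longrightarrow> backward_control D (t, x0)"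
proof -
  have "compact ({0..T} \<times> \<Lambda>)" by (intro compact_Times compact_Lambda) auto
  then obtain D where "D > 0" "\<And>q. q \<in> {0..T} \<times> \<Lambda> \<Longrightarrow> backward_control D q"
  proof (rule compact_uniform_constant[where P = backward_control])
    fix q :: "real \<times> 'm" assume "q \<in> {0..T} \<times> \<Lambda>"
    then show "\<exists>U D. open U \<and> q \<in> U \<and> (\<forall>y\<in>U \<inter> {0..T} \<times> \<Lambda>. backward_control D y)"
      using backward_control_local[of "snd q" "fst q"] by (cases q) (simp, blast)
  qed (use backward_control_mono that in auto)
  then show ?thesis using that[of D] by simp
qed

end

section \<open>Stretching of tangent vectors near the centre of a leaf\<close>

context riemannian_flow
begin

lemma coord_deriv_tendsto:
  assumes y: "y \<longlonglongrightarrow> z" "a \<longlonglongrightarrow> b" and w: "\<phi> t z \<in> cdom M w"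
  shows "(\<lambda>n. coord_deriv z w t (y n) (a n)) \<longlonglongrightarrow> coord_deriv z w t z b"
proof -
  obtain r B where r: "r > 0" "B > 0"
    and dom: "\<And>s y. \<bar>s - t\<bar> < r \<Longrightarrow> y \<in> ball z r \<Longrightarrow> y \<in> cdom M z \<and> \<phi> s y \<in> cdom M w \<and> \<phi> s y \<in> UNIV"
    and bd: "\<And>s y a. \<bar>s - t\<bar> < r \<Longrightarrow> y \<in> ball z r \<Longrightarrow> norm (coord_deriv z w s y a) \<le> B * norm a"
    and lip: "\<And>s y y' a. \<bar>s - t\<bar> < r \<Longrightarrow> y \<in> ball z r \<Longrightarrow> y' \<in> ball z r \<Longrightarrow>
       norm (coord_deriv z w s y a - coord_deriv z w s y' a) \<le> B * norm (chart M z y - chart M z y') * norm a"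
    using coord_deriv_local_bound[OF w open_UNIV UNIV_I] by metis
  have t: "\<bar>t - t\<bar> < r" using r by simp
  have ev: "\<forall>\<^sub>F n in sequentially. y n \<in> ball z r" using topological_tendstoD[OF y(1), of "ball z r"] r by simp
  have "(\<lambda>n. coord_deriv z w t (y n) (a n) - coord_deriv z w t z b) \<longlonglongrightarrow> 0"
  proof (rule Lim_null_comparison)
    show "\<forall>\<^sub>F n in sequentially. norm (coord_deriv z w t (y n) (a n) - coord_deriv z w t z b)
       \<le> B * norm (a n - b) + B * norm (chart M z (y n) - chart M z z) * norm b"
      using ev
    proof eventually_elim
      case (elim n)
      have l: "linear (coord_deriv z w t (y n))" using dom[OF t elim] by (intro linear_coord_deriv) auto
      have "coord_deriv z w t (y n) (a n) - coord_deriv z w t z b =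
        coord_deriv z w t (y n) (a n - b) + (coord_deriv z w t (y n) b - coord_deriv z w t z b)"
        by (simp add: linear_diff[OF l])
      also have "norm \<dots> \<le> norm (coord_deriv z w t (y n) (a n - b)) + norm (coord_deriv z w t (y n) b - coord_deriv z w t z b)"
        by (rule norm_triangle_ineq)
      also have "\<dots> \<le> B * norm (a n - b) + B * norm (chart M z (y n) - chart M z z) * norm b"
        using r by (intro add_mono bd lip t elim) auto
      finally show ?case .
    qed
    have "(\<lambda>n. chart M z (y n)) \<longlonglongrightarrow> chart M z z" by (rule isCont_tendsto_compose[OF isCont_chart y(1)]) simp
    then have "(\<lambda>n. B * norm (a n - b) + B * norm (chart M z (y n) - chart M z z) * norm b) \<longlonglongrightarrow>
       B * norm (b - b) + B * norm (chart M z z - chart M z z) * norm b"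
      by (intro tendsto_intros y)
    then show "(\<lambda>n. B * norm (a n - b) + B * norm (chart M z (y n) - chart M z z) * norm b) \<longlonglongrightarrow> 0" by simp
  qed
  then show ?thesis by (simp add: LIM_zero_iff)
qed

lemma coord_norm_tendsto:
  assumes "y \<longlonglongrightarrow> z" "a \<longlonglongrightarrow> b" "z \<in> cdom M w"
  shows "(\<lambda>n. coord_norm w (y n) (a n)) \<longlonglongrightarrow> coord_norm w z b"
proof -
  have "open (cdom M w \<times> (UNIV::'e set))" using open_cdom by (intro open_Times) auto
  then have "isCont (\<lambda>(y, a). coord_norm w y a) (z, b)"
    using continuous_on_coord_norm[of w] assms(3) by (simp add: continuous_on_eq_continuous_at)
  from isCont_tendsto_compose[OF this tendsto_Pair[OF assms(1,2)]] show ?thesis by simp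
qed

text \<open>Stretching only depends on the direction of \<open>v\<close>, and directions form a compact set.\<close>

definition stretch :: "real \<Rightarrow> 'm \<Rightarrow> 'e \<Rightarrow> real" where
  "stretch t y v = gnorm M (\<phi> t y) (mdiff M (\<phi> t) y v) / gnorm M y v"

text \<open>Convergence of tangent vectors at varying points is expressed in the chart at the limit point.\<close>

lemma stretch_tendsto:
  assumes y: "y \<longlonglongrightarrow> z" and a: "(\<lambda>n. coord_change M (y n) z (v n)) \<longlonglongrightarrow> b" and b: "b \<noteq> 0"
  shows "(\<lambda>n. stretch t (y n) (v n)) \<longlonglongrightarrow> stretch t z b" "stretch t z b > 0"
proof -
  define w where "w = \<phi> t z"
  have yt: "(\<lambda>n. \<phi> t (y n)) \<longlonglongrightarrow> w" unfolding w_def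
    using isCont_tendsto_compose[OF isCont_flow[of t z] tendsto_Pair[OF tendsto_const y]] by simp
  have wt: "\<phi> t z \<in> cdom M w" by (simp add: w_def)
  have 1: "(\<lambda>n. coord_norm z (y n) (coord_change M (y n) z (v n))) \<longlonglongrightarrow> coord_norm z z b"
    by (rule coord_norm_tendsto[OF y a]) simp
  have 2: "(\<lambda>n. coord_norm w (\<phi> t (y n)) (coord_deriv z w t (y n) (coord_change M (y n) z (v n)))) \<longlonglongrightarrow>
      coord_norm w w (coord_deriv z w t z b)"
    by (rule coord_norm_tendsto[OF yt coord_deriv_tendsto[OF y a wt]]) simp
  have pos1: "coord_norm z z b > 0" by (rule coord_norm_pos) (use b in auto)
  have cd0: "coord_deriv w z (- t) (\<phi> t z) (coord_deriv z w t z b) = b"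
    using coord_deriv_chain[of z z t w "- t" z b] by (simp add: w_def coord_deriv_id)
  have "coord_deriv z w t z b \<noteq> 0"
  proof
    assume "coord_deriv z w t z b = 0"
    moreover have "linear (coord_deriv w z (- t) (\<phi> t z))" by (rule linear_coord_deriv) (auto simp: w_def)
    ultimately show False using cd0 b by (simp add: linear_0)
  qed
  then have pos2: "coord_norm w w (coord_deriv z w t z b) > 0" by (intro coord_norm_pos) auto
  have lim: "stretch t z b = coord_norm w w (coord_deriv z w t z b) / coord_norm z z b"
    unfolding stretch_def mdiff_coord_deriv
    by (simp add: w_def coord_norm_def coord_deriv_id)
  show "stretch t z b > 0" unfolding lim using pos1 pos2 by simp
  have q: "(\<lambda>n. coord_norm w (\<phi> t (y n)) (coord_deriv z w t (y n) (coord_change M (y n) z (v n))) /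
      coord_norm z (y n) (coord_change M (y n) z (v n))) \<longlonglongrightarrow> stretch t z b"
    unfolding lim using pos1 by (intro tendsto_divide 1 2) simp
  have "\<forall>\<^sub>F n in sequentially. y n \<in> cdom M z" "\<forall>\<^sub>F n in sequentially. \<phi> t (y n) \<in> cdom M w"
    using topological_tendstoD[OF y open_cdom cdom_self] topological_tendstoD[OF yt open_cdom cdom_self] by auto
  then have "\<forall>\<^sub>F n in sequentially. coord_norm w (\<phi> t (y n)) (coord_deriv z w t (y n) (coord_change M (y n) z (v n))) /
      coord_norm z (y n) (coord_change M (y n) z (v n)) = stretch t (y n) (v n)"
    by eventually_elim (simp add: stretch_def coord_deriv_mdiff coord_norm_change)
  with q show "(\<lambda>n. stretch t (y n) (v n)) \<longlonglongrightarrow> stretch t z b"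
    by (rule Lim_transform_eventually)
qed

end

context leaf_system
begin

lemma stretch_scale: "c \<noteq> 0 \<Longrightarrow> stretch t y (c *\<^sub>R v) = stretch t y v"
  unfolding stretch_def linear_cmul[OF linear_mdiff] gnorm_scale by simp

text \<open>
  Vectors tangent to a leaf near its centre are stretched almost as some vector of the invariant bundle
  at the centre: in a continuous family of parametrizations both are images of the same vector, and the
  vectors of norm one form a compact set.
\<close>

lemma stretch_near_center:
  assumes \<sigma>: "\<sigma> > 1"
  obtains \<epsilon> where "\<epsilon> > 0" "\<And>x0 x v. x0 \<in> \<Lambda> \<Longrightarrow> x \<in> sleaf K \<epsilon> x0 \<Longrightarrow> v \<in> tleaf K x0 x \<Longrightarrow> v \<noteq> 0 \<Longrightarrow>
     \<exists>w\<in>E1 x0. w \<noteq> 0 \<and> stretch t x v \<le> \<sigma> * stretch t x0 w \<and> stretch t x0 w \<le> \<sigma> * stretch t x v"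
proof (rule ccontr)
  assume none: "\<not> thesis"
  define bad where "bad = (\<lambda>x0 x v. x0 \<in> \<Lambda> \<and> v \<in> tleaf K x0 x \<and> v \<noteq> 0 \<and>
     (\<forall>w\<in>E1 x0. w \<noteq> 0 \<longrightarrow> \<not> (stretch t x v \<le> \<sigma> * stretch t x0 w \<and> stretch t x0 w \<le> \<sigma> * stretch t x v)))"
  have "\<exists>x0 x v. x \<in> sleaf K (1 / real (Suc n)) x0 \<and> bad x0 x v" for n
    using that[of "1 / real (Suc n)"] none unfolding bad_def by (metis divide_pos_pos of_nat_0_less_iff zero_less_Suc zero_less_one)
  then obtain a x v where seq: "\<And>n. x n \<in> sleaf K (1 / real (Suc n)) (a n)" "\<And>n. bad (a n) (x n) (v n)" by metis
  have "\<forall>n. a n \<in> \<Lambda>" using seq(2) by (simp add: bad_def)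
  then obtain z s where z: "z \<in> \<Lambda>" "strict_mono s" "(a \<circ> s) \<longlonglongrightarrow> z"
    using compact_Lambda unfolding compact_def by blast
  have xz: "(x \<circ> s) \<longlonglongrightarrow> z"
  proof -
    have "(\<lambda>n. dist (a (s n)) (x (s n))) \<longlonglongrightarrow> 0"
    proof (rule tendsto_sandwich[OF _ _ tendsto_const])
      have "(\<lambda>n. 1 / real (Suc n)) \<longlonglongrightarrow> 0" by (rule LIMSEQ_inverse_real_of_nat[unfolded inverse_eq_divide])
      from LIMSEQ_subseq_LIMSEQ[OF this z(2)] show "(\<lambda>n. 1 / real (Suc (s n))) \<longlonglongrightarrow> 0" by (simp add: o_def)
      show "\<forall>\<^sub>F n in sequentially. dist (a (s n)) (x (s n)) \<le> 1 / real (Suc (s n))"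
        by (intro always_eventually allI sleaf_dist seq)
    qed simp
    moreover have "(\<lambda>n. dist (a (s n)) z) \<longlonglongrightarrow> 0"
      using iffD1[OF tendsto_dist_iff z(3)] by (simp add: o_def)
    ultimately have "(\<lambda>n. dist (a (s n)) (x (s n)) + dist (a (s n)) z) \<longlonglongrightarrow> 0 + 0" by (rule tendsto_add)
    then have lim: "(\<lambda>n. dist (a (s n)) (x (s n)) + dist (a (s n)) z) \<longlonglongrightarrow> 0" by simp
    have "(\<lambda>n. dist (x (s n)) z) \<longlonglongrightarrow> 0"
    proof (rule tendsto_sandwich[OF _ _ tendsto_const lim])
      show "\<forall>\<^sub>F n in sequentially. dist (x (s n)) z \<le> dist (a (s n)) (x (s n)) + dist (a (s n)) z"
        by (intro always_eventually allI) (metis dist_triangle3 dist_commute add.commute dist_triangle)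
    qed simp
    then have "(\<lambda>n. x (s n)) \<longlonglongrightarrow> z" by (rule iffD2[OF tendsto_dist_iff])
    then show ?thesis by (simp add: o_def)
  qed
  have "continuous_disc_family K \<Lambda> (leaf K)" using unstable_leaves by (simp add: unstable_subfamily_def)
  note ex = this[unfolded continuous_disc_family_def, THEN bspec, OF z(1)]
  from ex obtain N V \<Theta> where fam: "open N \<and> z \<in> N \<and> subspace (V :: 'e set) \<and>
     (\<forall>x\<in>N \<inter> \<Lambda>. disc_param K V (\<Theta> x) (leaf K x) \<and> \<Theta> x 0 = x) \<and>
     continuous_on ((N \<inter> \<Lambda>) \<times> disc V) (\<lambda>(x, v). \<Theta> x v) \<and>
     (\<forall>y. \<exists>f' f''.
        (\<forall>x\<in>N \<inter> \<Lambda>. derivs2_on (chart K y \<circ> \<Theta> x) {v\<in>disc V. \<Theta> x v \<in> cdom K y} (f' x) (f'' x)) \<and>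
        continuous_on {(x, v). x \<in> N \<inter> \<Lambda> \<and> v \<in> disc V \<and> \<Theta> x v \<in> cdom K y} (\<lambda>(x, v). f' x v) \<and>
        continuous_on {(x, v). x \<in> N \<inter> \<Lambda> \<and> v \<in> disc V \<and> \<Theta> x v \<in> cdom K y} (\<lambda>(x, v). f'' x v))"
    by (elim exE) (rule that)
  then have N: "open N" "z \<in> N" "subspace V"
    and par: "\<And>y. y \<in> N \<inter> \<Lambda> \<Longrightarrow> disc_param K V (\<Theta> y) (leaf K y) \<and> \<Theta> y 0 = y"
    and cont: "continuous_on ((N \<inter> \<Lambda>) \<times> disc V) (\<lambda>(x, v). \<Theta> x v)"
    by blast+
  note der = fam[THEN conjunct2, THEN conjunct2, THEN conjunct2, THEN conjunct2, THEN conjunct2]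
  obtain f' f'' where f': "\<And>x. x \<in> N \<inter> \<Lambda> \<Longrightarrow> derivs2_on (chart K z \<circ> \<Theta> x) {v\<in>disc V. \<Theta> x v \<in> cdom K z} (f' x) (f'' x)"
    and f'_cont: "continuous_on {(x, v). x \<in> N \<inter> \<Lambda> \<and> v \<in> disc V \<and> \<Theta> x v \<in> cdom K z} (\<lambda>(x, v). f' x v)"
    using der[rule_format, of z] by blast
  obtain n0 where n0: "\<And>n. n \<ge> n0 \<Longrightarrow> a (s n) \<in> N"
    using topological_tendstoD[OF z(3) N(1,2)] unfolding eventually_sequentially by auto
  define a1 x1 v1 where "a1 = (\<lambda>n. a (s (n + n0)))" and "x1 = (\<lambda>n. x (s (n + n0)))" and "v1 = (\<lambda>n. v (s (n + n0)))"
  have lim1: "a1 \<longlonglongrightarrow> z" "x1 \<longlonglongrightarrow> z"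
    using LIMSEQ_ignore_initial_segment[OF z(3), of n0] LIMSEQ_ignore_initial_segment[OF xz, of n0]
    by (simp_all add: a1_def x1_def o_def)
  have a1: "a1 n \<in> N \<inter> \<Lambda>" and bad1: "bad (a1 n) (x1 n) (v1 n)" and x1: "x1 n \<in> leaf K (a1 n)" for n
    using n0[of "n + n0"] seq[of "s (n + n0)"] by (auto simp: a1_def x1_def v1_def bad_def intro: sleaf_leaf)
  have W: "disc_param K V (\<Theta> (a1 n)) (leaf K (a1 n))" "\<Theta> (a1 n) 0 = a1 n" for n using par[OF a1] by auto
  note p = disc_param_piece[OF W(1)]
  have piece: "C2_into K (disc V) (\<Theta> (a1 n))" "solid_in V (disc V)"
    "q \<in> disc V \<Longrightarrow> inj_on (diff_into K (disc V) (\<Theta> (a1 n)) q) V" for n q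
    using p(1)[of n] by (auto simp: embedded_piece_def)
  have ex: "\<exists>q h. q \<in> disc V \<and> \<Theta> (a1 n) q = x1 n \<and> h \<in> V \<inter> sphere 0 1 \<and>
     (\<exists>c. c \<noteq> 0 \<and> v1 n = c *\<^sub>R diff_into K (disc V) (\<Theta> (a1 n)) q h)" for n
  proof -
    obtain q where q: "q \<in> disc V" "\<Theta> (a1 n) q = x1 n" using x1[of n] p(2)[of n] by auto
    have "v1 n \<in> tangent_at K (leaf K (a1 n)) (\<Theta> (a1 n) q)" "v1 n \<noteq> 0"
      using bad1[of n] q(2) by (auto simp: bad_def tleaf_def)
    then obtain h where h: "h \<in> V" "v1 n = diff_into K (disc V) (\<Theta> (a1 n)) q h"
      unfolding tangent_at_param[OF W(1) q(1)] by blast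
    note l = linear_diff_into[OF piece(1)[of n] q(1)]
    have h0: "h \<noteq> 0" using \<open>v1 n \<noteq> 0\<close> h(2) linear_0[OF l] by auto
    have "v1 n = norm h *\<^sub>R diff_into K (disc V) (\<Theta> (a1 n)) q ((1 / norm h) *\<^sub>R h)"
      unfolding h(2) linear_cmul[OF l] using h0 by simp
    moreover have "(1 / norm h) *\<^sub>R h \<in> V \<inter> sphere 0 1" using h(1) N(3) h0 by (simp add: subspace_scale)
    moreover have "norm h \<noteq> 0" using h0 by simp
    ultimately show ?thesis using q by blast
  qed
  obtain q h c where q: "\<And>n. q n \<in> disc V" "\<And>n. \<Theta> (a1 n) (q n) = x1 n" and h: "\<And>n. h n \<in> V \<inter> sphere 0 1"
    and c: "\<And>n. c n \<noteq> 0" "\<And>n. v1 n = c n *\<^sub>R diff_into K (disc V) (\<Theta> (a1 n)) (q n) (h n)"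
    using ex by metis
  have "compact (disc V \<times> (V \<inter> sphere 0 1))"
  proof (intro compact_Times)
    show "compact (disc V)" using p(1)[of 0] by (simp add: embedded_piece_def)
    show "compact (V \<inter> sphere 0 1)" using closed_subspace[OF N(3)] by (intro closed_Int_compact) auto
  qed
  moreover have "\<forall>n. (q n, h n) \<in> disc V \<times> (V \<inter> sphere 0 1)" using q(1) h by blast
  ultimately have "\<exists>l\<in>disc V \<times> (V \<inter> sphere 0 1). \<exists>r. strict_mono r \<and> ((\<lambda>n. (q n, h n)) \<circ> r) \<longlonglongrightarrow> l"
    unfolding compact_def by (elim allE[of _ "\<lambda>n. (q n, h n)"]) simp
  then obtain l r where lr: "l \<in> disc V \<times> (V \<inter> sphere 0 1)" "strict_mono r" "((\<lambda>n. (q n, h n)) \<circ> r) \<longlonglongrightarrow> l"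
    by blast
  obtain ql hl where l: "l = (ql, hl)" by (cases l)
  have qlim: "(\<lambda>n. q (r n)) \<longlonglongrightarrow> ql" and hlim: "(\<lambda>n. h (r n)) \<longlonglongrightarrow> hl"
    using tendsto_fst[OF lr(3)] tendsto_snd[OF lr(3)] by (simp_all add: l o_def)
  have lims: "(\<lambda>n. a1 (r n)) \<longlonglongrightarrow> z" "(\<lambda>n. x1 (r n)) \<longlonglongrightarrow> z"
    using LIMSEQ_subseq_LIMSEQ[OF lim1(1) lr(2)] LIMSEQ_subseq_LIMSEQ[OF lim1(2) lr(2)] by (simp_all add: o_def)
  have zN: "z \<in> N \<inter> \<Lambda>" using N z(1) by blast
  have z0: "0 \<in> disc V" by (rule solid_in_zero[OF piece(2)])
  have hV: "hl \<in> V" "norm hl = 1" and qV: "ql \<in> disc V" using lr(1) by (auto simp: l)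
  \<comment> \<open>The points and the centres have the same limit \<open>z\<close>, whose only parameter in its leaf is \<open>0\<close>.\<close>
  have "ql = 0"
  proof -
    have "(\<lambda>n. (\<lambda>(x, v). \<Theta> x v) (a1 (r n), q (r n))) \<longlonglongrightarrow> (\<lambda>(x, v). \<Theta> x v) (z, ql)"
      by (rule continuous_on_tendsto_compose[OF cont tendsto_Pair[OF lims(1) qlim]])
        (use a1 q(1) zN qV in \<open>auto intro!: always_eventually\<close>)
    then have "(\<lambda>n. x1 (r n)) \<longlonglongrightarrow> \<Theta> z ql" by (simp add: q(2))
    then have "z = \<Theta> z ql" by (rule LIMSEQ_unique[OF lims(2)])
    then have "\<Theta> z ql = \<Theta> z 0" using conjunct2[OF par[OF zN]] by metis
    moreover have "inj_on (\<Theta> z) (disc V)" using par[OF zN] by (simp add: disc_param_def)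
    ultimately show ?thesis using qV z0 by (simp add: inj_on_eq_iff)
  qed
  define b where "b = blinfun_apply (f' z 0) hl"
  \<comment> \<open>In the chart at \<open>z\<close> the derivative of a parametrization is the continuous family \<open>f'\<close>.\<close>
  have agree: "coord_change K (\<Theta> y u) z (diff_into K (disc V) (\<Theta> y) u k) = f' y u k"
    if y: "y \<in> N \<inter> \<Lambda>" "u \<in> disc V" "\<Theta> y u \<in> cdom K z" "k \<in> V" for y u k
  proof -
    have C2: "C2_into K (disc V) (\<Theta> y)" using par[OF y(1)] by (simp add: disc_param_def)
    obtain U where U: "open U" "u \<in> U" "\<And>w. w \<in> U \<Longrightarrow> w \<noteq> u \<Longrightarrow> w \<in> disc V \<Longrightarrow> \<Theta> y w \<in> cdom K z"
      using chart_dom_eventually[OF C2_into_continuous_on[OF C2] y(2,3)] unfolding eventually_at_topological by auto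
    have "at u within {v\<in>disc V. \<Theta> y v \<in> cdom K z} = at u within disc V"
      by (rule at_within_nhd[OF U(2,1)]) (use U(3) in auto)
    then have "((chart K z \<circ> \<Theta> y) has_derivative f' y u) (at u within disc V)"
      using f'[OF y(1)] y(2,3) unfolding derivs2_on_def by auto
    moreover have "((chart K z \<circ> \<Theta> y) has_derivative (\<lambda>a. coord_change K (\<Theta> y u) z (diff_into K (disc V) (\<Theta> y) u a))) (at u within disc V)"
      using piece_derivative[OF C2 y(2,3)] by (simp add: o_def)
    ultimately show ?thesis using derivative_unique_on_solid[OF piece(2) y(2,4)] by metis
  qed
  have b0: "b \<noteq> 0"
  proof
    assume "b = 0"
    have C2: "C2_into K (disc V) (\<Theta> z)" "inj_on (diff_into K (disc V) (\<Theta> z) 0) V" "\<Theta> z 0 = z"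
      using par[OF zN] z0 by (auto simp: disc_param_def)
    have "coord_change K z z (diff_into K (disc V) (\<Theta> z) 0 hl) = 0"
      using agree[OF zN z0 _ hV(1)] \<open>b = 0\<close> C2(3) by (simp add: b_def)
    then have "diff_into K (disc V) (\<Theta> z) 0 hl = diff_into K (disc V) (\<Theta> z) 0 0"
      using linear_0[OF linear_diff_into[OF C2(1) z0]] by (simp add: coord_change_coord_deriv coord_deriv_id)
    then have "hl = 0" using C2(2) hV(1) subspace_0[OF N(3)] by (simp add: inj_on_eq_iff)
    then show False using hV(2) by simp
  qed
  have conv: "(\<lambda>n. coord_change K (\<Theta> (a1 (r n)) (u n)) z (diff_into K (disc V) (\<Theta> (a1 (r n))) (u n) (h (r n)))) \<longlonglongrightarrow> b"
    if u: "\<And>n. u n \<in> disc V" "u \<longlonglongrightarrow> 0" and y: "(\<lambda>n. \<Theta> (a1 (r n)) (u n)) \<longlonglongrightarrow> z" for u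
  proof -
    define S where "S = {(x, v). x \<in> N \<inter> \<Lambda> \<and> v \<in> disc V \<and> \<Theta> x v \<in> cdom K z}"
    have ev: "\<forall>\<^sub>F n in sequentially. \<Theta> (a1 (r n)) (u n) \<in> cdom K z"
      using topological_tendstoD[OF y open_cdom cdom_self] .
    then have "\<forall>\<^sub>F n in sequentially. (a1 (r n), u n) \<in> S"
      by eventually_elim (use a1 u(1) in \<open>auto simp: S_def\<close>)
    moreover have "(z, 0) \<in> S" using zN z0 par[OF zN] by (auto simp: S_def)
    ultimately have "(\<lambda>n. (\<lambda>(x, v). f' x v) (a1 (r n), u n)) \<longlonglongrightarrow> (\<lambda>(x, v). f' x v) (z, 0)"
      by (intro continuous_on_tendsto_compose[OF f'_cont[folded S_def] tendsto_Pair[OF lims(1) u(2)]])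
    then have "(\<lambda>n. blinfun_apply (f' (a1 (r n)) (u n)) (h (r n))) \<longlonglongrightarrow> b"
      unfolding b_def by (intro blinfun.tendsto hlim) simp
    moreover have "\<forall>\<^sub>F n in sequentially. blinfun_apply (f' (a1 (r n)) (u n)) (h (r n)) =
       coord_change K (\<Theta> (a1 (r n)) (u n)) z (diff_into K (disc V) (\<Theta> (a1 (r n))) (u n) (h (r n)))"
      using ev by eventually_elim (use a1 u(1) h in \<open>auto simp: agree\<close>)
    ultimately show ?thesis by (rule Lim_transform_eventually)
  qed
  \<comment> \<open>The images at the centre of the vectors of parameters whose images at the points are bad: both
      sequences of images converge to \<open>b\<close>, and so do their stretching factors to that of \<open>b\<close>.\<close>
  define w where "w = (\<lambda>n. diff_into K (disc V) (\<Theta> (a1 (r n))) 0 (h (r n)))"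
  define v' where "v' = (\<lambda>n. diff_into K (disc V) (\<Theta> (a1 (r n))) (q (r n)) (h (r n)))"
  have "(\<lambda>n. stretch t (x1 (r n)) (v' n)) \<longlonglongrightarrow> stretch t z b" and pos: "stretch t z b > 0"
    using stretch_tendsto[OF lims(2) _ b0, of v' t] conv[of "\<lambda>n. q (r n)"] q qlim lims(2)
    by (simp_all add: v'_def \<open>ql = 0\<close>)
  moreover have "stretch t (x1 (r n)) (v' n) = stretch t (x1 (r n)) (v1 (r n))" for n
    unfolding c(2)[of "r n"] v'_def by (rule stretch_scale[OF c(1), symmetric])
  ultimately have s1: "(\<lambda>n. stretch t (x1 (r n)) (v1 (r n))) \<longlonglongrightarrow> stretch t z b" by simp
  have s2: "(\<lambda>n. stretch t (a1 (r n)) (w n)) \<longlonglongrightarrow> stretch t z b"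
    using stretch_tendsto(1)[OF lims(1) _ b0, of w t] conv[of "\<lambda>n. 0"] z0 lims(1)
    by (simp add: w_def W(2))
  have lt: "stretch t z b < \<sigma> * stretch t z b" using pos \<sigma> by simp
  have gap: "\<forall>\<^sub>F n in sequentially. f n \<le> \<sigma> * g n"
    if "f \<longlonglongrightarrow> stretch t z b" "g \<longlonglongrightarrow> stretch t z b" for f g :: "nat \<Rightarrow> real"
  proof -
    have "(\<lambda>n. \<sigma> * g n - f n) \<longlonglongrightarrow> \<sigma> * stretch t z b - stretch t z b" by (intro tendsto_intros that)
    from order_tendstoD(1)[OF this, of 0] show ?thesis using lt by (auto elim: eventually_mono)
  qed
  have "\<forall>\<^sub>F n in sequentially. False"
    using gap[OF s1 s2] gap[OF s2 s1]
  proof eventually_elim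
    case (elim n)
    have "w n \<in> tangent_at K (leaf K (a1 (r n))) (\<Theta> (a1 (r n)) 0)"
      unfolding w_def tangent_at_param[OF W(1) z0] using h by blast
    then have "w n \<in> E1 (a1 (r n))" using tleaf_center a1 by (simp add: W(2) tleaf_def)
    moreover have "w n \<noteq> 0"
    proof
      assume "w n = 0"
      then have "diff_into K (disc V) (\<Theta> (a1 (r n))) 0 (h (r n)) = diff_into K (disc V) (\<Theta> (a1 (r n))) 0 0"
        using linear_0[OF linear_diff_into[OF piece(1) z0]] by (simp add: w_def)
      then have "h (r n) = 0" using piece(3)[OF z0] h subspace_0[OF N(3)] by (meson IntD1 inj_on_eq_iff)
      then show False using h[of "r n"] by simp
    qed
    ultimately show False using bad1[of "r n"] elim by (auto simp: bad_def)
  qed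
  then show False by simp
qed

end

section \<open>Uniform rates and the chain along a backward orbit\<close>

context leaf_system
begin

abbreviation pt :: "nat \<Rightarrow> 'm \<Rightarrow> 'm" where "pt k y \<equiv> fiter K (- int k) y"

lemma pt_flow: "pt k y = flow K (- (real k * time K)) y" by (simp add: fiter_def)

lemma pt_0 [simp]: "pt 0 y = y" unfolding pt_flow by simp

lemma pt_1: "pt 1 y = flow K (- time K) y" unfolding pt_flow by simp

lemma flow_pt: "flow K (- s) (pt k y) = flow K (- (s + real k * time K)) y"
  by (simp add: pt_flow flow_add[symmetric])

lemma pt_Suc: "flow K (- time K) (pt k y) = pt (Suc k) y"
  unfolding flow_pt unfolding pt_flow by (simp add: algebra_simps)

lemma time_nonneg: "0 \<le> time K" "0 \<le> real k * time K" using t0(1) by auto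

lemma pt_Lambda: "x0 \<in> \<Lambda> \<Longrightarrow> pt k x0 \<in> \<Lambda>"
  unfolding pt_flow by (rule flow_Lambda)

lemma pt_sleaf: "x0 \<in> \<Lambda> \<Longrightarrow> x \<in> sleaf K r x0 \<Longrightarrow> pt k x \<in> sleaf K r (pt k x0)"
  unfolding pt_flow by (rule sleaf_backward[OF _ time_nonneg(2)])

lemma \<alpha>_pos: "\<alpha> > 0" and \<alpha>_le_\<beta>: "\<alpha> \<le> \<beta>"
  using lupc by (simp_all add: LUPC_def)

lemma \<gamma>_pos: "\<gamma> > 0" using t0(2) C by simp

text \<open>
  The growth conditions concern forward times, hence the base point of the image and not \<open>x0\<close> itself.
  A vector that the backward flow takes to \<open>w\<close> contracts by the factor by which the forward flow stretches
  \<open>w\<close>, and this is up to \<open>3 / 2\<close> the factor of a vector of the invariant bundle at that base point.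
\<close>

lemma center_rates:
  obtains \<epsilon> where "\<epsilon> > 0" "\<And>x0 x. x0 \<in> \<Lambda> \<Longrightarrow> x \<in> sleaf K \<epsilon> x0 \<Longrightarrow>
     \<exists>\<alpha>1 \<beta>1. \<alpha> \<le> \<alpha>1 \<and> \<alpha>1 \<le> \<beta>1 \<and> \<beta>1 \<le> \<beta> \<and> \<alpha> \<le> 2 * \<alpha>1 - \<beta>1 \<and> (\<forall>v\<in>tleaf K x0 x.
       gnorm K (pt 1 x) (mdiff K (flow K (- time K)) x v) \<le> 3 / 2 * C * exp (- \<alpha>1 * time K) * gnorm K x v \<and>
       gnorm K x v \<le> 3 / 2 * C * exp (\<beta>1 * time K) * gnorm K (pt 1 x) (mdiff K (flow K (- time K)) x v))"
proof -
  obtain \<epsilon> where \<epsilon>: "\<epsilon> > 0" and near: "\<And>x0 x v. x0 \<in> \<Lambda> \<Longrightarrow> x \<in> sleaf K \<epsilon> x0 \<Longrightarrow> v \<in> tleaf K x0 x \<Longrightarrow> v \<noteq> 0 \<Longrightarrow>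
     \<exists>w\<in>E1 x0. w \<noteq> 0 \<and> stretch (time K) x v \<le> (3 / 2) * stretch (time K) x0 w \<and> stretch (time K) x0 w \<le> (3 / 2) * stretch (time K) x v"
    using stretch_near_center[of "3 / 2" "time K"] by auto
  show ?thesis
  proof (rule that[OF \<epsilon>])
    fix x0 x assume x0: "x0 \<in> \<Lambda>" and x: "x \<in> sleaf K \<epsilon> x0"
    define y0 y where "y0 = pt 1 x0" and "y = pt 1 x"
    have y0': "y0 = flow K (- time K) x0" and y': "y = flow K (- time K) x" unfolding y0_def y_def pt_1 by simp_all
    have y0: "y0 \<in> \<Lambda>" and y: "y \<in> sleaf K \<epsilon> y0"
      unfolding y0_def y_def by (rule pt_Lambda[OF x0], rule pt_sleaf[OF x0 x])
    have "\<forall>x\<in>\<Lambda>. \<exists>\<alpha>1 \<beta>1. \<alpha> \<le> \<alpha>1 \<and> \<alpha>1 \<le> \<beta>1 \<and> \<beta>1 \<le> \<beta> \<and> 2 * \<alpha>1 - \<beta>1 \<ge> \<alpha> \<and>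
        (\<forall>u\<in>E1 x. \<forall>t>0. 1 / C * exp (\<alpha>1 * t) * gnorm K x u \<le> gnorm K (flow K t x) (mdiff K (flow K t) x u) \<and>
           gnorm K (flow K t x) (mdiff K (flow K t) x u) \<le> C * exp (\<beta>1 * t) * gnorm K x u)"
      using lupc unfolding LUPC_def by blast
    then obtain \<alpha>1 \<beta>1 where r: "\<alpha> \<le> \<alpha>1" "\<alpha>1 \<le> \<beta>1" "\<beta>1 \<le> \<beta>" "\<alpha> \<le> 2 * \<alpha>1 - \<beta>1"
      and E: "\<And>u. u \<in> E1 y0 \<Longrightarrow> 1 / C * exp (\<alpha>1 * time K) * gnorm K y0 u \<le> gnorm K (flow K (time K) y0) (mdiff K (flow K (time K)) y0 u)"
        "\<And>u. u \<in> E1 y0 \<Longrightarrow> gnorm K (flow K (time K) y0) (mdiff K (flow K (time K)) y0 u) \<le> C * exp (\<beta>1 * time K) * gnorm K y0 u"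
      using y0 t0(1) by metis
    have "gnorm K y (mdiff K (flow K (- time K)) x v) \<le> 3 / 2 * C * exp (- \<alpha>1 * time K) * gnorm K x v \<and>
       gnorm K x v \<le> 3 / 2 * C * exp (\<beta>1 * time K) * gnorm K y (mdiff K (flow K (- time K)) x v)"
      if v: "v \<in> tleaf K x0 x" for v
    proof (cases "v = 0")
      case True
      then show ?thesis by (simp add: linear_0[OF linear_mdiff])
    next
      case False
      define w where "w = mdiff K (flow K (- time K)) x v"
      have w: "w \<in> tleaf K y0 y" unfolding w_def y0' y'
        using mdiff_tleaf[OF x0 time_nonneg(1) sleaf_leaf[OF x]] v by blast
      have w0: "w \<noteq> 0" using False inj_mdiff[of "- time K" x] linear_0[OF linear_mdiff] unfolding w_def inj_def by metis
      have ret: "flow K (time K) y = x" "mdiff K (flow K (time K)) y w = v" by (simp_all add: y' w_def)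
      have g: "gnorm K y w > 0" using gnorm_ge0[of y w] gnorm_eq_0[of y w] w0 by linarith
      obtain e where e: "e \<in> E1 y0" "e \<noteq> 0" "stretch (time K) y w \<le> (3 / 2) * stretch (time K) y0 e"
        "stretch (time K) y0 e \<le> (3 / 2) * stretch (time K) y w" using near[OF y0 y w w0] by blast
      have ge: "gnorm K y0 e > 0" using gnorm_ge0[of y0 e] gnorm_eq_0[of y0 e] e(2) by linarith
      have s: "1 / C * exp (\<alpha>1 * time K) \<le> stretch (time K) y0 e" "stretch (time K) y0 e \<le> C * exp (\<beta>1 * time K)"
        using E[OF e(1)] ge unfolding stretch_def by (simp_all only: pos_le_divide_eq pos_divide_le_eq)
      have sw: "stretch (time K) y w = gnorm K x v / gnorm K y w" by (simp add: stretch_def ret)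
      have "gnorm K x v / gnorm K y w \<le> 3 / 2 * (C * exp (\<beta>1 * time K))" using e(3) s(2) unfolding sw by linarith
      then have 1: "gnorm K x v \<le> 3 / 2 * C * exp (\<beta>1 * time K) * gnorm K y w" using g by (simp add: pos_divide_le_eq mult.assoc)
      have "1 / C * exp (\<alpha>1 * time K) \<le> 3 / 2 * (gnorm K x v / gnorm K y w)" using e(4) s(1) unfolding sw by linarith
      then have "1 / C * exp (\<alpha>1 * time K) * gnorm K y w \<le> 3 / 2 * gnorm K x v" using g by (simp add: field_simps)
      then have "C * exp (- \<alpha>1 * time K) * (1 / C * exp (\<alpha>1 * time K) * gnorm K y w) \<le> C * exp (- \<alpha>1 * time K) * (3 / 2 * gnorm K x v)"
        using C by (intro mult_left_mono) auto
      moreover have "C * exp (- \<alpha>1 * time K) * (1 / C * exp (\<alpha>1 * time K) * gnorm K y w) = gnorm K y w"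
        using C by (simp add: exp_minus)
      ultimately have 2: "gnorm K y w \<le> 3 / 2 * C * exp (- \<alpha>1 * time K) * gnorm K x v" by simp
      show ?thesis using 1 2 by (simp add: w_def)
    qed
    then show "\<exists>\<alpha>1 \<beta>1. \<alpha> \<le> \<alpha>1 \<and> \<alpha>1 \<le> \<beta>1 \<and> \<beta>1 \<le> \<beta> \<and> \<alpha> \<le> 2 * \<alpha>1 - \<beta>1 \<and> (\<forall>v\<in>tleaf K x0 x.
       gnorm K (pt 1 x) (mdiff K (flow K (- time K)) x v) \<le> 3 / 2 * C * exp (- \<alpha>1 * time K) * gnorm K x v \<and>
       gnorm K x v \<le> 3 / 2 * C * exp (\<beta>1 * time K) * gnorm K (pt 1 x) (mdiff K (flow K (- time K)) x v))"
      using r unfolding y_def by blast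
  qed
qed

text \<open>
  One link of a \<open>contraction_chain\<close>: the rates may vary from point to point, while \<open>Q\<close> bounds
  \<open>1 / \<mu>\<close> uniformly.
\<close>

definition uniform_step :: "real \<Rightarrow> real \<Rightarrow> real \<Rightarrow> 'm \<Rightarrow> 'm \<Rightarrow> ('e \<Rightarrow> 'e \<Rightarrow> 'e) \<Rightarrow> real \<Rightarrow> real \<Rightarrow> bool" where
  "uniform_step \<rho> D Q x0 x g' \<kappa> \<mu> \<longleftrightarrow> 0 \<le> \<kappa> \<and> \<kappa> \<le> 1 \<and> 0 < \<mu> \<and> 1 / \<mu> \<le> Q \<and> \<kappa>\<^sup>2 / \<mu> \<le> \<gamma> \<and>
     (\<forall>u\<in>tball K x0 x \<rho>. (phihat K x0 x (- time K) has_derivative g' u) (at u within tball K x0 x \<rho>) \<and>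
        phihat K x0 x (- time K) u \<in> tleaf K (pt 1 x0) (pt 1 x) \<and>
        (\<forall>v\<in>tleaf K x0 x. g' u v \<in> tleaf K (pt 1 x0) (pt 1 x) \<and> g' 0 v = mdiff K (flow K (- time K)) x v \<and>
           gnorm K (pt 1 x) (g' u v) \<le> \<kappa> * gnorm K x v \<and> \<mu> * gnorm K x v \<le> gnorm K (pt 1 x) (g' 0 v) \<and>
           (\<forall>u'\<in>tball K x0 x \<rho>. gnorm K (pt 1 x) (g' u v - g' u' v) \<le> D * gnorm K x (u - u') * gnorm K x v)))"

text \<open>
  With \<open>\<alpha>1\<close>, \<open>\<beta>1\<close> the rates of the base point of the image, the contraction rate on a small ball is
  \<open>2 C exp (- \<alpha>1 t0)\<close> and the contraction of the linear part is at least \<open>exp (- \<beta>1 t0) / (2 C)\<close>; the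
  condition on \<open>2 \<alpha>1 - \<beta>1\<close> is exactly what makes the first one squared small relative to the second.
\<close>

lemma uniform_step_exists:
  assumes D: "D > 0" and control: "\<And>y0. y0 \<in> \<Lambda> \<Longrightarrow> backward_control D (time K, y0)"
  obtains \<epsilon> where "\<epsilon> > 0" "\<epsilon> \<le> 1 / D" "\<And>\<rho> x0 x. 0 < \<rho> \<Longrightarrow> \<rho> \<le> \<epsilon> \<Longrightarrow> x0 \<in> \<Lambda> \<Longrightarrow> x \<in> sleaf K \<epsilon> x0 \<Longrightarrow>
     \<exists>g' \<kappa> \<mu>. uniform_step \<rho> D (2 * C * exp (\<beta> * time K)) x0 x g' \<kappa> \<mu>"
proof -
  obtain \<epsilon>1 where \<epsilon>1: "\<epsilon>1 > 0" and rates: "\<And>x0 x. x0 \<in> \<Lambda> \<Longrightarrow> x \<in> sleaf K \<epsilon>1 x0 \<Longrightarrow>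
     \<exists>\<alpha>1 \<beta>1. \<alpha> \<le> \<alpha>1 \<and> \<alpha>1 \<le> \<beta>1 \<and> \<beta>1 \<le> \<beta> \<and> \<alpha> \<le> 2 * \<alpha>1 - \<beta>1 \<and> (\<forall>v\<in>tleaf K x0 x.
       gnorm K (pt 1 x) (mdiff K (flow K (- time K)) x v) \<le> 3 / 2 * C * exp (- \<alpha>1 * time K) * gnorm K x v \<and>
       gnorm K x v \<le> 3 / 2 * C * exp (\<beta>1 * time K) * gnorm K (pt 1 x) (mdiff K (flow K (- time K)) x v))"
    using center_rates by metis
  define b where "b = C * exp (- \<beta> * time K) / (2 * D)"
  have b: "b > 0" using C D by (simp add: b_def)
  define \<epsilon> where "\<epsilon> = min (min \<epsilon>1 (1 / D)) b"
  have \<epsilon>: "\<epsilon> > 0" "\<epsilon> \<le> \<epsilon>1" "\<epsilon> \<le> 1 / D" "\<epsilon> \<le> b" using \<epsilon>1 D b by (auto simp: \<epsilon>_def)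
  show ?thesis
  proof (rule that[OF \<epsilon>(1,3)])
    fix \<rho> x0 x assume \<rho>: "0 < \<rho>" "\<rho> \<le> \<epsilon>" and x0: "x0 \<in> \<Lambda>" and x: "x \<in> sleaf K \<epsilon> x0"
    have \<rho>D: "\<rho> \<le> 1 / D" using \<rho>(2) \<epsilon>(3) by simp
    have xl: "x \<in> leaf K x0" using x by (rule sleaf_leaf)
    define y0 y where "y0 = pt 1 x0" and "y = pt 1 x"
    have y0': "flow K (- time K) x0 = y0" and y': "flow K (- time K) x = y" unfolding y0_def y_def pt_1 by simp_all
    obtain \<alpha>1 \<beta>1 where r: "\<alpha> \<le> \<alpha>1" "\<alpha>1 \<le> \<beta>1" "\<beta>1 \<le> \<beta>" "\<alpha> \<le> 2 * \<alpha>1 - \<beta>1"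
      and lin: "\<And>v. v \<in> tleaf K x0 x \<Longrightarrow> gnorm K y (mdiff K (flow K (- time K)) x v) \<le> 3 / 2 * C * exp (- \<alpha>1 * time K) * gnorm K x v"
        "\<And>v. v \<in> tleaf K x0 x \<Longrightarrow> gnorm K x v \<le> 3 / 2 * C * exp (\<beta>1 * time K) * gnorm K y (mdiff K (flow K (- time K)) x v)"
      using rates[OF x0 sleaf_mono[OF x \<epsilon>(2)]] unfolding y_def by blast
    define S where "S = tball K x0 x \<rho>"
    have sub: "S \<subseteq> tball K x0 x (1 / D)" unfolding S_def using \<rho>D by (auto intro: tball_mono)
    have S0: "0 \<in> S" unfolding S_def using zero_in_tball[OF x0 xl] \<rho>(1) by simp
    obtain g' where "controlled_derivative D (1 / D) (time K) x0 x g'"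
      using control[OF x0] x0 time_nonneg(1) sleaf_mono[OF x \<epsilon>(3)] unfolding backward_control_def by blast
    note ctl = controlled_derivativeD[OF this, unfolded y0' y']
    have der: "(phihat K x0 x (- time K) has_derivative g' u) (at u within tball K x0 x (1 / D))"
      and g'V: "g' u v \<in> tleaf K y0 y" if "u \<in> S" for u v
      using ctl(2,3) that sub by auto
    have g'0: "g' 0 v = mdiff K (flow K (- time K)) x v" if "v \<in> tleaf K x0 x" for v
      using ctl(4)[OF _ that] S0 sub by auto
    have lip: "gnorm K y (g' u v - g' u' v) \<le> D * gnorm K x (u - u') * gnorm K x v"
      if "u \<in> S" "u' \<in> S" "v \<in> tleaf K x0 x" for u u' v
      using ctl(6) that sub by blast
    define \<kappa> where "\<kappa> = 2 * C * exp (- \<alpha>1 * time K)"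
    define \<mu> where "\<mu> = exp (- \<beta>1 * time K) / (2 * C)"
    have ph: "phihat K x0 x (- time K) u \<in> tleaf K y0 y" if "u \<in> S" for u
      using phihat_inverse(2)[OF ctl(1)] that sub by (auto simp: y0' y' tball_def)
    have contr: "gnorm K y (g' u v) \<le> \<kappa> * gnorm K x v" if u: "u \<in> S" and v: "v \<in> tleaf K x0 x" for u v
    proof -
      have "gnorm K y (g' u v) \<le> gnorm K y (g' u v - g' 0 v) + gnorm K y (g' 0 v)"
        unfolding gnorm_form_norm using form_norm_triangle[OF inner_form_metric, of y "g' u v - g' 0 v" "g' 0 v"] by simp
      also have "\<dots> \<le> D * gnorm K x u * gnorm K x v + 3 / 2 * C * exp (- \<alpha>1 * time K) * gnorm K x v"
        using lip[OF u S0 v] lin(1)[OF v] by (simp add: g'0[OF v])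
      also have "\<dots> = (D * gnorm K x u + 3 / 2 * C * exp (- \<alpha>1 * time K)) * gnorm K x v" by (simp add: algebra_simps)
      also have "\<dots> \<le> \<kappa> * gnorm K x v"
      proof (intro mult_right_mono gnorm_ge0)
        have "D * gnorm K x u \<le> D * b" using u D \<rho>(2) \<epsilon>(4) unfolding S_def tball_def by (intro mult_left_mono) auto
        also have "\<dots> = C * exp (- \<beta> * time K) / 2" using D by (simp add: b_def)
        also have "\<dots> \<le> C * exp (- \<alpha>1 * time K) / 2"
          using C r(2,3) time_nonneg(1) by (intro divide_right_mono mult_left_mono) (auto intro: mult_right_mono)
        finally show "D * gnorm K x u + 3 / 2 * C * exp (- \<alpha>1 * time K) \<le> \<kappa>" by (simp add: \<kappa>_def)
      qed
      finally show ?thesis .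
    qed
    have expand: "\<mu> * gnorm K x v \<le> gnorm K y (g' 0 v)" if v: "v \<in> tleaf K x0 x" for v
    proof -
      have "\<mu> * gnorm K x v \<le> \<mu> * (3 / 2 * C * exp (\<beta>1 * time K) * gnorm K y (g' 0 v))"
        using lin(2)[OF v] C by (intro mult_left_mono) (auto simp: \<mu>_def g'0[OF v])
      also have "\<dots> = 3 / 4 * gnorm K y (g' 0 v)" using C by (simp add: \<mu>_def exp_minus field_simps)
      also have "\<dots> \<le> gnorm K y (g' 0 v)" using gnorm_ge0[of y "g' 0 v"] by linarith
      finally show ?thesis .
    qed
    have C3: "C \<le> C ^ 3" using C power_increasing[of 1 3 C] by simp
    have expa: "exp (- \<alpha>1 * time K) \<le> exp (- \<alpha> * time K / 2)"
    proof -
      have "\<alpha> * time K \<le> \<alpha>1 * time K" "0 \<le> \<alpha> * time K" using r(1) \<alpha>_pos time_nonneg(1) by (auto intro: mult_right_mono)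
      then show ?thesis by simp
    qed
    have \<kappa>1: "\<kappa> \<le> 1"
    proof -
      have "\<kappa> \<le> 8 * C ^ 3 * exp (- \<alpha> * time K / 2)" unfolding \<kappa>_def
        using C3 C expa by (intro mult_mono) auto
      then show ?thesis using t0(2,3) by simp
    qed
    have \<mu>Q: "1 / \<mu> \<le> 2 * C * exp (\<beta> * time K)"
    proof -
      have "1 / \<mu> = 2 * C * exp (\<beta>1 * time K)" by (simp add: \<mu>_def exp_minus field_simps)
      also have "\<dots> \<le> 2 * C * exp (\<beta> * time K)" using C r(3) time_nonneg(1) by (intro mult_left_mono) (auto intro: mult_right_mono)
      finally show ?thesis .
    qed
    have pinch: "\<kappa>\<^sup>2 / \<mu> \<le> \<gamma>"
    proof -
      have "\<kappa>\<^sup>2 / \<mu> = 8 * C ^ 3 * (exp (- \<alpha>1 * time K) * exp (- \<alpha>1 * time K) * exp (\<beta>1 * time K))"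
        using C by (simp add: \<kappa>_def \<mu>_def power2_eq_square power3_eq_cube exp_minus field_simps)
      also have "exp (- \<alpha>1 * time K) * exp (- \<alpha>1 * time K) * exp (\<beta>1 * time K) = exp (- ((2 * \<alpha>1 - \<beta>1) * time K))"
        by (simp add: exp_add[symmetric] algebra_simps)
      also have "\<dots> \<le> exp (- \<alpha> * time K / 2)"
      proof -
        have "\<alpha> * time K \<le> (2 * \<alpha>1 - \<beta>1) * time K" "0 \<le> \<alpha> * time K"
          using r(4) \<alpha>_pos time_nonneg(1) by (auto intro: mult_right_mono)
        then show ?thesis by simp
      qed
      finally show ?thesis unfolding t0(2) using C by (simp add: mult_left_mono)
    qed
    have "uniform_step \<rho> D (2 * C * exp (\<beta> * time K)) x0 x g' \<kappa> \<mu>"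
      unfolding uniform_step_def y0_def[symmetric] y_def[symmetric] S_def[symmetric]
      using C \<kappa>1 \<mu>Q pinch has_derivative_subset[OF der sub] ph g'V g'0 contr expand lip
      by (auto simp: \<kappa>_def \<mu>_def)
    then show "\<exists>g' \<kappa> \<mu>. uniform_step \<rho> D (2 * C * exp (\<beta> * time K)) x0 x g' \<kappa> \<mu>" by blast
  qed
qed

text \<open>
  All points of the backward orbit lie in leaves of the same size as the first one, so that one radius
  serves for all links.
\<close>

lemma chain_exists:
  assumes D: "D > 0" and control: "\<And>y0. y0 \<in> \<Lambda> \<Longrightarrow> backward_control D (time K, y0)"
  obtains \<epsilon> Q where "\<epsilon> > 0" "\<epsilon> \<le> 1 / D" "\<forall>\<rho> x0 x. 0 < \<rho> \<longrightarrow> \<rho> \<le> \<epsilon> \<longrightarrow> x0 \<in> \<Lambda> \<longrightarrow> x \<in> sleaf K \<rho> x0 \<longrightarrow>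
     (\<exists>h' \<kappa> \<mu>. contraction_chain (\<lambda>k. tleaf K (pt k x0) (pt k x)) (\<lambda>k. metric K (pt k x))
        (\<lambda>k. phihat K (pt k x0) (pt k x) (- time K)) h' \<rho> D Q \<gamma> \<kappa> \<mu> \<and>
       (\<forall>k. \<forall>v\<in>tleaf K (pt k x0) (pt k x). h' k 0 v = mdiff K (flow K (- time K)) (pt k x) v))"
proof -
  define Q where "Q = 2 * C * exp (\<beta> * time K)"
  have Q: "Q > 0" using C by (simp add: Q_def)
  obtain \<epsilon>1 where \<epsilon>1: "\<epsilon>1 > 0" "\<epsilon>1 \<le> 1 / D" and step: "\<And>\<rho> x0 x. 0 < \<rho> \<Longrightarrow> \<rho> \<le> \<epsilon>1 \<Longrightarrow> x0 \<in> \<Lambda> \<Longrightarrow> x \<in> sleaf K \<epsilon>1 x0 \<Longrightarrow>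
     \<exists>g' \<kappa> \<mu>. uniform_step \<rho> D Q x0 x g' \<kappa> \<mu>"
    using uniform_step_exists[OF D control] unfolding Q_def by metis
  define q where "q = Q * D / (1 - \<gamma>)"
  have q: "q > 0" using Q D t0(3) by (simp add: q_def)
  define \<epsilon> where "\<epsilon> = min (min \<epsilon>1 (eps0 K)) (1 / (2 * q))"
  have \<epsilon>: "\<epsilon> > 0" "\<epsilon> \<le> \<epsilon>1" "\<epsilon> \<le> eps0 K" "\<epsilon> \<le> 1 / (2 * q)" using \<epsilon>1 q eps0(1) by (auto simp: \<epsilon>_def)
  show ?thesis
  proof (rule that[of \<epsilon> Q]; (intro allI impI)?)
    show "\<epsilon> \<le> 1 / D" using \<epsilon>(2) \<epsilon>1(2) by simp
    fix \<rho> x0 x assume \<rho>: "0 < \<rho>" "\<rho> \<le> \<epsilon>" and x0: "x0 \<in> \<Lambda>" and x: "x \<in> sleaf K \<rho> x0"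
    have p0: "pt k x0 \<in> \<Lambda>" and p: "pt k x \<in> sleaf K \<rho> (pt k x0)" for k
      by (rule pt_Lambda[OF x0], rule pt_sleaf[OF x0 x])
    have pl: "pt k x \<in> leaf K (pt k x0)" for k by (rule sleaf_leaf[OF p])
    have pe: "pt k x \<in> sleaf K (eps0 K) (pt k x0)" for k using sleaf_mono[OF p, of "eps0 K"] \<rho>(2) \<epsilon>(3) by simp
    have "\<forall>k. \<exists>g' \<kappa> \<mu>. uniform_step \<rho> D Q (pt k x0) (pt k x) g' \<kappa> \<mu>"
      using step[OF \<rho>(1) _ p0 sleaf_mono[OF p]] \<rho>(2) \<epsilon>(2) by simp
    then obtain h' \<kappa> \<mu> where us: "\<And>k. uniform_step \<rho> D Q (pt k x0) (pt k x) (h' k) (\<kappa> k) (\<mu> k)" by metis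
    have pt1: "pt 1 (pt k y) = pt (Suc k) y" for k y unfolding pt_1 by (rule pt_Suc)
    have S0: "0 \<in> tball K (pt k x0) (pt k x) \<rho>" for k using zero_in_tball[OF p0 pl] \<rho>(1) by simp
    have B: "u \<in> tball K (pt k x0) (pt k x) \<rho>" if "u \<in> tleaf K (pt k x0) (pt k x)" "form_norm (metric K (pt k x)) u \<le> \<rho>" for u k
      using that by (simp add: tball_eq)
    note us1 = us[unfolded uniform_step_def pt1 gnorm_form_norm]
    have zero: "h' k 0 v = mdiff K (flow K (- time K)) (pt k x) v" if "v \<in> tleaf K (pt k x0) (pt k x)" for k v
      using us1[of k] S0[of k] that by blast
    have "contraction_chain (\<lambda>k. tleaf K (pt k x0) (pt k x)) (\<lambda>k. metric K (pt k x))
        (\<lambda>k. phihat K (pt k x0) (pt k x) (- time K)) h' \<rho> D Q \<gamma> \<kappa> \<mu>"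
    proof (unfold_locales, goal_cases)
      case (1 k) show ?case by (rule subspace_tleaf[OF p0 pl])
    next
      case (2 k) show ?case by (rule inner_form_metric)
    next
      case 3 show ?case by (rule \<rho>(1))
    next
      case (4 u k) show ?case using us1[of k] B[OF 4] unfolding tball_eq by blast
    next
      case (5 k) show ?case by (rule phihat_0[OF p0 pe time_nonneg(1)])
    next
      case (6 u k) show ?case using us1[of k] B[OF 6] by blast
    next
      case (7 u k v) show ?case using us1[of k] B[OF 7(1,2)] 7(3) by blast
    next
      case (8 k)
      have "h' k 0 ` tleaf K (pt k x0) (pt k x) = mdiff K (flow K (- time K)) (pt k x) ` tleaf K (pt k x0) (pt k x)"
        by (rule image_cong) (auto simp: zero)
      then show ?case using mdiff_tleaf[OF p0 time_nonneg(1) pl, of k] by (simp add: pt_Suc)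
    next
      case (9 u k v) show ?case using us1[of k] B[OF 9(1,2)] 9(3) by blast
    next
      case (10 v k) show ?case using us1[of k] S0[of k] 10 by blast
    next
      case (11 k) show ?case using us1[of k] by blast
    next
      case (12 k) show ?case using us1[of k] by blast
    next
      case (13 k) show ?case using us1[of k] by blast
    next
      case (14 k) show ?case using us1[of k] by blast
    next
      case (15 k) show ?case using us1[of k] by blast
    next
      case 16 show ?case by (rule t0(3))
    next
      case (17 u k u' v) show ?case using us1[of k] B[OF 17(1,2)] B[OF 17(3,4)] 17(5) by blast
    next
      case 18 show ?case using D by simp
    next
      case 19
      have "q * \<rho> \<le> q * (1 / (2 * q))" using \<rho>(2) \<epsilon>(4) q by (intro mult_left_mono) auto
      also have "\<dots> = 1 / 2" using q by simp
      finally show ?case unfolding q_def .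
    qed
    then show "\<exists>h' \<kappa> \<mu>. contraction_chain (\<lambda>k. tleaf K (pt k x0) (pt k x)) (\<lambda>k. metric K (pt k x))
        (\<lambda>k. phihat K (pt k x0) (pt k x) (- time K)) h' \<rho> D Q \<gamma> \<kappa> \<mu> \<and>
       (\<forall>k. \<forall>v\<in>tleaf K (pt k x0) (pt k x). h' k 0 v = mdiff K (flow K (- time K)) (pt k x) v)"
      using zero by blast
  qed (use \<epsilon> in auto)
qed

end

section \<open>The linearizing maps of the leaves\<close>

lemma C1_on_cong:
  assumes "\<And>u. u \<in> S \<Longrightarrow> f u = g u" and g: "C1_on g S"
  shows "C1_on f S"
proof -
  obtain g' where "\<forall>x\<in>S. (g has_derivative blinfun_apply (g' x)) (at x within S)" "continuous_on S g'"
    using g unfolding C1_on_def by blast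
  then show ?thesis unfolding C1_on_def
    by (intro exI[of _ g']) (auto intro: has_derivative_transform[OF _ assms(1)])
qed

lemma C1_diffeo_on_cong:
  assumes eq: "\<And>u. u \<in> S \<Longrightarrow> f u = g u" and g: "C1_diffeo_on g S"
  shows "C1_diffeo_on f S"
proof -
  have im: "f ` S = g ` S" using eq by (rule image_cong[OF refl])
  have inj: "inj_on f S" using g inj_on_cong[of S f g] eq unfolding C1_diffeo_on_def by blast
  have "inv_into S f y = inv_into S g y" if y: "y \<in> f ` S" for y
  proof -
    obtain u where u: "u \<in> S" "y = f u" using y by blast
    have "inv_into S g (g u) = u" using g u(1) unfolding C1_diffeo_on_def by (intro inv_into_f_f) auto
    then show ?thesis using inv_into_f_f[OF inj u(1)] by (simp add: u(2) eq[OF u(1)])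
  qed
  then show ?thesis using g inj C1_on_cong[of S f g] C1_on_cong[of "f ` S" "inv_into S f" "inv_into S g"] eq
    unfolding C1_diffeo_on_def im by blast
qed

context leaf_system
begin

lemma fiter_0 [simp]: "fiter K 0 y = y" by (simp add: fiter_def)

lemma form_norm_metric_ge0 [simp]: "form_norm (metric K y) v \<ge> 0"
  by (rule form_norm_ge0[OF inner_form_metric])

lemma phihat_eqI:
  assumes "flow K t x0 \<in> \<Lambda>" "flow K t x \<in> sleaf K (eps0 K) (flow K t x0)"
    and "w \<in> tball K (flow K t x0) (flow K t x) (eps0 K)"
    and "lexp K (flow K t x0) (flow K t x) w = flow K t (lexp K x0 x u)"
  shows "phihat K x0 x t u = w" "phihat_defined K x0 x t u"
proof -
  show "phihat K x0 x t u = w" unfolding phihat_def o_def assms(4)[symmetric]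
    by (rule inv_into_f_f[OF exp_inj[OF assms(1,2)] assms(3)])
  show "phihat_defined K x0 x t u" unfolding phihat_defined_def assms(4)[symmetric] using assms(3) by (rule imageI)
qed

text \<open>If the first map is defined, the exponential map at the intermediate point cancels against its inverse.\<close>

lemma phihat_compose:
  assumes def: "phihat_defined K x0 x (- t) u"
  shows "phihat K (flow K (- t) x0) (flow K (- t) x) (- s) (phihat K x0 x (- t) u) = phihat K x0 x (- (s + t)) u"
    "phihat_defined K (flow K (- t) x0) (flow K (- t) x) (- s) (phihat K x0 x (- t) u) \<longleftrightarrow> phihat_defined K x0 x (- (s + t)) u"
proof -
  have f: "flow K (- s) (flow K (- t) q) = flow K (- (s + t)) q" for q
    using flow_add[of "- s" "- t" q] by simp
  show "phihat K (flow K (- t) x0) (flow K (- t) x) (- s) (phihat K x0 x (- t) u) = phihat K x0 x (- (s + t)) u"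
    "phihat_defined K (flow K (- t) x0) (flow K (- t) x) (- s) (phihat K x0 x (- t) u) \<longleftrightarrow> phihat_defined K x0 x (- (s + t)) u"
    unfolding phihat_def[of K "flow K (- t) x0"] phihat_def[of K x0 x "- (s + t)"] o_def
      phihat_defined_def[of K "flow K (- t) x0"] phihat_defined_def[of K x0 x "- (s + t)"]
      phihat_inverse(1)[OF def] f by auto
qed

lemma at_within_tball:
  assumes "u \<in> tball K x0 x r" "gnorm K x u < r"
  shows "at u within tball K x0 x r = at u within tleaf K x0 x"
proof (rule at_within_nhd)
  show "open {u. gnorm K x u < r}" unfolding gnorm_form_norm
    by (intro open_Collect_less continuous_on_form_norm inner_form_metric continuous_intros)
qed (use assms in \<open>auto simp: tball_def\<close>)

end

text \<open>
  The chain along the backward orbit of a point \<open>x\<close> of the leaf of \<open>x0\<close>. The bounds at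
  intermediate times serve for the passage from multiples of the period to all real times.
\<close>

locale leaf_chain = leaf_system K \<Lambda> E0 Eu Es E1 E2 W2 C \<alpha> \<beta> \<alpha>2 \<beta>2 \<delta>1 \<delta>2 \<gamma>
  for K :: "('m::metric_space, 'e::euclidean_space) leaf_data" and \<Lambda> E0 Eu Es E1 E2 W2 C \<alpha> \<beta> \<alpha>2 \<beta>2 \<delta>1 \<delta>2 \<gamma> +
  fixes x0 x :: 'm and h' :: "nat \<Rightarrow> 'e \<Rightarrow> 'e \<Rightarrow> 'e" and \<rho> D Q Dm :: real and \<kappa> \<mu> :: "nat \<Rightarrow> real"
  assumes x0: "x0 \<in> \<Lambda>" and x: "x \<in> sleaf K \<rho> x0" and \<rho>_le: "\<rho> \<le> eps1 K / 2" "\<rho> \<le> 1 / D"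
    and control: "\<And>t y0. 0 \<le> t \<Longrightarrow> t \<le> time K \<Longrightarrow> y0 \<in> \<Lambda> \<Longrightarrow> backward_control D (t, y0)"
    and mdiff_bound: "\<And>t y0 y v. \<bar>t\<bar> \<le> time K \<Longrightarrow> y0 \<in> \<Lambda> \<Longrightarrow> y \<in> sleaf K \<rho> y0 \<Longrightarrow>
       gnorm K (flow K t y) (mdiff K (flow K t) y v) \<le> Dm * gnorm K y v"
    and Dm: "Dm \<ge> 0"
    and chain: "contraction_chain (\<lambda>k. tleaf K (fiter K (- int k) x0) (fiter K (- int k) x)) (\<lambda>k. metric K (fiter K (- int k) x))
       (\<lambda>k. phihat K (fiter K (- int k) x0) (fiter K (- int k) x) (- time K)) h' \<rho> D Q \<gamma> \<kappa> \<mu>"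
    and h'_0: "\<And>k v. v \<in> tleaf K (fiter K (- int k) x0) (fiter K (- int k) x) \<Longrightarrow>
       h' k 0 v = mdiff K (flow K (- time K)) (fiter K (- int k) x) v"
begin

sublocale ch: contraction_chain "\<lambda>k. tleaf K (pt k x0) (pt k x)" "\<lambda>k. metric K (pt k x)"
  "\<lambda>k. phihat K (pt k x0) (pt k x) (- time K)" h' \<rho> D Q \<gamma> \<kappa> \<mu>
  by (rule chain)

lemma D_pos: "D > 0" using control[OF order_refl time_nonneg(1) x0] by (simp add: backward_control_def)

lemma eps: "\<rho> \<le> eps1 K" "\<rho> \<le> eps0 K" using \<rho>_le(1) eps1 by simp_all

lemma pt_in: "pt k x0 \<in> \<Lambda>" "pt k x \<in> sleaf K \<rho> (pt k x0)" "pt k x \<in> sleaf K (eps0 K) (pt k x0)" "pt k x \<in> leaf K (pt k x0)"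
proof -
  show "pt k x0 \<in> \<Lambda>" "pt k x \<in> sleaf K \<rho> (pt k x0)" by (rule pt_Lambda[OF x0], rule pt_sleaf[OF x0 x])
  then show "pt k x \<in> sleaf K (eps0 K) (pt k x0)" "pt k x \<in> leaf K (pt k x0)"
    using sleaf_mono[OF _ eps(2)] sleaf_leaf by blast+
qed

lemma B_tball: "ch.B k = tball K (pt k x0) (pt k x) \<rho>"
  by (simp add: ch.B_def tball_eq)

lemma H_tball: "u \<in> tball K x0 x \<rho> \<Longrightarrow> ch.H k u \<in> tball K (pt k x0) (pt k x) \<rho>"
  using ch.H_B[of u k] unfolding B_tball by simp

lemma flow_s_pt: "flow K (- s) (pt p y) = flow K (- (s + real p * time K)) y" by (rule flow_pt)

lemma control_step:
  assumes "0 \<le> s" "s \<le> time K" "u \<in> tball K (pt p x0) (pt p x) \<rho>"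
  shows "phihat_defined K (pt p x0) (pt p x) (- s) u"
    "gnorm K (flow K (- s) (pt p x)) (phihat K (pt p x0) (pt p x) (- s) u) \<le> D * gnorm K (pt p x) u"
    "gnorm K (flow K (- s) (pt p x)) (phihat K (pt p x0) (pt p x) (- s) u - mdiff K (flow K (- s)) (pt p x) u)
       \<le> D * (gnorm K (pt p x) u)\<^sup>2"
  by (rule backward_control_bounds[OF control[OF assms(1,2) pt_in(1)] assms(1) pt_in(1)
        sleaf_mono[OF pt_in(2) \<rho>_le(2)] tball_mono[OF assms(3) \<rho>_le(2)]])+

lemma H_phihat:
  assumes u: "u \<in> tball K x0 x \<rho>"
  shows "ch.H p u = phihat K x0 x (- (real p * time K)) u \<and> phihat_defined K x0 x (- (real p * time K)) u"
proof (induction p)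
  case 0
  have "phihat K x0 x 0 u = u \<and> phihat_defined K x0 x 0 u"
    using phihat_eqI[of 0 x0 x u u] x0 sleaf_mono[OF x eps(2)] tball_mono[OF u eps(2)] by simp
  then show ?case by simp
next
  case (Suc p)
  have e: "real (Suc p) * time K = time K + real p * time K" by (simp add: algebra_simps)
  have "phihat_defined K (pt p x0) (pt p x) (- time K) (ch.H p u)"
    by (rule control_step(1)[OF time_nonneg(1) order_refl H_tball[OF u]])
  then show ?case
    using phihat_compose[of x0 x "real p * time K" u "time K", folded pt_flow] Suc unfolding e by simp
qed

lemma phihat_split:
  assumes u: "u \<in> tball K x0 x \<rho>" and s: "0 \<le> s" "s \<le> time K"
  shows "phihat K x0 x (- (s + real p * time K)) u = phihat K (pt p x0) (pt p x) (- s) (ch.H p u)"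
    "phihat_defined K x0 x (- (s + real p * time K)) u"
  using phihat_compose[of x0 x "real p * time K" u s] H_phihat[OF u, of p] control_step(1)[OF s H_tball[OF u], of p]
  unfolding pt_flow by simp_all

lemma lexp_H:
  assumes u: "u \<in> tball K x0 x \<rho>"
  shows "lexp K (pt p x0) (pt p x) (ch.H p u) = flow K (- (real p * time K)) (lexp K x0 x u)"
  using phihat_inverse(1)[of x0 x "- (real p * time K)" u] H_phihat[OF u, of p] by (simp add: pt_flow)

lemma flow_time_pt: "flow K (time K) (pt (Suc p) y) = pt p y"
  unfolding pt_flow flow_add[symmetric] by (simp add: algebra_simps)

lemma fhat_H:
  assumes u: "u \<in> tball K x0 x \<rho>"
  shows "fhat K (pt (Suc p) x0) (pt (Suc p) x) (ch.H (Suc p) u) = ch.H p u"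
  unfolding fhat_def
proof (rule phihat_eqI(1), unfold flow_time_pt)
  have "flow K (time K) (flow K (- (real (Suc p) * time K)) q) = flow K (- (real p * time K)) q" for q
    unfolding flow_add[symmetric] by (simp add: algebra_simps)
  then show "lexp K (pt p x0) (pt p x) (ch.H p u) = flow K (time K) (lexp K (pt (Suc p) x0) (pt (Suc p) x) (ch.H (Suc p) u))"
    unfolding lexp_H[OF u] by simp
qed (rule pt_in(1), rule pt_in(3), rule tball_mono[OF H_tball[OF u] eps(2)])

lemma inj_fhat: "inj_on (fhat K (pt (Suc p) x0) (pt (Suc p) x)) (tball K (pt (Suc p) x0) (pt (Suc p) x) (eps1 K))"
proof (rule inj_onI)
  fix v w assume vw: "v \<in> tball K (pt (Suc p) x0) (pt (Suc p) x) (eps1 K)" "w \<in> tball K (pt (Suc p) x0) (pt (Suc p) x) (eps1 K)"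
    and eq: "fhat K (pt (Suc p) x0) (pt (Suc p) x) v = fhat K (pt (Suc p) x0) (pt (Suc p) x) w"
  have d: "phihat_defined K (pt (Suc p) x0) (pt (Suc p) x) (time K) v" "phihat_defined K (pt (Suc p) x0) (pt (Suc p) x) (time K) w"
    using fhat_defined[OF pt_in(1) sleaf_mono[OF pt_in(2) eps(1)]] vw by blast+
  have "flow K (time K) (lexp K (pt (Suc p) x0) (pt (Suc p) x) v) = flow K (time K) (lexp K (pt (Suc p) x0) (pt (Suc p) x) w)"
    using phihat_inverse(1)[OF d(1)] phihat_inverse(1)[OF d(2)] eq unfolding fhat_def by simp
  then have "lexp K (pt (Suc p) x0) (pt (Suc p) x) v = lexp K (pt (Suc p) x0) (pt (Suc p) x) w"
    using inj_flow by (simp add: inj_eq)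
  then show "v = w"
    by (rule inj_onD[OF exp_inj[OF pt_in(1) pt_in(3)] _ tball_mono[OF vw(1) eps1(2)] tball_mono[OF vw(2) eps1(2)]])
qed

text \<open>
  The map induced by the flow is injective on the whole ball from which \<open>fhat_inv\<close> chooses preimages, so
  that the choice is the point of the chain.
\<close>

lemma fhat_inv_H: "u \<in> tball K x0 x \<rho> \<Longrightarrow> fhat_inv K p x0 x u = ch.H p u"
proof (induction p)
  case (Suc p)
  have "inv_into (tball K (pt (Suc p) x0) (pt (Suc p) x) (eps1 K)) (fhat K (pt (Suc p) x0) (pt (Suc p) x)) (ch.H p u) = ch.H (Suc p) u"
    unfolding fhat_H[OF Suc(2), of p, symmetric]
    by (rule inv_into_f_f[OF inj_fhat tball_mono[OF H_tball[OF Suc(2)] eps(1)]])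
  moreover have "fhat_inv K (Suc p) x0 x u = inv_into (tball K (pt (Suc p) x0) (pt (Suc p) x) (eps1 K)) (fhat K (pt (Suc p) x0) (pt (Suc p) x)) (ch.H p u)"
    unfolding fhat_inv.simps Let_def Suc(1)[OF Suc(2)] ..
  ultimately show ?case by metis
qed simp

lemma fhat_inv_is_defined: "u \<in> tball K x0 x \<rho> \<Longrightarrow> fhat_inv_defined K p x0 x u"
  unfolding fhat_inv_defined_def Let_def
proof (intro allI impI)
  fix k assume u: "u \<in> tball K x0 x \<rho>"
  show "fhat_inv K k x0 x u \<in> fhat K (pt (Suc k) x0) (pt (Suc k) x) ` tball K (pt (Suc k) x0) (pt (Suc k) x) (eps1 K)"
    unfolding fhat_inv_H[OF u] fhat_H[OF u, of k, symmetric]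
    by (rule imageI[OF tball_mono[OF H_tball[OF u] eps(1)]])
qed

lemma fiter_pt: "k \<le> p \<Longrightarrow> fiter K (int k) (pt p y) = pt (p - k) y"
  unfolding fiter_def flow_add[symmetric] by (simp add: of_nat_diff algebra_simps)

lemma fhat_pow_H:
  assumes u: "u \<in> tball K x0 x \<rho>"
  shows "k \<le> p \<Longrightarrow> fhat_pow K k (pt p x0) (pt p x) (ch.H p u) = ch.H (p - k) u"
proof (induction k)
  case (Suc k)
  have e: "p - k = Suc (p - Suc k)" using Suc(2) by simp
  have kp: "k \<le> p" using Suc(2) by simp
  show ?case unfolding fhat_pow.simps Suc(1)[OF kp] fiter_pt[OF kp] unfolding e by (rule fhat_H[OF u])
qed simp

text \<open>The iterate of \<open>fhat\<close> that ends at \<open>x\<close> is a local inverse of \<open>H p\<close>, whose image is open by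
  invariance of domain; hence its derivative inverts the derivative of \<open>H p\<close>.\<close>

lemma dfhat_back_inverse:
  assumes \<xi>: "\<xi> \<in> tball K x0 x \<rho>" "gnorm K x \<xi> < \<rho>" and v: "v \<in> tleaf K x0 x"
  shows "dfhat_back K p x0 x (ch.H p \<xi>) (ch.H' p \<xi> v) = v"
proof -
  define V where "V = tleaf K (pt p x0) (pt p x)"
  define g where "g = fhat_pow K p (pt p x0) (pt p x)"
  define S where "S = tball K x0 x \<rho>"
  define U where "U = {u\<in>tleaf K x0 x. gnorm K x u < \<rho>}"
  have B0: "ch.B 0 = S" unfolding B_tball S_def by simp
  have \<xi>B: "\<xi> \<in> ch.B 0" using \<xi>(1) by (simp add: B0 S_def)
  have US: "U \<subseteq> S" by (auto simp: U_def S_def tball_def)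
  have gH: "g (ch.H p u) = u" if "u \<in> S" for u
    using fhat_pow_H[of u p p] that by (simp add: g_def S_def)
  have HV: "ch.H p u \<in> V" if "u \<in> S" for u using H_tball[of u p] that by (simp add: S_def V_def tball_def)
  have subs: "subspace V" "subspace (tleaf K x0 x)" using ch.subspace_V[of p] ch.subspace_V[of 0] by (simp_all add: V_def)
  have Hc: "continuous_on S (ch.H p)" unfolding B0[symmetric] continuous_on_eq_continuous_within
    by (intro ballI has_derivative_continuous[OF ch.H_derivative])
  have inj: "inj_on (ch.H p) S" by (rule inj_on_inverseI[of S g]) (rule gH)
  have dim: "dim V \<le> dim (tleaf K x0 x)"
    using dim_image_le[OF ch.linear_H'[OF ch.zero_in_B], of p "tleaf K x0 x"] ch.H'_onto[of p] by (simp add: V_def)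
  have op: "openin (top_of_set V) (ch.H p ` U)"
  proof (rule invariance_of_domain_subspaces[OF _ subs(2,1) dim])
    show "openin (top_of_set (tleaf K x0 x)) U" unfolding U_def by (rule openin_gnorm_ball)
  qed (use US HV continuous_on_subset[OF Hc] inj_on_subset[OF inj] in auto)
  have \<xi>U: "\<xi> \<in> U" using \<xi> by (auto simp: U_def tball_def)
  have wN: "ch.H p \<xi> \<in> ch.H p ` U" using \<xi>U by blast
  obtain J where J: "linear J" "\<And>v. v \<in> tleaf K x0 x \<Longrightarrow> J (ch.H' p \<xi> v) = v"
    using linear_exists_left_inverse_on[OF ch.linear_H'[OF \<xi>B, of p] subs(2)] ch.H'_inj_at[OF \<xi>B, of p] by auto
  have gder: "(g has_derivative (\<lambda>v. J v)) (at (ch.H p \<xi>) within ch.H p ` U)"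
  proof (rule has_derivative_lift_left_inverse[where G = "ch.H p" and G' = "ch.H' p \<xi>" and S = S and k' = "\<lambda>v. v"])
    show "(ch.H p has_derivative ch.H' p \<xi>) (at (g (ch.H p \<xi>)) within S)"
      using ch.H_derivative[OF \<xi>B, of p] gH \<xi>(1) by (simp add: B0 S_def[symmetric])
    show "J (ch.H' p \<xi> (g t - g (ch.H p \<xi>))) = g t - g (ch.H p \<xi>)" if t: "t \<in> ch.H p ` U" for t
    proof -
      obtain u where u: "u \<in> U" "t = ch.H p u" using t by blast
      have "u - \<xi> \<in> tleaf K x0 x" using u(1) \<xi>U subs(2) by (auto simp: U_def intro: subspace_diff)
      then show ?thesis using gH[of u] gH[of \<xi>] u US \<xi>U by (simp add: J(2) subset_iff)
    qed
    show "g t \<in> S" if "t \<in> ch.H p ` U" for t using that gH US by (auto simp: subset_iff)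
    show "((\<lambda>t. ch.H p (g t)) has_derivative (\<lambda>v. v)) (at (ch.H p \<xi>) within ch.H p ` U)"
      by (rule has_derivative_transform[OF wN _ has_derivative_ident]) (use gH US in \<open>auto simp: subset_iff\<close>)
    have "continuous_on (ch.H p ` S) g"
      using compact_tball[OF x0 sleaf_leaf[OF x], of \<rho>] gH unfolding S_def[symmetric]
      by (intro continuous_on_inv[OF Hc]) auto
    then have "continuous_on (ch.H p ` U) g" by (rule continuous_on_subset) (use US in auto)
    then show "continuous (at (ch.H p \<xi>) within ch.H p ` U) g"
      using wN unfolding continuous_on_eq_continuous_within by blast
  qed (rule J(1))
  obtain N where N: "open N" "ch.H p ` U = V \<inter> N" using op unfolding openin_open by blast
  have "at (ch.H p \<xi>) within ch.H p ` U = at (ch.H p \<xi>) within V"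
    by (rule at_within_nhd[of _ N]) (use N wN in auto)
  with gder have gder: "(g has_derivative J) (at (ch.H p \<xi>) within V)" by simp
  have "(g has_derivative frechet_derivative g (at (ch.H p \<xi>) within V)) (at (ch.H p \<xi>) within V)"
    using gder differentiableI frechet_derivative_works by blast
  from derivative_unique_on_solid[OF solid_in_self[OF subs(1)] _ _ this gder, of "ch.H' p \<xi> v"]
  have "frechet_derivative g (at (ch.H p \<xi>) within V) (ch.H' p \<xi> v) = J (ch.H' p \<xi> v)"
    using HV[of \<xi>] \<xi>(1) ch.H'_V[OF \<xi>B, of v p] v by (simp add: S_def V_def)
  then show ?thesis unfolding dfhat_back_def Let_def tderiv_def using J(2)[OF v] by (simp add: g_def V_def)
qed

text \<open>At \<open>0\<close> the derivative of the iterate inverts the linear part of \<open>H p\<close>, as \<open>J p\<close> does.\<close>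

lemma F_approx_T:
  assumes u: "u \<in> tball K x0 x \<rho>"
  shows "F_approx K x0 x p u = ch.T p u"
proof -
  have z: "0 \<in> tball K x0 x \<rho>" "gnorm K x 0 < \<rho>" using ch.zero_in_B[of 0] ch.\<rho> unfolding B_tball by simp_all
  have "F_approx K x0 x p u = dfhat_back K p x0 x (ch.H p 0) (ch.H p u)"
    unfolding F_approx_def fhat_inv_H[OF u] by simp
  also have "ch.H p u = ch.H' p 0 (ch.T p u)"
    unfolding ch.T_def using ch.J_right[of "ch.H p u" p] H_tball[OF u, of p] by (simp add: tball_def)
  also have "dfhat_back K p x0 x (ch.H p 0) \<dots> = ch.T p u"
    by (rule dfhat_back_inverse[OF z]) (use ch.T_V[of p u] in simp)
  finally show ?thesis .
qed

lemma F_map_F: "u \<in> tball K x0 x \<rho> \<Longrightarrow> F_map K x0 x u = ch.F u"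
  unfolding F_map_def ch.F_def by (simp add: F_approx_T)

lemma tderiv_fhat_inv:
  assumes v: "v \<in> tleaf K x0 x"
  shows "tderiv K x0 x (fhat_inv K p x0 x) 0 v = ch.H' p 0 v"
proof -
  have z: "0 \<in> tball K x0 x \<rho>" "gnorm K x 0 < \<rho>" using ch.zero_in_B[of 0] ch.\<rho> unfolding B_tball by simp_all
  have "(ch.H p has_derivative ch.H' p 0) (at 0 within tball K x0 x \<rho>)"
    using ch.H_derivative[OF ch.zero_in_B, of p] unfolding B_tball by simp
  then have "(fhat_inv K p x0 x has_derivative ch.H' p 0) (at 0 within tball K x0 x \<rho>)"
    by (rule has_derivative_transform[OF z(1), rotated]) (rule fhat_inv_H)
  then have d: "(fhat_inv K p x0 x has_derivative ch.H' p 0) (at 0 within tleaf K x0 x)"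
    unfolding at_within_tball[OF z] .
  then have "(fhat_inv K p x0 x has_derivative frechet_derivative (fhat_inv K p x0 x) (at 0 within tleaf K x0 x)) (at 0 within tleaf K x0 x)"
    using differentiableI frechet_derivative_works by blast
  from derivative_unique_on_solid[OF solid_in_self _ v this d] show ?thesis
    unfolding tderiv_def using ch.subspace_V[of 0] subspace_0[of "tleaf K x0 x"] by simp
qed

lemma H'_mdiff: "v \<in> tleaf K x0 x \<Longrightarrow> ch.H' p 0 v = mdiff K (flow K (- (real p * time K))) x v"
proof (induction p)
  case (Suc p)
  have "ch.H' p 0 v \<in> tleaf K (pt p x0) (pt p x)" using ch.H'_V[OF ch.zero_in_B, of v p] Suc(2) by simp
  then have "ch.H' (Suc p) 0 v = mdiff K (flow K (- time K)) (pt p x) (ch.H' p 0 v)" by (simp add: h'_0)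
  also have "\<dots> = mdiff K (flow K (- time K + - (real p * time K))) x v"
    unfolding Suc(1)[OF Suc(2)] mdiff_add by (simp add: pt_flow)
  also have "- time K + - (real p * time K) = - (real (Suc p) * time K)" by (simp add: algebra_simps)
  finally show ?case .
qed simp

lemma J_mdiff:
  assumes w: "w \<in> tleaf K (pt p x0) (pt p x)"
  shows "ch.J p w = mdiff K (flow K (real p * time K)) (pt p x) w"
proof -
  have "mdiff K (flow K (- (real p * time K))) x (ch.J p w) = w"
    using ch.J_right[OF w] H'_mdiff[of "ch.J p w" p] ch.J(1)[of p w] by simp
  then show ?thesis using mdiff_minus(2)[of "real p * time K" x "ch.J p w"] by (simp add: pt_flow)
qed

text \<open>
  With \<open>w = H p u\<close>, the flow over the remaining time \<open>s\<close>, less than a period, and its linearization back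
  return \<open>w\<close> up to a vector \<open>d\<close> that is quadratic in \<open>w\<close>; carried back to \<open>x\<close> along the chain it becomes of
  order \<open>\<gamma> ^ p\<close>.
\<close>

lemma continuous_time_approx:
  assumes u: "u \<in> tball K x0 x \<rho>" and s: "0 \<le> s" "s \<le> time K" and t: "t = s + real p * time K"
  shows "gnorm K x (mdiff K (flow K t) (flow K (- t) x) (phihat K x0 x (- t) u) - ch.T p u)
     \<le> Dm * D * \<gamma> ^ p * (gnorm K x u)\<^sup>2"
proof -
  define y0 y w where "y0 = pt p x0" and "y = pt p x" and "w = ch.H p u"
  define z0 z where "z0 = flow K (- s) y0" and "z = flow K (- s) y"
  have zt: "z0 = flow K (- t) x0" "z = flow K (- t) x" by (simp_all add: z0_def z_def y0_def y_def flow_s_pt t)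
  have w: "w \<in> tball K y0 y \<rho>" unfolding w_def y0_def y_def by (rule H_tball[OF u])
  have y0: "y0 \<in> \<Lambda>" and yl: "y \<in> leaf K y0" using pt_in[of p] by (auto simp: y0_def y_def)
  define g where "g = phihat K y0 y (- s)"
  define n where "n = gnorm K y w"
  have wt: "w \<in> tleaf K y0 y" using w by (rule tball_tleaf)
  note ctl = control_step[OF s w[unfolded y0_def y_def], folded y0_def y_def]
  have quad: "gnorm K z (g w - mdiff K (flow K (- s)) y w) \<le> D * n\<^sup>2"
    using ctl(3) by (simp add: g_def n_def z_def)
  define d where "d = mdiff K (flow K s) z (g w) - w"
  have ret: "mdiff K (flow K s) z (mdiff K (flow K (- s)) y w) = w" by (simp add: z_def)
  have zs: "z0 \<in> \<Lambda>" "z \<in> sleaf K \<rho> z0" unfolding z0_def z_def y0_def y_def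
    by (rule flow_Lambda[OF pt_in(1)], rule sleaf_backward[OF pt_in(1) s(1) pt_in(2)])
  have sz: "flow K s z = y" by (simp add: z_def)
  have "d = mdiff K (flow K s) z (g w - mdiff K (flow K (- s)) y w)"
    by (simp add: d_def linear_diff[OF linear_mdiff] ret)
  then have "gnorm K y d \<le> Dm * gnorm K z (g w - mdiff K (flow K (- s)) y w)"
    using mdiff_bound[OF _ zs, of s "g w - mdiff K (flow K (- s)) y w"] s by (simp add: sz)
  also have "\<dots> \<le> Dm * (D * n\<^sup>2)" using quad Dm by (rule mult_left_mono)
  finally have dn: "ch.N p d \<le> Dm * D * (ch.N p (ch.H p u))\<^sup>2"
    by (simp add: n_def gnorm_form_norm y_def w_def mult.assoc)
  have gz: "g w \<in> tleaf K z0 z" using phihat_inverse(2)[OF ctl(1)]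
    by (auto simp: g_def z0_def z_def tball_def)
  have "mdiff K (flow K s) z (g w) \<in> tleaf K y0 y"
  proof -
    obtain b where b: "b \<in> tleaf K y0 y" "g w = mdiff K (flow K (- s)) y b"
      using gz mdiff_tleaf[OF y0 s(1) yl] unfolding z0_def z_def by blast
    then show ?thesis by (simp add: z_def)
  qed
  then have dV: "d \<in> tleaf K (pt p x0) (pt p x)"
    unfolding d_def using wt subspace_diff[OF ch.subspace_V[of p]] by (simp add: y0_def y_def)
  have "mdiff K (flow K t) (flow K (- t) x) (phihat K x0 x (- t) u) = mdiff K (flow K (real p * time K)) y (mdiff K (flow K s) z (g w))"
  proof -
    have "mdiff K (flow K t) (flow K (- t) x) (phihat K x0 x (- t) u) = mdiff K (flow K (real p * time K + s)) z (g w)"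
      unfolding zt(2)[symmetric] using phihat_split(1)[OF u s, of p] by (simp add: t g_def y0_def y_def w_def add.commute)
    then show ?thesis by (simp add: mdiff_add sz)
  qed
  also have "\<dots> = mdiff K (flow K (real p * time K)) y d + mdiff K (flow K (real p * time K)) y w"
    by (simp add: d_def linear_diff[OF linear_mdiff])
  also have "\<dots> = ch.J p d + ch.T p u"
    using J_mdiff[OF dV] J_mdiff[OF wt[unfolded y0_def y_def]] by (simp add: y_def ch.T_def w_def)
  finally have "mdiff K (flow K t) (flow K (- t) x) (phihat K x0 x (- t) u) - ch.T p u = ch.J p d" by simp
  moreover have "ch.N 0 (ch.J p d) \<le> Dm * D * \<gamma> ^ p * (ch.N 0 u)\<^sup>2"
    by (rule ch.J_quadratic[OF _ dV dn]) (use u Dm D_pos in \<open>auto simp: B_tball\<close>)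
  ultimately show ?thesis by (simp add: gnorm_form_norm)
qed

lemma period_split:
  assumes "t \<ge> 0"
  obtains s where "0 \<le> s" "s \<le> time K" "t = s + real (nat \<lfloor>t / time K\<rfloor>) * time K"
proof
  have f: "of_int \<lfloor>t / time K\<rfloor> \<le> t / time K" "t / time K < of_int \<lfloor>t / time K\<rfloor> + 1" by linarith+
  have "0 \<le> t / time K" using assms t0(1) by simp
  then have n: "real (nat \<lfloor>t / time K\<rfloor>) = of_int \<lfloor>t / time K\<rfloor>" by simp
  show "0 \<le> t - real (nat \<lfloor>t / time K\<rfloor>) * time K" unfolding n using f(1)[unfolded pos_le_divide_eq[OF t0(1)]] by linarith
  show "t - real (nat \<lfloor>t / time K\<rfloor>) * time K \<le> time K" unfolding n using f(2) t0(1) by (simp add: pos_divide_less_eq algebra_simps)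
qed simp

lemma phihat_always_defined:
  assumes u: "u \<in> tball K x0 x \<rho>" and t: "t \<ge> 0"
  shows "phihat_defined K x0 x (- t) u"
proof -
  obtain s where "0 \<le> s" "s \<le> time K" "t = s + real (nat \<lfloor>t / time K\<rfloor>) * time K" using period_split[OF t] .
  then show ?thesis using phihat_split(2)[OF u, of s "nat \<lfloor>t / time K\<rfloor>"] by simp
qed

text \<open>Whole periods contract; the factor \<open>D\<close> comes from the remaining time.\<close>

lemma phihat_bound:
  assumes u: "u \<in> tball K x0 x \<rho>" and t: "t \<ge> 0"
  shows "gnorm K (flow K (- t) x) (phihat K x0 x (- t) u) \<le> D * gnorm K x u"
proof -
  define p where "p = nat \<lfloor>t / time K\<rfloor>"
  obtain s where s: "0 \<le> s" "s \<le> time K" "t = s + real p * time K" using period_split[OF t] unfolding p_def .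
  define y0 y w where "y0 = pt p x0" and "y = pt p x" and "w = ch.H p u"
  have "gnorm K (flow K (- s) y) (phihat K y0 y (- s) w) \<le> D * gnorm K y w"
    unfolding y0_def y_def w_def by (rule control_step(2)[OF s(1,2) H_tball[OF u]])
  moreover have "gnorm K y w \<le> gnorm K x u"
  proof -
    have uB: "u \<in> ch.B 0" using u by (simp add: B_tball)
    have "ch.contraction p \<le> 1" unfolding ch.contraction_def by (intro prod_le_1) (auto simp: ch.\<kappa>)
    then have "ch.contraction p * ch.N 0 u \<le> 1 * ch.N 0 u" by (intro mult_right_mono) auto
    then show ?thesis using ch.H_contracts[OF uB, of p] by (simp add: gnorm_form_norm y_def w_def)
  qed
  then have "D * gnorm K y w \<le> D * gnorm K x u" using D_pos by (intro mult_left_mono) auto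
  ultimately have "gnorm K (flow K (- s) y) (phihat K y0 y (- s) w) \<le> D * gnorm K x u" by simp
  then show ?thesis using phihat_split(1)[OF u s(1,2), of p] unfolding s(3) by (simp add: y0_def y_def w_def flow_s_pt)
qed

text \<open>
  At time \<open>t\<close> both the error over the remaining time and that of \<open>T n\<close>, with \<open>n\<close> the number of whole periods
  in \<open>t\<close>, are of order \<open>\<gamma> ^ n\<close>.
\<close>

lemma F_map_continuous_limit:
  assumes u: "u \<in> tball K x0 x \<rho>"
  shows "((\<lambda>t. mdiff K (flow K t) (flow K (- t) x) (phihat K x0 x (- t) u)) \<longlongrightarrow> F_map K x0 x u) at_top"
proof (rule ch.tendsto_by_N[of 0], rule tendsto_sandwich[OF _ _ tendsto_const])
  define n where "n = (\<lambda>t. nat \<lfloor>t / time K\<rfloor>)"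
  define E where "E = (Dm * D + ch.c) * (gnorm K x u)\<^sup>2"
  have uB: "u \<in> ch.B 0" using u by (simp add: B_tball)
  have "ch.N 0 (mdiff K (flow K t) (flow K (- t) x) (phihat K x0 x (- t) u) - F_map K x0 x u) \<le> E * \<gamma> ^ n t" if t: "t \<ge> 0" for t
  proof -
    obtain s where s: "0 \<le> s" "s \<le> time K" "t = s + real (n t) * time K" using period_split[OF t] unfolding n_def .
    have "gnorm K x (mdiff K (flow K t) (flow K (- t) x) (phihat K x0 x (- t) u) - ch.T (n t) u) \<le> Dm * D * \<gamma> ^ n t * (gnorm K x u)\<^sup>2"
      by (rule continuous_time_approx[OF u s])
    moreover have "gnorm K x (ch.T (n t) u - ch.F u) \<le> ch.c * \<gamma> ^ n t * (gnorm K x u)\<^sup>2"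
      using ch.F_T_diff[OF uB, of "n t"] unfolding gnorm_form_norm
      by (simp add: form_norm_diff_commute[OF inner_form_metric, of x "ch.T (n t) u"])
    ultimately have "gnorm K x (mdiff K (flow K t) (flow K (- t) x) (phihat K x0 x (- t) u) - ch.F u)
        \<le> Dm * D * \<gamma> ^ n t * (gnorm K x u)\<^sup>2 + ch.c * \<gamma> ^ n t * (gnorm K x u)\<^sup>2"
      using form_norm_diff_triangle[OF inner_form_metric, of x "mdiff K (flow K t) (flow K (- t) x) (phihat K x0 x (- t) u)" "ch.F u" "ch.T (n t) u"]
      unfolding gnorm_form_norm by linarith
    then show ?thesis unfolding F_map_F[OF u] by (simp add: E_def gnorm_form_norm algebra_simps)
  qed
  then show "\<forall>\<^sub>F t in at_top. ch.N 0 (mdiff K (flow K t) (flow K (- t) x) (phihat K x0 x (- t) u) - F_map K x0 x u) \<le> E * \<gamma> ^ n t"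
    by (rule eventually_mono[OF eventually_ge_at_top[of "0::real"]])
  have "filterlim (\<lambda>t. inverse (time K) * t) at_top at_top"
    using t0(1) by (intro filterlim_tendsto_pos_mult_at_top[OF tendsto_const] filterlim_ident) simp
  then have "filterlim (\<lambda>t. t / time K) at_top at_top" by (simp add: divide_inverse mult.commute)
  then have "filterlim n sequentially at_top" unfolding n_def
    by (intro filterlim_compose[OF filterlim_nat_sequentially] filterlim_compose[OF filterlim_floor_sequentially])
  moreover have "(\<lambda>k. \<gamma> ^ k) \<longlonglongrightarrow> 0" using \<gamma>_pos t0(3) by (intro LIMSEQ_power_zero) simp
  ultimately have "((\<lambda>t. \<gamma> ^ n t) \<longlongrightarrow> 0) at_top" by (rule filterlim_compose[rotated])
  then have "((\<lambda>t. E * \<gamma> ^ n t) \<longlongrightarrow> E * 0) at_top" by (intro tendsto_intros)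
  then show "((\<lambda>t. E * \<gamma> ^ n t) \<longlongrightarrow> 0) at_top" by simp
qed (rule always_eventually, simp)

lemma F_map_frechet:
  assumes u: "u \<in> tball K x0 x \<rho>" and v: "v \<in> tleaf K x0 x"
  shows "gnorm K x (frechet_derivative (F_map K x0 x) (at u within tball K x0 x \<rho>) v) \<le> 2 * gnorm K x v"
proof -
  have B0: "ch.B 0 = tball K x0 x \<rho>" unfolding B_tball by simp
  have uB: "u \<in> ch.B 0" using u by (simp add: B0)
  have d: "(F_map K x0 x has_derivative ch.F' u) (at u within tball K x0 x \<rho>)"
    by (rule has_derivative_transform[OF u F_map_F ch.F_derivative[OF uB, unfolded B0]])
  then have "(F_map K x0 x has_derivative frechet_derivative (F_map K x0 x) (at u within tball K x0 x \<rho>)) (at u within tball K x0 x \<rho>)"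
    using differentiableI frechet_derivative_works by blast
  from derivative_unique_on_solid[OF solid_in_tball[OF x0 sleaf_leaf[OF x] ch.\<rho>] u v this d]
  show ?thesis using ch.F'_bound[OF uB, of v] v by (simp add: gnorm_form_norm)
qed

text \<open>
  The derivatives of the iterates invert those of the chain at \<open>\<xi>\<close>; the two sequences of vectors to which
  they are applied are the images under the linear parts of \<open>v\<close> itself and of \<open>T p u\<close>.
\<close>

lemma L_F_limits:
  assumes \<xi>: "\<xi> \<in> tball K x0 x (\<rho> / 2)"
  shows "v \<in> tleaf K x0 x \<Longrightarrow> (\<lambda>p. L_approx K x0 x \<xi> p v) \<longlonglongrightarrow> L_map K x0 x \<xi> v"
    "v \<in> tleaf K x0 x \<Longrightarrow> L_map K x0 x \<xi> v = ch.L \<xi> v"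
    "u \<in> tball K x0 x \<rho> \<Longrightarrow> (\<lambda>p. F_approx_at K x0 x \<xi> p u) \<longlonglongrightarrow> F_map_at K x0 x \<xi> u"
    "u \<in> tball K x0 x \<rho> \<Longrightarrow> F_map_at K x0 x \<xi> u = L_map K x0 x \<xi> (F_map K x0 x u)"
proof -
  have \<rho>: "\<rho> > 0" by (rule ch.\<rho>)
  have \<xi>': "\<xi> \<in> tball K x0 x \<rho>" "gnorm K x \<xi> < \<rho>" using \<xi> \<rho> by (auto simp: tball_def)
  have \<xi>B: "\<xi> \<in> ch.B 0" using \<xi>'(1) by (simp add: B_tball)
  define G where "G = (\<lambda>p. dfhat_back K p x0 x (ch.H p \<xi>))"
  have G: "G p (ch.H' p \<xi> w) = w" if "w \<in> tleaf K (pt 0 x0) (pt 0 x)" for p w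
    using dfhat_back_inverse[OF \<xi>', of w p] that by (simp add: G_def)
  have lim: "(\<lambda>p. G p (ch.H' p 0 (a p))) \<longlonglongrightarrow> ch.L \<xi> l"
    if "\<And>p. a p \<in> tleaf K x0 x" "a \<longlonglongrightarrow> l" "l \<in> tleaf K x0 x" for a l
    by (rule ch.inverse_derivatives_limit[OF \<xi>B G]) (use that in simp_all)
  have L: "(\<lambda>p. L_approx K x0 x \<xi> p v) \<longlonglongrightarrow> ch.L \<xi> v" if v: "v \<in> tleaf K x0 x" for v
    using lim[of "\<lambda>p. v" v] v unfolding L_approx_def tderiv_fhat_inv[OF v] fhat_inv_H[OF \<xi>'(1)] G_def by simp
  show Lm: "L_map K x0 x \<xi> v = ch.L \<xi> v" if "v \<in> tleaf K x0 x" for v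
    unfolding L_map_def using L[OF that] by (rule limI)
  show "(\<lambda>p. L_approx K x0 x \<xi> p v) \<longlonglongrightarrow> L_map K x0 x \<xi> v" if "v \<in> tleaf K x0 x"
    using L[OF that] unfolding Lm[OF that] .
  have F: "(\<lambda>p. F_approx_at K x0 x \<xi> p u) \<longlonglongrightarrow> L_map K x0 x \<xi> (F_map K x0 x u)" if u: "u \<in> tball K x0 x \<rho>" for u
  proof -
    have uB: "u \<in> ch.B 0" using u by (simp add: B_tball)
    have FV: "ch.F u \<in> tleaf K x0 x" using ch.F_V[OF uB] by simp
    have "F_approx_at K x0 x \<xi> p u = G p (ch.H' p 0 (ch.T p u))" for p
      unfolding F_approx_at_def fhat_inv_H[OF \<xi>'(1)] fhat_inv_H[OF u] G_def ch.T_def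
      using ch.J_right[of "ch.H p u" p] H_tball[OF u, of p] by (simp add: tball_def)
    then show ?thesis using lim[of "\<lambda>p. ch.T p u" "ch.F u"] ch.T_V ch.F_limit[OF uB] FV
      by (simp add: F_map_F[OF u] Lm[OF FV])
  qed
  show "F_map_at K x0 x \<xi> u = L_map K x0 x \<xi> (F_map K x0 x u)" if "u \<in> tball K x0 x \<rho>"
    unfolding F_map_at_def using F[OF that] by (rule limI)
  then show "(\<lambda>p. F_approx_at K x0 x \<xi> p u) \<longlonglongrightarrow> F_map_at K x0 x \<xi> u" if "u \<in> tball K x0 x \<rho>"
    using F[OF that] that by simp
qed

end

context leaf_system
begin

lemma leaf_chain_exists:
  obtains \<epsilon> D Q Dm where "\<epsilon> > 0" "\<epsilon> \<le> eps1 K / 2" "D > 0" "Q * D / (1 - \<gamma>) \<ge> 0"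
    "\<forall>\<rho> x0 x. 0 < \<rho> \<longrightarrow> \<rho> \<le> \<epsilon> \<longrightarrow> x0 \<in> \<Lambda> \<longrightarrow> x \<in> sleaf K \<rho> x0 \<longrightarrow>
       (\<exists>h' \<kappa> \<mu>. leaf_chain K \<Lambda> E0 Eu Es E1 E2 W2 C \<alpha> \<beta> \<alpha>2 \<beta>2 \<delta>1 \<delta>2 \<gamma> x0 x h' \<rho> D Q Dm \<kappa> \<mu>)"
proof -
  obtain xc where xc: "xc \<in> \<Lambda>" using basic by (auto simp: basic_set_def)
  obtain D where control: "\<And>t y0. 0 \<le> t \<Longrightarrow> t \<le> time K \<Longrightarrow> y0 \<in> \<Lambda> \<Longrightarrow> backward_control D (t, y0)"
    using backward_control_uniform[of "time K"] by blast
  have D: "D > 0" using control[OF order_refl time_nonneg(1) xc] by (simp add: backward_control_def)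
  obtain Dm where Dm: "Dm > 0" and bound: "\<And>t y0 y v. \<bar>t\<bar> \<le> time K \<Longrightarrow> y0 \<in> \<Lambda> \<Longrightarrow> dist y0 y < 1 / Dm \<Longrightarrow>
      gnorm K (flow K t y) (mdiff K (flow K t) y v) \<le> Dm * gnorm K y v"
    using mdiff_uniform_bound[OF compact_Lambda, of "time K"] by metis
  have ctl: "\<And>y0. y0 \<in> \<Lambda> \<Longrightarrow> backward_control D (time K, y0)"
    by (rule control[OF time_nonneg(1) order_refl])
  obtain \<epsilon>1 Q where \<epsilon>1: "\<epsilon>1 > 0" "\<epsilon>1 \<le> 1 / D" and ex: "\<forall>\<rho> x0 x. 0 < \<rho> \<longrightarrow> \<rho> \<le> \<epsilon>1 \<longrightarrow> x0 \<in> \<Lambda> \<longrightarrow> x \<in> sleaf K \<rho> x0 \<longrightarrow>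
     (\<exists>h' \<kappa> \<mu>. contraction_chain (\<lambda>k. tleaf K (pt k x0) (pt k x)) (\<lambda>k. metric K (pt k x))
        (\<lambda>k. phihat K (pt k x0) (pt k x) (- time K)) h' \<rho> D Q \<gamma> \<kappa> \<mu> \<and>
       (\<forall>k. \<forall>v\<in>tleaf K (pt k x0) (pt k x). h' k 0 v = mdiff K (flow K (- time K)) (pt k x) v))"
    by (rule chain_exists[OF D ctl])
  define \<epsilon> where "\<epsilon> = min \<epsilon>1 (min (eps1 K / 2) (1 / (2 * Dm)))"
  have \<epsilon>: "\<epsilon> > 0" "\<epsilon> \<le> \<epsilon>1" "\<epsilon> \<le> eps1 K / 2" "\<epsilon> \<le> 1 / (2 * Dm)" using \<epsilon>1 eps1(1) Dm by (auto simp: \<epsilon>_def)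
  have \<epsilon>Dm: "\<epsilon> < 1 / Dm"
  proof -
    have "1 / (2 * Dm) < 1 / Dm" using Dm by (simp add: field_simps)
    then show ?thesis using \<epsilon>(4) by linarith
  qed
  have main: "\<exists>h' \<kappa> \<mu>. leaf_chain K \<Lambda> E0 Eu Es E1 E2 W2 C \<alpha> \<beta> \<alpha>2 \<beta>2 \<delta>1 \<delta>2 \<gamma> x0 x h' \<rho> D Q Dm \<kappa> \<mu>"
    if \<rho>: "0 < \<rho>" "\<rho> \<le> \<epsilon>" and x0: "x0 \<in> \<Lambda>" and x: "x \<in> sleaf K \<rho> x0" for \<rho> x0 x
  proof -
    have \<rho>1: "\<rho> \<le> \<epsilon>1" using \<rho>(2) \<epsilon>(2) by simp
    obtain h' \<kappa> \<mu> where c: "contraction_chain (\<lambda>k. tleaf K (pt k x0) (pt k x)) (\<lambda>k. metric K (pt k x))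
        (\<lambda>k. phihat K (pt k x0) (pt k x) (- time K)) h' \<rho> D Q \<gamma> \<kappa> \<mu>"
       and h'0: "\<And>k v. v \<in> tleaf K (pt k x0) (pt k x) \<Longrightarrow> h' k 0 v = mdiff K (flow K (- time K)) (pt k x) v"
      using ex[rule_format, OF \<rho>(1) \<rho>1 x0 x] by blast
    have "leaf_chain K \<Lambda> E0 Eu Es E1 E2 W2 C \<alpha> \<beta> \<alpha>2 \<beta>2 \<delta>1 \<delta>2 \<gamma> x0 x h' \<rho> D Q Dm \<kappa> \<mu>"
    proof (intro leaf_chain.intro leaf_chain_axioms.intro leaf_system_axioms x0 x c control h'0)
      show "\<rho> \<le> eps1 K / 2" "\<rho> \<le> 1 / D" using \<rho>(2) \<epsilon>(3) \<rho>1 \<epsilon>1(2) by linarith+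
      show "0 \<le> Dm" using Dm by simp
      fix t y0 y v assume "\<bar>t\<bar> \<le> time K" "y0 \<in> \<Lambda>" "y \<in> sleaf K \<rho> y0"
      then show "gnorm K (flow K t y) (mdiff K (flow K t) y v) \<le> Dm * gnorm K y v"
        using sleaf_dist[of y \<rho> y0] \<rho>(2) \<epsilon>Dm by (intro bound) auto
    qed
    then show ?thesis by blast
  qed
  \<comment> \<open>The sign of \<open>Q\<close> is visible only inside a chain, and there is at least the one of a point of \<open>\<Lambda>\<close>.\<close>
  have "xc \<in> sleaf K \<epsilon> xc" using leaf_center[OF xc] \<epsilon>(1) by (simp add: sleaf_def small_leaf_def local_unstable_def)
  then obtain h' \<kappa> \<mu> where c: "leaf_chain K \<Lambda> E0 Eu Es E1 E2 W2 C \<alpha> \<beta> \<alpha>2 \<beta>2 \<delta>1 \<delta>2 \<gamma> xc xc h' \<epsilon> D Q Dm \<kappa> \<mu>"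
    using main[OF \<epsilon>(1) order_refl xc] by blast
  then interpret leaf_chain K \<Lambda> E0 Eu Es E1 E2 W2 C \<alpha> \<beta> \<alpha>2 \<beta>2 \<delta>1 \<delta>2 \<gamma> xc xc h' \<epsilon> D Q Dm \<kappa> \<mu> .
  have "Q * D / (1 - \<gamma>) \<ge> 0" using ch.c_ge0 unfolding ch.c_def .
  then show ?thesis using main by (intro that[OF \<epsilon>(1,3) D] allI impI)
qed

text \<open>The linearizing maps are equivariant because the points \<open>\<phi>\<^sub>-\<^sub>s\<close> of the orbit of \<open>\<phi>\<^sub>-\<^sub>t(x)\<close> are points
  of the orbit of \<open>x\<close>, so that both limits are taken along the same curve.\<close>

lemma F_map_equivariant:
  assumes lim: "((\<lambda>s. mdiff K (flow K s) (flow K (- s) x) (phihat K x0 x (- s) u)) \<longlongrightarrow> F_map K x0 x u) at_top"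
      "((\<lambda>s. mdiff K (flow K s) (flow K (- s) (flow K (- t) x))
          (phihat K (flow K (- t) x0) (flow K (- t) x) (- s) (phihat K x0 x (- t) u))) \<longlongrightarrow>
        F_map K (flow K (- t) x0) (flow K (- t) x) (phihat K x0 x (- t) u)) at_top"
    and d: "phihat_defined K x0 x (- t) u"
  shows "mdiff K (flow K (- t)) x (F_map K x0 x u) = F_map K (flow K (- t) x0) (flow K (- t) x) (phihat K x0 x (- t) u)"
proof -
  have "filterlim (\<lambda>s. t + s) at_top at_top" by (rule filterlim_tendsto_add_at_top[OF tendsto_const filterlim_ident])
  from filterlim_compose[OF lim(1) this]
  have "((\<lambda>s. mdiff K (flow K (t + s)) (flow K (- (t + s)) x) (phihat K x0 x (- (t + s)) u)) \<longlongrightarrow> F_map K x0 x u) at_top" .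
  moreover have "bounded_linear (mdiff K (flow K (- t)) x)"
    using linear_mdiff by (simp add: linear_conv_bounded_linear)
  ultimately have "((\<lambda>s. mdiff K (flow K (- t)) x (mdiff K (flow K (t + s)) (flow K (- (t + s)) x) (phihat K x0 x (- (t + s)) u)))
      \<longlongrightarrow> mdiff K (flow K (- t)) x (F_map K x0 x u)) at_top"
    by (rule bounded_linear.tendsto[rotated])
  moreover have "mdiff K (flow K (- t)) x (mdiff K (flow K (t + s)) (flow K (- (t + s)) x) (phihat K x0 x (- (t + s)) u)) =
      mdiff K (flow K s) (flow K (- s) (flow K (- t) x))
          (phihat K (flow K (- t) x0) (flow K (- t) x) (- s) (phihat K x0 x (- t) u))" for s
  proof -
    have e: "flow K (- s) (flow K (- t) x) = flow K (- (t + s)) x" using flow_add[of "- s" "- t" x] by (simp add: algebra_simps)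
    have "mdiff K (flow K (- t + (t + s))) (flow K (- (t + s)) x) w =
        mdiff K (flow K (- t)) x (mdiff K (flow K (t + s)) (flow K (- (t + s)) x) w)" for w
      unfolding mdiff_add[of "- t" "t + s"] flow_minus ..
    then have "mdiff K (flow K s) (flow K (- (t + s)) x) w =
        mdiff K (flow K (- t)) x (mdiff K (flow K (t + s)) (flow K (- (t + s)) x) w)" for w
      by simp
    then show ?thesis unfolding phihat_compose(1)[OF d] e by (simp add: add.commute)
  qed
  ultimately have "((\<lambda>s. mdiff K (flow K s) (flow K (- s) (flow K (- t) x))
          (phihat K (flow K (- t) x0) (flow K (- t) x) (- s) (phihat K x0 x (- t) u))) \<longlongrightarrow>
      mdiff K (flow K (- t)) x (F_map K x0 x u)) at_top" by simp
  from tendsto_unique[OF _ this lim(2)] show ?thesis by simp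
qed

end

theorem lemma6p1:
  fixes K :: "('m::metric_space, 'e::euclidean_space) leaf_data"
    and \<Lambda> :: "'m set"
    and E0 Eu Es E1 E2 :: "'m \<Rightarrow> 'e set"
    and W2 :: "'m \<Rightarrow> 'm set"
    and C \<alpha> \<beta> \<alpha>2 \<beta>2 \<delta>1 \<delta>2 \<gamma> :: real
  assumes manifold: "riemannian_manifold K" "complete (UNIV :: 'm set)"
    and flow: "C2_flow K (flow K)"
    and basic: "basic_set K (flow K) \<Lambda> E0 Eu Es"
    and lupc: "LUPC K (flow K) \<Lambda> Eu E1 E2 C \<alpha> \<beta> \<alpha>2 \<beta>2"
    and cond_I: "condition_I K (flow K) \<Lambda> E1 E2 \<delta>1 (leaf K) \<delta>2 W2"
    and eps0: "0 < eps0 K" "eps0 K \<le> \<delta>1"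
    and exponentials: "leaf_exponentials K \<Lambda> C"
    and C: "C \<ge> 1"
    and t0: "time K > 0" "\<gamma> = 8 * C ^ 3 * exp (- \<alpha> * time K / 2)" "\<gamma> < 1"
    and eps1: "0 < eps1 K" "eps1 K \<le> eps0 K"
    and fhat_defined: "\<And>x0 x. x0 \<in> \<Lambda> \<Longrightarrow> x \<in> sleaf K (eps1 K) x0 \<Longrightarrow>
          flow K (time K) x \<in> sleaf K (eps0 K) (flow K (time K) x0) \<and>
          (\<forall>u\<in>tball K x0 x (eps1 K). phihat_defined K x0 x (time K) u)"
  shows "\<exists>\<epsilon>>0. \<epsilon> \<le> eps1 K / 2 \<and> (\<forall>\<epsilon>2. 0 < \<epsilon>2 \<and> \<epsilon>2 \<le> \<epsilon> \<longrightarrow>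
    (\<exists>C1>0. \<exists>B. \<forall>x0\<in>\<Lambda>. \<forall>x\<in>sleaf K \<epsilon>2 x0.
      \<comment> \<open>(a)\<close>
      (\<forall>u\<in>tball K x0 x \<epsilon>2.
         (\<forall>p. fhat_inv_defined K p x0 x u) \<and>
         (\<lambda>p. F_approx K x0 x p u) \<longlonglongrightarrow> F_map K x0 x u \<and>
         F_map K x0 x u \<in> tball K x0 x (2 * \<epsilon>2) \<and>
         (\<forall>p. gnorm K x (F_map K x0 x u - F_approx K x0 x p u) \<le> C1 * \<gamma> ^ p * (gnorm K x u)\<^sup>2)) \<and>
      \<comment> \<open>(b)\<close>
      C1_diffeo_on (F_map K x0 x) (tball K x0 x \<epsilon>2) \<and>
      (\<forall>u\<in>tball K x0 x \<epsilon>2. \<forall>v\<in>tleaf K x0 x.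
         gnorm K x (frechet_derivative (F_map K x0 x) (at u within tball K x0 x \<epsilon>2) v)
           \<le> B * gnorm K x v) \<and>
      \<comment> \<open>(c)\<close>
      (\<forall>q\<ge>1. \<forall>v\<in>tball K x0 x \<epsilon>2.
         fhat_inv K q x0 x v \<in> tball K (fiter K (- int q) x0) (fiter K (- int q) x) \<epsilon>2 \<and>
         tderiv K x0 x (fhat_inv K q x0 x) 0 (F_map K x0 x v) =
           F_map K (fiter K (- int q) x0) (fiter K (- int q) x) (fhat_inv K q x0 x v)) \<and>
      \<comment> \<open>(d)\<close>
      (\<forall>\<xi>\<in>tball K x0 x (\<epsilon>2 / 2).
         (\<forall>v\<in>tleaf K x0 x.
            (\<lambda>p. L_approx K x0 x \<xi> p v) \<longlonglongrightarrow> L_map K x0 x \<xi> v \<and>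
            L_map K x0 x \<xi> v \<in> tleaf K x0 x \<and>
            gnorm K x (L_map K x0 x \<xi> v) \<le> 2 * gnorm K x v) \<and>
         (\<forall>v\<in>tleaf K x0 x. \<forall>w\<in>tleaf K x0 x. \<forall>a b.
            L_map K x0 x \<xi> (a *\<^sub>R v + b *\<^sub>R w) = a *\<^sub>R L_map K x0 x \<xi> v + b *\<^sub>R L_map K x0 x \<xi> w) \<and>
         (\<forall>u\<in>tball K x0 x (\<epsilon>2 / 2).
            (\<lambda>p. F_approx_at K x0 x \<xi> p u) \<longlonglongrightarrow> F_map_at K x0 x \<xi> u \<and>
            F_map_at K x0 x \<xi> u = L_map K x0 x \<xi> (F_map K x0 x u))) \<and>
      \<comment> \<open>(e)\<close>
      (\<forall>u\<in>tball K x0 x \<epsilon>2.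
         ((\<lambda>t. mdiff K (flow K t) (flow K (- t) x) (phihat K x0 x (- t) u))
            \<longlongrightarrow> F_map K x0 x u) at_top \<and>
         (\<forall>t\<ge>0. phihat_defined K x0 x (- t) u \<and>
            mdiff K (flow K (- t)) x (F_map K x0 x u) =
              F_map K (flow K (- t) x0) (flow K (- t) x) (phihat K x0 x (- t) u)))))"
proof -
  interpret leaf_system K \<Lambda> E0 Eu Es E1 E2 W2 C \<alpha> \<beta> \<alpha>2 \<beta>2 \<delta>1 \<delta>2 \<gamma>
    by (rule leaf_system.intro)
      (fact manifold flow basic lupc cond_I eps0 exponentials C t0 eps1 fhat_defined)+
  obtain \<epsilon> D Q Dm where \<epsilon>: "\<epsilon> > 0" "\<epsilon> \<le> eps1 K / 2" and D: "D > 0" and QD: "Q * D / (1 - \<gamma>) \<ge> 0"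
    and chains: "\<forall>\<rho> x0 x. 0 < \<rho> \<longrightarrow> \<rho> \<le> \<epsilon> \<longrightarrow> x0 \<in> \<Lambda> \<longrightarrow> x \<in> sleaf K \<rho> x0 \<longrightarrow>
       (\<exists>h' \<kappa> \<mu>. leaf_chain K \<Lambda> E0 Eu Es E1 E2 W2 C \<alpha> \<beta> \<alpha>2 \<beta>2 \<delta>1 \<delta>2 \<gamma> x0 x h' \<rho> D Q Dm \<kappa> \<mu>)"
    by (rule leaf_chain_exists)
  note chain = chains[rule_format]
  \<comment> \<open>For times that are not multiples of the period the induced maps only contract up to the factor
      \<open>D\<close>; the smaller radius keeps their values in the domain of the linearizing maps.\<close>
  define \<epsilon>' where "\<epsilon>' = \<epsilon> / (D + 1)"
  have \<epsilon>': "\<epsilon>' > 0" "\<epsilon>' \<le> \<epsilon>" "D * \<epsilon>' \<le> \<epsilon>" using \<epsilon>(1) D by (auto simp: \<epsilon>'_def field_simps)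
  have limit: "((\<lambda>s. mdiff K (flow K s) (flow K (- s) x) (phihat K x0 x (- s) u)) \<longlongrightarrow> F_map K x0 x u) at_top"
    if x: "x0 \<in> \<Lambda>" "x \<in> sleaf K \<epsilon> x0" and u: "u \<in> tball K x0 x \<epsilon>" for x0 x u
  proof -
    obtain h' \<kappa> \<mu> where "leaf_chain K \<Lambda> E0 Eu Es E1 E2 W2 C \<alpha> \<beta> \<alpha>2 \<beta>2 \<delta>1 \<delta>2 \<gamma> x0 x h' \<epsilon> D Q Dm \<kappa> \<mu>"
      using chain[OF \<epsilon>(1) order_refl x] by blast
    then show ?thesis by (rule leaf_chain.F_map_continuous_limit[OF _ u])
  qed
  show ?thesis
  proof (rule exI[of _ \<epsilon>'], intro conjI allI impI, goal_cases)
    case 1 show ?case by (rule \<epsilon>'(1))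
    case 2 show ?case using \<epsilon>'(2) \<epsilon>(2) by simp
  next
    case (3 \<epsilon>2)
    then have \<epsilon>2: "0 < \<epsilon>2" "\<epsilon>2 \<le> \<epsilon>'" "\<epsilon>2 \<le> \<epsilon>" using \<epsilon>'(2) by auto
    \<comment> \<open>The constant of the chains, made positive.\<close>
    define C1 where "C1 = Q * D / (1 - \<gamma>) + 1"
    have C1_pos: "C1 > 0" using QD by (simp add: C1_def)
    show ?case
    proof (rule exI[of _ C1], rule conjI[OF C1_pos], rule exI[of _ "2::real"], intro conjI ballI allI impI)
      fix x0 x assume x0: "x0 \<in> \<Lambda>" and x: "x \<in> sleaf K \<epsilon>2 x0"
      obtain h' \<kappa> \<mu> where "leaf_chain K \<Lambda> E0 Eu Es E1 E2 W2 C \<alpha> \<beta> \<alpha>2 \<beta>2 \<delta>1 \<delta>2 \<gamma> x0 x h' \<epsilon>2 D Q Dm \<kappa> \<mu>"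
        using chain[OF \<epsilon>2(1,3) x0 x] by blast
      then interpret c: leaf_chain K \<Lambda> E0 Eu Es E1 E2 W2 C \<alpha> \<beta> \<alpha>2 \<beta>2 \<delta>1 \<delta>2 \<gamma> x0 x h' \<epsilon>2 D Q Dm \<kappa> \<mu> .
      have B0: "c.ch.B 0 = tball K x0 x \<epsilon>2" unfolding c.B_tball by simp
      have equi: "mdiff K (flow K (- t)) x (F_map K x0 x u) = F_map K (flow K (- t) x0) (flow K (- t) x) (phihat K x0 x (- t) u)"
        if u: "u \<in> tball K x0 x \<epsilon>2" and t: "t \<ge> 0" for u t
      proof (rule F_map_equivariant[OF limit limit c.phihat_always_defined[OF u t]])
        show "x0 \<in> \<Lambda>" "x \<in> sleaf K \<epsilon> x0" "u \<in> tball K x0 x \<epsilon>"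
          using x0 sleaf_mono[OF x \<epsilon>2(3)] tball_mono[OF u \<epsilon>2(3)] by auto
        show "flow K (- t) x0 \<in> \<Lambda>" by (rule flow_Lambda[OF x0])
        show "flow K (- t) x \<in> sleaf K \<epsilon> (flow K (- t) x0)" by (rule sleaf_backward[OF x0 t sleaf_mono[OF x \<epsilon>2(3)]])
        have "D * gnorm K x u \<le> D * \<epsilon>'" using u \<epsilon>2(2) D by (intro mult_left_mono) (auto simp: tball_def)
        then have "gnorm K (flow K (- t) x) (phihat K x0 x (- t) u) \<le> \<epsilon>" using c.phihat_bound[OF u t] \<epsilon>'(3) by linarith
        then show "phihat K x0 x (- t) u \<in> tball K (flow K (- t) x0) (flow K (- t) x) \<epsilon>"
          using phihat_inverse(2)[OF c.phihat_always_defined[OF u t]] by (simp add: tball_def)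
      qed
      {
        fix u assume u: "u \<in> tball K x0 x \<epsilon>2"
        then have uB: "u \<in> c.ch.B 0" by (simp add: B0)
        show "fhat_inv_defined K p x0 x u" for p by (rule c.fhat_inv_is_defined[OF u])
        show "(\<lambda>p. F_approx K x0 x p u) \<longlonglongrightarrow> F_map K x0 x u"
          using c.ch.F_limit[OF uB] by (simp add: c.F_approx_T[OF u] c.F_map_F[OF u])
        show "F_map K x0 x u \<in> tball K x0 x (2 * \<epsilon>2)"
          using c.ch.F_V[OF uB] c.ch.F_bound[OF uB] u by (simp add: c.F_map_F[OF u] tball_def gnorm_form_norm)
        show "gnorm K x (F_map K x0 x u - F_approx K x0 x p u) \<le> C1 * \<gamma> ^ p * (gnorm K x u)\<^sup>2" for p
        proof -
          have "gnorm K x (F_map K x0 x u - F_approx K x0 x p u) \<le> c.ch.c * \<gamma> ^ p * (gnorm K x u)\<^sup>2"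
            using c.ch.F_T_diff[OF uB, of p] by (simp add: c.F_approx_T[OF u] c.F_map_F[OF u] gnorm_form_norm)
          also have "\<dots> \<le> C1 * \<gamma> ^ p * (gnorm K x u)\<^sup>2"
            using \<gamma>_pos by (intro mult_right_mono) (auto simp: C1_def c.ch.c_def)
          finally show ?thesis .
        qed
        show "gnorm K x (frechet_derivative (F_map K x0 x) (at u within tball K x0 x \<epsilon>2) v) \<le> 2 * gnorm K x v"
          if "v \<in> tleaf K x0 x" for v by (rule c.F_map_frechet[OF u that])
        show "((\<lambda>t. mdiff K (flow K t) (flow K (- t) x) (phihat K x0 x (- t) u)) \<longlongrightarrow> F_map K x0 x u) at_top"
          by (rule c.F_map_continuous_limit[OF u])
        show "phihat_defined K x0 x (- t) u" if "0 \<le> t" for t by (rule c.phihat_always_defined[OF u that])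
        show "mdiff K (flow K (- t)) x (F_map K x0 x u) =
              F_map K (flow K (- t) x0) (flow K (- t) x) (phihat K x0 x (- t) u)" if "0 \<le> t" for t
          by (rule equi[OF u that])
      next
        show "C1_diffeo_on (F_map K x0 x) (tball K x0 x \<epsilon>2)"
          by (rule C1_diffeo_on_cong[OF c.F_map_F c.ch.F_C1_diffeo[unfolded B0]])
      next
        fix q v assume v: "v \<in> tball K x0 x \<epsilon>2"
        then have vB: "v \<in> c.ch.B 0" by (simp add: B0)
        show "fhat_inv K q x0 x v \<in> tball K (fiter K (- int q) x0) (fiter K (- int q) x) \<epsilon>2"
          unfolding c.fhat_inv_H[OF v] by (rule c.H_tball[OF v])
        have FV: "F_map K x0 x v \<in> tleaf K x0 x" using c.ch.F_V[OF vB] by (simp add: c.F_map_F[OF v])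
        have "tderiv K x0 x (fhat_inv K q x0 x) 0 (F_map K x0 x v) = mdiff K (flow K (- (real q * time K))) x (F_map K x0 x v)"
          unfolding c.tderiv_fhat_inv[OF FV] by (rule c.H'_mdiff[OF FV])
        also have "\<dots> = F_map K (fiter K (- int q) x0) (fiter K (- int q) x) (phihat K x0 x (- (real q * time K)) v)"
          using equi[OF v time_nonneg(2), of q] unfolding pt_flow[symmetric] .
        also have "phihat K x0 x (- (real q * time K)) v = fhat_inv K q x0 x v"
          using c.H_phihat[OF v, of q] c.fhat_inv_H[OF v, of q] by simp
        finally show "tderiv K x0 x (fhat_inv K q x0 x) 0 (F_map K x0 x v) =
           F_map K (fiter K (- int q) x0) (fiter K (- int q) x) (fhat_inv K q x0 x v)" .
      next
        fix \<xi> assume \<xi>: "\<xi> \<in> tball K x0 x (\<epsilon>2 / 2)"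
        have \<xi>B: "\<xi> \<in> c.ch.B 0" unfolding B0 using tball_mono[OF \<xi>] \<epsilon>2(1) by simp
        note L = c.L_F_limits[OF \<xi>]
        show "L_map K x0 x \<xi> (a *\<^sub>R v + b *\<^sub>R w) = a *\<^sub>R L_map K x0 x \<xi> v + b *\<^sub>R L_map K x0 x \<xi> w"
          if "v \<in> tleaf K x0 x" "w \<in> tleaf K x0 x" for v w a b
          using c.ch.L_linear[OF \<xi>B, of v w a b] that subspace_add[OF subspace_tleaf[OF x0 sleaf_leaf[OF x]]]
            subspace_scale[OF subspace_tleaf[OF x0 sleaf_leaf[OF x]]] by (simp add: L(2))
        show "(\<lambda>p. L_approx K x0 x \<xi> p v) \<longlonglongrightarrow> L_map K x0 x \<xi> v" if "v \<in> tleaf K x0 x" for v by (rule L(1)[OF that])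
        show "L_map K x0 x \<xi> v \<in> tleaf K x0 x" if "v \<in> tleaf K x0 x" for v
          using c.ch.L_V[OF \<xi>B, of v] that by (simp add: L(2))
        show "gnorm K x (L_map K x0 x \<xi> v) \<le> 2 * gnorm K x v" if "v \<in> tleaf K x0 x" for v
          using c.ch.L_bound[OF \<xi>B, of v] that by (simp add: L(2) gnorm_form_norm)
        have half: "u \<in> tball K x0 x \<epsilon>2" if "u \<in> tball K x0 x (\<epsilon>2 / 2)" for u
          using tball_mono[OF that] \<epsilon>2(1) by simp
        show "(\<lambda>p. F_approx_at K x0 x \<xi> p u) \<longlonglongrightarrow> F_map_at K x0 x \<xi> u" if "u \<in> tball K x0 x (\<epsilon>2 / 2)" for u
          by (rule L(3)[OF half[OF that]])
        show "F_map_at K x0 x \<xi> u = L_map K x0 x \<xi> (F_map K x0 x u)" if "u \<in> tball K x0 x (\<epsilon>2 / 2)" for u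
          by (rule L(4)[OF half[OF that]])
      }
    qed
  qed
qed

end
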